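(* Let $\Bbbk$ be a field, let $X$ be a generic matrix (a matrix of distinct indeterminates), and let $\Pi$ be the poset of all minors of $X$. There exists a polynomial $f\in\Bbbk[X]$ such that, for any ideal $\Omega\subseteq\Pi$, the poset ideal $\Omega\Bbbk[X]$ is Knutson with respect to $f$, i.e. $\Omega\Bbbk[X]\in\mathcal{C}_f$. In particular, $\mathrm{in}_\prec(\Omega\Bbbk[X])$ is a squarefree monomial ideal for any antidiagonal term order $\prec$, and $\Bbbk[X]/\Omega\Bbbk[X]$ is $F$-pure in positive characteristic (i.e. if $\Bbbk$ has positive characteristic).
   Context: $\Bbbk[X]$ is the polynomial ring over $\Bbbk$ in the entries of $X=(x_{i,j})$. For row indices $i_1<\cdots<i_r$ and column indices $j_1<\cdots<j_r$, $[i_1\cdots i_r\mid j_1\cdots j_r]$ denotes the corresponding $r$-minor. The set $\Pi$ of all minors of $X$ is partially ordered by $$[a_1\ldots a_r|b_1\ldots b_r]\le[c_1\ldots c_s|d_1\ldots d_s]\iff r\ge s,\ a_i\le c_i\text{ and }b_i\le d_i\text{ for all }i=1,\ldots,s.$$ An ideal of $\Pi$ is a subset $\Omega\subseteq\Pi$ such that for all $\omega\in\Omega$ and $\pi\in\Pi$, if $\pi\le\omega$ then $\pi\in\Omega$. The poset ideal $\Omega\Bbbk[X]$ is the ideal of $\Bbbk[X]$ generated by $\Omega$. Antidiagonal term order: a term order on $\Bbbk[X]$ such that the initial term of every minor $[i_1\cdots i_r\mid j_1\cdots j_r]$ is its antidiagonal term $x_{i_1,j_r}x_{i_2,j_{r-1}}\cdots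 x_{i_r,j_1}$. For an ideal $I$, $\mathrm{in}_\prec(I)$ is its initial ideal with respect to $\prec$. Knutson ideals: let $R$ be a polynomial ring over a field and $f\in R$ a homogeneous polynomial whose leading term with respect to some term order is a squarefree monomial. $\mathcal{C}_f$ is the smallest set of ideals of $R$ such that: (i) $(f)\in\mathcal{C}_f$; (ii) if $I\in\mathcal{C}_f$ then $(I:J)\in\mathcal{C}_f$ for every ideal $J\subseteq R$; (iii) if $I,J\in\mathcal{C}_f$ then $I+J\in\mathcal{C}_f$ and $I\cap J\in\mathcal{C}_f$. Ideals in $\mathcal{C}_f$ are called Knutson ideals associated to $f$. (In the statement, $f$ is such a polynomial.) A ring $S$ of characteristic $p>0$ is $F$-pure if the Frobenius map $S\to F_*S$ is pure, i.e. remains injective after tensoring with any $S$-module.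
   Formalization: The claim that the poset ideal is Knutson with respect to f is stated for nonempty Ω only: the empty Ω generates the zero ideal, which is never in C_f since every ideal in C_f contains the nonzero polynomial f. *)

theory Defs
  imports
    "Jordan_Normal_Form.Determinant"
    "Jordan_Normal_Form.VS_Connect"
    "HOL-Algebra.QuotRing"
    "HOL-Algebra.Multiplicative_Group"
    "HOL-Algebra.Generated_Groups"
    "HOL-Algebra.Free_Abelian_Groups"
    "HOL-Library.Poly_Mapping"
begin

section \<open>Polynomials, term orders and initial ideals\<close>

text \<open>
  A polynomial over \<open>'k\<close> in indeterminates indexed by \<open>'v\<close> is a finitely supported family of
  coefficients indexed by exponent vectors. For ideals and quotients the type is viewed as the
  record \<^const>\<open>class_ring\<close>, whose carrier is the whole type.
\<close>

type_synonym 'v monom = "'v \<Rightarrow>\<^sub>0 nat"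
type_synonym ('v, 'k) mpoly = "'v monom \<Rightarrow>\<^sub>0 'k"

definition monom_poly :: "'v monom \<Rightarrow> ('v, 'k::comm_ring_1) mpoly" where
  "monom_poly t = Poly_Mapping.single t 1"

definition indet :: "'v \<Rightarrow> ('v, 'k::comm_ring_1) mpoly" where
  "indet v = monom_poly (Poly_Mapping.single v 1)"

definition monom_degree :: "'v monom \<Rightarrow> nat" where
  "monom_degree t = (\<Sum>v\<in>Poly_Mapping.keys t. Poly_Mapping.lookup t v)"

definition squarefree_monom :: "'v monom \<Rightarrow> bool" where
  "squarefree_monom t \<longleftrightarrow> (\<forall>v. Poly_Mapping.lookup t v \<le> 1)"

definition homogeneous :: "('v, 'k::zero) mpoly \<Rightarrow> bool" where
  "homogeneous f \<longleftrightarrow> (\<exists>d. \<forall>t\<in>Poly_Mapping.keys f. monom_degree t = d)"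

text \<open>Well-foundedness is automatic, by Dickson's lemma, when \<open>'v\<close> is finite.\<close>

definition term_order :: "('v monom \<Rightarrow> 'v monom \<Rightarrow> bool) \<Rightarrow> bool" where
  "term_order leq \<longleftrightarrow>
     class.linorder leq (\<lambda>s t. leq s t \<and> s \<noteq> t) \<and>
     (\<forall>t. leq 0 t) \<and>
     (\<forall>s t u. leq s t \<longrightarrow> leq (s + u) (t + u))"

text \<open>
  The initial monomial, without its coefficient. A relation is used since the zero
  polynomial has no initial monomial.
\<close>

definition is_initial_monom ::
  "('v monom \<Rightarrow> 'v monom \<Rightarrow> bool) \<Rightarrow> ('v, 'k::zero) mpoly \<Rightarrow> 'v monom \<Rightarrow> bool" where
  "is_initial_monom leq f t \<longleftrightarrow>
     t \<in> Poly_Mapping.keys f \<and> (\<forall>s\<in>Poly_Mapping.keys f. leq s t)"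

definition initial_ideal ::
  "('v monom \<Rightarrow> 'v monom \<Rightarrow> bool) \<Rightarrow> ('v, 'k::field) mpoly set \<Rightarrow> ('v, 'k) mpoly set" where
  "initial_ideal leq I =
     Idl\<^bsub>class_ring\<^esub> (monom_poly ` {t. \<exists>f\<in>I. is_initial_monom leq f t})"

definition squarefree_monomial_ideal :: "('v, 'k::field) mpoly set \<Rightarrow> bool" where
  "squarefree_monomial_ideal I \<longleftrightarrow>
     (\<exists>B. (\<forall>t\<in>B. squarefree_monom t) \<and> I = Idl\<^bsub>class_ring\<^esub> (monom_poly ` B))"

section \<open>Minors of the generic matrix\<close>

text \<open>
  The rows and columns of the generic matrix are indexed by \<open>'r\<close> and \<open>'c\<close>, and its
  indeterminates by \<open>'r \<times> 'c\<close>. The minor \<open>[a\<^sub>1 \<dots> a\<^sub>r | b\<^sub>1 \<dots> b\<^sub>r]\<close> is represented by its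
  strictly increasing lists of row and column indices; the empty minor is excluded.
\<close>

type_synonym ('r, 'c) minor_index = "'r list \<times> 'c list"

definition minors :: "('r::{finite,linorder}, 'c::{finite,linorder}) minor_index set" where
  "minors = {(a, b). a \<noteq> [] \<and> length a = length b \<and> sorted_wrt (<) a \<and> sorted_wrt (<) b}"

fun minor_le ::
  "('r::{finite,linorder}, 'c::{finite,linorder}) minor_index \<Rightarrow> ('r, 'c) minor_index \<Rightarrow> bool" where
  "minor_le (a, b) (c, d) \<longleftrightarrow>
     length c \<le> length a \<and> (\<forall>i<length c. a ! i \<le> c ! i \<and> b ! i \<le> d ! i)"

definition minor_poset_ideal ::
  "('r::{finite,linorder}, 'c::{finite,linorder}) minor_index set \<Rightarrow> bool" where
  "minor_poset_ideal \<Omega> \<longleftrightarrow>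
     \<Omega> \<subseteq> minors \<and> (\<forall>\<omega>\<in>\<Omega>. \<forall>\<pi>\<in>minors. minor_le \<pi> \<omega> \<longrightarrow> \<pi> \<in> \<Omega>)"

fun minor_poly :: "('r, 'c) minor_index \<Rightarrow> ('r \<times> 'c, 'k::comm_ring_1) mpoly" where
  "minor_poly (a, b) = det (mat (length a) (length a) (\<lambda>(i, j). indet (a ! i, b ! j)))"

definition poset_ideal :: "('r, 'c) minor_index set \<Rightarrow> ('r \<times> 'c, 'k::field) mpoly set" where
  "poset_ideal \<Omega> = Idl\<^bsub>class_ring\<^esub> (minor_poly ` \<Omega>)"

fun antidiagonal :: "('r, 'c) minor_index \<Rightarrow> ('r \<times> 'c) monom" where
  "antidiagonal (a, b) = (\<Sum>i<length a. Poly_Mapping.single (a ! i, rev b ! i) 1)"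

definition antidiagonal_order ::
  "'k::field itself \<Rightarrow>
   (('r::{finite,linorder} \<times> 'c::{finite,linorder}) monom \<Rightarrow> ('r \<times> 'c) monom \<Rightarrow> bool) \<Rightarrow> bool" where
  "antidiagonal_order (_ :: 'k itself) leq \<longleftrightarrow>
     term_order leq \<and>
     (\<forall>\<pi>\<in>minors. is_initial_monom leq (minor_poly \<pi> :: ('r \<times> 'c, 'k) mpoly) (antidiagonal \<pi>))"

section \<open>Knutson ideals\<close>

definition knutson_poly :: "('v::finite, 'k::field) mpoly \<Rightarrow> bool" where
  "knutson_poly f \<longleftrightarrow>
     homogeneous f \<and>
     (\<exists>leq t. term_order leq \<and> is_initial_monom leq f t \<and> squarefree_monom t)"

definition colon_ideal :: "'a::comm_ring_1 set \<Rightarrow> 'a set \<Rightarrow> 'a set" where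
  "colon_ideal I J = {x. \<forall>y\<in>J. x * y \<in> I}"

text \<open>
  Every member contains \<open>f\<close>. Hence the zero ideal, which is generated by the empty set of minors,
  is not a member when \<open>f \<noteq> 0\<close>.
\<close>

inductive_set knutson_ideals :: "'a::comm_ring_1 \<Rightarrow> 'a set set" for f :: 'a where
  principal: "PIdl\<^bsub>class_ring\<^esub> f \<in> knutson_ideals f"
| colon: "I \<in> knutson_ideals f \<Longrightarrow> ideal J class_ring \<Longrightarrow> colon_ideal I J \<in> knutson_ideals f"
| sum: "I \<in> knutson_ideals f \<Longrightarrow> J \<in> knutson_ideals f \<Longrightarrow> I <+>\<^bsub>class_ring\<^esub> J \<in> knutson_ideals f"
| inter: "I \<in> knutson_ideals f \<Longrightarrow> J \<in> knutson_ideals f \<Longrightarrow> I \<inter> J \<in> knutson_ideals f"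

section \<open>Tensor products and F-purity\<close>

text \<open>
  Purity only concerns the injectivity of maps, so the tensor product is kept as an abelian group.
\<close>

definition tensor_relators ::
  "('s, 'x) ring_scheme \<Rightarrow> ('s, 'm, 'y) module_scheme \<Rightarrow> ('s, 'n, 'z) module_scheme
   \<Rightarrow> ('m \<times> 'n \<Rightarrow>\<^sub>0 int) set" where
  "tensor_relators R M N =
     {frag_of (x \<oplus>\<^bsub>M\<^esub> x', y) - frag_of (x, y) - frag_of (x', y) | x x' y.
        x \<in> carrier M \<and> x' \<in> carrier M \<and> y \<in> carrier N} \<union>
     {frag_of (x, y \<oplus>\<^bsub>N\<^esub> y') - frag_of (x, y) - frag_of (x, y') | x y y'.
        x \<in> carrier M \<and> y \<in> carrier N \<and> y' \<in> carrier N} \<union>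
     {frag_of (r \<odot>\<^bsub>M\<^esub> x, y) - frag_of (x, r \<odot>\<^bsub>N\<^esub> y) | r x y.
        r \<in> carrier R \<and> x \<in> carrier M \<and> y \<in> carrier N}"

definition tensor_kernel ::
  "('s, 'x) ring_scheme \<Rightarrow> ('s, 'm, 'y) module_scheme \<Rightarrow> ('s, 'n, 'z) module_scheme
   \<Rightarrow> ('m \<times> 'n \<Rightarrow>\<^sub>0 int) set" where
  "tensor_kernel R M N =
     generate (free_Abelian_group (carrier M \<times> carrier N)) (tensor_relators R M N)"

definition tensor_product ::
  "('s, 'x) ring_scheme \<Rightarrow> ('s, 'm, 'y) module_scheme \<Rightarrow> ('s, 'n, 'z) module_scheme
   \<Rightarrow> ('m \<times> 'n \<Rightarrow>\<^sub>0 int) set monoid" where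
  "tensor_product R M N =
     free_Abelian_group (carrier M \<times> carrier N) Mod tensor_kernel R M N"

text \<open>
  The map \<open>\<phi> \<otimes> id\<close> from \<open>M \<otimes> Q\<close> to \<open>N \<otimes> Q\<close>. The set under \<^const>\<open>the_elem\<close> is a singleton
  whenever \<open>\<phi>\<close> is a homomorphism of modules and \<open>C\<close> is an element of \<open>M \<otimes> Q\<close>.
\<close>

definition tensor_map ::
  "('s, 'x) ring_scheme \<Rightarrow> ('s, 'n, 'z) module_scheme \<Rightarrow> ('s, 'q, 'w) module_scheme \<Rightarrow> ('m \<Rightarrow> 'n)
   \<Rightarrow> ('m \<times> 'q \<Rightarrow>\<^sub>0 int) set \<Rightarrow> ('n \<times> 'q \<Rightarrow>\<^sub>0 int) set" where
  "tensor_map R N Q \<phi> C =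
     the_elem ((\<lambda>u. tensor_kernel R N Q #>\<^bsub>free_Abelian_group (carrier N \<times> carrier Q)\<^esub>
                      frag_extend (\<lambda>(x, y). frag_of (\<phi> x, y)) u) ` C)"

text \<open>
  Here \<open>Q\<close> ranges over the modules whose elements are of type \<open>'q\<close>. Full purity is
  expressed by leaving \<open>'q\<close> as a free type variable of a theorem.
\<close>

definition pure_module_hom ::
  "'q itself \<Rightarrow> ('s, 'x) ring_scheme \<Rightarrow> ('s, 'm, 'y) module_scheme \<Rightarrow> ('s, 'n, 'z) module_scheme
   \<Rightarrow> ('m \<Rightarrow> 'n) \<Rightarrow> bool" where
  "pure_module_hom (_ :: 'q itself) R M N \<phi> \<longleftrightarrow>
     \<phi> \<in> LinearCombinations.module_hom R M N \<and>
     (\<forall>Q :: ('s, 'q) module. Module.module R Q \<longrightarrow>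
        inj_on (tensor_map R N Q \<phi>) (carrier (tensor_product R M Q)))"

text \<open>
  The modules \<open>S\<close> and \<open>F\<^sub>* S\<close>. The fields \<^const>\<open>monoid.mult\<close> and \<^const>\<open>one\<close> of a module
  record carry no meaning.
\<close>

definition regular_module :: "('s, 'x) ring_scheme \<Rightarrow> ('s, 's) module" where
  "regular_module S =
     \<lparr>carrier = carrier S, monoid.mult = monoid.mult S, one = \<one>\<^bsub>S\<^esub>,
      ring.zero = \<zero>\<^bsub>S\<^esub>, ring.add = ring.add S, smult = monoid.mult S\<rparr>"

definition frobenius_module :: "nat \<Rightarrow> ('s, 'x) ring_scheme \<Rightarrow> ('s, 's) module" where
  "frobenius_module p S =
     \<lparr>carrier = carrier S, monoid.mult = monoid.mult S, one = \<one>\<^bsub>S\<^esub>,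
      ring.zero = \<zero>\<^bsub>S\<^esub>, ring.add = ring.add S, smult = (\<lambda>s x. (s [^]\<^bsub>S\<^esub> p) \<otimes>\<^bsub>S\<^esub> x)\<rparr>"

text \<open>The additive order of \<open>\<one>\<close>; it is \<open>0\<close> if that order is infinite.\<close>

definition ring_characteristic :: "('s, 'x) ring_scheme \<Rightarrow> nat" where
  "ring_characteristic S = group.ord (add_monoid S) \<one>\<^bsub>S\<^esub>"

definition F_pure :: "'q itself \<Rightarrow> ('s, 'x) ring_scheme \<Rightarrow> bool" where
  "F_pure (T :: 'q itself) S \<longleftrightarrow>
     (let p = ring_characteristic S in
        0 < p \<and>
        pure_module_hom T S (regular_module S) (frobenius_module p S) (\<lambda>x. x [^]\<^bsub>S\<^esub> p))"

end

theory Submission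
  imports Defs "HOL-Combinatorics.List_Permutation" "HOL-Library.Countable" "HOL-Library.Cardinality"
begin

text \<open>
  Put \<open>I(\<delta>)\<close> for the ideal generated by the minors that are not \<open>\<ge> \<delta>\<close>. If \<open>\<delta>\<close> is minimal outside
  \<open>\<Omega>\<close>, straightening gives \<open>\<delta> I(\<delta>) \<subseteq> \<Omega>R\<close>, and \<open>\<delta>\<close> is a nonzerodivisor modulo \<open>I(\<delta>)\<close>, so
  \<open>\<Omega>R = I(\<delta>) \<inter> (\<Omega> \<union> {\<delta>})R\<close>. By downward induction only the ideals \<open>I(\<delta>)\<close> matter, and these
  are sums of ideals of \<open>t\<close>-minors of the first rows or of the first columns.

  Border the generic matrix by an identity matrix and arrange its columns in a cycle. Then the
  summands of \<open>I(\<delta>)\<close> are the ideals of \<open>k\<close>-minors of windows of consecutive columns. They are reached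
  from the principal ideals of the windows of maximal size by one step: for the windows \<open>S \<union> {c}\<close> and
  \<open>S \<union> {d}\<close>, the sum of their ideals of \<open>(k+1)\<close>-minors contains the product of the \<open>k\<close>-minors of \<open>S\<close> and
  the \<open>(k+1)\<close>-minors of \<open>S \<union> {c, d}\<close>, and either factor is recovered as a colon ideal. So the product
  \<open>f\<close> of the maximal minors of the windows works. Its initial monomial is squarefree since the
  antidiagonals of these minors partition the variables.

  In characteristic \<open>p\<close> the map \<open>g \<mapsto> Tr (f\<^sup>p\<^sup>-\<^sup>1 g)\<close> is a splitting of Frobenius that preserves all Knutson
  ideals. It takes an initial monomial \<open>t\<close> to every monomial \<open>w\<close> with \<open>t\<close> dividing \<open>w\<^sup>p\<close>, hence to the
  squarefree part of \<open>t\<close>. In characteristic 0 the question is whether an integer linear system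
  is solvable; it is compared with the reductions modulo all large primes by running the same
  argument over the product of the prime fields.
\<close>

section \<open>Ideals and determinants\<close>

text \<open>Two obstacles shape the proof. First, the prime needed in characteristic 0 depends on
  the obstruction at hand, while a type cannot depend on it; \<open>prime_fields\<close> therefore
  carries all primes at once. It has zero divisors, so the determinantal part works over arbitrary
  commutative rings: leading coefficients are kept at 1 or -1, and regularity goes back to McCoy's
  theorem instead of primeness. Second, regularity modulo a determinantal ideal is obtained without
  a standard monomial basis. The ideal is shown to be the kernel of a substitution of a sum of
  generic rank-one matrices with prescribed supports; a minor whose image has a coefficient 1 is
  then regular modulo the ideal. That such a coefficient survives is a tropical statement: cells
  with no two in strict south-east position are the tight cells of a dual solution of a
  transportation problem with strictly Monge costs. Bordering by an identity matrix serves twice: it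
  gives minors of all sizes a common size in the Garnir relation, and it makes the ideals of initial
  rows and of initial columns two cases of one notion.\<close>

global_interpretation rmod: Modules.module "(*) :: 'a::comm_ring_1 \<Rightarrow> 'a \<Rightarrow> 'a"
  by unfold_locales (auto simp: algebra_simps)

text \<open>The ring acts on itself by multiplication, so submodules are ideals and spans are
  generated ideals; the calculus of spans then serves as a calculus of ideals.\<close>

abbreviation gen_ideal :: "'a::comm_ring_1 set \<Rightarrow> 'a set" where
  "gen_ideal \<equiv> rmod.span"

lemma gen_ideal_mult_left: "x \<in> gen_ideal S \<Longrightarrow> r * x \<in> gen_ideal S"
  by (rule rmod.span_scale)

lemma gen_ideal_minimal: "S \<subseteq> gen_ideal T \<Longrightarrow> gen_ideal S \<subseteq> gen_ideal T"
  by (metis rmod.span_minimal rmod.subspace_span)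

section \<open>Laplace expansion and symmetries of minors indexed by lists\<close>

definition del :: "nat \<Rightarrow> 'a list \<Rightarrow> 'a list" where
  "del j xs = take j xs @ drop (Suc j) xs"

lemma length_del [simp]: "j < length xs \<Longrightarrow> length (del j xs) = length xs - 1"
  by (auto simp: del_def)

lemma nth_del:
  "j < length xs \<Longrightarrow> i < length xs - 1 \<Longrightarrow> del j xs ! i = xs ! (if i < j then i else Suc i)"
  by (auto simp: del_def nth_append min_def)

lemma del_0 [simp]: "del 0 (x # xs) = xs"
  by (simp add: del_def)

lemma del_Suc [simp]: "del (Suc j) (x # xs) = x # del j xs"
  by (simp add: del_def)

lemma mset_del:
  assumes "j < length xs"
  shows "mset xs = add_mset (xs ! j) (mset (del j xs))"
proof -
  have "mset (take j xs @ xs ! j # drop (Suc j) xs) = add_mset (xs ! j) (mset (del j xs))"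
    by (simp add: del_def)
  then show ?thesis using id_take_nth_drop[OF assms] by metis
qed

lemma set_del: "set (del j xs) \<subseteq> set xs"
  by (auto simp: del_def dest: in_set_takeD in_set_dropD)

lemma set_del_insert:
  assumes "j < length xs"
  shows "set xs = insert (xs ! j) (set (del j xs))"
  by (metis assms mset_del set_mset_add_mset_insert set_mset_mset)

lemma distinct_del: "distinct xs \<Longrightarrow> distinct (del j xs)"
  by (auto simp: del_def set_take_disj_set_drop_if_distinct)

lemma set_del_distinct: "distinct xs \<Longrightarrow> j < length xs \<Longrightarrow> set (del j xs) = set xs - {xs ! j}"
proof -
  assume "distinct xs" "j < length xs"
  then have "distinct (xs ! j # del j xs)"
    by (metis mset_del mset.simps(2) mset_eq_imp_distinct_iff)
  then show ?thesis using set_del_insert[OF \<open>j < length xs\<close>] by auto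
qed

lemma del_update_same [simp]: "del j (xs[j := y]) = del j xs"
  by (simp add: del_def)

lemma del_append1: "j < length xs \<Longrightarrow> del j (xs @ ys) = del j xs @ ys"
  by (simp add: del_def)

text \<open>The index lists may be unsorted and may have repetitions, over arbitrary index types.
  One set of lemmas then serves the generic, the bordered and the doubled matrix, and manipulating
  indices costs only a sign or a zero.\<close>

definition lm :: "('x \<Rightarrow> 'y \<Rightarrow> 'k::comm_ring_1) \<Rightarrow> 'x list \<Rightarrow> 'y list \<Rightarrow> 'k" where
  "lm e a b = det (mat (length a) (length a) (\<lambda>(i, j). e (a ! i) (b ! j)))"

lemma lm_Nil [simp]: "lm e [] b = 1"
  by (simp add: lm_def)

lemma lm_cong:
  assumes "length a = length b" "\<And>x y. x \<in> set a \<Longrightarrow> y \<in> set b \<Longrightarrow> e x y = e' x y"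
  shows "lm e a b = lm e' a b"
  unfolding lm_def using assms by (intro arg_cong[where f = det] eq_matI) auto

lemma lm_map: "length b = length a \<Longrightarrow> lm e (map f a) (map g b) = lm (\<lambda>x y. e (f x) (g y)) a b"
  unfolding lm_def by (intro arg_cong[where f = det] eq_matI) auto

lemma lm_transpose:
  assumes "length a = length b"
  shows "lm e a b = lm (\<lambda>y x. e x y) b a"
proof -
  let ?A = "mat (length a) (length a) (\<lambda>(i, j). e (a ! i) (b ! j))"
  have "det (transpose_mat ?A) = det ?A" by (rule det_transpose) auto
  moreover have "transpose_mat ?A = mat (length b) (length b) (\<lambda>(i, j). e (a ! j) (b ! i))"
    using assms by (intro eq_matI) auto
  ultimately show ?thesis by (simp add: lm_def)
qed

lemma lm_expand_row:
  assumes len: "length a = length b" and i: "i < length a"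
  shows "lm e a b = (\<Sum>j<length b. e (a ! i) (b ! j) * (-1) ^ (i + j) * lm e (del i a) (del j b))"
proof -
  let ?n = "length a"
  let ?A = "mat ?n ?n (\<lambda>(i, j). e (a ! i) (b ! j))"
  have "det ?A = (\<Sum>j<?n. ?A $$ (i, j) * cofactor ?A i j)"
    by (rule laplace_expansion_row) (use i in auto)
  also have "\<dots> = (\<Sum>j<length b. e (a ! i) (b ! j) * (-1) ^ (i + j) * lm e (del i a) (del j b))"
  proof (rule sum.cong)
    show "{..<?n} = {..<length b}" by (simp add: len)
    fix j assume j: "j \<in> {..<length b}"
    have "mat_delete ?A i j = mat (?n - 1) (?n - 1) (\<lambda>(k, l). e (del i a ! k) (del j b ! l))"
      using i j len by (intro eq_matI) (auto simp: mat_delete_def nth_del)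
    moreover have "length (del i a) = ?n - 1" using i by simp
    ultimately have "det (mat_delete ?A i j) = lm e (del i a) (del j b)"
      unfolding lm_def by (simp only:)
    moreover have "?A $$ (i, j) = e (a ! i) (b ! j)" using i j len by simp
    ultimately show "?A $$ (i, j) * cofactor ?A i j =
        e (a ! i) (b ! j) * (-1) ^ (i + j) * lm e (del i a) (del j b)"
      unfolding cofactor_def by (simp only: mult.assoc)
  qed
  finally show ?thesis by (simp add: lm_def)
qed

lemma lm_expand_col:
  assumes len: "length a = length b" and j: "j < length b"
  shows "lm e a b = (\<Sum>i<length a. e (a ! i) (b ! j) * (-1) ^ (i + j) * lm e (del i a) (del j b))"
proof -
  have "lm e a b = lm (\<lambda>y x. e x y) b a" by (rule lm_transpose[OF len])
  also have "\<dots> = (\<Sum>i<length a. e (a ! i) (b ! j) * (-1) ^ (j + i) * lm (\<lambda>y x. e x y) (del j b) (del i a))"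
    by (rule lm_expand_row) (use assms in auto)
  also have "\<dots> = (\<Sum>i<length a. e (a ! i) (b ! j) * (-1) ^ (i + j) * lm e (del i a) (del j b))"
  proof (rule sum.cong[OF refl])
    fix i assume "i \<in> {..<length a}"
    then have "lm (\<lambda>y x. e x y) (del j b) (del i a) = lm e (del i a) (del j b)"
      by (intro lm_transpose[symmetric]) (use assms in simp)
    then show "e (a ! i) (b ! j) * (-1) ^ (j + i) * lm (\<lambda>y x. e x y) (del j b) (del i a) =
        e (a ! i) (b ! j) * (-1) ^ (i + j) * lm e (del i a) (del j b)"
      by (simp add: add.commute)
  qed
  finally show ?thesis .
qed

lemma lm_expand_first_row:
  assumes "Suc (length a) = length b"
  shows "lm e (x # a) b = (\<Sum>j<length b. e x (b ! j) * (-1) ^ j * lm e a (del j b))"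
proof -
  have "0 < length (x # a)" "length (x # a) = length b" using assms by auto
  from lm_expand_row[OF this(2,1), of e] show ?thesis by simp
qed

lemma lm_expand_first_col:
  assumes "length a = Suc (length b)"
  shows "lm e a (y # b) = (\<Sum>i<length a. e (a ! i) y * (-1) ^ i * lm e (del i a) b)"
  using lm_expand_col[of a "y # b" 0 e] assms by simp

lemma lm_not_distinct_rows:
  assumes "length a = length b" "\<not> distinct a"
  shows "lm e a b = 0"
proof -
  from assms(2) obtain i j where ij: "i < length a" "j < length a" "i \<noteq> j" "a ! i = a ! j"
    by (auto simp: distinct_conv_nth)
  show ?thesis unfolding lm_def
    by (rule det_identical_rows[of _ "length a" i j])
       (use ij in \<open>auto intro!: eq_vecI\<close>)
qed

lemma lm_not_distinct_cols:
  assumes "length a = length b" "\<not> distinct b"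
  shows "lm e a b = 0"
  unfolding lm_transpose[OF assms(1)]
  by (rule lm_not_distinct_rows) (use assms in auto)

text \<open>Signs are never tracked: ideals are closed under negation, so it suffices that
  reordering preserves a minor up to sign.\<close>

lemma lm_perm_rows:
  assumes "mset a = mset a'"
  shows "lm e a' b = lm e a b \<or> lm e a' b = - lm e a b"
proof -
  from mset_eq_permutation[OF assms[symmetric]] obtain p
    where p: "p permutes {..<length a}" "permute_list p a = a'" by blast
  let ?A = "mat (length a) (length a) (\<lambda>(i, j). e (a ! i) (b ! j))"
  have len: "length a' = length a" using p(2) by auto
  have p0: "p permutes {0..<length a}" using p(1) by (simp add: lessThan_atLeast0)
  have "det (mat (length a) (length a) (\<lambda>(i, j). ?A $$ (p i, j))) = signof p * det ?A"
    by (rule det_permute_rows[OF _ p0]) auto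
  moreover have "mat (length a) (length a) (\<lambda>(i, j). ?A $$ (p i, j)) =
      mat (length a') (length a') (\<lambda>(i, j). e (a' ! i) (b ! j))"
    unfolding len
  proof (intro eq_matI)
    fix i j assume "i < dim_row (mat (length a) (length a) (\<lambda>(i, j). e (a' ! i) (b ! j)))"
      "j < dim_col (mat (length a) (length a) (\<lambda>(i, j). e (a' ! i) (b ! j)))"
    then have ij: "i < length a" "j < length a" by auto
    have "p i < length a" using permutes_in_image[OF p(1), of i] ij by simp
    moreover have "a' ! i = a ! p i" using permute_list_nth[OF p(1)] p(2) ij by auto
    ultimately show "mat (length a) (length a) (\<lambda>(i, j). ?A $$ (p i, j)) $$ (i, j) =
        mat (length a) (length a) (\<lambda>(i, j). e (a' ! i) (b ! j)) $$ (i, j)"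
      using ij by simp
  qed auto
  ultimately show ?thesis
    unfolding lm_def by (auto simp: sign_def)
qed

lemma lm_perm_cols:
  assumes "mset b = mset b'" "length a = length b"
  shows "lm e a b' = lm e a b \<or> lm e a b' = - lm e a b"
proof -
  have "length b' = length a" using assms by (metis size_mset)
  then have "lm e a b = lm (\<lambda>y x. e x y) b a" "lm e a b' = lm (\<lambda>y x. e x y) b' a"
    using assms(2) by (auto intro: lm_transpose)
  then show ?thesis
    using lm_perm_rows[OF assms(1), of "\<lambda>y x. e x y" a] by metis
qed

lemma gen_ideal_lm_perm:
  assumes "lm e a b \<in> gen_ideal S" "mset a = mset a'" "mset b = mset b'" "length a = length b"
  shows "lm e a' b' \<in> gen_ideal S"
proof -
  have len: "length a' = length a" "length b' = length a" using assms by (metis size_mset)+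
  have "lm e a' b \<in> gen_ideal S"
    using lm_perm_rows[OF assms(2), of e b] assms(1) rmod.span_neg by force
  then show ?thesis
    using lm_perm_cols[OF assms(3), of a' e] rmod.span_neg len assms(4) by force
qed

text \<open>Additivity is phrased through an index whose column happens to be the sum of those of
  \<open>y\<close> and \<open>z\<close>; the doubled matrix below provides such indices.\<close>

lemma lm_add_col:
  assumes len: "length a = length b" and j: "j < length b"
    and e: "\<And>x. x \<in> set a \<Longrightarrow> e x (b ! j) = e x y + e x z"
  shows "lm e a b = lm e a (b[j := y]) + lm e a (b[j := z])"
proof -
  have "lm e a b = (\<Sum>i<length a. e (a ! i) (b ! j) * (-1) ^ (i + j) * lm e (del i a) (del j b))"
    by (rule lm_expand_col[OF len j])
  also have "\<dots> = (\<Sum>i<length a. e (a ! i) y * (-1) ^ (i + j) * lm e (del i a) (del j b)) +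
     (\<Sum>i<length a. e (a ! i) z * (-1) ^ (i + j) * lm e (del i a) (del j b))"
    unfolding sum.distrib[symmetric]
    by (intro sum.cong refl) (simp add: e distrib_right)
  also have "(\<Sum>i<length a. e (a ! i) y * (-1) ^ (i + j) * lm e (del i a) (del j b)) = lm e a (b[j := y])"
    using lm_expand_col[of a "b[j := y]" j e] assms by simp
  also have "(\<Sum>i<length a. e (a ! i) z * (-1) ^ (i + j) * lm e (del i a) (del j b)) = lm e a (b[j := z])"
    using lm_expand_col[of a "b[j := z]" j e] assms by simp
  finally show ?thesis .
qed

lemma lm_block_triangular:
  assumes "length a1 = length b1" "length a2 = length b2"
    and "\<And>x y. x \<in> set a1 \<Longrightarrow> y \<in> set b2 \<Longrightarrow> e x y = 0"
  shows "lm e (a1 @ a2) (b1 @ b2) = lm e a1 b1 * lm e a2 b2"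
  using assms
proof (induction a1 arbitrary: b1)
  case Nil
  then show ?case by simp
next
  case (Cons x a1)
  have l: "Suc (length (a1 @ a2)) = length (b1 @ b2)" "Suc (length a1) = length b1"
    using Cons.prems by auto
  have "lm e ((x # a1) @ a2) (b1 @ b2) =
      (\<Sum>j<length (b1 @ b2). e x ((b1 @ b2) ! j) * (-1) ^ j * lm e (a1 @ a2) (del j (b1 @ b2)))"
    using lm_expand_first_row[OF l(1), of e x] by simp
  also have "\<dots> = (\<Sum>j<length b1. e x ((b1 @ b2) ! j) * (-1) ^ j * lm e (a1 @ a2) (del j (b1 @ b2)))"
    by (rule sum.mono_neutral_right) (auto simp: nth_append Cons.prems)
  also have "\<dots> = (\<Sum>j<length b1. e x (b1 ! j) * (-1) ^ j * lm e a1 (del j b1) * lm e a2 b2)"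
  proof (intro sum.cong refl)
    fix j assume j: "j \<in> {..<length b1}"
    have "lm e (a1 @ a2) (del j (b1 @ b2)) = lm e a1 (del j b1) * lm e a2 b2"
      using Cons.IH[of "del j b1"] Cons.prems j l by (simp add: del_append1)
    moreover have "(b1 @ b2) ! j = b1 ! j" using j by (simp add: nth_append)
    ultimately show "e x ((b1 @ b2) ! j) * (-1) ^ j * lm e (a1 @ a2) (del j (b1 @ b2)) =
        e x (b1 ! j) * (-1) ^ j * lm e a1 (del j b1) * lm e a2 b2"
      by (simp only: mult.assoc)
  qed
  also have "\<dots> = lm e (x # a1) b1 * lm e a2 b2"
    using lm_expand_first_row[OF l(2), of e x] by (simp add: sum_distrib_right)
  finally show ?case .
qed

text \<open>Columns that vanish on the rows being expanded survive in every term.\<close>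

lemma lm_in_ideal_rows:
  assumes "length b = length a2 + length a"
  shows "lm e (a2 @ a) b \<in> gen_ideal {lm e a b' | b'. length b' = length a \<and> mset b' \<subseteq># mset b \<and>
    (\<forall>y\<in>set b. (\<forall>x\<in>set a2. e x y = 0) \<longrightarrow> y \<in> set b')}"
  using assms
proof (induction a2 arbitrary: b)
  case Nil
  then show ?case by (auto intro!: rmod.span_base)
next
  case (Cons x a2)
  have l: "Suc (length (a2 @ a)) = length b" using Cons.prems by simp
  let ?G = "\<lambda>b a2. {lm e a b' | b'. length b' = length a \<and> mset b' \<subseteq># mset b \<and>
    (\<forall>y\<in>set b. (\<forall>x\<in>set a2. e x y = 0) \<longrightarrow> y \<in> set b')}"
  have "lm e (x # a2 @ a) b \<in> gen_ideal (?G b (x # a2))"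
    unfolding lm_expand_first_row[OF l]
  proof (rule rmod.span_sum)
    fix j assume j: "j \<in> {..<length b}"
    show "e x (b ! j) * (-1) ^ j * lm e (a2 @ a) (del j b) \<in> gen_ideal (?G b (x # a2))"
    proof (cases "e x (b ! j) = 0")
      case True
      then show ?thesis by (simp add: rmod.span_zero)
    next
      case False
      have ms: "mset b = add_mset (b ! j) (mset (del j b))" using j mset_del by auto
      \<comment> \<open>The deleted column has a nonzero entry in row \<open>x\<close>, so it is not
        one of those that must survive.\<close>
      have "?G (del j b) a2 \<subseteq> ?G b (x # a2)"
      proof clarify
        fix b' assume b': "length b' = length a" "mset b' \<subseteq># mset (del j b)"
          "\<forall>y\<in>set (del j b). (\<forall>x\<in>set a2. e x y = 0) \<longrightarrow> y \<in> set b'"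
        have "mset b' \<subseteq># mset b" using b'(2) ms by (metis subset_mset.order_trans mset_subset_eq_add_right union_mset_add_mset_right add_mset_add_single mset_subset_eq_add_left)
        moreover have "y \<in> set b'" if "y \<in> set b" "\<forall>x\<in>set (x # a2). e x y = 0" for y
        proof -
          have "y \<noteq> b ! j" using that(2) False by auto
          then have "y \<in> set (del j b)" using that(1) j set_del_insert[of j b] by auto
          then show ?thesis using b'(3) that(2) by auto
        qed
        ultimately show "\<exists>b'a. lm e a b' = lm e a b'a \<and> length b'a = length a \<and> mset b'a \<subseteq># mset b \<and>
           (\<forall>y\<in>set b. (\<forall>x\<in>set (x # a2). e x y = 0) \<longrightarrow> y \<in> set b'a)" using b'(1) by blast
      qed
      then have "gen_ideal (?G (del j b) a2) \<subseteq> gen_ideal (?G b (x # a2))"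
        by (rule rmod.span_mono)
      moreover have "lm e (a2 @ a) (del j b) \<in> gen_ideal (?G (del j b) a2)"
        by (rule Cons.IH) (use l j in simp)
      ultimately have "lm e (a2 @ a) (del j b) \<in> gen_ideal (?G b (x # a2))"
        by (rule subsetD)
      then show ?thesis by (rule gen_ideal_mult_left)
    qed
  qed
  then show ?case by simp
qed

text \<open>Expanding the bordered determinant with row \<open>x\<close> and column \<open>c\<close> along \<open>x\<close> expresses
  \<open>lm e a1 b1 * e x c\<close>; substituting it in the expansion of \<open>lm e a0 (c # q)\<close> along \<open>c\<close>
  exchanges \<open>c\<close> with the columns \<open>b1\<close>.\<close>

lemma lm_exchange:
  assumes l1: "length a1 = length b1" and l0: "length a0 = Suc (length q)"
  shows "lm e a1 b1 * lm e a0 (c # q) =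
    (\<Sum>i<length a0. (-1) ^ i * lm e (del i a0) q * lm e (a0 ! i # a1) (c # b1)) +
    (\<Sum>j<length b1. (-1) ^ j * lm e a1 (c # del j b1) * lm e a0 (b1 ! j # q))"
proof -
  have border: "lm e a1 b1 * e x c = lm e (x # a1) (c # b1) +
      (\<Sum>j<length b1. (-1) ^ j * e x (b1 ! j) * lm e a1 (c # del j b1))" for x
  proof -
    have "lm e (x # a1) (c # b1) = (\<Sum>j<length (c # b1). e x ((c # b1) ! j) * (-1) ^ j * lm e a1 (del j (c # b1)))"
      by (rule lm_expand_first_row) (use l1 in simp)
    also have "\<dots> = e x c * lm e a1 b1 +
        (\<Sum>j<length b1. - ((-1) ^ j * e x (b1 ! j) * lm e a1 (c # del j b1)))"
    proof -
      have "(\<Sum>j<length (c # b1). e x ((c # b1) ! j) * (-1) ^ j * lm e a1 (del j (c # b1))) =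
        (\<Sum>j<Suc (length b1). e x ((c # b1) ! j) * (-1) ^ j * lm e a1 (del j (c # b1)))" by simp
      also have "\<dots> = e x c * lm e a1 b1 +
        (\<Sum>j<length b1. e x (b1 ! j) * (-1) ^ Suc j * lm e a1 (c # del j b1))"
        unfolding sum.lessThan_Suc_shift by simp
      also have "(\<Sum>j<length b1. e x (b1 ! j) * (-1) ^ Suc j * lm e a1 (c # del j b1)) =
        (\<Sum>j<length b1. - ((-1) ^ j * e x (b1 ! j) * lm e a1 (c # del j b1)))"
        by (intro sum.cong refl) simp
      finally show ?thesis .
    qed
    finally have "lm e (x # a1) (c # b1) = e x c * lm e a1 b1 -
        (\<Sum>j<length b1. (-1) ^ j * e x (b1 ! j) * lm e a1 (c # del j b1))"
      by (simp only: sum_negf diff_conv_add_uminus)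
    then show ?thesis by (simp only: diff_add_cancel mult.commute[of "lm e a1 b1"])
  qed
  have "lm e a1 b1 * lm e a0 (c # q) = (\<Sum>i<length a0. (-1) ^ i * lm e (del i a0) q * (lm e a1 b1 * e (a0 ! i) c))"
    unfolding lm_expand_first_col[OF l0] sum_distrib_left
    by (intro sum.cong refl) (simp only: mult_ac)
  also have "\<dots> = (\<Sum>i<length a0. (-1) ^ i * lm e (del i a0) q * lm e (a0 ! i # a1) (c # b1)) +
      (\<Sum>i<length a0. \<Sum>j<length b1. (-1) ^ i * lm e (del i a0) q * ((-1) ^ j * e (a0 ! i) (b1 ! j) * lm e a1 (c # del j b1)))"
    unfolding sum.distrib[symmetric]
    by (intro sum.cong refl) (simp only: border distrib_left sum_distrib_left)
  also have "(\<Sum>i<length a0. \<Sum>j<length b1. (-1) ^ i * lm e (del i a0) q * ((-1) ^ j * e (a0 ! i) (b1 ! j) * lm e a1 (c # del j b1))) =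
      (\<Sum>j<length b1. (-1) ^ j * lm e a1 (c # del j b1) * lm e a0 (b1 ! j # q))"
    unfolding lm_expand_first_col[OF l0] sum_distrib_left
    by (subst sum.swap) (intro sum.cong refl, simp only: mult_ac)
  finally show ?thesis .
qed

section \<open>The Garnir relation by doubling a matrix\<close>

lemma lm_zero_col:
  assumes "length a = length b" "y \<in> set b" "\<And>x. x \<in> set a \<Longrightarrow> e x y = 0"
  shows "lm e a b = 0"
proof -
  obtain j where j: "j < length b" "b ! j = y" using assms(2) by (auto simp: in_set_conv_nth)
  show ?thesis
    unfolding lm_expand_col[OF assms(1) j(1), of e] j(2)
    by (rule sum.neutral) (simp add: assms(3))
qed

lemma lm_add_row:
  assumes len: "length a = length b" and i: "i < length a"
    and e: "\<And>y. y \<in> set b \<Longrightarrow> e (a ! i) y = e x y + e z y"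
  shows "lm e a b = lm e (a[i := x]) b + lm e (a[i := z]) b"
  unfolding lm_transpose[OF len] lm_transpose[of "a[i := x]" b, simplified, OF len]
    lm_transpose[of "a[i := z]" b, simplified, OF len]
  by (rule lm_add_col) (use assms in auto)

text \<open>Determinants of two stacked copies of a matrix: a row carries the coefficients with which it
  takes the upper and the lower copy, and a column those with which it occurs in them.\<close>

fun twofold :: "('x \<Rightarrow> 'y \<Rightarrow> 'k::comm_ring_1) \<Rightarrow> ('k \<times> 'k) \<times> 'x \<Rightarrow> ('k \<times> 'k) \<times> 'y \<Rightarrow> 'k" where
  "twofold e ((g, d), x) ((s, t), y) = (g * s + d * t) * e x y"

lemma twofold_alt: "twofold e r c =
    (fst (fst r) * fst (fst c) + snd (fst r) * snd (fst c)) * e (snd r) (snd c)"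
  by (cases r; cases c) auto

abbreviation upper :: "'x \<Rightarrow> ('k::comm_ring_1 \<times> 'k) \<times> 'x" where "upper x \<equiv> ((1, 0), x)"
abbreviation lower :: "'x \<Rightarrow> ('k::comm_ring_1 \<times> 'k) \<times> 'x" where "lower x \<equiv> ((0, 1), x)"
abbreviation both :: "'x \<Rightarrow> ('k::comm_ring_1 \<times> 'k) \<times> 'x" where "both x \<equiv> ((1, 1), x)"
abbreviation low_up :: "'x \<Rightarrow> ('k::comm_ring_1 \<times> 'k) \<times> 'x" where "low_up x \<equiv> ((- 1, 1), x)"

text \<open>Subtracting each upper row from its lower copy leaves the determinant unchanged. This is
  done one row at a time: \<open>lower\<close> is the sum of \<open>low_up\<close> and
  \<open>upper\<close>, and the second summand repeats a row that is already present.\<close>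

lemma twofold_subtract_rows:
  fixes e :: "'x \<Rightarrow> 'y \<Rightarrow> 'k::comm_ring_1"
  assumes "length b = 2 * length rs" "k \<le> length rs"
  shows "lm (twofold e) (map upper rs @ map lower rs) b =
    lm (twofold e) (map upper rs @ map low_up (take k rs) @ map lower (drop k rs)) b"
  using assms(2)
proof (induction k)
  case 0
  then show ?case by simp
next
  case (Suc k)
  let ?R = "\<lambda>z. map upper rs @ map low_up (take k rs) @ z # map lower (drop (Suc k) rs)"
  let ?x = "rs ! k" and ?i = "length rs + k"
  have k: "k < length rs" using Suc.prems by simp
  have l: "length (?R z) = length b" for z using assms(1) k by simp
  have upd: "(?R z)[?i := z'] = ?R z'" for z z'
    using k by (simp add: list_update_append)
  have nth: "?R z ! ?i = z" for z
    using k by (simp add: nth_append)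
  have "lm (twofold e) (?R (lower ?x)) b = lm (twofold e) ((?R (lower ?x))[?i := low_up ?x]) b +
      lm (twofold e) ((?R (lower ?x))[?i := upper ?x]) b"
  proof (rule lm_add_row)
    show "?i < length (?R (lower ?x))" using k by simp
    fix y show "twofold e (?R (lower ?x) ! ?i) y = twofold e (low_up ?x) y + twofold e (upper ?x) y"
      unfolding nth by (simp add: twofold_alt algebra_simps)
  qed (rule l)
  also have "lm (twofold e) ((?R (lower ?x))[?i := upper ?x]) b = 0"
    unfolding upd by (rule lm_not_distinct_rows[OF l]) (use k in \<open>auto simp: image_iff\<close>)
  finally have "lm (twofold e) (?R (lower ?x)) b = lm (twofold e) (?R (low_up ?x)) b"
    by (simp only: upd add_0_right)
  moreover have "lm (twofold e) (map upper rs @ map lower rs) b =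
      lm (twofold e) (map upper rs @ map low_up (take k rs) @ map lower (drop k rs)) b"
    using Suc by simp
  moreover have "(map lower (drop k rs) :: (('k \<times> 'k) \<times> 'x) list) = lower ?x # map lower (drop (Suc k) rs)"
    using k by (simp add: Cons_nth_drop_Suc[symmetric])
  moreover have "(map low_up (take (Suc k) rs) :: (('k \<times> 'k) \<times> 'x) list) = map low_up (take k rs) @ [low_up ?x]"
    using k by (simp add: take_Suc_conv_app_nth)
  ultimately show ?case by (simp only: append_assoc append_Cons append_Nil)
qed

text \<open>After the row subtraction the lower half is zero on every column that occurs in both
  copies. Its rows then have only the columns \<open>u\<close> and \<open>w\<close> to use, and
  these are fewer than the rows.\<close>

lemma twofold_eq_0:
  fixes e :: "'x \<Rightarrow> 'y \<Rightarrow> 'k::comm_ring_1"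
  assumes "length c + length u + length w = 2 * length rs" "length u + length w < length rs"
    and b: "mset b = mset (map upper u @ map both c @ map lower w)"
  shows "lm (twofold e) (map upper rs @ map lower rs) b = 0"
proof -
  let ?L = "map low_up rs :: (('k \<times> 'k) \<times> 'x) list"
  have lb: "length b = length u + length c + length w"
    using arg_cong[OF b, of size] by simp
  have "lm (twofold e) (map upper rs @ map lower rs) b = lm (twofold e) (map upper rs @ ?L) b"
    using twofold_subtract_rows[of b rs "length rs" e] lb assms(1) by simp
  also have "lm (twofold e) (map upper rs @ ?L) b \<in> gen_ideal {lm (twofold e) ?L b' | b'.
      length b' = length ?L \<and> mset b' \<subseteq># mset b \<and>
      (\<forall>y\<in>set b. (\<forall>x\<in>set (map upper rs). twofold e x y = 0) \<longrightarrow> y \<in> set b')}"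
    by (rule lm_in_ideal_rows) (use lb assms(1) in simp)
  also have "\<dots> \<subseteq> gen_ideal {0}"
  proof (rule rmod.span_mono, clarsimp)
    fix b' :: "(('k \<times> 'k) \<times> 'y) list"
    assume b': "length b' = length rs" "mset b' \<subseteq># mset b"
    have "\<exists>y\<in>set b'. fst y = (1, 1)"
    proof (rule ccontr)
      assume "\<not> ?thesis"
      then have "filter_mset (\<lambda>y. fst y \<noteq> (1, 1)) (mset b') = mset b'"
        by (auto simp flip: mset_filter intro!: arg_cong[where f = mset] filter_True)
      then have "mset b' \<subseteq># filter_mset (\<lambda>y. fst y \<noteq> (1, 1)) (mset b)"
        using multiset_filter_mono[OF b'(2), of "\<lambda>y. fst y \<noteq> (1, 1)"] by simp
      then have "length rs \<le> size (filter_mset (\<lambda>y. fst y \<noteq> (1, 1)) (mset b))"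
        using b'(1) size_mset_mono by fastforce
      also have "\<dots> = length u + length w"
        unfolding b mset_filter[symmetric] size_mset by (simp add: filter_map o_def)
      finally show False using assms(2) by simp
    qed
    then obtain y where y: "y \<in> set b'" "fst y = (1, 1)" by blast
    show "lm (twofold e) ?L b' = 0"
      by (rule lm_zero_col[OF _ y(1)]) (use b'(1) y(2) in \<open>auto simp: twofold_alt\<close>)
  qed
  also have "gen_ideal {0 :: 'k} = {0}" by simp
  finally show ?thesis by simp
qed

lemma twofold_upper:
  assumes "length b = length rs" "\<And>y. y \<in> set b \<Longrightarrow> fst (fst y) = 1"
  shows "lm (twofold e) (map upper rs) b = lm e rs (map snd b)"
proof -
  have "lm (twofold e) (map upper rs) b = lm (\<lambda>x y. twofold e (upper x) y) rs b"
    using lm_map[of b rs "twofold e" upper id] assms(1) by simp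
  also have "\<dots> = lm (\<lambda>x y. e x (snd y)) rs b"
    by (rule lm_cong) (use assms in force)+
  also have "\<dots> = lm e rs (map snd b)"
    using lm_map[of b rs e id snd] assms(1) by simp
  finally show ?thesis .
qed

text \<open>The Garnir relation. Both halves of the determinant with columns \<open>u\<close> (above), \<open>pr\<close> and \<open>q1\<close>
  (in both halves) and \<open>w\<close> (below) vanish together; deleting the upper copies of \<open>q1\<close> one at a time
  changes it by elements of the ideal and turns it into the product on the left.\<close>

lemma garnir_product:
  fixes e :: "'x \<Rightarrow> 'y \<Rightarrow> 'k::comm_ring_1"
  assumes lp: "length (u @ pr) = length rs" and lq: "length (q1 @ w) = length rs"
    and less: "length u + length w < length rs"
  shows "lm e rs (u @ pr) * lm e rs (q1 @ w) \<in> gen_ideal {lm e rs p | p.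
    length p = length rs \<and> distinct p \<and> set u \<subseteq> set p \<and> set p \<subseteq> set u \<union> set q1 \<union> set pr \<and>
    (\<exists>y\<in>set p. y \<in> set q1 \<and> y \<notin> set u)}" (is "_ \<in> gen_ideal ?G")
proof -
  let ?R = "map upper rs @ map lower rs :: (('k \<times> 'k) \<times> 'x) list"
  let ?B = "\<lambda>z k. map upper u @ map both pr @ map lower (take k q1) @ z @ map both (drop (Suc k) q1) @ map lower w
      :: (('k \<times> 'k) \<times> 'y) list"
  let ?W = "\<lambda>k. map upper u @ map both pr @ map lower (take k q1) @ map both (drop k q1) @ map lower w
      :: (('k \<times> 'k) \<times> 'y) list"
  have "lm (twofold e) ?R (?W k) \<in> gen_ideal ?G" if "k \<le> length q1" for k
    using that
  proof (induction k)
    case 0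
    have "lm (twofold e) ?R (?W 0) = 0"
      by (rule twofold_eq_0[of "pr @ q1" u w]) (use assms in auto)
    then show ?case by (simp add: rmod.span_zero)
  next
    case (Suc k)
    have k: "k < length q1" using Suc.prems by simp
    let ?y = "q1 ! k" and ?j = "length u + length pr + k"
    have l: "length ?R = length (?B [z] k)" for z using k lp lq by simp
    have upd: "(?B [z] k)[?j := z'] = ?B [z'] k" for z z'
      using k by (simp add: list_update_append)
    have nth: "?B [z] k ! ?j = z" for z
      using k by (simp add: nth_append)
    have WB: "?W k = ?B [both ?y] k" "?W (Suc k) = ?B [lower ?y] k"
      using k by (simp_all add: Cons_nth_drop_Suc[symmetric] take_Suc_conv_app_nth)
    have "lm (twofold e) ?R (?B [both ?y] k) = lm (twofold e) ?R ((?B [both ?y] k)[?j := upper ?y]) +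
        lm (twofold e) ?R ((?B [both ?y] k)[?j := lower ?y])"
    proof (rule lm_add_col)
      show "?j < length (?B [both ?y] k)" using k by simp
      fix x assume "x \<in> set ?R"
      then show "twofold e x (?B [both ?y] k ! ?j) = twofold e x (upper ?y) + twofold e x (lower ?y)"
        unfolding nth by (auto simp: algebra_simps)
    qed (use l in simp)
    then have eq: "lm (twofold e) ?R (?W (Suc k)) = lm (twofold e) ?R (?W k) - lm (twofold e) ?R (?B [upper ?y] k)"
      unfolding upd WB by simp
    have "lm (twofold e) ?R (?B [upper ?y] k) \<in> gen_ideal ?G"
    proof (cases "?y \<in> set u")
      case True
      have "\<not> distinct (?B [upper ?y] k)" using True by (auto simp: image_iff)
      then have "lm (twofold e) ?R (?B [upper ?y] k) = 0"
        by (rule lm_not_distinct_cols[OF l])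
      then show ?thesis by (simp add: rmod.span_zero)
    next
      case False
      let ?b = "?B [upper ?y] k" and ?U = "map upper rs :: (('k \<times> 'k) \<times> 'x) list"
      \<comment> \<open>The columns \<open>u\<close> and the new upper \<open>?y\<close> vanish on
        the lower rows. Expanding along these rows hence leaves minors of the upper rows that still
        contain all of them; a minor that picks a purely lower column is zero.\<close>
      have "lm (twofold e) (map lower rs @ ?U) ?b \<in> gen_ideal {lm (twofold e) ?U b' | b'.
        length b' = length ?U \<and> mset b' \<subseteq># mset ?b \<and>
        (\<forall>y\<in>set ?b. (\<forall>x\<in>set (map lower rs). twofold e x y = 0) \<longrightarrow> y \<in> set b')}"
        by (rule lm_in_ideal_rows) (use l[of "upper ?y"] in simp)
      also have "\<dots> \<subseteq> gen_ideal ?G"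
      proof (rule gen_ideal_minimal, clarify)
        fix b' :: "(('k \<times> 'k) \<times> 'y) list"
        assume b': "length b' = length ?U" "mset b' \<subseteq># mset ?b"
          and keep: "\<forall>y\<in>set ?b. (\<forall>x\<in>set (map lower rs). twofold e x y = 0) \<longrightarrow> y \<in> set b'"
        have sub: "set b' \<subseteq> set ?b" using b'(2) by (metis set_mset_mset set_mset_mono)
        have keepu: "upper y \<in> set b'" if "y = ?y \<or> y \<in> set u" for y
          using that keep by (auto simp: image_iff)
        show "lm (twofold e) ?U b' \<in> gen_ideal ?G"
        proof (cases "\<exists>y\<in>set b'. fst (fst y) = 0")
          case True
          then obtain y where y: "y \<in> set b'" "fst (fst y) = 0" by blast
          then have "fst y = (0, 1)" using sub by (auto simp: image_iff)
          then have "lm (twofold e) ?U b' = 0"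
            by (intro lm_zero_col[OF _ y(1)]) (use b'(1) in \<open>auto simp: twofold_alt\<close>)
          then show ?thesis by (simp add: rmod.span_zero)
        next
          case F: False
          have one: "fst (fst y) = 1" "snd y \<in> insert ?y (set u \<union> set q1 \<union> set pr)" if "y \<in> set b'" for y
          proof -
            have "y \<in> set ?b" using sub that by blast
            then consider "y \<in> upper ` set u" | "y \<in> both ` set pr" | "y \<in> lower ` set (take k q1)" | "y = upper ?y"
              | "y \<in> both ` set (drop (Suc k) q1)" | "y \<in> lower ` set w" by auto
            then have "fst (fst y) = 1 \<and> snd y \<in> insert ?y (set u \<union> set q1 \<union> set pr)"
              using F that by cases (auto dest: in_set_dropD)
            then show "fst (fst y) = 1" "snd y \<in> insert ?y (set u \<union> set q1 \<union> set pr)" by auto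
          qed
          have eq: "lm (twofold e) ?U b' = lm e rs (map snd b')"
            by (rule twofold_upper) (use b'(1) one in auto)
          show ?thesis
          proof (cases "distinct (map snd b')")
            case True
            have "?y \<in> set q1" using k by simp
            moreover have "?y \<in> snd ` set b'" "set u \<subseteq> snd ` set b'"
              using keepu by force+
            moreover have "snd ` set b' \<subseteq> set u \<union> set q1 \<union> set pr"
            proof clarify
              fix y assume "y \<in> set b'" "snd y \<notin> set pr" "snd y \<notin> set q1"
              then show "snd y \<in> set u" using one(2)[of y] \<open>?y \<in> set q1\<close> by auto
            qed
            ultimately have "length (map snd b') = length rs \<and> distinct (map snd b') \<and> set u \<subseteq> set (map snd b') \<and>
                set (map snd b') \<subseteq> set u \<union> set q1 \<union> set pr \<and> (\<exists>y\<in>set (map snd b'). y \<in> set q1 \<and> y \<notin> set u)"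
              using True b'(1) False by (metis length_map list.set_map)
            then have "lm e rs (map snd b') \<in> ?G" by blast
            then show ?thesis unfolding eq by (rule rmod.span_base)
          next
            case False
            have "lm e rs (map snd b') = 0"
              by (rule lm_not_distinct_cols) (use False b'(1) in auto)
            then show ?thesis unfolding eq by (simp add: rmod.span_zero)
          qed
        qed
      qed
      finally have *: "lm (twofold e) (map lower rs @ ?U) ?b \<in> gen_ideal ?G" .
      show ?thesis
        by (rule gen_ideal_lm_perm[OF *]) (use l[of "upper ?y"] in auto)
    qed
    then show ?case unfolding eq using Suc k by (intro rmod.span_diff) auto
  qed
  from this[of "length q1"] have "lm (twofold e) ?R ((map upper u @ map both pr) @ (map lower q1 @ map lower w)) \<in> gen_ideal ?G"
    by simp
  also have "lm (twofold e) ?R ((map upper u @ map both pr) @ (map lower q1 @ map lower w)) =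
     lm (twofold e) (map upper rs) (map upper u @ map both pr) * lm (twofold e) (map lower rs) (map lower q1 @ map lower w)"
    by (rule lm_block_triangular) (use lp lq in auto)
  also have "lm (twofold e) (map upper rs) (map upper u @ map both pr) = lm e rs (u @ pr)"
    by (subst twofold_upper) (use lp in \<open>auto simp: o_def\<close>)
  also have "lm (twofold e) (map lower rs) (map lower q1 @ map lower w) = lm e rs (q1 @ w)"
    unfolding map_append[symmetric] by (subst lm_map) (use lq in auto)
  finally show ?thesis .
qed

section \<open>Minors of the bordered matrix and straightening of products\<close>

fun bordered :: "('r \<Rightarrow> 'c \<Rightarrow> 'k::comm_ring_1) \<Rightarrow> 'r \<Rightarrow> 'c + 'r \<Rightarrow> 'k" where
  "bordered e x (Inl c) = e x c"
| "bordered e x (Inr r) = (if x = r then 1 else 0)"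

text \<open>Expanding along an identity column deletes it together with its row. What is left is, up
  to sign, the minor of \<open>e\<close> on the unmatched rows and the ordinary columns. In this way
  minors of all sizes are encoded by minors of one size.\<close>

lemma lm_bordered:
  assumes "length a = length p" "distinct a" "distinct p" "\<And>r. Inr r \<in> set p \<Longrightarrow> r \<in> set a"
  shows "\<exists>a' b'. distinct a' \<and> distinct b' \<and> length a' = length b' \<and>
    set a' = {r \<in> set a. Inr r \<notin> set p} \<and> set b' = {c. Inl c \<in> set p} \<and>
    (lm (bordered e) a p = lm e a' b' \<or> lm (bordered e) a p = - lm e a' b')"
  using assms
proof (induction "length p" arbitrary: a p rule: less_induct)
  case less
  show ?case
  proof (cases "\<exists>r. Inr r \<in> set p")
    case False
    define b where "b = map projl p"
    have p: "p = map Inl b"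
      unfolding b_def using False by (auto simp: list_eq_iff_nth_eq in_set_conv_nth) (metis sum.collapse(1) sum.exhaust_disc sum.collapse(2))
    have "distinct b" using less.prems(3) unfolding p by (simp add: distinct_map)
    moreover have "lm (bordered e) a p = lm e a b"
      using lm_map[of b a "bordered e" id Inl] less.prems(1) unfolding p by simp
    ultimately show ?thesis
      using less.prems unfolding p by (intro exI[of _ a] exI[of _ b]) auto
  next
    case True
    then obtain r where r: "Inr r \<in> set p" by blast
    then obtain j where j: "j < length p" "p ! j = Inr r" by (auto simp: in_set_conv_nth)
    obtain i where i: "i < length a" "a ! i = r" using less.prems(4)[OF r] by (auto simp: in_set_conv_nth)
    have "lm (bordered e) a p = (\<Sum>k<length a. bordered e (a ! k) (p ! j) * (-1) ^ (k + j) * lm (bordered e) (del k a) (del j p))"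
      by (rule lm_expand_col) (use less.prems j in auto)
    also have "\<dots> = (\<Sum>k\<in>{i}. bordered e (a ! k) (p ! j) * (-1) ^ (k + j) * lm (bordered e) (del k a) (del j p))"
      by (rule sum.mono_neutral_right)
        (use i j less.prems(2) in \<open>auto simp: nth_eq_iff_index_eq\<close>)
    also have "\<dots> = (-1) ^ (i + j) * lm (bordered e) (del i a) (del j p)"
      using i j by simp
    finally have eq: "lm (bordered e) a p = (-1) ^ (i + j) * lm (bordered e) (del i a) (del j p)" .
    have sets: "set (del i a) = set a - {r}" "set (del j p) = set p - {Inr r}"
      using set_del_distinct i j less.prems by metis+
    have "\<exists>a' b'. distinct a' \<and> distinct b' \<and> length a' = length b' \<and>
      set a' = {s \<in> set (del i a). Inr s \<notin> set (del j p)} \<and> set b' = {c. Inl c \<in> set (del j p)} \<and>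
      (lm (bordered e) (del i a) (del j p) = lm e a' b' \<or> lm (bordered e) (del i a) (del j p) = - lm e a' b')"
      by (rule less.hyps) (use less.prems i j sets distinct_del in auto)
    then obtain a' b' where ab: "distinct a'" "distinct b'" "length a' = length b'"
      "set a' = {s \<in> set (del i a). Inr s \<notin> set (del j p)}" "set b' = {c. Inl c \<in> set (del j p)}"
      "lm (bordered e) (del i a) (del j p) = lm e a' b' \<or> lm (bordered e) (del i a) (del j p) = - lm e a' b'"
      by blast
    have "lm (bordered e) a p = lm e a' b' \<or> lm (bordered e) a p = - lm e a' b'"
      using ab(6) unfolding eq by (cases "even (i + j)") auto
    moreover have "set a' = {s \<in> set a. Inr s \<notin> set p}" using ab(4) r unfolding sets by auto
    moreover have "set b' = {c. Inl c \<in> set p}" using ab(5) unfolding sets by auto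
    ultimately show ?thesis using ab(1-3) by blast
  qed
qed

lemma lm_up_to_sign:
  assumes "distinct a" "distinct a'" "set a = set a'" "distinct b" "distinct b'" "set b = set b'"
    and len: "length a = length b"
  shows "lm e a' b' = lm e a b \<or> lm e a' b' = - lm e a b"
proof -
  have "mset a = mset a'" "mset b = mset b'" using assms set_eq_iff_mset_eq_distinct by blast+
  then show ?thesis
    using lm_perm_rows[of a a' e b'] lm_perm_cols[of b b' a e] len by auto
qed

lemma lm_bordered_full:
  assumes "distinct rs" "set rs = UNIV" "distinct p" "length p = length rs"
    and ab: "distinct a" "distinct b" "set a = {r. Inr r \<notin> set p}" "set b = {c. Inl c \<in> set p}"
  shows "length a = length b" "lm (bordered e) rs p = lm e a b \<or> lm (bordered e) rs p = - lm e a b"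
proof -
  obtain a' b' where ab': "distinct a'" "distinct b'" "length a' = length b'"
    "set a' = {r \<in> set rs. Inr r \<notin> set p}" "set b' = {c. Inl c \<in> set p}"
    "lm (bordered e) rs p = lm e a' b' \<or> lm (bordered e) rs p = - lm e a' b'"
    using lm_bordered[of rs p e] assms by auto
  have "set a' = set a" "set b' = set b" using ab ab' assms(2) by auto
  then show "length a = length b" using ab ab'(1-3) by (metis distinct_card)
  show "lm (bordered e) rs p = lm e a b \<or> lm (bordered e) rs p = - lm e a b"
    using lm_up_to_sign[of a' a b' b e] ab' ab \<open>set a' = set a\<close> \<open>set b' = set b\<close> by auto
qed

text \<open>Carries the Garnir relation, which concerns two minors of one size, over to minors of
  different sizes: \<open>p\<close> and \<open>q\<close> encode \<open>[a|b]\<close> and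
  \<open>[c|d]\<close> by their matrix columns together with the identity columns of the missing
  rows.\<close>

lemma lm_product_bordered:
  fixes e :: "'r::finite \<Rightarrow> 'c \<Rightarrow> 'k::comm_ring_1" and rs :: "'r list"
  assumes rs: "distinct rs" "set rs = UNIV"
    and p: "distinct p" "length p = length rs" "set a = {r. Inr r \<notin> set p}" "set b = {c. Inl c \<in> set p}"
      "distinct a" "distinct b"
    and q: "distinct q" "length q = length rs" "set c = {r. Inr r \<notin> set q}" "set d = {c. Inl c \<in> set q}"
      "distinct c" "distinct d"
    and uw: "p = u @ pr" "q = q1 @ w" "length u + length w < length rs"
    and G: "\<And>p' a' b'. distinct p' \<Longrightarrow> set u \<subseteq> set p' \<Longrightarrow> set p' \<subseteq> set u \<union> set q1 \<union> set pr \<Longrightarrow>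
      (\<exists>y\<in>set p'. y \<in> set q1 \<and> y \<notin> set u) \<Longrightarrow> distinct a' \<Longrightarrow> distinct b' \<Longrightarrow> length a' = length b' \<Longrightarrow>
      set a' = {r. Inr r \<notin> set p'} \<Longrightarrow> set b' = {c. Inl c \<in> set p'} \<Longrightarrow> lm e a' b' \<in> G"
  shows "lm e a b * lm e c d \<in> gen_ideal G"
proof -
  have "lm (bordered e) rs (u @ pr) * lm (bordered e) rs (q1 @ w) \<in> gen_ideal {lm (bordered e) rs p | p.
      length p = length rs \<and> distinct p \<and> set u \<subseteq> set p \<and> set p \<subseteq> set u \<union> set q1 \<union> set pr \<and>
      (\<exists>y\<in>set p. y \<in> set q1 \<and> y \<notin> set u)}"
    by (rule garnir_product) (use p q uw in auto)
  also have "\<dots> \<subseteq> gen_ideal G"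
  proof (rule gen_ideal_minimal, clarify)
    fix p' y assume p': "length p' = length rs" "distinct p'" "set u \<subseteq> set p'"
      "set p' \<subseteq> set u \<union> set q1 \<union> set pr" "y \<in> set p'" "y \<in> set q1" "y \<notin> set u"
    obtain a' where a': "distinct a'" "set a' = {r. Inr r \<notin> set p'}"
      using finite_distinct_list[of "{r. Inr r \<notin> set p'}"] by auto
    have "finite {c. Inl c \<in> set p'}"
      using finite_vimageI[of "set p'" Inl] by (simp add: vimage_def)
    then obtain b' where b': "distinct b'" "set b' = {c. Inl c \<in> set p'}"
      using finite_distinct_list by metis
    note full = lm_bordered_full[OF rs p'(2,1) a'(1) b'(1) a'(2) b'(2)]
    have "lm e a' b' \<in> G"
      by (rule G[of p']) (use p' a' b' full(1) in auto)
    then have "lm e a' b' \<in> gen_ideal G" by (rule rmod.span_base)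
    then show "lm (bordered e) rs p' \<in> gen_ideal G" using full(2)[of e] rmod.span_neg by force
  qed
  finally have *: "lm (bordered e) rs p * lm (bordered e) rs q \<in> gen_ideal G" using uw by simp
  have "lm (bordered e) rs p = lm e a b \<or> lm (bordered e) rs p = - lm e a b"
    by (rule lm_bordered_full(2)) (use rs p in auto)
  moreover have "lm (bordered e) rs q = lm e c d \<or> lm (bordered e) rs q = - lm e c d"
    by (rule lm_bordered_full(2)) (use rs q in auto)
  ultimately show ?thesis using * rmod.span_neg[OF *] by auto
qed

text \<open>The two bordered minors are split so that the Garnir condition
  \<open>length u + length w < length rs\<close> becomes
  \<open>card (set a \<inter> A) < length c\<close>. Keeping \<open>u\<close> preserves the columns
  \<open>b\<close> and lets no new row outside \<open>A\<close> enter, while no identity column of a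
  row in \<open>set a \<inter> A\<close> is available, so these rows stay. The column gained from
  the second factor changes the index pair.\<close>

lemma lm_straighten_rows:
  fixes e :: "'r::finite \<Rightarrow> 'c::finite \<Rightarrow> 'k::comm_ring_1"
  assumes ab: "distinct a" "distinct b" "length a = length b"
    and cd: "distinct c" "distinct d" "length c = length d"
    and A: "set c \<subseteq> A" "card (set a \<inter> A) < length c"
    and G: "\<And>a' b'. distinct a' \<Longrightarrow> distinct b' \<Longrightarrow> length a' = length b' \<Longrightarrow> set b \<subseteq> set b' \<Longrightarrow>
      set a' - A \<subseteq> set a \<Longrightarrow> set a \<inter> A \<subseteq> set a' \<Longrightarrow> set a' \<noteq> set a \<or> set b' \<noteq> set b \<Longrightarrow> lm e a' b' \<in> G"
  shows "lm e a b * lm e c d \<in> gen_ideal G"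
proof -
  obtain rs :: "'r list" where rs: "distinct rs" "set rs = UNIV"
    using finite_distinct_list[of "UNIV :: 'r set"] by auto
  \<comment> \<open>\<open>l1\<close> and \<open>l2\<close> list the rows missing from
    \<open>a\<close>, outside and inside \<open>A\<close>; \<open>l3\<close> and \<open>l4\<close>
    do the same for \<open>c\<close>, whose rows all lie in \<open>A\<close>.\<close>
  obtain l1 where l1: "distinct l1" "set l1 = - A - set a" using finite_distinct_list[of "- A - set a"] by auto
  obtain l2 where l2: "distinct l2" "set l2 = A - set a" using finite_distinct_list[of "A - set a"] by auto
  obtain l3 where l3: "distinct l3" "set l3 = - A" using finite_distinct_list[of "- A"] by auto
  obtain l4 where l4: "distinct l4" "set l4 = A - set c" using finite_distinct_list[of "A - set c"] by auto
  have len: "length rs = card (UNIV :: 'r set)" "length a = card (set a)" "length c = card (set c)"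
    "length l1 = card (- A - set a)" "length l2 = card (A - set a)" "length l3 = card (- A)" "length l4 = card (A - set c)"
    using rs ab cd l1 l2 l3 l4 by (metis distinct_card)+
  have ca: "card (set a) + card (- set a) = card (UNIV :: 'r set)"
    by (subst card_Un_disjoint[symmetric]) auto
  have ca2: "card (- A - set a) + card (A - set a) = card (- set a)"
    by (subst card_Un_disjoint[symmetric]) (auto intro!: arg_cong[where f = card])
  have ca3: "card (- A) + card (A - set c) + card (set c) = card (UNIV :: 'r set)"
  proof -
    have "card (A - set c) + card (set c) = card A"
      using A(1) by (subst card_Un_disjoint[symmetric]) (auto intro!: arg_cong[where f = card])
    moreover have "card A + card (- A) = card (UNIV :: 'r set)"
      by (subst card_Un_disjoint[symmetric]) auto
    ultimately show ?thesis by simp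
  qed
  have ca4: "card (A - set a) + card (set a \<inter> A) + card (- A) = card (UNIV :: 'r set)"
  proof -
    have "card (A - set a) + card (set a \<inter> A) = card A"
      by (subst card_Un_disjoint[symmetric]) (auto intro!: arg_cong[where f = card])
    moreover have "card A + card (- A) = card (UNIV :: 'r set)"
      by (subst card_Un_disjoint[symmetric]) auto
    ultimately show ?thesis by simp
  qed
  show ?thesis
  proof (rule lm_product_bordered[OF rs, of "map Inl b @ map Inr l1 @ map Inr l2" a b "map Inl d @ map Inr l3 @ map Inr l4" c d
      "map Inl b @ map Inr l1" "map Inr l2" "map Inl d @ map Inr l3" "map Inr l4"])
    fix p' a' b'
    assume p': "distinct p'" "set (map Inl b @ map Inr l1) \<subseteq> set p'"
      "set p' \<subseteq> set (map Inl b @ map Inr l1) \<union> set (map Inl d @ map Inr l3) \<union> set (map Inr l2)"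
      and y: "\<exists>y\<in>set p'. y \<in> set (map Inl d @ map Inr l3) \<and> y \<notin> set (map Inl b @ map Inr l1)"
      and ab': "distinct a'" "distinct b'" "length a' = length b'"
      "set a' = {r. Inr r \<notin> set p'}" "set b' = {c. Inl c \<in> set p'}"
    show "lm e a' b' \<in> G"
    proof (rule G)
      show "set b \<subseteq> set b'" using ab'(5) p'(2) by auto
      show "set a' - A \<subseteq> set a" using ab'(4) p'(2) l1 by auto
      show "set a \<inter> A \<subseteq> set a'" using ab'(4) p'(3) l1 l2 l3 by auto
      from y obtain y where y: "y \<in> set p'" "y \<in> set (map Inl d @ map Inr l3)" "y \<notin> set (map Inl b @ map Inr l1)" by blast
      show "set a' \<noteq> set a \<or> set b' \<noteq> set b"
      proof (cases y)
        case (Inl c)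
        then have "c \<in> set b'" "c \<notin> set b" using y ab' by auto
        then show ?thesis by blast
      next
        case (Inr r)
        then have "r \<notin> set a'" "r \<in> set a" using y ab' l1 l3 by auto
        then show ?thesis by blast
      qed
    qed (use ab' in auto)
  qed (use ab cd l1 l2 l3 l4 len ca ca2 ca3 ca4 A in \<open>auto simp: distinct_map\<close>)
qed

lemma lm_straighten_cols:
  fixes e :: "'r::finite \<Rightarrow> 'c::finite \<Rightarrow> 'k::comm_ring_1"
  assumes ab: "distinct a" "distinct b" "length a = length b"
    and cd: "distinct c" "distinct d" "length c = length d"
    and C: "set d \<subseteq> C" "card (set b \<inter> C) < length d"
    and G: "\<And>a' b'. distinct a' \<Longrightarrow> distinct b' \<Longrightarrow> length a' = length b' \<Longrightarrow> set a \<subseteq> set a' \<Longrightarrow>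
      set b' - C \<subseteq> set b \<Longrightarrow> set b \<inter> C \<subseteq> set b' \<Longrightarrow> set a' \<noteq> set a \<or> set b' \<noteq> set b \<Longrightarrow> lm e a' b' \<in> G"
  shows "lm e a b * lm e c d \<in> gen_ideal G"
proof -
  have "lm (\<lambda>y x. e x y) b a * lm (\<lambda>y x. e x y) d c \<in> gen_ideal G"
  proof (rule lm_straighten_rows[OF ab(2,1) _ cd(2,1) _ C])
    fix b' a' assume *: "distinct b'" "distinct a'" "length b' = length a'" "set a \<subseteq> set a'" "set b' - C \<subseteq> set b"
      "set b \<inter> C \<subseteq> set b'" "set b' \<noteq> set b \<or> set a' \<noteq> set a"
    have "lm e a' b' \<in> G" by (rule G) (use * in auto)
    then show "lm (\<lambda>y x. e x y) b' a' \<in> G" using lm_transpose[of a' b' e] *(3) by simp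
  qed (use ab cd in auto)
  then show ?thesis using lm_transpose[of a b e] lm_transpose[of c d e] ab cd by simp
qed

section \<open>Coefficients of products and McCoy's theorem\<close>

lemma poly_mapping_eq_sum_single:
  "f = (\<Sum>t\<in>Poly_Mapping.keys f. Poly_Mapping.single t (Poly_Mapping.lookup f t))"
proof (rule poly_mapping_eqI)
  fix s
  have "Poly_Mapping.lookup (\<Sum>t\<in>Poly_Mapping.keys f. Poly_Mapping.single t (Poly_Mapping.lookup f t)) s =
    (\<Sum>t\<in>Poly_Mapping.keys f. if t = s then Poly_Mapping.lookup f t else 0)"
    by (simp add: lookup_sum lookup_single when_def)
  also have "\<dots> = Poly_Mapping.lookup f s"
    by (simp add: in_keys_iff)
  finally show "Poly_Mapping.lookup f s = Poly_Mapping.lookup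
      (\<Sum>t\<in>Poly_Mapping.keys f. Poly_Mapping.single t (Poly_Mapping.lookup f t)) s" ..
qed

lemma lookup_single_mult_add [simp]:
  fixes f :: "'a::cancel_comm_monoid_add \<Rightarrow>\<^sub>0 'k::comm_ring_1"
  shows "Poly_Mapping.lookup (Poly_Mapping.single s c * f) (s + t) = c * Poly_Mapping.lookup f t"
proof -
  have "Poly_Mapping.single s c * f = (\<Sum>u\<in>Poly_Mapping.keys f. Poly_Mapping.single (s + u) (c * Poly_Mapping.lookup f u))"
    by (subst poly_mapping_eq_sum_single[of f]) (simp add: sum_distrib_left mult_single)
  then have "Poly_Mapping.lookup (Poly_Mapping.single s c * f) (s + t) =
      (\<Sum>u\<in>Poly_Mapping.keys f. if u = t then c * Poly_Mapping.lookup f u else 0)"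
    by (simp add: lookup_sum lookup_single when_def)
  also have "\<dots> = c * Poly_Mapping.lookup f t" by (simp add: in_keys_iff)
  finally show ?thesis .
qed

lemma lookup_single_0_mult [simp]:
  fixes f :: "'a::cancel_comm_monoid_add \<Rightarrow>\<^sub>0 'k::comm_ring_1"
  shows "Poly_Mapping.lookup (Poly_Mapping.single 0 c * f) t = c * Poly_Mapping.lookup f t"
  using lookup_single_mult_add[of 0 c f t] by simp

lemma keys_single_mult:
  fixes f :: "'a::cancel_comm_monoid_add \<Rightarrow>\<^sub>0 'k::comm_ring_1"
  shows "Poly_Mapping.keys (Poly_Mapping.single s c * f) \<subseteq> (+) s ` Poly_Mapping.keys f"
  using keys_mult[of "Poly_Mapping.single s c" f] by (auto split: if_splits)

lemma in_keys_multE: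
  assumes "t \<in> Poly_Mapping.keys (f * g)"
  obtains u v where "t = u + v" "u \<in> Poly_Mapping.keys f" "v \<in> Poly_Mapping.keys g"
  using assms keys_mult[of f g] by blast

lemma mpoly_induct [case_names zero add]:
  fixes f :: "'a \<Rightarrow>\<^sub>0 'k::comm_ring_1"
  assumes "P 0" and add: "\<And>t c f. P f \<Longrightarrow> P (Poly_Mapping.single t c + f)"
  shows "P f"
proof -
  have "P (\<Sum>t\<in>S. Poly_Mapping.single t (g t))" if "finite S" for S and g :: "'a \<Rightarrow> 'k"
    using that by induction (auto intro: assms)
  from this[of "Poly_Mapping.keys f" "Poly_Mapping.lookup f"] show ?thesis
    using poly_mapping_eq_sum_single[of f] by simp
qed

text \<open>McCoy's theorem. A nonzero annihilator with fewest terms is annihilated by every coefficient: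
  going down from the top, \<open>h\<^sub>t G\<close> loses the leading term of \<open>G\<close>, so it vanishes by minimality.\<close>

lemma mult_eq_0_unit_coeff:
  fixes h g :: "(nat \<Rightarrow>\<^sub>0 nat) \<Rightarrow>\<^sub>0 'k::comm_ring_1"
  assumes hg: "h * g = 0" and unit: "u * Poly_Mapping.lookup h m = 1"
  shows "g = 0"
proof (rule ccontr)
  assume "g \<noteq> 0"
  define P where "P = (\<lambda>n. \<exists>g. g \<noteq> 0 \<and> h * g = 0 \<and> card (Poly_Mapping.keys g) = n)"
  have "\<exists>n. P n" using hg \<open>g \<noteq> 0\<close> by (auto simp: P_def)
  then have "P (LEAST n. P n)" by (rule LeastI_ex)
  then obtain g where g: "g \<noteq> 0" "h * g = 0" and card: "card (Poly_Mapping.keys g) = (LEAST n. P n)"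
    by (auto simp: P_def)
  have min: "g' = 0" if "h * g' = 0" "card (Poly_Mapping.keys g') < card (Poly_Mapping.keys g)" for g'
    using not_less_Least[of "card (Poly_Mapping.keys g')" P] that by (auto simp: P_def card)
  have kg: "Poly_Mapping.keys g \<noteq> {}" using g(1) by simp
  have "Poly_Mapping.single 0 (Poly_Mapping.lookup h t) * g = 0" for t
  proof (rule ccontr)
    let ?B = "{t. Poly_Mapping.single 0 (Poly_Mapping.lookup h t) * g \<noteq> 0}"
    assume "Poly_Mapping.single 0 (Poly_Mapping.lookup h t) * g \<noteq> 0"
    then have "?B \<noteq> {}" by auto
    moreover have sub: "?B \<subseteq> Poly_Mapping.keys h" by (auto simp: in_keys_iff)
    then have fin: "finite ?B" by (rule finite_subset) simp
    ultimately have tB: "Max ?B \<in> ?B" by (rule Max_in[rotated])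
    define t where "t = Max ?B"
    define s where "s = Max (Poly_Mapping.keys g)"
    have s: "s \<in> Poly_Mapping.keys g" unfolding s_def using kg by (intro Max_in) auto
    have "h * g = (\<Sum>i\<in>Poly_Mapping.keys h. Poly_Mapping.single i (Poly_Mapping.lookup h i) * g)"
      by (subst poly_mapping_eq_sum_single[of h]) (simp add: sum_distrib_right)
    also have "\<dots> = (\<Sum>i\<in>?B. Poly_Mapping.single i (Poly_Mapping.lookup h i) * g)"
    proof (rule sum.mono_neutral_right[OF _ sub], simp, intro ballI)
      fix i assume "i \<in> Poly_Mapping.keys h - ?B"
      then have *: "Poly_Mapping.single 0 (Poly_Mapping.lookup h i) * g = 0" by simp
      have "Poly_Mapping.single i (Poly_Mapping.lookup h i) =
          Poly_Mapping.single i 1 * Poly_Mapping.single 0 (Poly_Mapping.lookup h i)"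
        by (simp add: mult_single)
      then show "Poly_Mapping.single i (Poly_Mapping.lookup h i) * g = 0"
        by (simp only: mult.assoc * mult_zero_right)
    qed
    finally have sumB: "(\<Sum>i\<in>?B. Poly_Mapping.lookup (Poly_Mapping.single i (Poly_Mapping.lookup h i) * g) (t + s)) = 0"
      unfolding lookup_sum[symmetric] using g(2) by simp
    have "Poly_Mapping.lookup (Poly_Mapping.single i (Poly_Mapping.lookup h i) * g) (t + s) = 0"
      if "i \<in> ?B" "i \<noteq> t" for i
    proof (rule ccontr)
      assume "\<not> ?thesis"
      then have "t + s \<in> Poly_Mapping.keys (Poly_Mapping.single i (Poly_Mapping.lookup h i) * g)"
        by (simp add: in_keys_iff)
      then obtain u where u: "u \<in> Poly_Mapping.keys g" "t + s = i + u"
        using keys_single_mult by blast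
      have "i < t" using that fin by (simp add: t_def order_less_le)
      moreover have "u \<le> s" using u(1) by (simp add: s_def)
      ultimately have "i + u < t + s" by (rule add_less_le_mono)
      then show False using u(2) by (simp only: less_irrefl)
    qed
    then have "(\<Sum>i\<in>?B - {t}. Poly_Mapping.lookup (Poly_Mapping.single i (Poly_Mapping.lookup h i) * g) (t + s)) = 0"
      by (intro sum.neutral) blast
    moreover have "t \<in> ?B" using tB unfolding t_def .
    ultimately have "Poly_Mapping.lookup (Poly_Mapping.single t (Poly_Mapping.lookup h t) * g) (t + s) = 0"
      using sumB sum.remove[OF fin \<open>t \<in> ?B\<close>, of "\<lambda>i. Poly_Mapping.lookup (Poly_Mapping.single i (Poly_Mapping.lookup h i) * g) (t + s)"]
      by (simp only: add_0_right)
    then have "Poly_Mapping.lookup h t * Poly_Mapping.lookup g s = 0"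
      by (simp only: lookup_single_mult_add)
    then have "Poly_Mapping.keys (Poly_Mapping.single 0 (Poly_Mapping.lookup h t) * g) \<subseteq> Poly_Mapping.keys g - {s}"
      by (auto simp: in_keys_iff)
    then have "card (Poly_Mapping.keys (Poly_Mapping.single 0 (Poly_Mapping.lookup h t) * g)) < card (Poly_Mapping.keys g)"
      using s by (metis card_Diff1_less finite_keys card_mono finite_Diff order_le_less_trans)
    moreover have "h * (Poly_Mapping.single 0 (Poly_Mapping.lookup h t) * g) = 0"
      by (metis mult.left_commute mult_zero_right g(2))
    ultimately have "Poly_Mapping.single 0 (Poly_Mapping.lookup h t) * g = 0" using min by blast
    then show False using tB by (simp add: t_def)
  qed
  then have "Poly_Mapping.single 0 u * (Poly_Mapping.single 0 (Poly_Mapping.lookup h m) * g) = 0" by simp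
  moreover have "Poly_Mapping.single 0 u * Poly_Mapping.single 0 (Poly_Mapping.lookup h m) =
      (1 :: (nat \<Rightarrow>\<^sub>0 nat) \<Rightarrow>\<^sub>0 'k)"
    using unit by (simp add: mult_single)
  ultimately have "1 * g = 0" by (simp only: mult.assoc[symmetric])
  then show False using g(1) by simp
qed

section \<open>Substitution\<close>

definition subst_monom :: "('v::finite \<Rightarrow> ('w, 'k::comm_ring_1) mpoly) \<Rightarrow> 'v monom \<Rightarrow> ('w, 'k) mpoly" where
  "subst_monom \<sigma> t = (\<Prod>v\<in>UNIV. \<sigma> v ^ Poly_Mapping.lookup t v)"

definition subst :: "('v::finite \<Rightarrow> ('w, 'k::comm_ring_1) mpoly) \<Rightarrow> ('v, 'k) mpoly \<Rightarrow> ('w, 'k) mpoly" where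
  "subst \<sigma> f = (\<Sum>t\<in>Poly_Mapping.keys f. Poly_Mapping.single 0 (Poly_Mapping.lookup f t) * subst_monom \<sigma> t)"

lemma subst_monom_add: "subst_monom \<sigma> (s + t) = subst_monom \<sigma> s * subst_monom \<sigma> t"
  by (simp add: subst_monom_def lookup_add power_add prod.distrib)

lemma subst_monom_0 [simp]: "subst_monom \<sigma> 0 = 1"
  by (simp add: subst_monom_def)

lemma subst_monom_single: "subst_monom \<sigma> (Poly_Mapping.single v n) = \<sigma> v ^ n"
proof -
  have "subst_monom \<sigma> (Poly_Mapping.single v n) = (\<Prod>w\<in>UNIV. if w = v then \<sigma> v ^ n else 1)"
    unfolding subst_monom_def by (rule prod.cong) (auto simp: lookup_single when_def)
  then show ?thesis by simp
qed

lemma subst_superset: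
  assumes "finite S" "Poly_Mapping.keys f \<subseteq> S"
  shows "subst \<sigma> f = (\<Sum>t\<in>S. Poly_Mapping.single 0 (Poly_Mapping.lookup f t) * subst_monom \<sigma> t)"
  unfolding subst_def by (rule sum.mono_neutral_left) (use assms in \<open>auto simp: in_keys_iff\<close>)

lemma subst_0 [simp]: "subst \<sigma> 0 = 0"
  by (simp add: subst_def)

lemma subst_single [simp]: "subst \<sigma> (Poly_Mapping.single t c) = Poly_Mapping.single 0 c * subst_monom \<sigma> t"
  by (subst subst_superset[of "{t}"]) auto

lemma subst_add: "subst \<sigma> (f + g) = subst \<sigma> f + subst \<sigma> g"
proof -
  let ?S = "Poly_Mapping.keys f \<union> Poly_Mapping.keys g"
  have "subst \<sigma> (f + g) = (\<Sum>t\<in>?S. Poly_Mapping.single 0 (Poly_Mapping.lookup (f + g) t) * subst_monom \<sigma> t)"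
    by (rule subst_superset) (use keys_add[of f g] in auto)
  also have "\<dots> = (\<Sum>t\<in>?S. Poly_Mapping.single 0 (Poly_Mapping.lookup f t) * subst_monom \<sigma> t) +
      (\<Sum>t\<in>?S. Poly_Mapping.single 0 (Poly_Mapping.lookup g t) * subst_monom \<sigma> t)"
    by (simp add: lookup_add single_add distrib_right sum.distrib)
  finally show ?thesis using subst_superset[of ?S f \<sigma>] subst_superset[of ?S g \<sigma>] by simp
qed

lemma subst_mult:
  fixes \<sigma> :: "'v::finite \<Rightarrow> ('w, 'k::comm_ring_1) mpoly"
  shows "subst \<sigma> (f * g) = subst \<sigma> f * subst \<sigma> g"
proof (induction f rule: mpoly_induct)
  case (add t c f)
  have "subst \<sigma> (Poly_Mapping.single t c * g) = subst \<sigma> (Poly_Mapping.single t c) * subst \<sigma> g"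
  proof (induction g rule: mpoly_induct)
    case (add s d g)
    have "subst \<sigma> (Poly_Mapping.single t c * Poly_Mapping.single s d) =
        Poly_Mapping.single 0 (c * d) * (subst_monom \<sigma> t * subst_monom \<sigma> s)"
      by (simp add: mult_single subst_monom_add)
    also have "(Poly_Mapping.single 0 (c * d) :: ('w, 'k) mpoly) = Poly_Mapping.single 0 c * Poly_Mapping.single 0 d"
      by (simp add: mult_single)
    finally have "subst \<sigma> (Poly_Mapping.single t c * Poly_Mapping.single s d) =
        subst \<sigma> (Poly_Mapping.single t c) * subst \<sigma> (Poly_Mapping.single s d)"
      by (simp only: subst_single mult_ac)
    then show ?case using add by (simp only: distrib_left subst_add)
  qed simp
  then show ?case using add by (simp only: distrib_right subst_add)
qed simp

lemma subst_1 [simp]: "subst \<sigma> 1 = 1"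
  using subst_single[of \<sigma> 0 1] by simp

lemma subst_hom: "comm_ring_hom (subst \<sigma>)"
  by unfold_locales (auto simp: subst_add subst_mult)

lemma subst_indet [simp]: "subst \<sigma> (indet v) = \<sigma> v"
  by (simp add: indet_def monom_poly_def subst_monom_single)

lemma subst_lm: "subst \<sigma> (lm e a b) = lm (\<lambda>x y. subst \<sigma> (e x y)) a b"
proof -
  interpret comm_ring_hom "subst \<sigma>" by (rule subst_hom)
  have "map_mat (subst \<sigma>) (mat (length a) (length a) (\<lambda>(i, j). e (a ! i) (b ! j))) =
      mat (length a) (length a) (\<lambda>(i, j). subst \<sigma> (e (a ! i) (b ! j)))"
    by (intro eq_matI) auto
  then show ?thesis unfolding lm_def hom_det[symmetric] by simp
qed

section \<open>Weights\<close>

definition weight :: "('v \<Rightarrow> real) \<Rightarrow> 'v monom \<Rightarrow> real" where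
  "weight \<nu> t = (\<Sum>v\<in>Poly_Mapping.keys t. real (Poly_Mapping.lookup t v) * \<nu> v)"

lemma weight_superset:
  assumes "finite S" "Poly_Mapping.keys t \<subseteq> S"
  shows "weight \<nu> t = (\<Sum>v\<in>S. real (Poly_Mapping.lookup t v) * \<nu> v)"
  unfolding weight_def by (rule sum.mono_neutral_left) (use assms in \<open>auto simp: in_keys_iff\<close>)

lemma weight_add: "weight \<nu> (s + t) = weight \<nu> s + weight \<nu> t"
proof -
  let ?S = "Poly_Mapping.keys s \<union> Poly_Mapping.keys t"
  have "weight \<nu> (s + t) = (\<Sum>v\<in>?S. real (Poly_Mapping.lookup (s + t) v) * \<nu> v)"
    by (rule weight_superset) (use keys_add[of s t] in auto)
  also have "\<dots> = (\<Sum>v\<in>?S. real (Poly_Mapping.lookup s v) * \<nu> v) + (\<Sum>v\<in>?S. real (Poly_Mapping.lookup t v) * \<nu> v)"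
    by (simp add: lookup_add distrib_right sum.distrib)
  finally show ?thesis using weight_superset[of ?S s \<nu>] weight_superset[of ?S t \<nu>] by simp
qed

lemma weight_0 [simp]: "weight \<nu> 0 = 0"
  by (simp add: weight_def)

lemma weight_single [simp]: "weight \<nu> (Poly_Mapping.single v n) = real n * \<nu> v"
  by (subst weight_superset[of "{v}"]) auto

lemma weight_sum: "weight \<nu> (sum f A) = (\<Sum>a\<in>A. weight \<nu> (f a))"
  by (induction A rule: infinite_finite_induct) (auto simp: weight_add)

text \<open>\<open>M\<close> is the part of \<open>H\<close> that counts at level \<open>c\<close>:
  both have the same coefficients at weights at least \<open>c\<close>. Unlike an initial form,
  \<open>M\<close> may be zero when \<open>H\<close> lies entirely below \<open>c\<close>; this
  makes the notion compatible with sums and products without case distinctions.\<close>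

definition approx :: "('v \<Rightarrow> real) \<Rightarrow> real \<Rightarrow> ('v, 'k::comm_ring_1) mpoly \<Rightarrow> ('v, 'k) mpoly \<Rightarrow> bool" where
  "approx \<nu> c H M \<longleftrightarrow> (\<forall>t\<in>Poly_Mapping.keys (H - M). weight \<nu> t < c) \<and> (\<forall>t\<in>Poly_Mapping.keys M. weight \<nu> t \<le> c)"

lemma approx_refl: "(\<And>t. t \<in> Poly_Mapping.keys M \<Longrightarrow> weight \<nu> t \<le> c) \<Longrightarrow> approx \<nu> c M M"
  by (simp add: approx_def)

lemma approx_add:
  assumes "approx \<nu> c H M" "approx \<nu> c H' M'"
  shows "approx \<nu> c (H + H') (M + M')"
proof -
  have "H + H' - (M + M') = (H - M) + (H' - M')" by simp
  then have "Poly_Mapping.keys (H + H' - (M + M')) \<subseteq> Poly_Mapping.keys (H - M) \<union> Poly_Mapping.keys (H' - M')"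
    using keys_add[of "H - M" "H' - M'"] by (simp only:)
  then show ?thesis using assms keys_add[of M M'] unfolding approx_def by blast
qed

lemma approx_0: "approx \<nu> c 0 0"
  by (simp add: approx_def)

lemma approx_sum:
  assumes "\<And>i. i \<in> A \<Longrightarrow> approx \<nu> c (H i) (M i)"
  shows "approx \<nu> c (sum H A) (sum M A)"
  using assms
proof (induction A rule: infinite_finite_induct)
  case (insert x A)
  have "approx \<nu> c (H x + sum H A) (M x + sum M A)"
    by (rule approx_add) (use insert in auto)
  then show ?case using insert.hyps by simp
qed (simp_all add: approx_0)

lemma approx_mult:
  assumes "approx \<nu> c H M" "approx \<nu> d H' M'"
  shows "approx \<nu> (c + d) (H * H') (M * M')"
proof -
  have eq: "H * H' - M * M' = (H - M) * H' + M * (H' - M')"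
    by (simp only: left_diff_distrib right_diff_distrib) simp
  have ltle: "weight \<nu> t < c + d" if t: "t \<in> Poly_Mapping.keys (A * B)"
    and A: "\<forall>t\<in>Poly_Mapping.keys A. weight \<nu> t < c" and B: "\<forall>t\<in>Poly_Mapping.keys B. weight \<nu> t \<le> d"
    for t and A B :: "('a, 'b) mpoly"
    by (rule in_keys_multE[OF t]) (use A B in \<open>simp add: weight_add add_less_le_mono\<close>)
  have lelt: "weight \<nu> t < c + d" if t: "t \<in> Poly_Mapping.keys (A * B)"
    and A: "\<forall>t\<in>Poly_Mapping.keys A. weight \<nu> t \<le> c" and B: "\<forall>t\<in>Poly_Mapping.keys B. weight \<nu> t < d"
    for t and A B :: "('a, 'b) mpoly"
    by (rule in_keys_multE[OF t]) (use A B in \<open>simp add: weight_add add_le_less_mono\<close>)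
  have HM: "\<forall>t\<in>Poly_Mapping.keys (H - M). weight \<nu> t < c" "\<forall>t\<in>Poly_Mapping.keys M. weight \<nu> t \<le> c"
    "\<forall>t\<in>Poly_Mapping.keys (H' - M'). weight \<nu> t < d" "\<forall>t\<in>Poly_Mapping.keys M'. weight \<nu> t \<le> d"
    using assms unfolding approx_def by blast+
  have HM': "\<forall>t\<in>Poly_Mapping.keys H'. weight \<nu> t \<le> d"
  proof
    fix t assume "t \<in> Poly_Mapping.keys H'"
    then have "t \<in> Poly_Mapping.keys (H' - M') \<union> Poly_Mapping.keys M'"
      using keys_add[of "H' - M'" M'] by auto
    then show "weight \<nu> t \<le> d" using HM(3,4) less_imp_le by blast
  qed
  have "weight \<nu> t < c + d" if "t \<in> Poly_Mapping.keys (H * H' - M * M')" for t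
  proof -
    have "t \<in> Poly_Mapping.keys ((H - M) * H') \<or> t \<in> Poly_Mapping.keys (M * (H' - M'))"
      using that keys_add[of "(H - M) * H'" "M * (H' - M')"] unfolding eq by blast
    then show ?thesis
      using ltle[OF _ HM(1) HM'] lelt[OF _ HM(2,3)] by blast
  qed
  moreover have "weight \<nu> t \<le> c + d" if "t \<in> Poly_Mapping.keys (M * M')" for t
    by (rule in_keys_multE[OF that]) (use HM in \<open>simp add: weight_add add_mono\<close>)
  ultimately show ?thesis unfolding approx_def by blast
qed

lemma approx_1: "approx \<nu> 0 1 1"
  by (rule approx_refl) simp

lemma approx_power:
  assumes "approx \<nu> c H M"
  shows "approx \<nu> (real n * c) (H ^ n) (M ^ n)"
proof (induction n)
  case (Suc n)
  then have "approx \<nu> (c + real n * c) (H * H ^ n) (M * M ^ n)" by (rule approx_mult[OF assms])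
  then show ?case by (simp add: distrib_right)
qed (simp add: approx_1)

lemma approx_prod:
  assumes "\<And>i. i \<in> A \<Longrightarrow> approx \<nu> (c i) (H i) (M i)"
  shows "approx \<nu> (sum c A) (prod H A) (prod M A)"
  using assms
proof (induction A rule: infinite_finite_induct)
  case (insert x A)
  have "approx \<nu> (c x + sum c A) (H x * prod H A) (M x * prod M A)"
    by (rule approx_mult) (use insert in auto)
  then show ?case using insert.hyps by simp
qed (simp_all add: approx_1)

lemma approx_lookup:
  assumes "approx \<nu> c H M" "c \<le> weight \<nu> t"
  shows "Poly_Mapping.lookup H t = Poly_Mapping.lookup M t"
proof -
  have "t \<notin> Poly_Mapping.keys (H - M)" using assms by (auto simp: approx_def)
  then show ?thesis by (simp add: in_keys_iff lookup_minus)
qed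

section \<open>Potentials of Monge matrices\<close>

lemma exists_between_finite:
  fixes X Y :: "real set"
  assumes "finite X" "finite Y" "\<And>x y. x \<in> X \<Longrightarrow> y \<in> Y \<Longrightarrow> x < y"
  shows "\<exists>z. (\<forall>x\<in>X. x < z) \<and> (\<forall>y\<in>Y. z < y)"
proof (cases "X = {} \<or> Y = {}")
  case True
  have "\<exists>z. \<forall>x\<in>X. x < z"
  proof (cases "X = {}")
    case False
    then have "x < Max X + 1" if "x \<in> X" for x using Max_ge[OF assms(1) that] by linarith
    then show ?thesis by blast
  qed simp
  moreover have "\<exists>z. \<forall>y\<in>Y. z < y"
  proof (cases "Y = {}")
    case False
    then have "Min Y - 1 < y" if "y \<in> Y" for y using Min_le[OF assms(2) that] by linarith
    then show ?thesis by blast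
  qed simp
  ultimately show ?thesis using True by blast
next
  case False
  then have "Max X < Min Y" using assms by simp
  then obtain z where z: "Max X < z" "z < Min Y" using dense by blast
  have "x < z" if "x \<in> X" for x using Max_ge[OF assms(1) that] z(1) by simp
  moreover have "z < y" if "y \<in> Y" for y using Min_le[OF assms(2) that] z(2) by simp
  ultimately show ?thesis by blast
qed

text \<open>A dual solution of the transportation problem with costs \<open>w\<close> whose tight
  cells are exactly those in \<open>C\<close>.\<close>

definition potential :: "'r set \<Rightarrow> 'c set \<Rightarrow> ('r \<Rightarrow> 'c \<Rightarrow> real) \<Rightarrow> ('r \<Rightarrow> 'c \<Rightarrow> bool) \<Rightarrow> bool" where
  "potential A B w C \<longleftrightarrow> (\<exists>\<alpha> \<beta>. \<forall>i\<in>A. \<forall>j\<in>B. if C i j then \<alpha> i + \<beta> j = w i j else \<alpha> i + \<beta> j < w i j)"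

lemma potential_transpose: "potential B A (\<lambda>j i. w i j) (\<lambda>j i. C i j) \<Longrightarrow> potential A B w C"
  unfolding potential_def by (metis add.commute)

text \<open>Row \<open>M\<close> can be tight only at the corner. If the corner is not tight, a very
  small \<open>\<alpha> M\<close> works. If it is tight together with another cell of column
  \<open>N\<close>, the Monge inequality against that cell gives strictness along row
  \<open>M\<close>. If it is the only tight cell of column \<open>N\<close>, the value at
  \<open>N\<close> can be chosen anew.\<close>

lemma potential_step:
  assumes fin: "finite A" "finite B" and M: "M \<in> A" and N: "N \<in> B"
    and monge: "\<And>i j. i \<in> A - {M} \<Longrightarrow> j \<in> B - {N} \<Longrightarrow> w i j + w M N < w i N + w M j"
    and row: "\<And>j. j \<in> B \<Longrightarrow> C M j \<Longrightarrow> j = N"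
    and p1: "potential (A - {M}) B w C" and p2: "potential (A - {M}) (B - {N}) w C"
  shows "potential A B w C"
proof -
  consider "\<not> C M N" | "C M N" "\<exists>i\<in>A - {M}. C i N" | "C M N" "\<not> (\<exists>i\<in>A - {M}. C i N)" by blast
  then show ?thesis
  proof cases
    case 1
    obtain \<alpha> \<beta> where ab: "\<forall>i\<in>A - {M}. \<forall>j\<in>B. if C i j then \<alpha> i + \<beta> j = w i j else \<alpha> i + \<beta> j < w i j"
      using p1 unfolding potential_def by blast
    obtain z where z: "\<forall>y\<in>(\<lambda>j. w M j - \<beta> j) ` B. z < y"
      using exists_between_finite[of "{}" "(\<lambda>j. w M j - \<beta> j) ` B"] fin by auto
    have "if C i j then (\<alpha>(M := z)) i + \<beta> j = w i j else (\<alpha>(M := z)) i + \<beta> j < w i j" if "i \<in> A" "j \<in> B" for i j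
    proof (cases "i = M")
      case True
      then have "\<not> C i j" using 1 row[of j] that by auto
      moreover have "z < w M j - \<beta> j" using z that by blast
      ultimately show ?thesis using True by simp
    next
      case False
      then show ?thesis using ab that by simp
    qed
    then show ?thesis unfolding potential_def by blast
  next
    case 2
    obtain \<alpha> \<beta> where ab: "\<forall>i\<in>A - {M}. \<forall>j\<in>B. if C i j then \<alpha> i + \<beta> j = w i j else \<alpha> i + \<beta> j < w i j"
      using p1 unfolding potential_def by blast
    obtain i0 where i0: "i0 \<in> A - {M}" "C i0 N" using 2 by blast
    let ?z = "w M N - \<beta> N"
    have "if C i j then (\<alpha>(M := ?z)) i + \<beta> j = w i j else (\<alpha>(M := ?z)) i + \<beta> j < w i j" if "i \<in> A" "j \<in> B" for i j
    proof (cases "i = M")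
      case True
      show ?thesis
      proof (cases "j = N")
        case j: True
        then show ?thesis using True 2 by simp
      next
        case j: False
        have "\<alpha> i0 + \<beta> N = w i0 N" using ab i0 N by (auto split: if_splits)
        moreover have "if C i0 j then \<alpha> i0 + \<beta> j = w i0 j else \<alpha> i0 + \<beta> j < w i0 j" using ab i0 that by blast
        then have "\<alpha> i0 + \<beta> j \<le> w i0 j" by (cases "C i0 j") auto
        moreover note \<open>\<alpha> i0 + \<beta> j \<le> w i0 j\<close>
        moreover have "w i0 j + w M N < w i0 N + w M j" using monge[of i0 j] i0 that j by simp
        moreover have "\<not> C M j" using row[of j] that j by auto
        ultimately show ?thesis using True by simp
      qed
    next
      case False
      then show ?thesis using ab that by simp
    qed
    then show ?thesis unfolding potential_def by blast
  next
    case 3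
    obtain \<alpha> \<beta> where ab: "\<forall>i\<in>A - {M}. \<forall>j\<in>B - {N}. if C i j then \<alpha> i + \<beta> j = w i j else \<alpha> i + \<beta> j < w i j"
      using p2 unfolding potential_def by blast
    \<comment> \<open>The upper bounds for \<open>\<beta> N\<close> come from column
      \<open>N\<close>, the lower ones from row \<open>M\<close> once \<open>\<alpha> M\<close> is
      set to make the corner tight; the Monge inequality separates them.\<close>
    have "\<exists>z. (\<forall>x\<in>(\<lambda>j. w M N + \<beta> j - w M j) ` (B - {N}). x < z) \<and> (\<forall>y\<in>(\<lambda>i. w i N - \<alpha> i) ` (A - {M}). z < y)"
    proof (rule exists_between_finite)
      fix x y assume "x \<in> (\<lambda>j. w M N + \<beta> j - w M j) ` (B - {N})" "y \<in> (\<lambda>i. w i N - \<alpha> i) ` (A - {M})"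
      then obtain i j where ij: "i \<in> A - {M}" "j \<in> B - {N}" "x = w M N + \<beta> j - w M j" "y = w i N - \<alpha> i" by blast
      have "if C i j then \<alpha> i + \<beta> j = w i j else \<alpha> i + \<beta> j < w i j" using ab ij by blast
      then have "\<alpha> i + \<beta> j \<le> w i j" by (cases "C i j") auto
      then show "x < y" using monge[OF ij(1,2)] ij(3,4) by simp
    qed (use fin in auto)
    then obtain z where z: "\<And>j. j \<in> B - {N} \<Longrightarrow> w M N + \<beta> j - w M j < z" "\<And>i. i \<in> A - {M} \<Longrightarrow> z < w i N - \<alpha> i"
      by blast
    let ?a = "\<alpha>(M := w M N - z)" and ?b = "\<beta>(N := z)"
    have "if C i j then ?a i + ?b j = w i j else ?a i + ?b j < w i j" if ij: "i \<in> A" "j \<in> B" for i j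
    proof -
      consider "i = M" "j = N" | "i = M" "j \<noteq> N" | "i \<noteq> M" "j = N" | "i \<noteq> M" "j \<noteq> N" by blast
      then show ?thesis
      proof cases
        case 1
        then show ?thesis using 3 by simp
      next
        case 2
        have "\<not> C M j" using row[of j] ij 2 by auto
        then show ?thesis using 2 z(1)[of j] ij by simp
      next
        case c: 3
        have "\<not> C i N" using 3(2) ij c by auto
        then show ?thesis using c z(2)[of i] ij by simp
      next
        case 4
        then show ?thesis using ab ij by simp
      qed
    qed
    then show ?thesis unfolding potential_def by blast
  qed
qed

text \<open>The corner of largest row and smallest column is the only possible common point of a chain
  with the last row or with the first column; removing one of them shrinks the problem.\<close>

lemma potential_chain:
  fixes \<rho> :: "'r \<Rightarrow> nat" and \<gamma> :: "'c \<Rightarrow> nat"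
  assumes "finite A" "finite B" "inj \<rho>" "inj \<gamma>"
    and monge: "\<And>i k j l. \<rho> i < \<rho> k \<Longrightarrow> \<gamma> j < \<gamma> l \<Longrightarrow> w i l + w k j < w i j + w k l"
    and chain: "\<And>i k j l. C i j \<Longrightarrow> C k l \<Longrightarrow> \<not> (\<rho> i < \<rho> k \<and> \<gamma> j < \<gamma> l)"
  shows "potential A B w C"
  using assms(1,2)
proof (induction "card A + card B" arbitrary: A B rule: less_induct)
  case less
  show ?case
  proof (cases "A = {} \<or> B = {}")
    case True
    then show ?thesis by (auto simp: potential_def)
  next
    case False
    have "Max (\<rho> ` A) \<in> \<rho> ` A" using False less.prems(1) by (intro Max_in) auto
    then obtain M where M: "M \<in> A" "\<rho> M = Max (\<rho> ` A)" by auto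
    have M2: "\<rho> i \<le> \<rho> M" if "i \<in> A" for i using M(2) less.prems(1) that by simp
    have "Min (\<gamma> ` B) \<in> \<gamma> ` B" using False less.prems(2) by (intro Min_in) auto
    then obtain N where N: "N \<in> B" "\<gamma> N = Min (\<gamma> ` B)" by auto
    have N2: "\<gamma> N \<le> \<gamma> j" if "j \<in> B" for j using N(2) less.prems(2) that by simp
    have lt: "\<rho> i < \<rho> M" if "i \<in> A - {M}" for i
      using that M2[of i] injD[OF assms(3), of i M] by fastforce
    have lt': "\<gamma> N < \<gamma> j" if "j \<in> B - {N}" for j
      using that N2[of j] injD[OF assms(4), of j N] by fastforce
    have mo: "w i j + w M N < w i N + w M j" if "i \<in> A - {M}" "j \<in> B - {N}" for i j
      using monge[OF lt[OF that(1)] lt'[OF that(2)]] by simp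
    have c: "card (A - {M}) < card A" "card (B - {N}) < card B"
      using card_Diff1_less[OF _ M(1)] card_Diff1_less[OF _ N(1)] less.prems by blast+
    have p: "potential (A - {M}) B w C" "potential A (B - {N}) w C" "potential (A - {M}) (B - {N}) w C"
      by (rule less.hyps; use c less.prems in simp)+
    show ?thesis
    proof (cases "\<exists>j\<in>B. C M j \<and> j \<noteq> N")
      case False
      then show ?thesis
        using potential_step[OF less.prems M(1) N(1) mo _ p(1,3)] by blast
    next
      case True
      then obtain j where j: "j \<in> B - {N}" "C M j" by blast
      \<comment> \<open>A tight cell in row \<open>M\<close> away from \<open>N\<close> forbids
        tight cells in column \<open>N\<close> outside row \<open>M\<close>, so rows and columns
        exchange their roles.\<close>
      have col: "i = M" if "i \<in> A" "C i N" for i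
        using chain[OF that(2) j(2)] lt'[OF j(1)] lt[of i] that(1) by blast
      have "potential B A (\<lambda>j i. w i j) (\<lambda>j i. C i j)"
      proof (rule potential_step[OF less.prems(2,1) N(1) M(1)])
        show "w i j + w M N < w M j + w i N" if "j \<in> B - {N}" "i \<in> A - {M}" for i j
          using mo[OF that(2,1)] by simp
        show "i = M" if "i \<in> A" "C i N" for i using col that by blast
        show "potential (B - {N}) A (\<lambda>j i. w i j) (\<lambda>j i. C i j)"
          "potential (B - {N}) (A - {M}) (\<lambda>j i. w i j) (\<lambda>j i. C i j)"
          using p(2,3) by (simp_all add: potential_transpose)
      qed
      then show ?thesis by (rule potential_transpose)
    qed
  qed
qed

section \<open>Substituting sums of rank-one matrices\<close>

lemma monom_poly_0 [simp]: "monom_poly 0 = 1"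
  by (simp add: monom_poly_def)

lemma monom_poly_mult: "monom_poly s * monom_poly t = monom_poly (s + t)"
  by (simp add: monom_poly_def mult_single)

lemma monom_poly_prod: "(\<Prod>i\<in>A. monom_poly (f i)) = monom_poly (sum f A)"
  by (induction A rule: infinite_finite_induct) (auto simp: monom_poly_mult)

lemma lookup_monom_poly: "Poly_Mapping.lookup (monom_poly t :: ('v, 'k::comm_ring_1) mpoly) s = (if s = t then 1 else 0)"
  by (simp add: monom_poly_def lookup_single when_def)

lemma keys_monom_poly [simp]: "Poly_Mapping.keys (monom_poly t :: ('v, 'k::comm_ring_1) mpoly) = {t}"
  by (auto simp: monom_poly_def)

locale matrix_order =
  fixes \<rho> :: "'r::finite \<Rightarrow> nat" and \<gamma> :: "'c::finite \<Rightarrow> nat"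
  assumes inj_row: "inj \<rho>" and inj_col: "inj \<gamma>"
begin

text \<open>A product is strictly supermodular in its factors: exchanging the columns of two cells
  in strict south-east position lowers the total weight, so the diagonal of a minor is its heaviest
  term.\<close>

definition wt :: "'r \<times> 'c \<Rightarrow> real" where
  "wt v = real (\<rho> (fst v) * \<gamma> (snd v))"

definition strict_se :: "'r \<times> 'c \<Rightarrow> 'r \<times> 'c \<Rightarrow> bool" where
  "strict_se u v \<longleftrightarrow> \<rho> (fst u) < \<rho> (fst v) \<and> \<gamma> (snd u) < \<gamma> (snd v)"

lemma wt_monge: "\<rho> i < \<rho> k \<Longrightarrow> \<gamma> j < \<gamma> l \<Longrightarrow> wt (i, l) + wt (k, j) < wt (i, j) + wt (k, l)"
proof -
  assume "\<rho> i < \<rho> k" "\<gamma> j < \<gamma> l"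
  then have "0 < (real (\<rho> k) - real (\<rho> i)) * (real (\<gamma> l) - real (\<gamma> j))" by simp
  then show ?thesis by (simp add: wt_def algebra_simps)
qed

end

text \<open>A sum of \<open>N\<close> generic matrices of rank one, the \<open>k\<close>-th supported on the rows \<open>RA k\<close> and
  columns \<open>RC k\<close>; \<open>\<rho>\<close> and \<open>\<gamma>\<close> order the rows and the columns.\<close>

locale rank_sum = matrix_order \<rho> \<gamma>
  for \<rho> :: "'r::finite \<Rightarrow> nat" and \<gamma> :: "'c::finite \<Rightarrow> nat" +
  fixes N :: nat and RA :: "nat \<Rightarrow> 'r set" and RC :: "nat \<Rightarrow> 'c set"
begin

text \<open>The new variables are numbered by natural numbers because McCoy's theorem above relies
  on the linear order of the monomials in such variables.\<close>

definition var :: "nat \<Rightarrow> 'r + 'c \<Rightarrow> nat" where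
  "var k x = to_nat (k, x)"

lemma var_eq [simp]: "var k x = var l y \<longleftrightarrow> k = l \<and> x = y"
  by (simp add: var_def)

definition entry_monom :: "nat \<Rightarrow> 'r \<times> 'c \<Rightarrow> nat \<Rightarrow> nat monom" where
  "entry_monom k v n = Poly_Mapping.single (var k (Inl (fst v))) n + Poly_Mapping.single (var k (Inr (snd v))) n"

definition entry :: "'r \<times> 'c \<Rightarrow> (nat, 'k::comm_ring_1) mpoly" where
  "entry v = (\<Sum>k<N. if fst v \<in> RA k \<and> snd v \<in> RC k then monom_poly (entry_monom k v 1) else 0)"

definition eval_rank :: "('r \<times> 'c, 'k::comm_ring_1) mpoly \<Rightarrow> (nat, 'k) mpoly" where
  "eval_rank = subst entry"

text \<open>Each class satisfies the hypothesis of \<open>potential_chain\<close> on its cells and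
  lies in the support of its rank-one summand.\<close>

definition partition :: "('r \<times> 'c) set \<Rightarrow> ('r \<times> 'c \<Rightarrow> nat) \<Rightarrow> bool" where
  "partition S \<kappa> \<longleftrightarrow> (\<forall>s\<in>S. \<kappa> s < N \<and> fst s \<in> RA (\<kappa> s) \<and> snd s \<in> RC (\<kappa> s)) \<and>
     (\<forall>s\<in>S. \<forall>t\<in>S. \<kappa> s = \<kappa> t \<longrightarrow> \<not> strict_se s t)"

definition image_monom :: "('r \<times> 'c \<Rightarrow> nat) \<Rightarrow> ('r \<times> 'c) monom \<Rightarrow> nat monom" where
  "image_monom \<kappa> m = (\<Sum>v\<in>UNIV. entry_monom (\<kappa> v) v (Poly_Mapping.lookup m v))"

lemma entry_monom_0 [simp]: "entry_monom k v 0 = 0"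
  by (simp add: entry_monom_def)

lemma monom_poly_entry_power: "monom_poly (entry_monom k v 1) ^ n = monom_poly (entry_monom k v n)"
proof (induction n)
  case (Suc n)
  have "entry_monom k v 1 + entry_monom k v n = entry_monom k v (Suc n)"
    by (rule poly_mapping_eqI) (simp add: entry_monom_def lookup_add lookup_single when_def)
  then show ?case using Suc by (simp add: monom_poly_mult)
qed simp

lemma prod_entries:
  "(\<Prod>v\<in>UNIV. (if v \<in> S then monom_poly (entry_monom (\<kappa> v) v 1) else 0) ^ Poly_Mapping.lookup m v) =
    (if Poly_Mapping.keys m \<subseteq> S then monom_poly (image_monom \<kappa> m) else (0 :: (nat, 'k::comm_ring_1) mpoly))"
proof (cases "Poly_Mapping.keys m \<subseteq> S")
  case True
  have "(\<Prod>v\<in>UNIV. (if v \<in> S then monom_poly (entry_monom (\<kappa> v) v 1) else (0 :: (nat, 'k) mpoly)) ^ Poly_Mapping.lookup m v) =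
      (\<Prod>v\<in>UNIV. monom_poly (entry_monom (\<kappa> v) v (Poly_Mapping.lookup m v)))"
  proof (rule prod.cong[OF refl])
    fix v
    show "(if v \<in> S then monom_poly (entry_monom (\<kappa> v) v 1) else (0 :: (nat, 'k) mpoly)) ^ Poly_Mapping.lookup m v =
        monom_poly (entry_monom (\<kappa> v) v (Poly_Mapping.lookup m v))"
    proof (cases "v \<in> S")
      case False
      then have "Poly_Mapping.lookup m v = 0" using True unfolding in_keys_iff subset_iff by blast
      then show ?thesis by simp
    next
      case True
      then show ?thesis by (simp only: if_True monom_poly_entry_power)
    qed
  qed
  then show ?thesis using True by (simp add: monom_poly_prod image_monom_def)
next
  case False
  then obtain v where v: "v \<notin> S" "Poly_Mapping.lookup m v \<noteq> 0" unfolding in_keys_iff subset_iff by blast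
  have "(\<Prod>v\<in>UNIV. (if v \<in> S then monom_poly (entry_monom (\<kappa> v) v 1) else (0 :: (nat, 'k) mpoly)) ^ Poly_Mapping.lookup m v) = 0"
  proof (rule prod_zero, simp, rule bexI[of _ v])
    show "(if v \<in> S then monom_poly (entry_monom (\<kappa> v) v 1) else (0 :: (nat, 'k) mpoly)) ^ Poly_Mapping.lookup m v = 0"
      using v by (simp add: zero_power)
  qed simp
  then show ?thesis using False by simp
qed

lemma lookup_image_monom_row:
  assumes "Poly_Mapping.keys m \<subseteq> S"
  shows "Poly_Mapping.lookup (image_monom \<kappa> m) (var k (Inl r)) =
    (\<Sum>v\<in>{v\<in>S. \<kappa> v = k \<and> fst v = r}. Poly_Mapping.lookup m v)"
proof -
  have "Poly_Mapping.lookup (image_monom \<kappa> m) (var k (Inl r)) =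
      (\<Sum>v\<in>UNIV. if \<kappa> v = k \<and> fst v = r then Poly_Mapping.lookup m v else 0)"
    unfolding image_monom_def lookup_sum
    by (rule sum.cong) (auto simp: entry_monom_def lookup_add lookup_single when_def)
  also have "\<dots> = (\<Sum>v\<in>{v\<in>S. \<kappa> v = k \<and> fst v = r}. if \<kappa> v = k \<and> fst v = r then Poly_Mapping.lookup m v else 0)"
    by (rule sum.mono_neutral_right) (use assms in \<open>auto simp: in_keys_iff\<close>)
  finally show ?thesis by simp
qed

lemma lookup_image_monom_col:
  assumes "Poly_Mapping.keys m \<subseteq> S"
  shows "Poly_Mapping.lookup (image_monom \<kappa> m) (var k (Inr c)) =
    (\<Sum>v\<in>{v\<in>S. \<kappa> v = k \<and> snd v = c}. Poly_Mapping.lookup m v)"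
proof -
  have "Poly_Mapping.lookup (image_monom \<kappa> m) (var k (Inr c)) =
      (\<Sum>v\<in>UNIV. if \<kappa> v = k \<and> snd v = c then Poly_Mapping.lookup m v else 0)"
    unfolding image_monom_def lookup_sum
    by (rule sum.cong) (auto simp: entry_monom_def lookup_add lookup_single when_def)
  also have "\<dots> = (\<Sum>v\<in>{v\<in>S. \<kappa> v = k \<and> snd v = c}. if \<kappa> v = k \<and> snd v = c then Poly_Mapping.lookup m v else 0)"
    by (rule sum.mono_neutral_right) (use assms in \<open>auto simp: in_keys_iff\<close>)
  finally show ?thesis by simp
qed

lemma sum_eq_exists_other:
  fixes f g :: "'a \<Rightarrow> nat"
  assumes "finite A" "x \<in> A" "sum f A = sum g A" "f x \<noteq> g x"
  shows "\<exists>y\<in>A. y \<noteq> x \<and> f y \<noteq> g y"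
proof (rule ccontr)
  assume "\<not> ?thesis"
  then have "sum f (A - {x}) = sum g (A - {x})" by (intro sum.cong) auto
  then show False using assms by (simp add: sum.remove)
qed

text \<open>On one class of the partition the row and column sums determine the exponents. Among the
  cells of a class where \<open>m\<close> and \<open>m'\<close> differ take a topmost one, and among
  these the rightmost: its row forces another difference to the left and its column one below, and
  these two are in strict south-east position.\<close>

lemma image_monom_inj:
  assumes part: "partition S \<kappa>" and S: "Poly_Mapping.keys m \<subseteq> S" "Poly_Mapping.keys m' \<subseteq> S"
    and eq: "image_monom \<kappa> m = image_monom \<kappa> m'"
  shows "m = m'"
proof (rule ccontr)
  assume "m \<noteq> m'"
  let ?d = "\<lambda>v. Poly_Mapping.lookup m v \<noteq> Poly_Mapping.lookup m' v"
  obtain v0 where v0: "?d v0" using \<open>m \<noteq> m'\<close> by (metis poly_mapping_eqI)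
  define D where "D = {v. ?d v \<and> \<kappa> v = \<kappa> v0}"
  have DS: "D \<subseteq> S"
  proof
    fix v assume "v \<in> D"
    then have "v \<in> Poly_Mapping.keys m \<or> v \<in> Poly_Mapping.keys m'" unfolding D_def in_keys_iff by auto
    then show "v \<in> S" using S by blast
  qed
  have "v0 \<in> D" using v0 by (simp add: D_def)
  then have "D \<noteq> {}" by blast
  define R where "R = Min ((\<rho> \<circ> fst) ` D)"
  have "R \<in> (\<rho> \<circ> fst) ` D" unfolding R_def using \<open>D \<noteq> {}\<close> by (intro Min_in) auto
  then have D': "{v\<in>D. \<rho> (fst v) = R} \<noteq> {}" by auto
  define C where "C = Max ((\<gamma> \<circ> snd) ` {v\<in>D. \<rho> (fst v) = R})"
  have "C \<in> (\<gamma> \<circ> snd) ` {v\<in>D. \<rho> (fst v) = R}" unfolding C_def using D' by (intro Max_in) auto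
  then obtain v where v: "v \<in> D" "\<rho> (fst v) = R" "\<gamma> (snd v) = C" by auto
  have minR: "R \<le> \<rho> (fst u)" if "u \<in> D" for u using that by (auto simp: R_def)
  have maxC: "\<gamma> (snd u) \<le> C" if "u \<in> D" "\<rho> (fst u) = R" for u using that by (auto simp: C_def)
  have vS: "v \<in> S" "?d v" "\<kappa> v = \<kappa> v0" using v(1) DS by (auto simp: D_def)
  have "\<exists>u\<in>{u\<in>S. \<kappa> u = \<kappa> v0 \<and> fst u = fst v}. u \<noteq> v \<and> ?d u"
  proof (rule sum_eq_exists_other)
    show "(\<Sum>u\<in>{u\<in>S. \<kappa> u = \<kappa> v0 \<and> fst u = fst v}. Poly_Mapping.lookup m u) =
        (\<Sum>u\<in>{u\<in>S. \<kappa> u = \<kappa> v0 \<and> fst u = fst v}. Poly_Mapping.lookup m' u)"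
      using arg_cong[OF eq, of "\<lambda>t. Poly_Mapping.lookup t (var (\<kappa> v0) (Inl (fst v)))"]
      by (simp add: lookup_image_monom_row[OF S(1)] lookup_image_monom_row[OF S(2)])
  qed (use vS in auto)
  then obtain u1 where u1: "u1 \<in> D" "fst u1 = fst v" "u1 \<noteq> v" by (auto simp: D_def)
  have "\<exists>u\<in>{u\<in>S. \<kappa> u = \<kappa> v0 \<and> snd u = snd v}. u \<noteq> v \<and> ?d u"
  proof (rule sum_eq_exists_other)
    show "(\<Sum>u\<in>{u\<in>S. \<kappa> u = \<kappa> v0 \<and> snd u = snd v}. Poly_Mapping.lookup m u) =
        (\<Sum>u\<in>{u\<in>S. \<kappa> u = \<kappa> v0 \<and> snd u = snd v}. Poly_Mapping.lookup m' u)"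
      using arg_cong[OF eq, of "\<lambda>t. Poly_Mapping.lookup t (var (\<kappa> v0) (Inr (snd v)))"]
      by (simp add: lookup_image_monom_col[OF S(1)] lookup_image_monom_col[OF S(2)])
  qed (use vS in auto)
  then obtain u2 where u2: "u2 \<in> D" "snd u2 = snd v" "u2 \<noteq> v" by (auto simp: D_def)
  have "\<gamma> (snd u1) \<noteq> \<gamma> (snd v)" using u1 injD[OF inj_col] by (metis prod_eqI)
  then have "\<gamma> (snd u1) < \<gamma> (snd u2)" using maxC[OF u1(1)] u1(2) u2(2) v by simp
  moreover have "\<rho> (fst u2) \<noteq> \<rho> (fst v)" using u2 injD[OF inj_row] by (metis prod_eqI)
  then have "\<rho> (fst u1) < \<rho> (fst u2)" using minR[OF u2(1)] u1(2) v by simp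
  ultimately have "strict_se u1 u2" by (simp add: strict_se_def)
  moreover have "\<kappa> u1 = \<kappa> u2" using u1(1) u2(1) by (simp add: D_def)
  ultimately show False using part u1(1) u2(1) DS unfolding partition_def by blast
qed

text \<open>With the potentials of the chains as weights of the new variables, an entry on the \<open>k\<close>-th chain is
  dominated by its \<open>k\<close>-th summand and every other summand is of lower weight. So the monomial \<open>m\<close>
  leaves a trace in the image that nothing else can cancel.\<close>

lemma lookup_eval_rank:
  fixes g :: "('r \<times> 'c, 'k::comm_ring_1) mpoly"
  assumes part: "partition S \<kappa>" and S: "Poly_Mapping.keys m \<subseteq> S"
    and max: "\<And>m'. m' \<in> Poly_Mapping.keys g \<Longrightarrow> weight wt m' \<le> weight wt m"
  shows "Poly_Mapping.lookup (eval_rank g) (image_monom \<kappa> m) = Poly_Mapping.lookup g m"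
proof -
  have "\<forall>k. \<exists>p. \<forall>i j. if (i, j) \<in> S \<and> \<kappa> (i, j) = k then fst p i + snd p j = wt (i, j) else fst p i + snd p j < wt (i, j)"
  proof
    fix k
    have "potential UNIV UNIV (\<lambda>i j. wt (i, j)) (\<lambda>i j. (i, j) \<in> S \<and> \<kappa> (i, j) = k)"
    proof (rule potential_chain[OF _ _ inj_row inj_col wt_monge])
      fix i l j k' assume "(i, j) \<in> S \<and> \<kappa> (i, j) = k" "(l, k') \<in> S \<and> \<kappa> (l, k') = k"
      then have "\<not> strict_se (i, j) (l, k')" using part unfolding partition_def by metis
      then show "\<not> (\<rho> i < \<rho> l \<and> \<gamma> j < \<gamma> k')" by (simp add: strict_se_def)
    qed simp_all
    then show "\<exists>p. \<forall>i j. if (i, j) \<in> S \<and> \<kappa> (i, j) = k then fst p i + snd p j = wt (i, j) else fst p i + snd p j < wt (i, j)"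
      unfolding potential_def by (elim exE) (rule_tac x = "(\<alpha>, \<beta>)" in exI, simp)
  qed
  from choice[OF this] obtain p where p: "\<And>k i j. if (i, j) \<in> S \<and> \<kappa> (i, j) = k then fst (p k) i + snd (p k) j = wt (i, j)
      else fst (p k) i + snd (p k) j < wt (i, j)" by blast
  define \<nu> :: "nat \<Rightarrow> real" where
    "\<nu> n = (case from_nat n of (k, Inl i) \<Rightarrow> fst (p k) i | (k, Inr j) \<Rightarrow> snd (p k) j)" for n
  have \<nu>: "\<nu> (var k (Inl i)) = fst (p k) i" "\<nu> (var k (Inr j)) = snd (p k) j" for k i j
    by (simp_all add: \<nu>_def var_def)
  have w1: "weight \<nu> (entry_monom k v n) = real n * (fst (p k) (fst v) + snd (p k) (snd v))" for k v n
    by (simp add: entry_monom_def weight_add \<nu> distrib_left)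
  define M :: "'r \<times> 'c \<Rightarrow> (nat, 'k) mpoly" where
    "M v = (if v \<in> S then monom_poly (entry_monom (\<kappa> v) v 1) else 0)" for v
  have rect: "\<kappa> v < N \<and> fst v \<in> RA (\<kappa> v) \<and> snd v \<in> RC (\<kappa> v)" if "v \<in> S" for v
    using part that by (auto simp: partition_def)
  have 1: "approx \<nu> (wt v) (entry v :: (nat, 'k) mpoly) (M v)" for v
  proof -
    have "M v = (\<Sum>k<N. if v \<in> S \<and> \<kappa> v = k then monom_poly (entry_monom k v 1) else 0)"
      using rect[of v] by (auto simp: M_def)
    moreover have "approx \<nu> (wt v) (if fst v \<in> RA k \<and> snd v \<in> RC k then monom_poly (entry_monom k v 1) else (0 :: (nat, 'k) mpoly))
        (if v \<in> S \<and> \<kappa> v = k then monom_poly (entry_monom k v 1) else 0)" for k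
    proof (cases "v \<in> S \<and> \<kappa> v = k")
      case True
      then have "weight \<nu> (entry_monom k v 1) = wt v" using p[of "fst v" "snd v" k] by (simp add: w1)
      then show ?thesis using True rect[of v] by (auto simp: approx_def)
    next
      case False
      then have "weight \<nu> (entry_monom k v 1) < wt v" using p[of "fst v" "snd v" k] by (auto simp: w1)
      then show ?thesis unfolding if_not_P[OF False] by (auto simp: approx_def)
    qed
    ultimately show ?thesis unfolding entry_def by (simp only: approx_sum)
  qed
  have W: "weight wt t = (\<Sum>v\<in>UNIV. real (Poly_Mapping.lookup t v) * wt v)" for t
    by (rule weight_superset) auto
  have 2: "approx \<nu> (weight wt t) (subst_monom entry t :: (nat, 'k) mpoly)
      (if Poly_Mapping.keys t \<subseteq> S then monom_poly (image_monom \<kappa> t) else 0)" for t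
    unfolding subst_monom_def W prod_entries[symmetric] M_def[symmetric]
    by (intro approx_prod approx_power 1)
  have w2: "weight \<nu> (image_monom \<kappa> m) = weight wt m"
  proof -
    have "weight \<nu> (image_monom \<kappa> m) = (\<Sum>v\<in>UNIV. real (Poly_Mapping.lookup m v) * (fst (p (\<kappa> v)) (fst v) + snd (p (\<kappa> v)) (snd v)))"
      by (simp add: image_monom_def weight_sum w1)
    also have "\<dots> = (\<Sum>v\<in>UNIV. real (Poly_Mapping.lookup m v) * wt v)"
    proof (rule sum.cong[OF refl])
      fix v
      show "real (Poly_Mapping.lookup m v) * (fst (p (\<kappa> v)) (fst v) + snd (p (\<kappa> v)) (snd v)) = real (Poly_Mapping.lookup m v) * wt v"
      proof (cases "v \<in> S")
        case True
        then show ?thesis using p[of "fst v" "snd v" "\<kappa> v"] by simp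
      next
        case False
        then have "Poly_Mapping.lookup m v = 0" using S unfolding in_keys_iff subset_iff by blast
        then show ?thesis by simp
      qed
    qed
    finally show ?thesis by (simp add: W)
  qed
  have "Poly_Mapping.lookup (eval_rank g) (image_monom \<kappa> m) =
      (\<Sum>t\<in>Poly_Mapping.keys g. Poly_Mapping.lookup g t * Poly_Mapping.lookup (subst_monom entry t :: (nat, 'k) mpoly) (image_monom \<kappa> m))"
    by (simp add: eval_rank_def subst_def lookup_sum)
  also have "\<dots> = (\<Sum>t\<in>Poly_Mapping.keys g. if t = m then Poly_Mapping.lookup g t else 0)"
  proof (rule sum.cong[OF refl])
    fix t assume "t \<in> Poly_Mapping.keys g"
    then have "weight wt t \<le> weight \<nu> (image_monom \<kappa> m)" using max w2 by simp
    from approx_lookup[OF 2 this]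
    have "Poly_Mapping.lookup (subst_monom entry t :: (nat, 'k) mpoly) (image_monom \<kappa> m) =
        (if Poly_Mapping.keys t \<subseteq> S \<and> image_monom \<kappa> m = image_monom \<kappa> t then 1 else 0)"
      by (simp add: lookup_monom_poly)
    moreover have "Poly_Mapping.keys t \<subseteq> S \<and> image_monom \<kappa> m = image_monom \<kappa> t \<longleftrightarrow> t = m"
      using image_monom_inj[OF part S] S by blast
    ultimately show "Poly_Mapping.lookup g t * Poly_Mapping.lookup (subst_monom entry t :: (nat, 'k) mpoly) (image_monom \<kappa> m) =
        (if t = m then Poly_Mapping.lookup g t else 0)" by simp
  qed
  also have "\<dots> = Poly_Mapping.lookup g m" by (simp add: in_keys_iff)
  finally show ?thesis .
qed

end

section \<open>Diagonal terms of the minors of the generic matrix\<close>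

definition gmin :: "'r list \<Rightarrow> 'c list \<Rightarrow> ('r \<times> 'c, 'k::comm_ring_1) mpoly" where
  "gmin = lm (\<lambda>x y. indet (x, y))"

definition list_monom :: "'v list \<Rightarrow> 'v monom" where
  "list_monom qs = (\<Sum>v\<leftarrow>qs. Poly_Mapping.single v 1)"

lemma list_monom_Nil [simp]: "list_monom [] = 0"
  by (simp add: list_monom_def)

lemma list_monom_Cons [simp]: "list_monom (v # qs) = Poly_Mapping.single v 1 + list_monom qs"
  by (simp add: list_monom_def)

lemma lookup_list_monom: "Poly_Mapping.lookup (list_monom qs) v = count_list qs v"
  by (induction qs) (auto simp: lookup_add lookup_single)

lemma keys_list_monom [simp]: "Poly_Mapping.keys (list_monom qs) = set qs"
  by (auto simp: in_keys_iff lookup_list_monom count_list_0_iff)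

lemma approx_smaller:
  assumes "approx \<nu> c H M" "c < d"
  shows "approx \<nu> d H 0"
proof -
  have "Poly_Mapping.keys H \<subseteq> Poly_Mapping.keys (H - M) \<union> Poly_Mapping.keys M"
    using keys_add[of "H - M" M] by simp
  then show ?thesis using assms unfolding approx_def by fastforce
qed

lemma approx_sign: "approx \<nu> 0 ((-1) ^ n) ((-1) ^ n :: ('v, 'k::comm_ring_1) mpoly)"
proof -
  have "approx \<nu> 0 (- 1) (- 1 :: ('v, 'k) mpoly)"
    by (rule approx_refl) (auto simp: in_keys_iff lookup_one when_def split: if_splits)
  from approx_power[OF this, of n] show ?thesis by simp
qed

lemma approx_indet: "approx \<nu> (\<nu> v) (indet v) (indet v)"
  by (rule approx_refl) (auto simp: indet_def)

context matrix_order
begin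

lemma weight_list_monom: "weight wt (list_monom qs) = (\<Sum>v\<leftarrow>qs. wt v)"
  by (induction qs) (auto simp: weight_add)

lemma weight_zip:
  "length a = length b \<Longrightarrow> weight wt (list_monom (zip a b)) = (\<Sum>i<length a. wt (a ! i, b ! i))"
  by (simp add: weight_list_monom sum_list_sum_nth atLeast0LessThan)

lemma strict_se_sorted:
  assumes "sorted_wrt strict_se qs"
  shows "sorted_wrt (\<lambda>y z. \<rho> y < \<rho> z) (map fst qs)" "sorted_wrt (\<lambda>y z. \<gamma> y < \<gamma> z) (map snd qs)"
  unfolding sorted_wrt_map by (rule sorted_wrt_mono_rel[OF _ assms], simp add: strict_se_def)+

text \<open>Moving from the \<open>j\<close>-th to the next column only swaps \<open>b\<^sub>j\<close> and \<open>b\<^sub>j\<^sub>+\<^sub>1\<close>.\<close>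

lemma weight_expand_less:
  assumes x: "\<And>y. y \<in> set a \<Longrightarrow> \<rho> x < \<rho> y" and b: "sorted_wrt (\<lambda>y z. \<gamma> y < \<gamma> z) b"
    and len: "length b = Suc (length a)" and j: "j < length a"
  shows "wt (x, b ! Suc j) + weight wt (list_monom (zip a (del (Suc j) b))) <
    wt (x, b ! j) + weight wt (list_monom (zip a (del j b)))"
proof -
  have l: "length a = length (del j b)" "length a = length (del (Suc j) b)" using len j by auto
  have eq: "(\<Sum>i\<in>{..<length a} - {j}. wt (a ! i, del (Suc j) b ! i)) = (\<Sum>i\<in>{..<length a} - {j}. wt (a ! i, del j b ! i))"
  proof (rule sum.cong[OF refl])
    fix i assume "i \<in> {..<length a} - {j}"
    then have "i < length a" "i \<noteq> j" by auto
    then have "del (Suc j) b ! i = del j b ! i"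
      using len j by (cases "i < j") (simp_all add: nth_del)
    then show "wt (a ! i, del (Suc j) b ! i) = wt (a ! i, del j b ! i)" by simp
  qed
  have "\<gamma> (b ! j) < \<gamma> (b ! Suc j)" using sorted_wrt_nth_less[OF b, of j "Suc j"] len j by simp
  then have "wt (x, b ! Suc j) + wt (a ! j, b ! j) < wt (x, b ! j) + wt (a ! j, b ! Suc j)"
    using wt_monge[OF x[of "a ! j"]] j by simp
  moreover have "del (Suc j) b ! j = b ! j" "del j b ! j = b ! Suc j" using len j by (simp_all add: nth_del)
  ultimately show ?thesis
    unfolding weight_zip[OF l(1)] weight_zip[OF l(2)] sum.remove[of "{..<length a}" j, simplified, OF j] eq
    by simp
qed

lemma weight_expand_less_first:
  assumes x: "\<And>y. y \<in> set a \<Longrightarrow> \<rho> x < \<rho> y" and b: "sorted_wrt (\<lambda>y z. \<gamma> y < \<gamma> z) b"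
    and len: "length b = Suc (length a)"
  shows "j < length a \<Longrightarrow> wt (x, b ! Suc j) + weight wt (list_monom (zip a (del (Suc j) b))) <
    wt (x, b ! 0) + weight wt (list_monom (zip a (del 0 b)))"
proof (induction j)
  case 0
  then show ?case using weight_expand_less[OF x b len, of 0] by simp
next
  case (Suc j)
  then show ?case using weight_expand_less[OF x b len, of "Suc j"] by simp
qed

lemma sorted_wrt_del:
  assumes "sorted_wrt P xs"
  shows "sorted_wrt P (del j xs)"
proof -
  have "sorted_wrt P (take j xs @ drop j xs)" using assms by simp
  then have "\<forall>x\<in>set (take j xs). \<forall>y\<in>set (drop j xs). P x y" unfolding sorted_wrt_append by blast
  moreover have "set (drop (Suc j) xs) \<subseteq> set (drop j xs)" by (rule set_drop_subset_set_drop) simp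
  ultimately show ?thesis
    unfolding del_def sorted_wrt_append using assms sorted_wrt_take sorted_wrt_drop by blast
qed

text \<open>In the expansion along the first row the terms lose weight from each column to the next,
  so only the first one reaches the level of the diagonal.\<close>

lemma gmin_approx:
  assumes "length a = length b" "sorted_wrt (\<lambda>y z. \<rho> y < \<rho> z) a" "sorted_wrt (\<lambda>y z. \<gamma> y < \<gamma> z) b"
  shows "approx wt (weight wt (list_monom (zip a b))) (gmin a b) (monom_poly (list_monom (zip a b)) :: ('r \<times> 'c, 'k::comm_ring_1) mpoly)"
  using assms
proof (induction a arbitrary: b)
  case Nil
  then show ?case by (simp add: gmin_def approx_1)
next
  case (Cons x a)
  let ?c = "weight wt (list_monom (zip (x # a) b))"
  obtain y b' where b: "b = y # b'" using Cons.prems(1) by (cases b) auto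
  have len: "Suc (length a) = length b" using Cons.prems(1) by simp
  have exp: "gmin (x # a) b = (\<Sum>j<length b. indet (x, b ! j) * (-1) ^ j * gmin a (del j b) :: ('r \<times> 'c, 'k) mpoly)"
    unfolding gmin_def by (rule lm_expand_first_row[OF len])
  have "approx wt ?c (\<Sum>j<length b. indet (x, b ! j) * (-1) ^ j * gmin a (del j b) :: ('r \<times> 'c, 'k) mpoly)
      (\<Sum>j<length b. if j = 0 then monom_poly (list_monom (zip (x # a) b)) else 0)"
  proof (rule approx_sum)
    fix j assume j: "j \<in> {..<length b}"
    have IH: "approx wt (weight wt (list_monom (zip a (del j b)))) (gmin a (del j b))
        (monom_poly (list_monom (zip a (del j b))) :: ('r \<times> 'c, 'k) mpoly)"
      by (rule Cons.IH) (use Cons.prems j len in \<open>auto intro: sorted_wrt_del\<close>)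
    have t: "approx wt (wt (x, b ! j) + 0 + weight wt (list_monom (zip a (del j b)))) (indet (x, b ! j) * (-1) ^ j * gmin a (del j b))
        (indet (x, b ! j) * (-1) ^ j * monom_poly (list_monom (zip a (del j b))) :: ('r \<times> 'c, 'k) mpoly)"
      by (intro approx_mult approx_indet approx_sign IH)
    have c0: "?c = wt (x, b ! 0) + weight wt (list_monom (zip a (del 0 b)))"
      by (simp add: b weight_add)
    show "approx wt ?c (indet (x, b ! j) * (-1) ^ j * gmin a (del j b))
        (if j = 0 then monom_poly (list_monom (zip (x # a) b)) else 0 :: ('r \<times> 'c, 'k) mpoly)"
    proof (cases j)
      case 0
      have "indet (x, b ! 0) * (-1) ^ 0 * monom_poly (list_monom (zip a (del 0 b))) =
          (monom_poly (list_monom (zip (x # a) b)) :: ('r \<times> 'c, 'k) mpoly)"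
        by (simp add: b indet_def monom_poly_mult)
      then show ?thesis using t unfolding 0 c0 by simp
    next
      case (Suc i)
      have "wt (x, b ! j) + 0 + weight wt (list_monom (zip a (del j b))) < ?c"
        unfolding Suc c0 using weight_expand_less_first[of a x b i] Cons.prems len j Suc by simp
      from approx_smaller[OF t this] show ?thesis using Suc by simp
    qed
  qed
  moreover have "(\<Sum>j<length b. if j = 0 then monom_poly (list_monom (zip (x # a) b)) else (0 :: ('r \<times> 'c, 'k) mpoly)) =
      monom_poly (list_monom (zip (x # a) b))"
    by (simp add: b)
  ultimately show ?case unfolding exp by simp
qed

end

section \<open>Determinantal ideals as kernels of substitutions\<close>

lemma lm_low_rank:
  fixes e :: "'x \<Rightarrow> 'y \<Rightarrow> 'k::comm_ring_1"
  assumes len: "length a = length b" and K: "finite K" "card K < length a"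
    and e: "\<And>x y. x \<in> set a \<Longrightarrow> y \<in> set b \<Longrightarrow> e x y = (\<Sum>k\<in>K. u k x * v k y)"
  shows "lm e a b = 0"
proof -
  obtain ks where ks: "set ks = K" "distinct ks" using finite_distinct_list[OF K(1)] by blast
  let ?n = "length a" and ?m = "length ks"
  have m: "?m < ?n" using ks K distinct_card by fastforce
  \<comment> \<open>The factors are padded with zeros to square matrices so that the determinant is
    multiplicative; column \<open>?m\<close> of \<open>U\<close> is then zero.\<close>
  define U where "U = mat ?n ?n (\<lambda>(i, k). if k < ?m then u (ks ! k) (a ! i) else 0)"
  define V where "V = mat ?n ?n (\<lambda>(k, j). if k < ?m then v (ks ! k) (b ! j) else 0)"
  have "mat ?n ?n (\<lambda>(i, j). e (a ! i) (b ! j)) = U * V"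
  proof (rule eq_matI)
    fix i j assume "i < dim_row (U * V)" "j < dim_col (U * V)"
    then have ij: "i < ?n" "j < ?n" by (auto simp: U_def V_def)
    have "(U * V) $$ (i, j) = (\<Sum>k<?n. U $$ (i, k) * V $$ (k, j))"
      using ij by (simp add: U_def V_def scalar_prod_def lessThan_atLeast0)
    also have "\<dots> = (\<Sum>k<?m. u (ks ! k) (a ! i) * v (ks ! k) (b ! j))"
      using ij m by (intro sum.mono_neutral_cong_right) (auto simp: U_def V_def)
    also have "\<dots> = (\<Sum>k\<leftarrow>ks. u k (a ! i) * v k (b ! j))"
      by (simp add: sum_list_sum_nth lessThan_atLeast0)
    also have "\<dots> = e (a ! i) (b ! j)"
      using ij len ks by (simp add: e sum_list_distinct_conv_sum_set)
    finally show "mat ?n ?n (\<lambda>(i, j). e (a ! i) (b ! j)) $$ (i, j) = (U * V) $$ (i, j)" using ij by simp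
  qed (auto simp: U_def V_def)
  then have "lm e a b = det (U * V)" unfolding lm_def by simp
  also have "det (U * V) = det U * det V"
    by (rule det_mult[of _ ?n]) (auto simp: U_def V_def)
  finally have "lm e a b = det U * det V" .
  moreover have "det U = lm (\<lambda>x k. if k < ?m then u (ks ! k) x else 0) a [0..<?n]"
    unfolding lm_def U_def by (intro arg_cong[where f = det] eq_matI) auto
  moreover have "\<dots> = 0"
    by (rule lm_zero_col[of _ _ ?m]) (use m in auto)
  ultimately show ?thesis by simp
qed

text \<open>Lists with repetitions or out of order contribute only zeros and negatives, so this
  amounts to the \<open>t\<close>-minors of the submatrices on \<open>A \<times> C\<close>.\<close>

definition block_gens :: "('r set \<times> 'c set \<times> nat) set \<Rightarrow> ('r \<times> 'c, 'k::comm_ring_1) mpoly set" where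
  "block_gens B = {gmin a b | a b A C t. (A, C, t) \<in> B \<and> length a = t \<and> length b = t \<and> set a \<subseteq> A \<and> set b \<subseteq> C}"

text \<open>The two halves of computing the kernel of \<open>eval_rank\<close>. By
  \<open>low_rank\<close> every block meets fewer than \<open>t\<close> summands, so its
  \<open>t\<close>-minors are sent to zero. By \<open>good\<close> a monomial that is divisible by
  no diagonal of a generator has a support that can be distributed over the summands, so that it
  leaves a trace in the image.\<close>

locale rank_blocks = rank_sum \<rho> \<gamma> N RA RC
  for \<rho> :: "'r::finite \<Rightarrow> nat" and \<gamma> :: "'c::finite \<Rightarrow> nat" and N RA RC +
  fixes B :: "('r set \<times> 'c set \<times> nat) set"
  assumes low_rank: "\<And>A C t. (A, C, t) \<in> B \<Longrightarrow> card {k. k < N \<and> RA k \<inter> A \<noteq> {} \<and> RC k \<inter> C \<noteq> {}} < t"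
    and good: "\<And>S. (\<And>A C t qs. (A, C, t) \<in> B \<Longrightarrow> sorted_wrt strict_se qs \<Longrightarrow> set qs \<subseteq> S \<inter> A \<times> C \<Longrightarrow> length qs < t) \<Longrightarrow>
      \<exists>\<kappa>. partition S \<kappa>"
begin

lemma eval_rank_add: "eval_rank (f + g) = eval_rank f + eval_rank g"
  and eval_rank_mult: "eval_rank (f * g) = eval_rank f * eval_rank g"
  and eval_rank_0 [simp]: "eval_rank 0 = 0"
  by (simp_all add: eval_rank_def subst_add subst_mult)

lemma eval_rank_gmin:
  assumes "(A, C, t) \<in> B" "length a = t" "length b = t" "set a \<subseteq> A" "set b \<subseteq> C"
  shows "eval_rank (gmin a b :: ('r \<times> 'c, 'k::comm_ring_1) mpoly) = 0"
proof -
  let ?K = "{k. k < N \<and> RA k \<inter> A \<noteq> {} \<and> RC k \<inter> C \<noteq> {}}"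
  let ?X = "\<lambda>k x. monom_poly (Poly_Mapping.single (var k x) 1) :: (nat, 'k) mpoly"
  have "eval_rank (gmin a b) = lm (\<lambda>x y. entry (x, y)) a b"
    by (simp add: eval_rank_def gmin_def subst_lm)
  also have "\<dots> = (0 :: (nat, 'k) mpoly)"
  proof (rule lm_low_rank[of a b ?K])
    fix x y assume xy: "x \<in> set a" "y \<in> set b"
    have "entry (x, y) = (\<Sum>k<N. if x \<in> RA k \<and> y \<in> RC k then monom_poly (entry_monom k (x, y) 1) else (0 :: (nat, 'k) mpoly))"
      by (simp add: entry_def)
    also have "\<dots> = (\<Sum>k\<in>?K. (if x \<in> RA k then ?X k (Inl x) else 0) * (if y \<in> RC k then ?X k (Inr y) else 0))"
      by (rule sum.mono_neutral_cong_right)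
        (use xy assms(4,5) in \<open>auto simp: entry_monom_def monom_poly_mult\<close>)
    finally show "entry (x, y) = (\<Sum>k\<in>?K. (if x \<in> RA k then ?X k (Inl x) else 0) * (if y \<in> RC k then ?X k (Inr y) else 0))" .
  qed (use assms low_rank in auto)
  finally show ?thesis .
qed

lemma eval_rank_ideal:
  fixes f :: "('r \<times> 'c, 'k::comm_ring_1) mpoly"
  assumes "f \<in> gen_ideal (block_gens B)"
  shows "eval_rank f = 0"
  using assms
proof (induction rule: rmod.span_induct_alt)
  case base
  then show ?case by simp
next
  case (step c x y)
  then obtain a b A C t where "x = gmin a b" "(A, C, t) \<in> B" "length a = t" "length b = t" "set a \<subseteq> A" "set b \<subseteq> C"
    by (auto simp: block_gens_def)
  then have "eval_rank x = 0" using eval_rank_gmin by metis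
  then show ?case using step by (simp add: eval_rank_add eval_rank_mult)
qed

definition nat_weight :: "('r \<times> 'c) monom \<Rightarrow> nat" where
  "nat_weight t = (\<Sum>v\<in>UNIV. Poly_Mapping.lookup t v * (\<rho> (fst v) * \<gamma> (snd v)))"

lemma weight_nat: "weight wt t = real (nat_weight t)"
  by (subst weight_superset[of UNIV]) (auto simp: nat_weight_def wt_def)

lemma exists_chain:
  assumes "\<nexists>\<kappa>. partition (Poly_Mapping.keys m) \<kappa>"
  obtains qs A C where "(A, C, length qs) \<in> B" "sorted_wrt strict_se qs" "set qs \<subseteq> A \<times> C"
    "\<exists>u. m = u + list_monom qs"
proof -
  obtain A C t qs where qs: "(A, C, t) \<in> B" "sorted_wrt strict_se qs" "set qs \<subseteq> Poly_Mapping.keys m \<inter> A \<times> C" "\<not> length qs < t"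
    using good[of "Poly_Mapping.keys m"] assms by blast
  let ?q = "take t qs"
  have len: "length ?q = t" using qs(4) by simp
  have sw: "sorted_wrt strict_se ?q" using qs(2) by (rule sorted_wrt_take)
  have "distinct ?q"
    using sw by (metis (no_types, lifting) distinct_conv_nth linorder_neqE_nat less_irrefl sorted_wrt_iff_nth_less strict_se_def)
  have sub: "set ?q \<subseteq> Poly_Mapping.keys m \<inter> A \<times> C" using qs(3) set_take_subset[of t qs] by blast
  have "m = (m - list_monom ?q) + list_monom ?q"
  proof (rule poly_mapping_eqI)
    fix v
    have "count_list ?q v \<le> 1" using \<open>distinct ?q\<close> by (simp add: distinct_count_atmost_1 count_list_eq_length_filter distinct_length_filter card_le_Suc0_iff_eq)
    moreover have "count_list ?q v = 0 \<or> Poly_Mapping.lookup m v \<noteq> 0"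
      using sub by (auto simp: count_list_0_iff in_keys_iff)
    ultimately have "count_list ?q v \<le> Poly_Mapping.lookup m v" by linarith
    then show "Poly_Mapping.lookup m v = Poly_Mapping.lookup ((m - list_monom ?q) + list_monom ?q) v"
      by (simp add: lookup_add lookup_minus lookup_list_monom)
  qed
  then show ?thesis using that[of A C ?q] qs(1) len sw sub by auto
qed

text \<open>If the support of a heaviest monomial of \<open>g\<close> had a partition, its
  coefficient would survive in the image. So the monomial is divisible by the diagonal of a
  generator, and subtracting a multiple of that generator trades it for lighter monomials. Since
  several monomials may share the greatest weight, the induction runs over the multiset of
  weights.\<close>

lemma kernel_subset:
  fixes g :: "('r \<times> 'c, 'k::comm_ring_1) mpoly"
  assumes "eval_rank g = 0"
  shows "g \<in> gen_ideal (block_gens B)"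
  using assms
proof (induction g rule: wf_induct_rule[OF wf_inv_image[OF wf_mult[OF wf_less], of "\<lambda>g. image_mset nat_weight (mset_set (Poly_Mapping.keys g))"]])
  case (1 g)
  show ?case
  proof (cases "g = 0")
    case True
    then show ?thesis by (simp add: rmod.span_zero)
  next
    case False
    then have ne: "nat_weight ` Poly_Mapping.keys g \<noteq> {}" by simp
    then have "Max (nat_weight ` Poly_Mapping.keys g) \<in> nat_weight ` Poly_Mapping.keys g" by (intro Max_in) auto
    then obtain m where m: "m \<in> Poly_Mapping.keys g" "nat_weight m = Max (nat_weight ` Poly_Mapping.keys g)" by auto
    have max: "nat_weight t \<le> nat_weight m" if "t \<in> Poly_Mapping.keys g" for t using m(2) that by simp
    have "\<nexists>\<kappa>. partition (Poly_Mapping.keys m) \<kappa>"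
    proof
      assume "\<exists>\<kappa>. partition (Poly_Mapping.keys m) \<kappa>"
      then obtain \<kappa> where "partition (Poly_Mapping.keys m) \<kappa>" ..
      from lookup_eval_rank[OF this, of m g] max have "Poly_Mapping.lookup (eval_rank g) (image_monom \<kappa> m) = Poly_Mapping.lookup g m"
        by (simp add: weight_nat)
      then show False using "1.prems" m(1) by (simp add: in_keys_iff)
    qed
    then obtain qs A C u where qs: "(A, C, length qs) \<in> B" "sorted_wrt strict_se qs" "set qs \<subseteq> A \<times> C" and u: "m = u + list_monom qs"
      by (rule exists_chain) blast
    let ?G = "gmin (map fst qs) (map snd qs) :: ('r \<times> 'c, 'k) mpoly"
    let ?h = "Poly_Mapping.single u (Poly_Mapping.lookup g m) * ?G"
    have "fst ` set qs \<subseteq> A" "snd ` set qs \<subseteq> C" using qs(3) by auto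
    then have G: "?G \<in> block_gens B" unfolding block_gens_def
      using qs(1) by (auto intro!: exI[of _ "map fst qs"] exI[of _ "map snd qs"] exI[of _ A] exI[of _ C])
    have "approx wt (weight wt (list_monom qs)) ?G (monom_poly (list_monom qs))"
      using gmin_approx[of "map fst qs" "map snd qs"] strict_se_sorted[OF qs(2)] by (simp add: zip_map_fst_snd)
    then have low: "weight wt t < weight wt (list_monom qs)" if "t \<in> Poly_Mapping.keys (?G - monom_poly (list_monom qs))" for t
      using that by (simp add: approx_def)
    have "?h = Poly_Mapping.single u (Poly_Mapping.lookup g m) * (?G - monom_poly (list_monom qs)) + Poly_Mapping.single m (Poly_Mapping.lookup g m)"
      by (simp add: right_diff_distrib monom_poly_def mult_single u)
    then have eq: "g - ?h = (g - Poly_Mapping.single m (Poly_Mapping.lookup g m)) -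
        Poly_Mapping.single u (Poly_Mapping.lookup g m) * (?G - monom_poly (list_monom qs))" by simp
    have keys: "t \<in> Poly_Mapping.keys g - {m} \<or> nat_weight t < nat_weight m" if "t \<in> Poly_Mapping.keys (g - ?h)" for t
    proof -
      have "t \<in> Poly_Mapping.keys (g - Poly_Mapping.single m (Poly_Mapping.lookup g m)) \<or>
          t \<in> Poly_Mapping.keys (Poly_Mapping.single u (Poly_Mapping.lookup g m) * (?G - monom_poly (list_monom qs)))"
        using that unfolding eq in_keys_iff lookup_minus by auto
      then show ?thesis
      proof
        assume "t \<in> Poly_Mapping.keys (g - Poly_Mapping.single m (Poly_Mapping.lookup g m))"
        then show ?thesis by (auto simp: in_keys_iff lookup_minus lookup_single when_def split: if_splits)
      next
        assume "t \<in> Poly_Mapping.keys (Poly_Mapping.single u (Poly_Mapping.lookup g m) * (?G - monom_poly (list_monom qs)))"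
        then obtain s where s: "s \<in> Poly_Mapping.keys (?G - monom_poly (list_monom qs))" "t = u + s"
          using keys_single_mult by blast
        have "weight wt t < weight wt m" using low[OF s(1)] by (simp add: s(2) u weight_add)
        then show ?thesis by (simp add: weight_nat)
      qed
    qed
    let ?K = "Poly_Mapping.keys g" and ?K' = "Poly_Mapping.keys (g - ?h)"
    let ?w = "\<lambda>X. image_mset nat_weight (mset_set X)"
    have "m \<notin> ?K'" using keys by blast
    have "(?w (?K \<inter> ?K') + ?w (?K' - ?K), ?w (?K \<inter> ?K') + ?w (?K - ?K')) \<in> Multiset.mult {(x, y). x < y}"
    proof (rule one_step_implies_mult)
      have "m \<in> ?K - ?K'" using m(1) \<open>m \<notin> ?K'\<close> by blast
      then show "?w (?K - ?K') \<noteq> {#}" by (auto simp: mset_set_empty_iff)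
      show "\<forall>k\<in>set_mset (?w (?K' - ?K)). \<exists>j\<in>set_mset (?w (?K - ?K')). (k, j) \<in> {(x, y). x < y}"
        using keys \<open>m \<in> ?K - ?K'\<close> by auto
    qed
    moreover have "?w (?K \<inter> ?K') + ?w (?K' - ?K) = ?w ?K'"
      by (subst image_mset_union[symmetric], subst mset_set_Union[symmetric]) (auto intro!: arg_cong[where f = "\<lambda>X. image_mset nat_weight (mset_set X)"])
    moreover have "?w (?K \<inter> ?K') + ?w (?K - ?K') = ?w ?K"
      by (subst image_mset_union[symmetric], subst mset_set_Union[symmetric]) (auto intro!: arg_cong[where f = "\<lambda>X. image_mset nat_weight (mset_set X)"])
    ultimately have "(g - ?h, g) \<in> inv_image (Multiset.mult {(x, y). x < y}) (\<lambda>g. ?w (Poly_Mapping.keys g))"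
      by simp
    moreover have "eval_rank (g - ?h) = 0"
    proof -
      have "eval_rank ((g - ?h) + ?h) = 0" using "1.prems" by simp
      moreover have "eval_rank ?h = 0"
        using eval_rank_ideal[OF gen_ideal_mult_left[OF rmod.span_base[OF G]]] .
      ultimately show ?thesis unfolding eval_rank_add by simp
    qed
    ultimately have "g - ?h \<in> gen_ideal (block_gens B)" by (rule "1.IH")
    moreover have "?h \<in> gen_ideal (block_gens B)" by (intro gen_ideal_mult_left rmod.span_base G)
    ultimately have "(g - ?h) + ?h \<in> gen_ideal (block_gens B)" by (rule rmod.span_add)
    then show ?thesis by simp
  qed
qed

text \<open>The diagonal of the minor survives in its image with coefficient 1, so that McCoy's theorem applies.\<close>

lemma gmin_nonzerodivisor:
  fixes g :: "('r \<times> 'c, 'k::comm_ring_1) mpoly"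
  assumes ab: "length a = length b" "sorted_wrt (\<lambda>y z. \<rho> y < \<rho> z) a" "sorted_wrt (\<lambda>y z. \<gamma> y < \<gamma> z) b"
    and few: "\<And>A C t. (A, C, t) \<in> B \<Longrightarrow> card {i. i < length a \<and> a ! i \<in> A \<and> b ! i \<in> C} < t"
    and mem: "gmin a b * g \<in> gen_ideal (block_gens B)"
  shows "g \<in> gen_ideal (block_gens B)"
proof (rule kernel_subset)
  let ?q = "zip a b"
  have "distinct a" using ab(2) by (auto simp: sorted_wrt_iff_nth_less distinct_conv_nth) (metis less_irrefl linorder_neqE_nat)
  have "\<exists>\<kappa>. partition (set ?q) \<kappa>"
  proof (rule good)
    fix A C t qs assume *: "(A, C, t) \<in> B" "sorted_wrt strict_se qs" "set qs \<subseteq> set ?q \<inter> A \<times> C"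
    have "distinct qs"
      using *(2) by (metis (no_types, lifting) distinct_conv_nth linorder_neqE_nat less_irrefl sorted_wrt_iff_nth_less strict_se_def)
    then have "length qs = card (set qs)" by (simp add: distinct_card)
    also have "\<dots> \<le> card ((\<lambda>i. (a ! i, b ! i)) ` {i. i < length a \<and> a ! i \<in> A \<and> b ! i \<in> C})"
    proof (rule card_mono)
      show "set qs \<subseteq> (\<lambda>i. (a ! i, b ! i)) ` {i. i < length a \<and> a ! i \<in> A \<and> b ! i \<in> C}"
      proof
        fix q assume "q \<in> set qs"
        then have q: "q \<in> set ?q" "fst q \<in> A" "snd q \<in> C" using *(3) by auto
        then obtain i where "i < length a" "q = (a ! i, b ! i)" by (auto simp: set_zip)
        then show "q \<in> (\<lambda>i. (a ! i, b ! i)) ` {i. i < length a \<and> a ! i \<in> A \<and> b ! i \<in> C}" using q by auto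
      qed
    qed simp
    also have "\<dots> \<le> card {i. i < length a \<and> a ! i \<in> A \<and> b ! i \<in> C}" by (rule card_image_le) simp
    also have "\<dots> < t" by (rule few[OF *(1)])
    finally show "length qs < t" .
  qed
  then obtain \<kappa> where \<kappa>: "partition (set ?q) \<kappa>" ..
  have appr: "approx wt (weight wt (list_monom ?q)) (gmin a b) (monom_poly (list_monom ?q) :: ('r \<times> 'c, 'k) mpoly)"
    by (rule gmin_approx[OF ab])
  have "Poly_Mapping.lookup (eval_rank (gmin a b :: ('r \<times> 'c, 'k) mpoly)) (image_monom \<kappa> (list_monom ?q)) =
      Poly_Mapping.lookup (gmin a b) (list_monom ?q)"
  proof (rule lookup_eval_rank[OF \<kappa>])
    fix m' assume "m' \<in> Poly_Mapping.keys (gmin a b :: ('r \<times> 'c, 'k) mpoly)"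
    moreover have "Poly_Mapping.keys (gmin a b :: ('r \<times> 'c, 'k) mpoly) \<subseteq>
        Poly_Mapping.keys (gmin a b - monom_poly (list_monom ?q) :: ('r \<times> 'c, 'k) mpoly) \<union> {list_monom ?q}"
      using keys_add[of "gmin a b - monom_poly (list_monom ?q)" "monom_poly (list_monom ?q) :: ('r \<times> 'c, 'k) mpoly"] by simp
    ultimately show "weight wt m' \<le> weight wt (list_monom ?q)"
      using appr by (auto simp: approx_def less_imp_le)
  qed simp
  also have "Poly_Mapping.lookup (gmin a b :: ('r \<times> 'c, 'k) mpoly) (list_monom ?q) = 1"
    using approx_lookup[OF appr, of "list_monom ?q"] by (simp add: lookup_monom_poly)
  finally have one: "1 * Poly_Mapping.lookup (eval_rank (gmin a b :: ('r \<times> 'c, 'k) mpoly)) (image_monom \<kappa> (list_monom ?q)) = 1"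
    by simp
  have "eval_rank (gmin a b) * eval_rank g = 0"
    using eval_rank_ideal[OF mem] by (simp add: eval_rank_mult)
  from mult_eq_0_unit_coeff[OF this one] show "eval_rank g = 0" .
qed

end

section \<open>Chains of cells and their levels\<close>

lemma sorted_wrt_last:
  assumes "sorted_wrt R qs" "x \<in> set qs"
  shows "x = last qs \<or> R x (last qs)"
proof -
  have eq: "butlast qs @ [last qs] = qs" using assms(2) by (intro append_butlast_last_id) auto
  have "sorted_wrt R (butlast qs @ [last qs])" "x \<in> set (butlast qs @ [last qs])"
    unfolding eq by (fact assms)+
  then show ?thesis by (auto simp: sorted_wrt_append)
qed

context matrix_order
begin

definition chains_to :: "('r \<times> 'c) set \<Rightarrow> 'r \<times> 'c \<Rightarrow> ('r \<times> 'c) list set" where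
  "chains_to S v = {qs. sorted_wrt strict_se qs \<and> set qs \<subseteq> S \<and> qs \<noteq> [] \<and> last qs = v}"

definition level :: "('r \<times> 'c) set \<Rightarrow> 'r \<times> 'c \<Rightarrow> nat" where
  "level S v = Max (length ` chains_to S v)"

lemma chain_distinct: "sorted_wrt strict_se qs \<Longrightarrow> distinct qs"
  by (metis (no_types, lifting) distinct_conv_nth linorder_neqE_nat less_irrefl sorted_wrt_iff_nth_less strict_se_def)

lemma chain_length: "sorted_wrt strict_se qs \<Longrightarrow> length qs \<le> card (UNIV :: ('r \<times> 'c) set)"
  by (metis chain_distinct distinct_card card_mono finite subset_UNIV)

lemma finite_chain_lengths: "finite (length ` chains_to S v)"
proof (rule finite_subset)
  show "length ` chains_to S v \<subseteq> {..card (UNIV :: ('r \<times> 'c) set)}"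
    by (rule image_subsetI) (unfold atMost_iff chains_to_def mem_Collect_eq, elim conjE, rule chain_length)
qed (rule finite_atMost)

lemma level_chain:
  assumes "v \<in> S"
  obtains qs where "qs \<in> chains_to S v" "length qs = level S v"
proof -
  have "[v] \<in> chains_to S v" using assms by (simp add: chains_to_def)
  then have "level S v \<in> length ` chains_to S v"
    unfolding level_def by (intro Max_in finite_chain_lengths) blast
  then show ?thesis using that by auto
qed

lemma level_pos:
  assumes "v \<in> S"
  shows "0 < level S v"
proof -
  obtain qs where "qs \<in> chains_to S v" "length qs = level S v" using level_chain[OF assms] .
  moreover have "0 < length qs" using \<open>qs \<in> chains_to S v\<close> by (simp add: chains_to_def)
  ultimately show ?thesis by simp
qed

lemma level_less:
  assumes "u \<in> S" "v \<in> S" "strict_se u v"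
  shows "level S u < level S v"
proof -
  obtain qs where qs: "qs \<in> chains_to S u" "length qs = level S u" using level_chain[OF assms(1)] by blast
  have "strict_se x v" if "x \<in> set qs" for x
  proof -
    have "x = u \<or> strict_se x u"
      using sorted_wrt_last[of strict_se qs x] that qs(1) by (auto simp: chains_to_def)
    then show ?thesis using assms(3) by (auto simp: strict_se_def)
  qed
  then have "qs @ [v] \<in> chains_to S v" using qs(1) assms(2) by (auto simp: chains_to_def sorted_wrt_append)
  then have "length (qs @ [v]) \<le> level S v"
    unfolding level_def by (intro Max_ge finite_chain_lengths imageI)
  then show ?thesis using qs(2) by simp
qed

end

text \<open>The block receives \<open>t - 1\<close> rank-one matrices supported on all of it, and
  every cell outside it one of its own. A set of cells with no chain of length \<open>t\<close> in
  the block is partitioned there by levels.\<close>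

lemma rank_blocks_single:
  fixes A :: "'r::finite set" and C :: "'c::finite set" and \<rho> :: "'r \<Rightarrow> nat" and \<gamma> :: "'c \<Rightarrow> nat"
  assumes "inj \<rho>" "inj \<gamma>" "0 < t"
  obtains N RA RC where "rank_blocks \<rho> \<gamma> N RA RC {(A, C, t)}"
proof -
  interpret matrix_order \<rho> \<gamma> by unfold_locales (fact assms)+
  obtain pos :: "'r \<times> 'c \<Rightarrow> nat" and n where pos: "pos ` UNIV = {i. i < n}" "inj pos"
    using finite_imp_inj_to_nat_seg[of "UNIV :: ('r \<times> 'c) set"] by auto
  define p where "p k = inv_into UNIV pos (k - (t - 1))" for k
  \<comment> \<open>Indices from \<open>t - 1\<close> on belong to single cells; the support is made
    empty for cells of the block, so that no further summand meets it.\<close>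
  define RA where "RA k = (if k < t - 1 then A else if p k \<in> A \<times> C then {} else {fst (p k)})" for k
  define RC where "RC k = (if k < t - 1 then C else {snd (p k)})" for k
  have "rank_blocks \<rho> \<gamma> (t - 1 + n) RA RC {(A, C, t)}"
  proof unfold_locales
    fix A' C' t' assume "(A', C', t') \<in> {(A, C, t)}"
    then have eq: "A' = A" "C' = C" "t' = t" by auto
    have "{k. k < t - 1 + n \<and> RA k \<inter> A \<noteq> {} \<and> RC k \<inter> C \<noteq> {}} \<subseteq> {..<t - 1}"
      by (auto simp: RA_def RC_def mem_Times_iff split: if_splits)
    from card_mono[OF _ this] show "card {k. k < t - 1 + n \<and> RA k \<inter> A' \<noteq> {} \<and> RC k \<inter> C' \<noteq> {}} < t'"
      using assms(3) unfolding eq by simp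
  next
    fix S assume "\<And>A' C' t' qs. (A', C', t') \<in> {(A, C, t)} \<Longrightarrow> sorted_wrt strict_se qs \<Longrightarrow> set qs \<subseteq> S \<inter> A' \<times> C' \<Longrightarrow> length qs < t'"
    then have S: "length qs < t" if "sorted_wrt strict_se qs" "set qs \<subseteq> S \<inter> A \<times> C" for qs using that by blast
    let ?S = "S \<inter> A \<times> C"
    define \<kappa> where "\<kappa> v = (if v \<in> A \<times> C then level ?S v - 1 else t - 1 + pos v)" for v
    have lev: "0 < level ?S v" "level ?S v < t" if v: "v \<in> ?S" for v
    proof -
      obtain qs where "qs \<in> chains_to ?S v" "length qs = level ?S v" using level_chain[OF v] .
      then show "level ?S v < t" using S[of qs] by (simp add: chains_to_def)
    qed (rule level_pos[OF v])
    have "rank_sum.partition \<rho> \<gamma> (t - 1 + n) RA RC S \<kappa>"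
    proof -
      interpret rank_sum \<rho> \<gamma> "t - 1 + n" RA RC by unfold_locales
      show ?thesis
        unfolding partition_def
      proof (intro conjI ballI impI)
        fix s assume s: "s \<in> S"
        show "\<kappa> s < t - 1 + n"
          using s lev[of s] pos(1) by (auto simp: \<kappa>_def)
        show "fst s \<in> RA (\<kappa> s)" "snd s \<in> RC (\<kappa> s)"
          using s lev[of s] pos(2) by (auto simp: \<kappa>_def RA_def RC_def p_def)
        fix u assume u: "u \<in> S" "\<kappa> s = \<kappa> u"
        show "\<not> strict_se s u"
        proof
          assume se: "strict_se s u"
          consider "s \<in> A \<times> C" "u \<in> A \<times> C" | "s \<in> A \<times> C" "u \<notin> A \<times> C" | "s \<notin> A \<times> C" "u \<in> A \<times> C" | "s \<notin> A \<times> C" "u \<notin> A \<times> C" by blast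
          then show False
          proof cases
            case 1
            then have "level ?S s < level ?S u" "0 < level ?S s" using level_less[of s ?S u] level_pos[of s ?S] s u se by auto
            then show False using u(2) 1 by (simp add: \<kappa>_def)
          next
            case 2
            then show False using u lev[of s] s by (simp add: \<kappa>_def)
          next
            case 3
            then show False using u lev[of u] s by (simp add: \<kappa>_def)
          next
            case 4
            then have "s = u" using u(2) pos(2) by (simp add: \<kappa>_def inj_eq)
            then show False using se by (simp add: strict_se_def)
          qed
        qed
      qed
    qed
    then show "\<exists>\<kappa>. rank_sum.partition \<rho> \<gamma> (t - 1 + n) RA RC S \<kappa>" by blast
  qed
  then show ?thesis by (rule that)
qed

section \<open>The ideal of the minors not above a given minor\<close>

definition rk :: "'a::{finite,linorder} \<Rightarrow> nat" where
  "rk x = card {y. y < x}"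

lemma rk_less [simp]: "rk x < rk y \<longleftrightarrow> x < y"
proof -
  have mono: "rk x < rk y" if "x < y" for x y :: 'a
    unfolding rk_def by (rule psubset_card_mono) (use that in auto)
  show ?thesis using mono[of x y] mono[of y x] by (cases x y rule: linorder_cases) auto
qed

lemma inj_rk: "inj rk"
  by (rule injI) (metis rk_less linorder_neq_iff)

definition downset :: "'a::order set \<Rightarrow> bool" where
  "downset A \<longleftrightarrow> (\<forall>x\<in>A. \<forall>y. y \<le> x \<longrightarrow> y \<in> A)"

text \<open>Rank conditions on initial rows and on initial columns that cut out the minors not above \<open>[a|b]\<close>.\<close>

definition cogen_blocks :: "'r::{finite,linorder} list \<Rightarrow> 'c::{finite,linorder} list \<Rightarrow> ('r set \<times> 'c set \<times> nat) set" where
  "cogen_blocks a b = {(A, UNIV, Suc (card (set a \<inter> A))) | A. downset A} \<union>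
     {(UNIV, C, Suc (card (set b \<inter> C))) | C. downset C}"

lemma sorted_nth_le:
  fixes a :: "'a::linorder list"
  assumes "sorted_wrt (<) a" "l \<le> card (set a \<inter> {..x})" "0 < l"
  shows "l - 1 < length a" "a ! (l - 1) \<le> x"
proof -
  have d: "distinct a" using assms(1) strict_sorted_iff by blast
  have "card (set a \<inter> {..x}) \<le> card (set a)" by (rule card_mono) auto
  then show l: "l - 1 < length a" using assms(2,3) d by (simp add: distinct_card)
  show "a ! (l - 1) \<le> x"
  proof (rule ccontr)
    assume "\<not> ?thesis"
    then have gt: "x < a ! (l - 1)" by simp
    have "set a \<inter> {..x} \<subseteq> (!) a ` {..<l - 1}"
    proof
      fix y assume "y \<in> set a \<inter> {..x}"
      then obtain i where i: "i < length a" "y = a ! i" "a ! i \<le> x" by (auto simp: in_set_conv_nth)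
      have "i < l - 1"
      proof (rule ccontr)
        assume "\<not> i < l - 1"
        then have "a ! (l - 1) \<le> a ! i"
          using sorted_wrt_nth_less[OF assms(1), of "l - 1" i] i(1) by (cases "i = l - 1") auto
        then show False using gt i(3) by simp
      qed
      then show "y \<in> (!) a ` {..<l - 1}" using i by auto
    qed
    then have "card (set a \<inter> {..x}) \<le> card ((!) a ` {..<l - 1})" by (rule card_mono[rotated]) simp
    also have "\<dots> \<le> l - 1" using card_image_le[of "{..<l - 1}" "(!) a"] by simp
    finally show False using assms(2,3) by simp
  qed
qed

lemma card_meets_downset:
  fixes a :: "'a::linorder list"
  assumes "distinct a" "downset A"
  shows "card {k. k < length a \<and> {x. a ! k \<le> x} \<inter> A \<noteq> {}} \<le> card (set a \<inter> A)"
proof -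
  have "(!) a ` {k. k < length a \<and> {x. a ! k \<le> x} \<inter> A \<noteq> {}} \<subseteq> set a \<inter> A"
    using assms(2) by (auto simp: downset_def)
  moreover have "inj_on ((!) a) {k. k < length a \<and> {x. a ! k \<le> x} \<inter> A \<noteq> {}}"
    using assms(1) by (auto intro!: inj_onI simp: nth_eq_iff_index_eq)
  ultimately show ?thesis by (intro card_inj_on_le[of "(!) a"]) auto
qed

text \<open>The \<open>k\<close>-th summand starts at row \<open>a ! k\<close> and column
  \<open>b ! k\<close>, so an initial segment of rows meets at most as many summands as it has
  entries of \<open>a\<close>. Conversely a longest chain ending in \<open>v\<close> lies in the
  rows up to \<open>fst v\<close>; the rank condition there bounds its length by the number of
  entries of \<open>a\<close> up to \<open>fst v\<close>, and likewise for columns. Hence the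
  summand with the number of the level of \<open>v\<close>, counted from 0, covers
  \<open>v\<close>.\<close>

lemma rank_blocks_cogen:
  assumes a: "sorted_wrt (<) (a :: 'r::{finite,linorder} list)" and b: "sorted_wrt (<) (b :: 'c::{finite,linorder} list)"
    and len: "length a = length b"
  shows "rank_blocks rk rk (length a) (\<lambda>k. {x. a ! k \<le> x}) (\<lambda>k. {x. b ! k \<le> x}) (cogen_blocks a b)"
proof -
  interpret matrix_order "rk :: 'r \<Rightarrow> nat" "rk :: 'c \<Rightarrow> nat" by unfold_locales (fact inj_rk)+
  interpret rank_sum "rk :: 'r \<Rightarrow> nat" "rk :: 'c \<Rightarrow> nat" "length a" "\<lambda>k. {x. a ! k \<le> x}" "\<lambda>k. {x. b ! k \<le> x}"
    by unfold_locales
  have d: "distinct a" "distinct b" using a b strict_sorted_iff by blast+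
  show ?thesis
  proof unfold_locales
    fix A C t assume "(A, C, t) \<in> cogen_blocks a b"
    then consider "downset A" "C = UNIV" "t = Suc (card (set a \<inter> A))" | "A = UNIV" "downset C" "t = Suc (card (set b \<inter> C))"
      by (auto simp: cogen_blocks_def)
    then show "card {k. k < length a \<and> {x. a ! k \<le> x} \<inter> A \<noteq> {} \<and> {x. b ! k \<le> x} \<inter> C \<noteq> {}} < t"
    proof cases
      case 1
      have "card {k. k < length a \<and> {x. a ! k \<le> x} \<inter> A \<noteq> {} \<and> {x. b ! k \<le> x} \<inter> C \<noteq> {}} \<le>
          card {k. k < length a \<and> {x. a ! k \<le> x} \<inter> A \<noteq> {}}" by (rule card_mono) auto
      then show ?thesis using card_meets_downset[OF d(1) 1(1)] 1(3) by simp
    next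
      case 2
      have "card {k. k < length a \<and> {x. a ! k \<le> x} \<inter> A \<noteq> {} \<and> {x. b ! k \<le> x} \<inter> C \<noteq> {}} \<le>
          card {k. k < length b \<and> {x. b ! k \<le> x} \<inter> C \<noteq> {}}" by (rule card_mono) (auto simp: len)
      then show ?thesis using card_meets_downset[OF d(2) 2(2)] 2(3) by simp
    qed
  next
    fix S assume S: "\<And>A C t qs. (A, C, t) \<in> cogen_blocks a b \<Longrightarrow> sorted_wrt strict_se qs \<Longrightarrow> set qs \<subseteq> S \<inter> A \<times> C \<Longrightarrow> length qs < t"
    have lev: "level S v - 1 < length a \<and> a ! (level S v - 1) \<le> fst v \<and> b ! (level S v - 1) \<le> snd v" if v: "v \<in> S" for v
    proof -
      obtain qs where qs: "qs \<in> chains_to S v" "length qs = level S v" using level_chain[OF v] .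
      then have sw: "sorted_wrt strict_se qs" "set qs \<subseteq> S" "qs \<noteq> []" "last qs = v" by (auto simp: chains_to_def)
      have le: "x = v \<or> strict_se x v" if "x \<in> set qs" for x
        using sorted_wrt_last[OF sw(1) that] sw(4) by simp
      have r: "set qs \<subseteq> S \<inter> {..fst v} \<times> UNIV" "set qs \<subseteq> S \<inter> UNIV \<times> {..snd v}"
        using le sw(2) by (force simp: strict_se_def)+
      have cb: "({..fst v}, UNIV, Suc (card (set a \<inter> {..fst v}))) \<in> cogen_blocks a b"
        "(UNIV, {..snd v}, Suc (card (set b \<inter> {..snd v}))) \<in> cogen_blocks a b"
        unfolding cogen_blocks_def downset_def by auto
      then have "level S v \<le> card (set a \<inter> {..fst v})" "level S v \<le> card (set b \<inter> {..snd v})"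
        using S[OF cb(1) sw(1) r(1)] S[OF cb(2) sw(1) r(2)] qs(2) by simp_all
      then show ?thesis
        using sorted_nth_le[OF a _ level_pos[OF v]] sorted_nth_le[OF b _ level_pos[OF v]] by blast
    qed
    have "partition S (\<lambda>v. level S v - 1)"
      unfolding partition_def
    proof (intro conjI ballI impI)
      fix s u assume su: "s \<in> S" "u \<in> S" "level S s - 1 = level S u - 1"
      show "\<not> strict_se s u"
      proof
        assume "strict_se s u"
        then have "level S s < level S u" using su level_less by blast
        then show False using su level_pos[of s S] by simp
      qed
    qed (use lev in auto)
    then show "\<exists>\<kappa>. partition S \<kappa>" by blast
  qed
qed

section \<open>Ideals of a ring type\<close>

lemma ideal_class_ring_iff: "ideal J (class_ring :: 'a::comm_ring_1 ring) \<longleftrightarrow> rmod.subspace J"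
proof
  assume J: "ideal J (class_ring :: 'a ring)"
  then interpret J: ideal J "class_ring :: 'a ring" .
  show "rmod.subspace J"
    unfolding rmod.subspace_def
    using J.zero_closed J.a_closed J.I_l_closed by (auto simp: class_ring_simps)
next
  assume J: "rmod.subspace J"
  have neg: "- x \<in> J" if "x \<in> J" for x using rmod.subspace_neg[OF J that] .
  show "ideal J (class_ring :: 'a ring)"
  proof (rule idealI)
    show "ring (class_ring :: 'a ring)" by (rule class_ring.ring_axioms)
    show "subgroup J (add_monoid (class_ring :: 'a ring))"
    proof (rule subgroup.intro)
      fix x assume "x \<in> J"
      moreover have "inv\<^bsub>add_monoid (class_ring :: 'a ring)\<^esub> x = - x"
        using class_ring_simps(7) by (metis a_inv_def class_ring_simps)
      ultimately show "inv\<^bsub>add_monoid (class_ring :: 'a ring)\<^esub> x \<in> J" using neg by simp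
    qed (use J in \<open>auto simp: rmod.subspace_def\<close>)
    fix a x assume "a \<in> J"
    then have "x * a \<in> J" by (rule rmod.subspace_scale[OF J])
    then show "x \<otimes>\<^bsub>class_ring\<^esub> a \<in> J" "a \<otimes>\<^bsub>class_ring\<^esub> x \<in> J"
      by (simp_all add: mult.commute[of a x])
  qed
qed

lemma genideal_class_ring: "Idl\<^bsub>class_ring\<^esub> S = gen_ideal (S :: 'a::comm_ring_1 set)"
proof
  have "gen_ideal S \<in> {I. ideal I (class_ring :: 'a ring) \<and> S \<subseteq> I}"
    by (simp add: ideal_class_ring_iff rmod.span_superset)
  then show "Idl\<^bsub>class_ring\<^esub> S \<subseteq> gen_ideal S" unfolding genideal_def by blast
  show "gen_ideal S \<subseteq> Idl\<^bsub>class_ring\<^esub> S"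
    unfolding genideal_def by (auto simp: ideal_class_ring_iff intro: rmod.span_minimal[THEN subsetD])
qed

lemma cgenideal_class_ring: "PIdl\<^bsub>class_ring\<^esub> f = gen_ideal {f :: 'a::comm_ring_1}"
  by (auto simp: cgenideal_def rmod.span_singleton)

lemma set_add_class_ring: "I <+>\<^bsub>class_ring\<^esub> J = {x + y | x y. x \<in> I \<and> y \<in> (J :: 'a::comm_ring_1 set)}"
  by (auto simp: set_add_def')

lemma set_add_gen_ideal:
  "gen_ideal S <+>\<^bsub>class_ring\<^esub> gen_ideal T = gen_ideal (S \<union> T :: 'a::comm_ring_1 set)"
  unfolding set_add_class_ring rmod.span_Un by auto

lemma knutson_subspace: "I \<in> knutson_ideals f \<Longrightarrow> rmod.subspace I"
proof (induction rule: knutson_ideals.induct)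
  case principal
  then show ?case by (simp add: cgenideal_class_ring)
next
  case (colon I J)
  then have I: "rmod.subspace I" by simp
  show ?case
    unfolding rmod.subspace_def colon_ideal_def mem_Collect_eq mult.assoc distrib_right mult_zero_left
    using rmod.subspace_0[OF I] rmod.subspace_add[OF I] rmod.subspace_scale[OF I] by blast
next
  case (sum I J)
  then have "gen_ideal I = I" "gen_ideal J = J" unfolding rmod.span_eq_iff by blast+
  then show ?case using set_add_gen_ideal[of I J] rmod.subspace_span by metis
next
  case (inter I J)
  then show ?case by (auto simp: rmod.subspace_def)
qed

section \<open>Poset ideals\<close>

definition omega_ideal :: "('r::{finite,linorder}, 'c::{finite,linorder}) minor_index set \<Rightarrow> ('r \<times> 'c, 'k::comm_ring_1) mpoly set" where
  "omega_ideal \<Omega> = gen_ideal (minor_poly ` \<Omega>)"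

lemma minor_poly_gmin: "minor_poly (a, b) = gmin a b"
  by (simp add: gmin_def lm_def)

text \<open>Choose \<open>t\<close> rows in \<open>A\<close> and expand along all the
  others.\<close>

lemma lm_in_ideal_few_rows:
  assumes len: "length c = length d" and t: "t \<le> card (set c \<inter> A)" and dc: "distinct c"
  shows "lm e c d \<in> gen_ideal {lm e c' d' | c' d'. length c' = t \<and> length d' = t \<and> set c' \<subseteq> A \<and> set d' \<subseteq> set d}"
proof -
  let ?f = "filter (\<lambda>x. x \<in> A) c"
  let ?c1 = "take t ?f" and ?c2 = "drop t ?f @ filter (\<lambda>x. x \<notin> A) c"
  have "length ?f = card (set c \<inter> A)"
    using dc by (metis Int_def distinct_card distinct_filter set_filter)
  then have l: "length ?c1 = t" using t by simp
  have "mset (?c1 @ ?c2) = mset (filter (\<lambda>x. x \<in> A) c @ filter (\<lambda>x. x \<notin> A) c)"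
    by (metis append.assoc append_take_drop_id)
  then have ms: "mset (?c2 @ ?c1) = mset c"
    by (simp only: mset_append mset_filter) (simp add: union_commute flip: multiset_partition)
  have ld: "length d = length ?c2 + length ?c1"
    using arg_cong[OF ms, of size] len by (simp only: size_mset length_append)
  have "lm e (?c2 @ ?c1) d \<in> gen_ideal {lm e ?c1 b' | b'. length b' = length ?c1 \<and> mset b' \<subseteq># mset d \<and>
     (\<forall>y\<in>set d. (\<forall>x\<in>set ?c2. e x y = 0) \<longrightarrow> y \<in> set b')}"
    by (rule lm_in_ideal_rows[OF ld])
  also have "\<dots> \<subseteq> gen_ideal {lm e c' d' | c' d'. length c' = t \<and> length d' = t \<and> set c' \<subseteq> A \<and> set d' \<subseteq> set d}"
  proof (rule rmod.span_mono, clarify)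
    fix b' assume b': "length b' = length ?c1" "mset b' \<subseteq># mset d"
    have "set b' \<subseteq> set d" using set_mset_mono[OF b'(2)] by simp
    moreover have "set ?c1 \<subseteq> A" using set_take_subset[of t ?f] by auto
    ultimately show "\<exists>c' d'. lm e ?c1 b' = lm e c' d' \<and> length c' = t \<and> length d' = t \<and> set c' \<subseteq> A \<and> set d' \<subseteq> set d"
      using b'(1) l by (intro exI[of _ ?c1] exI[of _ b'] conjI) simp_all
  qed
  finally show ?thesis
    by (rule gen_ideal_lm_perm) (use ms ld in \<open>simp_all only: length_append\<close>)
qed

lemma lm_in_ideal_few_cols:
  assumes len: "length c = length d" and t: "t \<le> card (set d \<inter> C)" and dd: "distinct d"
  shows "lm e c d \<in> gen_ideal {lm e c' d' | c' d'. length c' = t \<and> length d' = t \<and> set c' \<subseteq> set c \<and> set d' \<subseteq> C}"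
proof -
  have "lm (\<lambda>y x. e x y) d c \<in> gen_ideal {lm (\<lambda>y x. e x y) d' c' | d' c'. length d' = t \<and> length c' = t \<and> set d' \<subseteq> C \<and> set c' \<subseteq> set c}"
    by (rule lm_in_ideal_few_rows) (use assms in auto)
  also have "\<dots> \<subseteq> gen_ideal {lm e c' d' | c' d'. length c' = t \<and> length d' = t \<and> set c' \<subseteq> set c \<and> set d' \<subseteq> C}"
  proof (rule rmod.span_mono, clarify)
    fix d' c' assume *: "t = length d'" "length c' = length d'" "set d' \<subseteq> C" "set c' \<subseteq> set c"
    then show "\<exists>c'' d''. lm (\<lambda>y x. e x y) d' c' = lm e c'' d'' \<and> length c'' = length d' \<and> length d'' = length d' \<and> set c'' \<subseteq> set c \<and> set d'' \<subseteq> C"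
      using lm_transpose[of c' d' e] by metis
  qed
  finally show ?thesis using lm_transpose[OF len, of e] by simp
qed

lemma downset_atMost [simp]: "downset {..x :: 'a::order}"
  by (auto simp: downset_def)

lemma downset_UNIV [simp]: "downset UNIV"
  by (simp add: downset_def)

lemma card_Int_atMost:
  fixes c :: "'a::linorder list"
  assumes "sorted_wrt (<) c" "i < length c"
  shows "Suc i \<le> card (set c \<inter> {..c ! i})"
proof -
  have "(!) c ` {..i} \<subseteq> set c \<inter> {..c ! i}"
    using assms sorted_wrt_nth_less[OF assms(1)] by (auto simp: le_less)
  moreover have "distinct c" using assms(1) strict_sorted_iff by blast
  then have "inj_on ((!) c) {..i}" using assms(2) by (auto intro!: inj_onI simp: nth_eq_iff_index_eq)
  ultimately have "card {..i} \<le> card (set c \<inter> {..c ! i})" by (intro card_inj_on_le[of "(!) c"]) auto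
  then show ?thesis by simp
qed

lemma card_Int_less:
  fixes a :: "'a::linorder list"
  assumes "sorted_wrt (<) a" "c < a ! i" "i < length a"
  shows "card (set a \<inter> {..c}) \<le> i"
proof (rule ccontr)
  assume "\<not> ?thesis"
  then have "a ! (Suc i - 1) \<le> c" by (intro sorted_nth_le(2)[OF assms(1)]) auto
  then show False using assms(2) by simp
qed

text \<open>Failing to lie above \<open>[a|b]\<close> means having more rows than \<open>a\<close>,
  or more columns than \<open>b\<close>, in some initial segment: the whole index set for a longer
  minor, and otherwise the segment up to an index with \<open>c ! i < a ! i\<close> or
  \<open>d ! i < b ! i\<close>.\<close>

lemma minor_not_ge_in_cogen:
  assumes pi: "(c, d) \<in> minors" and ab: "sorted_wrt (<) a" "sorted_wrt (<) b" "length a = length b"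
    and nle: "\<not> minor_le (a, b) (c, d)"
  shows "gmin c d \<in> gen_ideal (block_gens (cogen_blocks a b))"
proof -
  have cd: "sorted_wrt (<) c" "sorted_wrt (<) d" "length c = length d" using pi by (auto simp: minors_def)
  have dist: "distinct c" "distinct d" "distinct a" using cd ab strict_sorted_iff by blast+
  have rows: "gmin c d \<in> gen_ideal (block_gens (cogen_blocks a b))"
    if "downset A" "card (set a \<inter> A) < card (set c \<inter> A)" for A
  proof -
    let ?t = "Suc (card (set a \<inter> A))"
    have "gmin c d \<in> gen_ideal {gmin c' d' | c' d'. length c' = ?t \<and> length d' = ?t \<and> set c' \<subseteq> A \<and> set d' \<subseteq> set d}"
      unfolding gmin_def by (rule lm_in_ideal_few_rows) (use that dist cd in auto)
    moreover have "{gmin c' d' | c' d'. length c' = ?t \<and> length d' = ?t \<and> set c' \<subseteq> A \<and> set d' \<subseteq> set d} \<subseteq>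
        block_gens (cogen_blocks a b)"
    proof clarify
      fix c' d' assume *: "length c' = ?t" "length d' = ?t" "set c' \<subseteq> A" "set d' \<subseteq> set d"
      have "(A, UNIV, ?t) \<in> cogen_blocks a b" using that(1) by (auto simp: cogen_blocks_def)
      then show "gmin c' d' \<in> block_gens (cogen_blocks a b)" using * unfolding block_gens_def by blast
    qed
    ultimately show ?thesis using rmod.span_mono by blast
  qed
  have cols: "gmin c d \<in> gen_ideal (block_gens (cogen_blocks a b))"
    if "downset C" "card (set b \<inter> C) < card (set d \<inter> C)" for C
  proof -
    let ?t = "Suc (card (set b \<inter> C))"
    have "gmin c d \<in> gen_ideal {gmin c' d' | c' d'. length c' = ?t \<and> length d' = ?t \<and> set c' \<subseteq> set c \<and> set d' \<subseteq> C}"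
      unfolding gmin_def by (rule lm_in_ideal_few_cols) (use that dist cd in auto)
    moreover have "{gmin c' d' | c' d'. length c' = ?t \<and> length d' = ?t \<and> set c' \<subseteq> set c \<and> set d' \<subseteq> C} \<subseteq>
        block_gens (cogen_blocks a b)"
    proof clarify
      fix c' d' assume *: "length c' = ?t" "length d' = ?t" "set c' \<subseteq> set c" "set d' \<subseteq> C"
      have "(UNIV, C, ?t) \<in> cogen_blocks a b" using that(1) by (auto simp: cogen_blocks_def)
      then show "gmin c' d' \<in> block_gens (cogen_blocks a b)" using * unfolding block_gens_def by blast
    qed
    ultimately show ?thesis using rmod.span_mono by blast
  qed
  have "length a < length c \<or> (\<exists>i<length c. c ! i < a ! i \<or> d ! i < b ! i)"
    using nle by (auto simp: not_le)
  then consider "length a < length c" | i where "i < length c" "length c \<le> length a" "c ! i < a ! i"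
    | i where "i < length c" "length c \<le> length a" "d ! i < b ! i"
    by (meson not_less)
  then show ?thesis
  proof cases
    case 1
    show ?thesis
      by (rule rows[of UNIV]) (use 1 dist in \<open>auto simp: distinct_card\<close>)
  next
    case (2 i)
    show ?thesis
      by (rule rows[of "{..c ! i}"])
        (use card_Int_atMost[OF cd(1) 2(1)] card_Int_less[OF ab(1) 2(3)] 2 in auto)
  next
    case (3 i)
    show ?thesis
      by (rule cols[of "{..d ! i}"])
        (use card_Int_atMost[OF cd(2), of i] card_Int_less[OF ab(2) 3(3)] 3 cd ab in auto)
  qed
qed

text \<open>Straightening controls minors only through their counts in initial segments; the
  segments up to the entries of \<open>a\<close> and \<open>b\<close> recover the order, and the
  whole index set recovers the lengths.\<close>

lemma minor_leI:
  assumes a: "sorted_wrt (<) a" "sorted_wrt (<) (a' :: 'r::{finite,linorder} list)"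
    and b: "sorted_wrt (<) b" "sorted_wrt (<) (b' :: 'c::{finite,linorder} list)"
    and len: "length a = length b" "length a' = length b'"
    and ca: "\<And>A. downset A \<Longrightarrow> card (set a \<inter> A) \<le> card (set a' \<inter> A)"
    and cb: "\<And>C. downset C \<Longrightarrow> card (set b \<inter> C) \<le> card (set b' \<inter> C)"
  shows "minor_le (a', b') (a, b)"
proof -
  have "distinct a" "distinct a'" using a strict_sorted_iff by blast+
  then have "length a \<le> length a'" using ca[of UNIV] by (simp add: distinct_card)
  moreover have "a' ! i \<le> a ! i" if "i < length a" for i
  proof -
    have "Suc i \<le> card (set a' \<inter> {..a ! i})"
      using card_Int_atMost[OF a(1) that] ca[of "{..a ! i}"] by simp
    from sorted_nth_le(2)[OF a(2) this] show ?thesis by simp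
  qed
  moreover have "b' ! i \<le> b ! i" if "i < length b" for i
  proof -
    have "Suc i \<le> card (set b' \<inter> {..b ! i})"
      using card_Int_atMost[OF b(1) that] cb[of "{..b ! i}"] by simp
    from sorted_nth_le(2)[OF b(2) this] show ?thesis by simp
  qed
  ultimately show ?thesis using len by simp
qed

lemma downset_linear: "downset A \<Longrightarrow> downset B \<Longrightarrow> A \<subseteq> B \<or> (B :: 'a::linorder set) \<subseteq> A"
  unfolding downset_def by (metis linorder_linear subsetI)

text \<open>Initial segments are nested. Inside \<open>A\<close> nothing of \<open>s\<close> is
  lost. Beyond \<open>A\<close> nothing new appears, so a segment containing \<open>A\<close> cannot
  lose elements when the total does not drop.\<close>

lemma card_Int_downset_mono:
  fixes A B :: "'a::{finite,linorder} set"
  assumes A: "downset A" and B: "downset B"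
    and s: "s' - A \<subseteq> s" "s \<inter> A \<subseteq> s'" and card: "card s \<le> card s'"
  shows "card (s \<inter> B) \<le> card (s' \<inter> B)"
proof (cases "B \<subseteq> A")
  case True
  then show ?thesis using s by (intro card_mono) auto
next
  case False
  then have "A \<subseteq> B" using downset_linear[OF A B] by blast
  then have "card (s' - B) \<le> card (s - B)" using s by (intro card_mono) auto
  moreover have "card s = card (s \<inter> B) + card (s - B)" "card s' = card (s' \<inter> B) + card (s' - B)"
    by (subst card_Un_disjoint[symmetric]; auto intro!: arg_cong[where f = card])+
  ultimately show ?thesis using card by simp
qed

lemma gmin_sort_sign:
  assumes "distinct a" "distinct b" "length a = length b"
  shows "gmin (sorted_list_of_set (set a)) (sorted_list_of_set (set b)) = (gmin a b :: ('r::linorder \<times> 'c::linorder, 'k::comm_ring_1) mpoly) \<or>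
    gmin (sorted_list_of_set (set a)) (sorted_list_of_set (set b)) = - (gmin a b :: ('r \<times> 'c, 'k) mpoly)"
  unfolding gmin_def
  using lm_up_to_sign[of a "sorted_list_of_set (set a)" b "sorted_list_of_set (set b)"] assms by simp

text \<open>The straightening relation on an initial segment produces minors that differ from
  \<open>[a|b]\<close> and have at least as many rows and columns as it in every initial segment.
  Sorted, these are strictly smaller minors and lie in \<open>\<Omega>\<close> by
  minimality.\<close>

lemma straighten_in_omega:
  fixes f :: "('r::{finite,linorder} \<times> 'c::{finite,linorder}, 'k::comm_ring_1) mpoly"
  assumes ab: "(a, b) \<in> minors"
    and min: "\<And>p. p \<in> minors \<Longrightarrow> minor_le p (a, b) \<Longrightarrow> p \<noteq> (a, b) \<Longrightarrow> p \<in> \<Omega>"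
    and f: "f \<in> gen_ideal (block_gens (cogen_blocks a b))"
  shows "gmin a b * f \<in> omega_ideal \<Omega>"
proof -
  have s: "sorted_wrt (<) a" "sorted_wrt (<) b" "length a = length b" "a \<noteq> []" using ab by (auto simp: minors_def)
  have d: "distinct a" "distinct b" using s strict_sorted_iff by blast+
  have sl: "sorted_list_of_set (set a) = a" "sorted_list_of_set (set b) = b"
    using s(1,2) by (simp_all add: strict_sorted_iff sorted_list_of_set.idem_if_sorted_distinct)
  have mem: "gmin a' b' \<in> (omega_ideal \<Omega> :: ('r \<times> 'c, 'k) mpoly set)"
    if *: "distinct a'" "distinct b'" "length a' = length b'" "set a' \<noteq> set a \<or> set b' \<noteq> set b"
      and ca: "\<And>A. downset A \<Longrightarrow> card (set a \<inter> A) \<le> card (set a' \<inter> A)"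
      and cb: "\<And>C. downset C \<Longrightarrow> card (set b \<inter> C) \<le> card (set b' \<inter> C)" for a' b'
  proof -
    let ?a = "sorted_list_of_set (set a')" and ?b = "sorted_list_of_set (set b')"
    have ss: "sorted_wrt (<) ?a" "sorted_wrt (<) ?b" by simp_all
    have len: "length ?a = length ?b" using * by (simp add: distinct_card)
    have le: "minor_le (?a, ?b) (a, b)"
      by (rule minor_leI[OF s(1) ss(1) s(2) ss(2) s(3) len]) (use ca cb in auto)
    have "?a \<noteq> []" using le s(4) by auto
    then have "(?a, ?b) \<in> minors" using ss len by (simp add: minors_def)
    moreover have "(?a, ?b) \<noteq> (a, b)" using *(4) by (metis List.finite_set Pair_inject set_sorted_list_of_set)
    ultimately have "(?a, ?b) \<in> \<Omega>" using min le by blast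
    then have "gmin ?a ?b \<in> (omega_ideal \<Omega> :: ('r \<times> 'c, 'k) mpoly set)"
      unfolding omega_ideal_def by (intro rmod.span_base) (auto simp: minor_poly_gmin[symmetric] simp del: minor_poly.simps)
    then show ?thesis
      using gmin_sort_sign[OF *(1-3)] rmod.span_neg unfolding omega_ideal_def by (metis minus_minus)
  qed
  have gen: "gmin a b * gmin c d' \<in> (omega_ideal \<Omega> :: ('r \<times> 'c, 'k) mpoly set)"
    if q: "(A, C, t) \<in> cogen_blocks a b" "length c = t" "length d' = t" "set c \<subseteq> A" "set d' \<subseteq> C" for A C t c d'
  proof (cases "distinct c \<and> distinct d'")
    case False
    then have "gmin c d' = (0 :: ('r \<times> 'c, 'k) mpoly)"
      unfolding gmin_def using q lm_not_distinct_rows lm_not_distinct_cols by metis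
    then show ?thesis by (simp add: omega_ideal_def rmod.span_zero)
  next
    case True
    consider "downset A" "t = Suc (card (set a \<inter> A))" | "downset C" "t = Suc (card (set b \<inter> C))"
      using q(1) by (auto simp: cogen_blocks_def)
    then have "gmin a b * gmin c d' \<in> gen_ideal (omega_ideal \<Omega> :: ('r \<times> 'c, 'k) mpoly set)"
    proof cases
      case 1
      show ?thesis unfolding gmin_def
      proof (rule lm_straighten_rows[where A = A])
        fix a' b' assume *: "distinct a'" "distinct b'" "length a' = length b'" "set b \<subseteq> set b'" "set a' - A \<subseteq> set a"
          "set a \<inter> A \<subseteq> set a'" "set a' \<noteq> set a \<or> set b' \<noteq> set b"
        have "card (set b) \<le> card (set b')" using *(4) by (simp add: card_mono)
        then have "card (set a) \<le> card (set a')" using * d s(3) by (simp add: distinct_card)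
        then have "gmin a' b' \<in> (omega_ideal \<Omega> :: ('r \<times> 'c, 'k) mpoly set)"
          by (intro mem * card_Int_downset_mono[OF 1(1)]) (use * in \<open>auto intro!: card_mono\<close>)
        then show "lm (\<lambda>x y. indet (x, y)) a' b' \<in> (omega_ideal \<Omega> :: ('r \<times> 'c, 'k) mpoly set)" unfolding gmin_def .
      qed (use True q d s 1 in auto)
    next
      case 2
      show ?thesis unfolding gmin_def
      proof (rule lm_straighten_cols[where C = C])
        fix a' b' assume *: "distinct a'" "distinct b'" "length a' = length b'" "set a \<subseteq> set a'" "set b' - C \<subseteq> set b"
          "set b \<inter> C \<subseteq> set b'" "set a' \<noteq> set a \<or> set b' \<noteq> set b"
        have "card (set a) \<le> card (set a')" using *(4) by (simp add: card_mono)
        then have "card (set b) \<le> card (set b')" using * d s(3) by (simp add: distinct_card)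
        then have "gmin a' b' \<in> (omega_ideal \<Omega> :: ('r \<times> 'c, 'k) mpoly set)"
          by (intro mem * card_Int_downset_mono[OF 2(1)]) (use * in \<open>auto intro!: card_mono\<close>)
        then show "lm (\<lambda>x y. indet (x, y)) a' b' \<in> (omega_ideal \<Omega> :: ('r \<times> 'c, 'k) mpoly set)" unfolding gmin_def .
      qed (use True q d s 2 in auto)
    qed
    then show ?thesis unfolding omega_ideal_def rmod.span_span .
  qed
  show ?thesis
    using f
  proof (induction rule: rmod.span_induct_alt)
    case base
    then show ?case by (simp add: omega_ideal_def rmod.span_zero)
  next
    case (step r x y)
    then obtain c d' A C t where "x = gmin c d'" "(A, C, t) \<in> cogen_blocks a b" "length c = t" "length d' = t" "set c \<subseteq> A" "set d' \<subseteq> C"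
      by (auto simp: block_gens_def)
    then have "gmin a b * x \<in> omega_ideal \<Omega>" using gen by metis
    then have "r * (gmin a b * x) + gmin a b * y \<in> omega_ideal \<Omega>"
      using step(2) unfolding omega_ideal_def by (rule rmod.span_add[OF rmod.span_scale])
    then show ?case by (simp only: distrib_left mult.left_commute)
  qed
qed

section \<open>Determinantal ideals of the bordered matrix\<close>

abbreviation bgen :: "'r \<Rightarrow> 'c + 'r \<Rightarrow> ('r \<times> 'c, 'k::comm_ring_1) mpoly" where
  "bgen \<equiv> bordered (\<lambda>x y. indet (x, y))"

definition col_ideal :: "nat \<Rightarrow> ('c + 'r) set \<Rightarrow> ('r \<times> 'c, 'k::comm_ring_1) mpoly set" where
  "col_ideal k S = gen_ideal {lm bgen a p | a p. length a = k \<and> length p = k \<and> set p \<subseteq> S}"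

lemma col_ideal_gen: "length a = k \<Longrightarrow> length p = k \<Longrightarrow> set p \<subseteq> S \<Longrightarrow> lm bgen a p \<in> col_ideal k S"
  unfolding col_ideal_def by (rule rmod.span_base) blast

lemma col_ideal_minimal:
  fixes T :: "('r \<times> 'c, 'k::comm_ring_1) mpoly set"
  assumes "\<And>a p. length a = k \<Longrightarrow> length p = k \<Longrightarrow> set p \<subseteq> S \<Longrightarrow> distinct a \<Longrightarrow> distinct p \<Longrightarrow> lm bgen a p \<in> gen_ideal T"
  shows "col_ideal k S \<subseteq> gen_ideal T"
  unfolding col_ideal_def
proof (rule gen_ideal_minimal, clarify)
  fix a :: "'r list" and p assume *: "length p = length a" "set p \<subseteq> S" "k = length a"
  show "lm bgen a p \<in> gen_ideal T"
  proof (cases "distinct a \<and> distinct p")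
    case True
    then show ?thesis using assms[of a p] * by simp
  next
    case False
    then have "lm bgen a p = (0 :: ('r \<times> 'c, 'k) mpoly)" using * lm_not_distinct_rows lm_not_distinct_cols by metis
    then show ?thesis by (simp only: rmod.span_zero)
  qed
qed

lemma col_ideal_mono: "S \<subseteq> T \<Longrightarrow> col_ideal k S \<subseteq> col_ideal k T"
  unfolding col_ideal_def by (rule rmod.span_mono) blast

lemma gen_ideal_col_ideal [simp]: "gen_ideal (col_ideal k S) = col_ideal k S"
  by (simp add: col_ideal_def)

lemma col_ideal_subspace [simp]: "rmod.subspace (col_ideal k S)"
  by (simp add: col_ideal_def)

lemma col_ideal_insert: "col_ideal (Suc k) (insert c S) \<subseteq> (col_ideal k S :: ('r \<times> 'c, 'k::comm_ring_1) mpoly set)"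
proof -
  have "col_ideal (Suc k) (insert c S) \<subseteq> gen_ideal (col_ideal k S :: ('r \<times> 'c, 'k) mpoly set)"
  proof (rule col_ideal_minimal)
    fix a :: "'r list" and p :: "('c + 'r) list" assume *: "length a = Suc k" "length p = Suc k" "set p \<subseteq> insert c S" "distinct a" "distinct p"
    obtain j where j: "j < length p" "set (del j p) \<subseteq> S"
    proof (cases "c \<in> set p")
      case True
      then obtain j where j: "j < length p" "p ! j = c" by (auto simp: in_set_conv_nth)
      have "set (del j p) = set p - {c}" using set_del_distinct[OF *(5) j(1)] j(2) by simp
      then show ?thesis using that j(1) *(3) by blast
    next
      case False
      then have "set (del 0 p) \<subseteq> S" using set_del[of 0 p] *(3) by blast
      then show ?thesis using that[of 0] *(2) by simp
    qed
    have len: "length a = length p" using * by simp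
    show "lm bgen a p \<in> gen_ideal (col_ideal k S :: ('r \<times> 'c, 'k) mpoly set)"
      unfolding lm_expand_col[OF len j(1)] gen_ideal_col_ideal
    proof (rule rmod.subspace_sum[OF col_ideal_subspace])
      fix i assume "i \<in> {..<length a}"
      then have "lm bgen (del i a) (del j p) \<in> (col_ideal k S :: ('r \<times> 'c, 'k) mpoly set)"
        by (intro col_ideal_gen) (use * j in auto)
      then show "bgen (a ! i) (p ! j) * (-1) ^ (i + j) * lm bgen (del i a) (del j p) \<in> (col_ideal k S :: ('r \<times> 'c, 'k) mpoly set)"
        by (rule rmod.subspace_scale[OF col_ideal_subspace])
    qed
  qed
  then show ?thesis by simp
qed

text \<open>By \<open>lm_exchange\<close>, a minor containing \<open>c\<close> times a
  \<open>k\<close>-minor of \<open>S\<close> is a sum of terms in which \<open>c\<close> has either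
  joined the columns from \<open>S\<close> or been exchanged for one of them. A minor without
  \<open>c\<close> uses only the columns \<open>insert d S\<close>.\<close>

lemma col_ideal_product:
  fixes x y :: "('r \<times> 'c, 'k::comm_ring_1) mpoly"
  assumes x: "x \<in> col_ideal (Suc k) (insert c (insert d S))" and y: "y \<in> col_ideal k S"
  shows "x * y \<in> gen_ideal (col_ideal (Suc k) (insert c S) \<union> col_ideal (Suc k) (insert d S))"
proof -
  let ?Q = "gen_ideal (col_ideal (Suc k) (insert c S) \<union> col_ideal (Suc k) (insert d S)) :: ('r \<times> 'c, 'k) mpoly set"
  have K1: "z \<in> ?Q" if "z \<in> col_ideal (Suc k) (insert c S)" for z using that by (intro rmod.span_base) blast
  have K2: "z \<in> ?Q" if "z \<in> col_ideal (Suc k) (insert d S)" for z using that by (intro rmod.span_base) blast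
  have prod: "lm bgen a1 b1 * lm bgen a0 p \<in> ?Q"
    if a1: "length a1 = k" "length b1 = k" "set b1 \<subseteq> S"
      and a0: "length a0 = Suc k" "length p = Suc k" "set p \<subseteq> insert c (insert d S)" "distinct p" for a1 b1 a0 p
  proof (cases "c \<in> set p")
    case False
    then have "lm bgen a0 p \<in> col_ideal (Suc k) (insert d S)" using a0 by (intro col_ideal_gen) auto
    then show ?thesis by (intro gen_ideal_mult_left K2)
  next
    case True
    then obtain j where j: "j < length p" "p ! j = c" by (auto simp: in_set_conv_nth)
    let ?q = "del j p"
    have q: "length ?q = k" "set ?q \<subseteq> insert d S"
      using set_del_distinct[OF a0(4) j(1)] j a0 by auto
    have ms: "mset p = mset (c # ?q)" using mset_del[OF j(1)] j(2) by simp
    have l: "length a1 = length b1" "length a0 = Suc (length ?q)" using a1 a0 q by auto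
    have "lm bgen a1 b1 * lm bgen a0 (c # ?q) \<in> ?Q"
      unfolding lm_exchange[OF l]
    proof (rule rmod.span_add; rule rmod.span_sum)
      fix i assume "i \<in> {..<length a0}"
      have "lm bgen (a0 ! i # a1) (c # b1) \<in> ?Q"
        by (rule K1, rule col_ideal_gen) (use a1 in auto)
      then show "(-1) ^ i * lm bgen (del i a0) ?q * lm bgen (a0 ! i # a1) (c # b1) \<in> ?Q" by (rule gen_ideal_mult_left)
    next
      fix i assume "i \<in> {..<length b1}"
      then have "b1 ! i \<in> S" using a1(3) nth_mem by blast
      then have "lm bgen a0 (b1 ! i # ?q) \<in> ?Q"
        by (intro K2 col_ideal_gen) (use a0 q in auto)
      then show "(-1) ^ i * lm bgen a1 (c # del i b1) * lm bgen a0 (b1 ! i # ?q) \<in> ?Q" by (rule gen_ideal_mult_left)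
    qed
    moreover have "lm bgen a0 (c # ?q) = (lm bgen a0 p :: ('r \<times> 'c, 'k) mpoly) \<or> lm bgen a0 (c # ?q) = - (lm bgen a0 p :: ('r \<times> 'c, 'k) mpoly)"
      by (rule lm_perm_cols[OF ms]) (use a0 in simp)
    ultimately show ?thesis using rmod.span_neg by fastforce
  qed
  have left: "lm bgen a1 b1 * x \<in> ?Q" if "length a1 = k" "length b1 = k" "set b1 \<subseteq> S" for a1 b1
  proof -
    have "x \<in> gen_ideal {lm bgen a p | a p. length a = Suc k \<and> length p = Suc k \<and> set p \<subseteq> insert c (insert d S)}"
      using x by (simp only: col_ideal_def)
    then show ?thesis
    proof (induction rule: rmod.span_induct_alt)
      case base
      then show ?case by (simp add: rmod.span_zero)
    next
      case (step r z w)
      then obtain a p where z: "z = lm bgen a p" "length a = Suc k" "length p = Suc k" "set p \<subseteq> insert c (insert d S)" by blast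
      have "lm bgen a1 b1 * z \<in> ?Q"
      proof (cases "distinct p")
        case True
        then show ?thesis unfolding z(1) using prod that z by blast
      next
        case False
        then have "z = 0" unfolding z(1) using z by (intro lm_not_distinct_cols) auto
        then show ?thesis by (simp add: rmod.span_zero)
      qed
      then have "r * (lm bgen a1 b1 * z) + lm bgen a1 b1 * w \<in> ?Q"
        using step(2) by (rule rmod.span_add[OF rmod.span_scale])
      then show ?case by (simp only: distrib_left mult.left_commute)
    qed
  qed
  have "y \<in> gen_ideal {lm bgen a p | a p. length a = k \<and> length p = k \<and> set p \<subseteq> S}"
    using y by (simp only: col_ideal_def)
  then show ?thesis
  proof (induction rule: rmod.span_induct_alt)
    case base
    then show ?case by (simp add: rmod.span_zero)
  next
    case (step r z w)
    then obtain a p where z: "z = lm bgen a p" "length a = k" "length p = k" "set p \<subseteq> S" by blast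
    have "z * x \<in> ?Q" unfolding z(1) using left z by blast
    then have "r * (z * x) + x * w \<in> ?Q" using step(2) by (rule rmod.span_add[OF rmod.span_scale])
    moreover have "x * (r * z + w) = r * (z * x) + x * w"
      by (simp only: distrib_left mult.left_commute mult.commute[of z x])
    ultimately show ?case by (simp only:)
  qed
qed

text \<open>\<open>h\<close> lies in \<open>J\<close> and is regular modulo \<open>K\<close>; hence
  \<open>x * h \<in> I\<close> together with \<open>I \<subseteq> K\<close> forces
  \<open>x \<in> K\<close>, and the colon ideal is no larger than \<open>K\<close>.\<close>

lemma colon_knutson:
  fixes f h :: "'a::comm_ring_1"
  assumes I: "I \<in> knutson_ideals f" and J: "rmod.subspace J" and K: "rmod.subspace K"
    and prod: "\<And>x y. x \<in> K \<Longrightarrow> y \<in> J \<Longrightarrow> x * y \<in> I"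
    and sub: "I \<subseteq> K" and h: "h \<in> J" "\<And>g. h * g \<in> K \<Longrightarrow> g \<in> K"
  shows "K \<in> knutson_ideals f"
proof -
  have "colon_ideal I J = K"
  proof
    show "colon_ideal I J \<subseteq> K"
    proof
      fix x assume "x \<in> colon_ideal I J"
      then have "x * h \<in> I" using h(1) by (simp add: colon_ideal_def)
      then have "h * x \<in> K" using sub by (auto simp: mult.commute)
      then show "x \<in> K" by (rule h(2))
    qed
    show "K \<subseteq> colon_ideal I J" using prod by (auto simp: colon_ideal_def)
  qed
  then show ?thesis using knutson_ideals.colon[OF I] J by (metis ideal_class_ring_iff)
qed

lemma col_ideal_sum_knutson:
  fixes f :: "('r \<times> 'c, 'k::comm_ring_1) mpoly"
  assumes "col_ideal k S \<in> knutson_ideals f" "col_ideal k T \<in> knutson_ideals f"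
  shows "gen_ideal (col_ideal k S \<union> col_ideal k T) \<in> knutson_ideals f"
  using knutson_ideals.sum[OF assms] set_add_gen_ideal[of "col_ideal k S :: ('r \<times> 'c, 'k) mpoly set" "col_ideal k T"]
  by (simp only: gen_ideal_col_ideal)

lemma col_ideal_up:
  fixes f h :: "('r \<times> 'c, 'k::comm_ring_1) mpoly"
  assumes "col_ideal (Suc k) (insert c S) \<in> knutson_ideals f" "col_ideal (Suc k) (insert d S) \<in> knutson_ideals f"
    and h: "h \<in> col_ideal k S" "\<And>g. h * g \<in> col_ideal (Suc k) (insert c (insert d S)) \<Longrightarrow> g \<in> col_ideal (Suc k) (insert c (insert d S))"
  shows "col_ideal (Suc k) (insert c (insert d S)) \<in> knutson_ideals f"
proof (rule colon_knutson[OF col_ideal_sum_knutson[OF assms(1,2)] col_ideal_subspace col_ideal_subspace _ _ h])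
  show "gen_ideal (col_ideal (Suc k) (insert c S) \<union> col_ideal (Suc k) (insert d S)) \<subseteq> col_ideal (Suc k) (insert c (insert d S))"
    by (rule rmod.span_minimal) (auto intro: col_ideal_mono[THEN subsetD, rotated])
qed (rule col_ideal_product)

lemma col_ideal_down:
  fixes f h :: "('r \<times> 'c, 'k::comm_ring_1) mpoly"
  assumes "col_ideal (Suc k) (insert c S) \<in> knutson_ideals f" "col_ideal (Suc k) (insert d S) \<in> knutson_ideals f"
    and h: "h \<in> col_ideal (Suc k) (insert c (insert d S))" "\<And>g. h * g \<in> col_ideal k S \<Longrightarrow> g \<in> col_ideal k S"
  shows "col_ideal k S \<in> knutson_ideals f"
proof (rule colon_knutson[OF col_ideal_sum_knutson[OF assms(1,2)] col_ideal_subspace col_ideal_subspace _ _ h])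
  show "gen_ideal (col_ideal (Suc k) (insert c S) \<union> col_ideal (Suc k) (insert d S)) \<subseteq> col_ideal k S"
    by (rule rmod.span_minimal) (use col_ideal_insert in auto)
  fix x y :: "('r \<times> 'c, 'k) mpoly" assume "x \<in> col_ideal k S" "y \<in> col_ideal (Suc k) (insert c (insert d S))"
  then show "x * y \<in> gen_ideal (col_ideal (Suc k) (insert c S) \<union> col_ideal (Suc k) (insert d S))"
    using col_ideal_product by (subst mult.commute) blast
qed

lemma lm_bgen_identity: "distinct bs \<Longrightarrow> lm bgen bs (map Inr bs) = (1 :: ('r \<times> 'c, 'k::comm_ring_1) mpoly)"
proof -
  assume d: "distinct bs"
  have "mat (length bs) (length bs) (\<lambda>(i, j). bgen (bs ! i) (map Inr bs ! j)) = (1\<^sub>m (length bs) :: ('r \<times> 'c, 'k) mpoly mat)"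
    by (rule eq_matI) (use d in \<open>auto simp: nth_eq_iff_index_eq\<close>)
  then show ?thesis by (simp add: lm_def)
qed

text \<open>Identity columns disappear together with their rows, so a nonzero \<open>k\<close>-minor
  of \<open>S\<close> has at least \<open>t\<close> rows outside \<open>B\<close> and expands into
  \<open>t\<close>-minors there. Conversely a \<open>t\<close>-minor of the block is padded by all
  identity columns of \<open>S\<close>.\<close>

lemma col_ideal_eq_block:
  fixes S :: "('c::finite + 'r::finite) set"
  defines "B \<equiv> {r. Inr r \<in> S}" and "C \<equiv> {c. Inl c \<in> S}"
  assumes k: "k = t + card B"
  shows "col_ideal k S = gen_ideal (block_gens {(- B, C, t)} :: ('r \<times> 'c, 'k::comm_ring_1) mpoly set)"
proof
  show "col_ideal k S \<subseteq> gen_ideal (block_gens {(- B, C, t)} :: ('r \<times> 'c, 'k) mpoly set)"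
  proof (rule col_ideal_minimal)
    fix a :: "'r list" and p :: "('c + 'r) list" assume *: "length a = k" "length p = k" "set p \<subseteq> S" "distinct a" "distinct p"
    show "lm bgen a p \<in> gen_ideal (block_gens {(- B, C, t)} :: ('r \<times> 'c, 'k) mpoly set)"
    proof (cases "\<exists>r. Inr r \<in> set p \<and> r \<notin> set a")
      case True
      then obtain r where r: "Inr r \<in> set p" "r \<notin> set a" by blast
      have "lm bgen a p = (0 :: ('r \<times> 'c, 'k) mpoly)"
        by (rule lm_zero_col[OF _ r(1)]) (use r(2) * in auto)
      then show ?thesis by (simp add: rmod.span_zero)
    next
      case False
      then have in_a: "Inr r \<in> set p \<Longrightarrow> r \<in> set a" for r by blast
      have len: "length a = length p" using * by simp
      obtain a' b' where ab: "distinct a'" "distinct b'" "length a' = length b'"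
        "set a' = {r \<in> set a. Inr r \<notin> set p}" "set b' = {c. Inl c \<in> set p}"
        "lm bgen a p = (gmin a' b' :: ('r \<times> 'c, 'k) mpoly) \<or> lm bgen a p = - (gmin a' b' :: ('r \<times> 'c, 'k) mpoly)"
        using lm_bordered[OF len *(4,5) in_a, where e = "\<lambda>x y. indet (x, y) :: ('r \<times> 'c, 'k) mpoly"] unfolding gmin_def by blast
      let ?P = "{r. Inr r \<in> set p}"
      have P: "?P \<subseteq> set a" "?P \<subseteq> B" using in_a *(3) by (auto simp: B_def)
      \<comment> \<open>\<open>a'\<close> has \<open>k - card ?P\<close> rows, at most
        \<open>card (B - ?P)\<close> of them in \<open>B\<close>; at least
        \<open>k - card B = t\<close> are left outside.\<close>
      have "set a' \<inter> - B = set a' - (B - ?P)" using ab(4) by auto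
      moreover have "card (set a') \<le> card (set a' - (B - ?P)) + card (B - ?P)"
        using diff_card_le_card_Diff[of "B - ?P" "set a'"] by simp
      moreover have "card (set a') + card ?P = k"
      proof -
        have "set a' \<union> ?P = set a" "set a' \<inter> ?P = {}" using ab(4) P by auto
        then show ?thesis using card_Un_disjoint[of "set a'" ?P] *(1,4) by (simp add: distinct_card)
      qed
      moreover have "card (B - ?P) + card ?P = card B"
        using P(2) by (metis card_Diff_subset card_mono finite le_add_diff_inverse2)
      ultimately have "t \<le> card (set a' \<inter> - B)" using k by simp
      then have "gmin a' b' \<in> gen_ideal {gmin c' d' | c' d'. length c' = t \<and> length d' = t \<and> set c' \<subseteq> - B \<and> set d' \<subseteq> set b'}"
        unfolding gmin_def by (intro lm_in_ideal_few_rows ab)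
      moreover have "{gmin c' d' | c' d'. length c' = t \<and> length d' = t \<and> set c' \<subseteq> - B \<and> set d' \<subseteq> set b'} \<subseteq>
          (block_gens {(- B, C, t)} :: ('r \<times> 'c, 'k) mpoly set)"
      proof clarify
        fix c' d' assume "t = length c'" "length d' = length c'" "set c' \<subseteq> - B" "set d' \<subseteq> set b'"
        moreover have "set b' \<subseteq> C" using ab(5) *(3) by (auto simp: C_def)
        ultimately show "gmin c' d' \<in> (block_gens {(- B, C, length c')} :: ('r \<times> 'c, 'k) mpoly set)" unfolding block_gens_def by blast
      qed
      ultimately have "gmin a' b' \<in> gen_ideal (block_gens {(- B, C, t)} :: ('r \<times> 'c, 'k) mpoly set)"
        using rmod.span_mono by blast
      then show ?thesis using ab(6) rmod.span_neg by force
    qed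
  qed
  have "block_gens {(- B, C, t)} \<subseteq> (col_ideal k S :: ('r \<times> 'c, 'k) mpoly set)"
  proof
    fix x :: "('r \<times> 'c, 'k) mpoly" assume "x \<in> block_gens {(- B, C, t)}"
    then obtain a b where x: "x = gmin a b" "length a = t" "length b = t" "set a \<subseteq> - B" "set b \<subseteq> C"
      by (auto simp: block_gens_def)
    obtain bs where bs: "distinct bs" "set bs = B" using finite_distinct_list[of B] by auto
    have lb: "length bs = card B" using bs by (metis distinct_card)
    have "lm bgen (a @ bs) (map Inl b @ map Inr bs) = lm bgen a (map Inl b) * (lm bgen bs (map Inr bs) :: ('r \<times> 'c, 'k) mpoly)"
      by (rule lm_block_triangular) (use x bs in auto)
    also have "lm bgen a (map Inl b) = (gmin a b :: ('r \<times> 'c, 'k) mpoly)"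
      using lm_map[of b a bgen id Inl] x by (simp add: gmin_def)
    finally have "x = lm bgen (a @ bs) (map Inl b @ map Inr bs)" using x(1) bs(1) by (simp add: lm_bgen_identity)
    then show "x \<in> col_ideal k S"
      using col_ideal_gen[of "a @ bs" k "map Inl b @ map Inr bs" S] x bs lb k by (auto simp: B_def C_def)
  qed
  then show "gen_ideal (block_gens {(- B, C, t)} :: ('r \<times> 'c, 'k) mpoly set) \<subseteq> col_ideal k S"
    by (rule rmod.span_minimal) simp
qed

lemma gmin_nonzerodivisor_block:
  fixes g :: "('r::{finite,linorder} \<times> 'c::{finite,linorder}, 'k::comm_ring_1) mpoly"
  assumes ab: "length a = length b" "sorted_wrt (<) a" "sorted_wrt (<) b" and t: "0 < t"
    and few: "card {i. i < length a \<and> a ! i \<in> A \<and> b ! i \<in> C} < t"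
    and mem: "gmin a b * g \<in> gen_ideal (block_gens {(A, C, t)})"
  shows "g \<in> gen_ideal (block_gens {(A, C, t)})"
proof -
  obtain N RA RC where "rank_blocks rk rk N RA RC {(A, C, t)}"
    using rank_blocks_single[OF inj_rk inj_rk t] .
  then interpret rank_blocks rk rk N RA RC "{(A, C, t)}" .
  show ?thesis by (rule gmin_nonzerodivisor[OF ab(1)]) (use ab few mem in auto)
qed

lemma gmin_nonzerodivisor_0:
  fixes g :: "('r::{finite,linorder} \<times> 'c::{finite,linorder}, 'k::comm_ring_1) mpoly"
  assumes ab: "length a = length b" "sorted_wrt (<) a" "sorted_wrt (<) b" and g: "gmin a b * g = 0"
  shows "g = 0"
proof -
  \<comment> \<open>The empty block has no 1-minors, so its ideal is zero and regularity modulo it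
    is plain regularity.\<close>
  have "block_gens {({}, {}, 1)} = ({} :: ('r \<times> 'c, 'k) mpoly set)" by (auto simp: block_gens_def)
  moreover have "g \<in> gen_ideal (block_gens {({}, {}, 1)})"
    by (rule gmin_nonzerodivisor_block[OF ab]) (use g in \<open>auto simp: rmod.span_zero\<close>)
  ultimately show ?thesis by simp
qed

lemma card_nth_in: "distinct b \<Longrightarrow> card {i. i < length b \<and> b ! i \<in> C} \<le> card (set b \<inter> C)"
  by (rule card_inj_on_le[of "(!) b"]) (auto intro!: inj_onI simp: nth_eq_iff_index_eq)

lemma card_sum_set:
  fixes S :: "('c::finite + 'r::finite) set"
  shows "card {r. Inr r \<in> S} + card {c. Inl c \<in> S} = card S"
proof -
  have "S = Inr ` {r. Inr r \<in> S} \<union> Inl ` {c. Inl c \<in> S}"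
  proof (intro equalityI subsetI)
    fix x assume "x \<in> S" then show "x \<in> Inr ` {r. Inr r \<in> S} \<union> Inl ` {c. Inl c \<in> S}" by (cases x) auto
  qed auto
  then have "card S = card (Inr ` {r. Inr r \<in> S} \<union> Inl ` {c. Inl c \<in> S})" by simp
  also have "\<dots> = card {r. Inr r \<in> S} + card {c. Inl c \<in> S}"
    by (subst card_Un_disjoint) (auto simp: card_image)
  finally show ?thesis by simp
qed

text \<open>The diagonal cells inside the block can be bounded by rows or by columns; these are the
  two alternatives in \<open>few\<close>.\<close>

lemma col_ideal_nonzerodivisor:
  fixes S :: "('c::{finite,linorder} + 'r::{finite,linorder}) set" and g :: "('r \<times> 'c, 'k::comm_ring_1) mpoly"
  assumes X: "card X = card Y" and k: "card {r. Inr r \<in> S} < k"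
    and few: "card (X - {r. Inr r \<in> S}) < k - card {r. Inr r \<in> S} \<or> card (Y \<inter> {c. Inl c \<in> S}) < k - card {r. Inr r \<in> S}"
    and mem: "gmin (sorted_list_of_set X) (sorted_list_of_set Y) * g \<in> col_ideal k S"
  shows "g \<in> col_ideal k S"
proof -
  let ?B = "{r. Inr r \<in> S}" and ?C = "{c. Inl c \<in> S}" and ?t = "k - card {r. Inr r \<in> S}"
  let ?a = "sorted_list_of_set X" and ?b = "sorted_list_of_set Y"
  have eq: "col_ideal k S = gen_ideal (block_gens {(- ?B, ?C, ?t)} :: ('r \<times> 'c, 'k) mpoly set)"
    by (rule col_ideal_eq_block) (use k in simp)
  have l: "length ?a = length ?b" using X by simp
  have "card {i. i < length ?a \<and> ?a ! i \<in> - ?B \<and> ?b ! i \<in> ?C} \<le> card {i. i < length ?a \<and> ?a ! i \<in> - ?B}"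
    by (rule card_mono) auto
  also have "\<dots> \<le> card (X \<inter> - ?B)" using card_nth_in[of ?a "- ?B"] by simp
  also have "X \<inter> - ?B = X - ?B" by auto
  finally have 1: "card {i. i < length ?a \<and> ?a ! i \<in> - ?B \<and> ?b ! i \<in> ?C} \<le> card (X - ?B)" .
  have "card {i. i < length ?a \<and> ?a ! i \<in> - ?B \<and> ?b ! i \<in> ?C} \<le> card {i. i < length ?b \<and> ?b ! i \<in> ?C}"
    by (rule card_mono) (use l in auto)
  also have "\<dots> \<le> card (Y \<inter> ?C)" using card_nth_in[of ?b ?C] by simp
  finally have 2: "card {i. i < length ?a \<and> ?a ! i \<in> - ?B \<and> ?b ! i \<in> ?C} \<le> card (Y \<inter> ?C)" .
  show ?thesis
    unfolding eq
    by (rule gmin_nonzerodivisor_block[OF l]) (use 1 2 few k mem eq in auto)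
qed

lemma gmin_in_col_ideal:
  fixes S :: "('c::{finite,linorder} + 'r::{finite,linorder}) set"
  assumes "card X = card Y" "k = card X + card {r. Inr r \<in> S}" "X \<inter> {r. Inr r \<in> S} = {}" "Y \<subseteq> {c. Inl c \<in> S}"
  shows "gmin (sorted_list_of_set X) (sorted_list_of_set Y) \<in> (col_ideal k S :: ('r \<times> 'c, 'k::comm_ring_1) mpoly set)"
proof -
  have "gmin (sorted_list_of_set X) (sorted_list_of_set Y) \<in>
      (block_gens {(- {r. Inr r \<in> S}, {c. Inl c \<in> S}, card X)} :: ('r \<times> 'c, 'k) mpoly set)"
    unfolding block_gens_def using assms by (auto intro!: exI[of _ "sorted_list_of_set X"] exI[of _ "sorted_list_of_set Y"])
  then show ?thesis unfolding col_ideal_eq_block[OF assms(2)] by (rule rmod.span_base)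
qed

lemma col_ideal_up_step:
  fixes S :: "('c::{finite,linorder} + 'r::{finite,linorder}) set" and f :: "('r \<times> 'c, 'k::comm_ring_1) mpoly"
  assumes K: "col_ideal (Suc k) (insert c S) \<in> knutson_ideals f" "col_ideal (Suc k) (insert d S) \<in> knutson_ideals f"
    and ids: "card {r. Inr r \<in> insert c (insert d S)} \<le> k" and km: "k \<le> card (UNIV :: 'r set)" and kS: "k \<le> card S"
  shows "col_ideal (Suc k) (insert c (insert d S)) \<in> knutson_ideals f"
proof -
  let ?B = "{r. Inr r \<in> insert c (insert d S)}" and ?Bs = "{r. Inr r \<in> S}" and ?Cs = "{c. Inl c \<in> S}"
  have sub: "?Bs \<subseteq> ?B" by auto
  have cardB: "card (?B - ?Bs) = card ?B - card ?Bs" using sub by (intro card_Diff_subset) auto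
  have le: "card ?Bs \<le> card ?B" by (rule card_mono) (use sub in auto)
  have "card (- ?B) = card (UNIV :: 'r set) - card ?B" by (simp add: Compl_eq_Diff_UNIV card_Diff_subset)
  then obtain X where X: "X \<subseteq> - ?B" "card X = k - card ?B"
    using obtain_subset_with_card_n[of "k - card ?B" "- ?B"] km by (metis diff_le_mono)
  have "k - card ?Bs \<le> card ?Cs" using card_sum_set[of S] kS by simp
  then obtain Y where Y: "Y \<subseteq> ?Cs" "card Y = k - card ?Bs"
    using obtain_subset_with_card_n by metis
  \<comment> \<open>The test minor must lie in the ideal of \<open>S\<close> and be regular modulo
    that of the larger set. It spends rows on all identity columns that are new in
    \<open>?B\<close>; only \<open>k - card ?B\<close> of its rows are outside \<open>?B\<close>,
    one too few for a diagonal of size \<open>Suc k - card ?B\<close>.\<close>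
  let ?X = "(?B - ?Bs) \<union> X"
  have cX: "card ?X = k - card ?Bs"
    by (subst card_Un_disjoint) (use X cardB le ids in auto)
  show ?thesis
  proof (rule col_ideal_up[OF K])
    show "gmin (sorted_list_of_set ?X) (sorted_list_of_set Y) \<in> (col_ideal k S :: ('r \<times> 'c, 'k) mpoly set)"
      by (rule gmin_in_col_ideal) (use X Y cX ids le in auto)
    fix g :: "('r \<times> 'c, 'k) mpoly"
    assume mem: "gmin (sorted_list_of_set ?X) (sorted_list_of_set Y) * g \<in> col_ideal (Suc k) (insert c (insert d S))"
    have XB: "?X - ?B = X" using X(1) by auto
    have few: "card (?X - ?B) < Suc k - card ?B" unfolding XB using X(2) ids by linarith
    have "card ?X = card Y" using cX Y(2) by simp
    then show "g \<in> col_ideal (Suc k) (insert c (insert d S))"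
      by (rule col_ideal_nonzerodivisor[OF _ le_imp_less_Suc[OF ids] disjI1[OF few] mem])
  qed
qed

lemma col_ideal_down_step:
  fixes S :: "('c::{finite,linorder} + 'r::{finite,linorder}) set" and f :: "('r \<times> 'c, 'k::comm_ring_1) mpoly"
  assumes K: "col_ideal (Suc k) (insert c S) \<in> knutson_ideals f" "col_ideal (Suc k) (insert d S) \<in> knutson_ideals f"
    and ids: "card {r. Inr r \<in> S} < k" and km: "Suc k \<le> card (UNIV :: 'r set)" and kS: "k \<le> card S"
    and cd: "c \<noteq> d" "c \<notin> S" "d \<notin> S"
  shows "col_ideal k S \<in> knutson_ideals f"
proof -
  let ?S = "insert c (insert d S)"
  let ?B = "{r. Inr r \<in> ?S}" and ?Bs = "{r. Inr r \<in> S}" and ?Cs = "{c. Inl c \<in> S}" and ?C = "{c. Inl c \<in> ?S}"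
  have cS: "card ?S = Suc (Suc (card S))" using cd by simp
  have sub: "?Bs \<subseteq> ?B" "?Cs \<subseteq> ?C" by auto
  have le: "card ?Bs \<le> card ?B" "card ?Cs \<le> card ?C" by (auto intro!: card_mono)
  have cC: "card (?C - ?Cs) = card ?C - card ?Cs" using sub by (intro card_Diff_subset) auto
  have sums: "card ?B + card ?C = card ?S" "card ?Bs + card ?Cs = card S" by (rule card_sum_set)+
  have j: "card ?B \<le> Suc (Suc (card ?Bs))" using sums cS le by linarith
  let ?t = "Suc k - card ?B"
  have "card (- ?B) = card (UNIV :: 'r set) - card ?B" by (simp add: Compl_eq_Diff_UNIV card_Diff_subset)
  then obtain X where X: "X \<subseteq> - ?B" "card X = ?t"
    using obtain_subset_with_card_n[of ?t "- ?B"] km by (metis diff_le_mono)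
  have "?t - (card ?C - card ?Cs) \<le> card ?Cs" using sums cS kS le by linarith
  then obtain Y where Y: "Y \<subseteq> ?Cs" "card Y = ?t - (card ?C - card ?Cs)"
    using obtain_subset_with_card_n by metis
  \<comment> \<open>The test minor uses all matrix columns that are new in \<open>?C\<close>. As
    \<open>c\<close> and \<open>d\<close> raise \<open>card ?B + card ?C\<close> by two, only
    \<open>k - 1 - card ?Bs\<close> of its columns lie in \<open>?Cs\<close>, one too few for a
    diagonal of size \<open>k - card ?Bs\<close>.\<close>
  let ?Y = "(?C - ?Cs) \<union> Y"
  have cY: "card ?Y = ?t"
    by (subst card_Un_disjoint) (use Y cC sums cS le ids in auto)
  show ?thesis
  proof (rule col_ideal_down[OF K])
    show "gmin (sorted_list_of_set X) (sorted_list_of_set ?Y) \<in> (col_ideal (Suc k) ?S :: ('r \<times> 'c, 'k) mpoly set)"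
      by (rule gmin_in_col_ideal) (use X Y cY ids j in auto)
    fix g :: "('r \<times> 'c, 'k) mpoly"
    assume mem: "gmin (sorted_list_of_set X) (sorted_list_of_set ?Y) * g \<in> col_ideal k S"
    have YC: "?Y \<inter> ?Cs = Y" using Y(1) by auto
    have few: "card (?Y \<inter> ?Cs) < k - card ?Bs" unfolding YC using Y(2) sums cS le ids by linarith
    have "card X = card ?Y" using X(2) cY by simp
    then show "g \<in> col_ideal k S"
      by (rule col_ideal_nonzerodivisor[OF _ ids disjI2[OF few] mem])
  qed
qed

section \<open>The polynomial\<close>

text \<open>The columns of the bordered matrix in cyclic order. The columns of the matrix are taken in
  decreasing order, which turns antidiagonals into diagonals.\<close>

definition cyc_list :: "('c::{finite,linorder} + 'r::{finite,linorder}) list" where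
  "cyc_list = map Inr (rev (sorted_list_of_set UNIV)) @ map Inl (rev (sorted_list_of_set UNIV))"

definition cyc :: "nat \<Rightarrow> 'c::{finite,linorder} + 'r::{finite,linorder}" where
  "cyc i = cyc_list ! (i mod (CARD('c) + CARD('r)))"

definition window :: "nat \<Rightarrow> nat \<Rightarrow> ('c::{finite,linorder} + 'r::{finite,linorder}) set" where
  "window x l = cyc ` {x..<x + l}"

definition window_minor :: "nat \<Rightarrow> ('r::{finite,linorder} \<times> 'c::{finite,linorder}, 'k::comm_ring_1) mpoly" where
  "window_minor x = lm bgen (sorted_list_of_set UNIV) (map cyc [x..<x + CARD('r)])"

text \<open>Window 0 consists of all identity columns and its minor is 1 or -1, so the product
  starts at 1; position \<open>CARD('r) + CARD('c)\<close> closes the cycle.\<close>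

definition cyc_poly :: "('r::{finite,linorder} \<times> 'c::{finite,linorder}, 'k::comm_ring_1) mpoly" where
  "cyc_poly = (\<Prod>x\<in>{1..<CARD('r) + CARD('c)}. window_minor x)"

lemma length_cyc_list: "length (cyc_list :: ('c::{finite,linorder} + 'r::{finite,linorder}) list) = CARD('c) + CARD('r)"
  by (simp add: cyc_list_def)

lemma distinct_cyc_list: "distinct (cyc_list :: ('c::{finite,linorder} + 'r::{finite,linorder}) list)"
  by (auto simp: cyc_list_def distinct_map)

lemma cyc_eq_iff:
  "(cyc i :: 'c::{finite,linorder} + 'r::{finite,linorder}) = cyc j \<longleftrightarrow> i mod (CARD('c) + CARD('r)) = j mod (CARD('c) + CARD('r))"
  unfolding cyc_def by (subst nth_eq_iff_index_eq[OF distinct_cyc_list]) (auto simp: length_cyc_list)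

lemma inj_on_cyc: "l \<le> CARD('c) + CARD('r) \<Longrightarrow> inj_on (cyc :: nat \<Rightarrow> 'c::{finite,linorder} + 'r::{finite,linorder}) {x..<x + l}"
proof (rule inj_onI)
  fix i j assume l: "l \<le> CARD('c) + CARD('r)" and ij: "i \<in> {x..<x + l}" "j \<in> {x..<x + l}"
    and eq: "cyc i = (cyc j :: 'c + 'r)"
  have "i mod (CARD('c) + CARD('r)) = j mod (CARD('c) + CARD('r))" using eq unfolding cyc_eq_iff .
  then have "int i mod int (CARD('c) + CARD('r)) = int j mod int (CARD('c) + CARD('r))" by (simp only: zmod_int[symmetric])
  then have "int (CARD('c) + CARD('r)) dvd int i - int j" by (simp add: mod_eq_dvd_iff)
  moreover have "\<bar>int i - int j\<bar> < int (CARD('c) + CARD('r))" using l ij by auto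
  ultimately show "i = j" using zdvd_imp_le[of "int (CARD('c) + CARD('r))" "\<bar>int i - int j\<bar>"] by auto
qed

lemma card_window: "l \<le> CARD('c) + CARD('r) \<Longrightarrow> card (window x l :: ('c::{finite,linorder} + 'r::{finite,linorder}) set) = l"
  unfolding window_def by (subst card_image[OF inj_on_cyc]) auto

lemma window_Suc_right: "window x (Suc l) = insert (cyc (x + l)) (window x l)"
  by (simp add: window_def atLeastLessThanSuc)

lemma window_Suc_left: "window x (Suc l) = insert (cyc x) (window (Suc x) l)"
proof -
  have "{x..<x + Suc l} = insert x {Suc x..<Suc x + l}" by auto
  then show ?thesis by (simp only: window_def image_insert)
qed

lemma cyc_row: "i < CARD('r) \<Longrightarrow> (cyc i :: 'c::{finite,linorder} + 'r::{finite,linorder}) =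
    Inr (sorted_list_of_set UNIV ! (CARD('r) - Suc i))"
  by (simp add: cyc_def cyc_list_def nth_append rev_nth)

lemma cyc_col: "i < CARD('c) \<Longrightarrow> (cyc (CARD('r) + i) :: 'c::{finite,linorder} + 'r::{finite,linorder}) =
    Inl (sorted_list_of_set UNIV ! (CARD('c) - Suc i))"
  by (simp add: cyc_def cyc_list_def nth_append rev_nth)

lemma cyc_row2: "i < CARD('r) \<Longrightarrow> (cyc (CARD('r) + CARD('c) + i) :: 'c::{finite,linorder} + 'r::{finite,linorder}) =
    Inr (sorted_list_of_set UNIV ! (CARD('r) - Suc i))"
proof -
  assume i: "i < CARD('r)"
  have "(cyc (CARD('r) + CARD('c) + i) :: 'c + 'r) = cyc i" unfolding cyc_eq_iff by (simp add: add.commute add.left_commute)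
  then show ?thesis using cyc_row[OF i] by simp
qed

section \<open>Window ideals as Knutson ideals\<close>

lemma prod_nonzerodivisor:
  assumes "finite A" "\<And>x g. x \<in> A \<Longrightarrow> h x * g = 0 \<Longrightarrow> g = (0 :: 'a::comm_ring_1)" "(\<Prod>x\<in>A. h x) * g = 0"
  shows "g = 0"
  using assms
proof (induction A arbitrary: g rule: finite_induct)
  case (insert x A)
  have "h x * ((\<Prod>x\<in>A. h x) * g) = 0"
    using insert.prems(2) unfolding prod.insert[OF insert.hyps] mult.assoc .
  then have "(\<Prod>x\<in>A. h x) * g = 0" by (rule insert.prems(1)[OF insertI1])
  then show ?case by (rule insert.IH[rotated]) (rule insert.prems(1)[OF insertI2])
qed simp

lemma window_minor_gmin:
  fixes x :: nat
  defines "A \<equiv> sorted_list_of_set {r :: 'r::{finite,linorder}. Inr r \<notin> (window x CARD('r) :: ('c::{finite,linorder} + 'r) set)}"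
    and "B \<equiv> sorted_list_of_set {c :: 'c. Inl c \<in> (window x CARD('r) :: ('c + 'r) set)}"
  shows "length A = length B"
    and "window_minor x = (gmin A B :: ('r \<times> 'c, 'k::comm_ring_1) mpoly) \<or> window_minor x = - (gmin A B :: ('r \<times> 'c, 'k) mpoly)"
proof -
  let ?p = "map cyc [x..<x + CARD('r)] :: ('c + 'r) list" and ?rs = "sorted_list_of_set UNIV :: 'r list"
  have c: "CARD('r) \<le> CARD('c) + CARD('r)" by simp
  have "inj_on (cyc :: nat \<Rightarrow> 'c + 'r) {x..<x + CARD('r)}" by (rule inj_on_cyc[OF c])
  then have p: "distinct ?p" "length ?p = length ?rs" by (simp_all add: distinct_map)
  have w: "set ?p = window x CARD('r)" by (simp add: window_def)
  have *: "distinct ?rs" "set ?rs = UNIV" "distinct A" "distinct B" "set A = {r. Inr r \<notin> set ?p}" "set B = {c. Inl c \<in> set ?p}"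
    unfolding w A_def B_def by simp_all
  show "length A = length B" by (rule lm_bordered_full(1)[OF *(1,2) p *(3-6)])
  show "window_minor x = (gmin A B :: ('r \<times> 'c, 'k::comm_ring_1) mpoly) \<or> window_minor x = - (gmin A B :: ('r \<times> 'c, 'k) mpoly)"
    using lm_bordered_full(2)[OF *(1,2) p *(3-6), where e = "\<lambda>x y. indet (x, y) :: ('r \<times> 'c, 'k) mpoly"]
    unfolding window_minor_def gmin_def .
qed

lemma window_minor_nonzerodivisor:
  fixes g :: "('r::{finite,linorder} \<times> 'c::{finite,linorder}, 'k::comm_ring_1) mpoly"
  assumes "window_minor x * g = 0"
  shows "g = 0"
proof -
  let ?A = "sorted_list_of_set {r :: 'r. Inr r \<notin> (window x CARD('r) :: ('c + 'r) set)}"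
  let ?B = "sorted_list_of_set {c :: 'c. Inl c \<in> (window x CARD('r) :: ('c + 'r) set)}"
  have "window_minor x = (gmin ?A ?B :: ('r \<times> 'c, 'k) mpoly) \<or> window_minor x = - (gmin ?A ?B :: ('r \<times> 'c, 'k) mpoly)"
    by (rule window_minor_gmin(2))
  then have "gmin ?A ?B * g = 0"
  proof
    assume "window_minor x = (gmin ?A ?B :: ('r \<times> 'c, 'k) mpoly)"
    then show ?thesis using assms by (simp only:)
  next
    assume "window_minor x = - (gmin ?A ?B :: ('r \<times> 'c, 'k) mpoly)"
    then show ?thesis using assms by (simp only: minus_mult_left[symmetric] neg_equal_0_iff_equal)
  qed
  then show ?thesis
    by (rule gmin_nonzerodivisor_0[OF window_minor_gmin(1) sorted_list_of_set.strict_sorted_key_list_of_set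
          sorted_list_of_set.strict_sorted_key_list_of_set])
qed

text \<open>A window of \<open>CARD('r)\<close> columns has a single maximal minor up to sign, so
  its ideal is principal. The product of the other window minors is a nonzerodivisor
  \<open>h\<close>, and the colon by \<open>h\<close> recovers the factor.\<close>

lemma window_ideal_knutson:
  assumes x: "x \<in> {1..<CARD('r) + CARD('c)}"
  shows "col_ideal CARD('r) (window x CARD('r)) \<in>
    knutson_ideals (cyc_poly :: ('r::{finite,linorder} \<times> 'c::{finite,linorder}, 'k::comm_ring_1) mpoly)"
proof -
  let ?f = "cyc_poly :: ('r \<times> 'c, 'k) mpoly" and ?w = "window_minor x :: ('r \<times> 'c, 'k) mpoly"
  define h :: "('r \<times> 'c, 'k) mpoly" where "h = (\<Prod>y\<in>{1..<CARD('r) + CARD('c)} - {x}. window_minor y)"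
  have f: "?f = ?w * h" unfolding cyc_poly_def h_def using x by (intro prod.remove) auto
  have hz: "g = 0" if "h * g = 0" for g
    using prod_nonzerodivisor[OF _ window_minor_nonzerodivisor that[unfolded h_def]] by simp
  have "col_ideal CARD('r) (window x CARD('r)) = gen_ideal {?w}"
  proof
    have c: "CARD('r) \<le> CARD('c) + CARD('r)" by simp
    have "inj_on (cyc :: nat \<Rightarrow> 'c + 'r) {x..<x + CARD('r)}" by (rule inj_on_cyc[OF c])
    then have p: "distinct (map cyc [x..<x + CARD('r)] :: ('c + 'r) list)" by (simp add: distinct_map)
    have cw: "card (window x CARD('r) :: ('c + 'r) set) = CARD('r)" by (rule card_window[OF c])
    show "col_ideal CARD('r) (window x CARD('r)) \<subseteq> gen_ideal {?w}"
    proof (rule col_ideal_minimal)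
      fix a :: "'r list" and q :: "('c + 'r) list"
      assume *: "length a = CARD('r)" "length q = CARD('r)" "set q \<subseteq> window x CARD('r)" "distinct a" "distinct q"
      have "set q = window x CARD('r)"
        by (rule card_subset_eq) (use * cw in \<open>auto simp: distinct_card\<close>)
      then have "set q = set (map cyc [x..<x + CARD('r)])" by (simp add: window_def)
      then have mq: "mset (map cyc [x..<x + CARD('r)]) = mset q" using *(5) p set_eq_iff_mset_eq_distinct by blast
      have "set a = UNIV" using *(1,4) by (intro card_eq_UNIV_imp_eq_UNIV) (simp_all only: distinct_card finite)
      then have ma: "mset (sorted_list_of_set UNIV) = mset a" using *(4) by (intro set_eq_iff_mset_eq_distinct[THEN iffD1]) auto
      have "?w \<in> gen_ideal {?w}" by (rule rmod.span_base) simp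
      then show "lm bgen a q \<in> gen_ideal {?w}"
        by (rule gen_ideal_lm_perm[OF _ ma mq, of bgen, folded window_minor_def]) simp
    qed
    have "?w \<in> col_ideal CARD('r) (window x CARD('r))"
      unfolding window_minor_def by (rule col_ideal_gen) (auto simp: window_def)
    then show "gen_ideal {?w} \<subseteq> col_ideal CARD('r) (window x CARD('r))"
      by (intro rmod.span_minimal) auto
  qed
  also have "gen_ideal {?w} \<in> knutson_ideals ?f"
  proof -
    have "colon_ideal (PIdl\<^bsub>class_ring\<^esub> ?f) (gen_ideal {h}) = gen_ideal {?w}"
    proof (intro equalityI subsetI)
      fix g assume "g \<in> colon_ideal (PIdl\<^bsub>class_ring\<^esub> ?f) (gen_ideal {h})"
      then have "g * h \<in> gen_ideal {?f}" by (simp add: colon_ideal_def cgenideal_class_ring rmod.span_base)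
      then obtain u where "g * h = u * ?f" by (auto simp: rmod.span_singleton)
      then have "h * (g - u * ?w) = 0" unfolding f by (simp only: right_diff_distrib mult_ac) simp
      then have "g = u * ?w" using hz[of "g - u * ?w"] by simp
      then show "g \<in> gen_ideal {?w}" by (auto simp: rmod.span_singleton)
    next
      fix g assume "g \<in> gen_ideal {?w}"
      then obtain u where g: "g = u * ?w" by (auto simp: rmod.span_singleton)
      have "g * y \<in> gen_ideal {?f}" if "y \<in> gen_ideal {h}" for y
      proof -
        obtain v where y: "y = v * h" using \<open>y \<in> gen_ideal {h}\<close> by (auto simp: rmod.span_singleton)
        have "g * y = (u * v) * ?f" unfolding g f y by (simp only: mult_ac)
        then show ?thesis by (auto simp: rmod.span_singleton)
      qed
      then show "g \<in> colon_ideal (PIdl\<^bsub>class_ring\<^esub> ?f) (gen_ideal {h})"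
        by (simp add: colon_ideal_def cgenideal_class_ring)
    qed
    moreover have "ideal (gen_ideal {h}) (class_ring :: ('r \<times> 'c, 'k) mpoly ring)" by (simp add: ideal_class_ring_iff)
    ultimately show ?thesis by (metis knutson_ideals.colon[OF knutson_ideals.principal])
  qed
  finally show ?thesis .
qed

lemma window_ids_less:
  assumes "l \<le> CARD('c) + CARD('r)" "CARD('r) < x + l" "x < CARD('r) + CARD('c)" "0 < l"
  shows "card {r :: 'r::{finite,linorder}. Inr r \<in> (window x l :: ('c::{finite,linorder} + 'r) set)} < l"
proof -
  \<comment> \<open>The first position of the window that carries a matrix column, as positions
    below \<open>CARD('r)\<close> are identity columns.\<close>
  define i where "i = max x CARD('r)"
  have c: "0 < CARD('c)" by simp
  have i: "i - CARD('r) < CARD('c)" "i = CARD('r) + (i - CARD('r))" "i \<in> {x..<x + l}"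
    using assms c unfolding i_def max_def by (auto split: if_splits intro!: gr0I)
  have "(cyc (CARD('r) + (i - CARD('r))) :: 'c + 'r) = Inl (sorted_list_of_set UNIV ! (CARD('c) - Suc (i - CARD('r))))"
    by (rule cyc_col[OF i(1)])
  then have "(cyc i :: 'c + 'r) = Inl (sorted_list_of_set UNIV ! (CARD('c) - Suc (i - CARD('r))))"
    by (simp only: i(2)[symmetric])
  moreover have "(cyc i :: 'c + 'r) \<in> window x l" unfolding window_def by (rule imageI) (rule i(3))
  ultimately have "sorted_list_of_set UNIV ! (CARD('c) - Suc (i - CARD('r))) \<in> {c :: 'c. Inl c \<in> (window x l :: ('c + 'r) set)}"
    by (simp only: mem_Collect_eq)
  then have "{c :: 'c. Inl c \<in> (window x l :: ('c + 'r) set)} \<noteq> {}" by blast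
  then have "0 < card {c :: 'c. Inl c \<in> (window x l :: ('c + 'r) set)}" by (simp add: card_gt_0_iff)
  then show ?thesis using card_sum_set[of "window x l :: ('c + 'r) set"] card_window[OF assms(1)] by simp
qed

text \<open>A window shorter than \<open>CARD('r)\<close> is the common part of its one-column
  extensions to the left and to the right; the induction ends at the windows of
  \<open>CARD('r)\<close> columns.\<close>

lemma window_down:
  assumes "CARD('r) < x + l" "x < CARD('r) + CARD('c)" "l \<le> CARD('r)" "0 < l"
  shows "col_ideal l (window x l) \<in>
    knutson_ideals (cyc_poly :: ('r::{finite,linorder} \<times> 'c::{finite,linorder}, 'k::comm_ring_1) mpoly)"
  using assms
proof (induction "CARD('r) - l" arbitrary: x l)
  case 0
  then have "l = CARD('r)" by simp
  then show ?case by (simp only:) (rule window_ideal_knutson, use 0 in simp)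
next
  case (Suc n)
  have c: "0 < CARD('c)" by simp
  obtain y where y: "x = Suc y" using Suc.prems Suc.hyps(2) by (cases x) auto
  have ids: "card {r :: 'r. Inr r \<in> (window x l :: ('c + 'r) set)} < l"
    by (rule window_ids_less) (use Suc.prems y in auto)
  have inj: "inj_on (cyc :: nat \<Rightarrow> 'c + 'r) {y..<y + (l + 2)}"
    by (rule inj_on_cyc) (use Suc.hyps(2) c in linarith)
  have notin: "(cyc y :: 'c + 'r) \<noteq> cyc (x + l)" "(cyc y :: 'c + 'r) \<notin> window x l" "(cyc (x + l) :: 'c + 'r) \<notin> window x l"
  proof -
    have neq: "(cyc a :: 'c + 'r) \<noteq> cyc b" if "a \<in> {y..<y + (l + 2)}" "b \<in> {y..<y + (l + 2)}" "a \<noteq> b" for a b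
      using inj_onD[OF inj _ that(1,2)] that(3) by blast
    show "(cyc y :: 'c + 'r) \<noteq> cyc (x + l)" by (rule neq) (auto simp: y)
    have 1: "\<forall>z\<in>{x..<x + l}. (cyc y :: 'c + 'r) \<noteq> cyc z" by (intro ballI neq) (auto simp: y)
    then show "(cyc y :: 'c + 'r) \<notin> window x l" unfolding window_def image_iff by blast
    have 2: "\<forall>z\<in>{x..<x + l}. (cyc (x + l) :: 'c + 'r) \<noteq> cyc z" by (intro ballI neq) (auto simp: y)
    then show "(cyc (x + l) :: 'c + 'r) \<notin> window x l" unfolding window_def image_iff by blast
  qed
  show ?case
  proof (rule col_ideal_down_step[OF _ _ ids _ _ notin])
    show "col_ideal (Suc l) (insert (cyc y) (window x l)) \<in> knutson_ideals (cyc_poly :: ('r \<times> 'c, 'k) mpoly)"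
      unfolding y window_Suc_left[symmetric] by (rule Suc.hyps(1)) (use Suc.prems Suc.hyps(2) y in linarith)+
    show "col_ideal (Suc l) (insert (cyc (x + l)) (window x l)) \<in> knutson_ideals (cyc_poly :: ('r \<times> 'c, 'k) mpoly)"
      unfolding window_Suc_right[symmetric] by (rule Suc.hyps(1)) (use Suc.prems Suc.hyps(2) in linarith)+
    show "Suc l \<le> CARD('r)" using Suc.hyps(2) by simp
    show "l \<le> card (window x l :: ('c + 'r) set)" by (subst card_window) (use Suc.prems c in linarith)+
  qed
qed

text \<open>A window is the union of its two subwindows that are one column shorter. Its subwindows
  of size \<open>k\<close> start at positions from \<open>x\<close> to \<open>x + l - k\<close>, and
  the first two hypotheses are what \<open>window_down\<close> requires at these extremes.\<close>

lemma window_up: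
  assumes "CARD('r) < x + k" "x + l < CARD('r) + CARD('c) + k" "k \<le> CARD('r)" "k \<le> l" "l \<le> CARD('c) + CARD('r)"
    and "card {r :: 'r. Inr r \<in> (window x l :: ('c + 'r) set)} < k"
  shows "col_ideal k (window x l) \<in>
    knutson_ideals (cyc_poly :: ('r::{finite,linorder} \<times> 'c::{finite,linorder}, 'k::comm_ring_1) mpoly)"
  using assms
proof (induction "l - k" arbitrary: x l)
  case 0
  have lk: "l = k" using 0(1,5) by simp
  have "x < CARD('r) + CARD('c)" using 0(3) unfolding lk by linarith
  moreover have "0 < k" using 0(7) by linarith
  ultimately show ?case unfolding lk by (rule window_down[OF 0(2) _ 0(4)])
next
  case (Suc n)
  obtain k' where k': "k = Suc k'" using Suc.prems(6) not0_implies_Suc[of k] by force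
  have "2 \<le> l" using Suc.hyps(2) k' by linarith
  then obtain l' where l': "l = Suc (Suc l')" by (metis Suc_le_D numeral_2_eq_2 Suc_le_mono)
  have num: "CARD('r) < x + k" "x + l < CARD('r) + CARD('c) + k" "k \<le> CARD('r)" "k \<le> l" "l \<le> CARD('c) + CARD('r)"
      "Suc n = l - k" "l = Suc (Suc l')"
    by (fact Suc.prems(1-5) Suc.hyps(2) l')+
  have eq: "window x l = (insert (cyc x) (insert (cyc (x + Suc l')) (window (Suc x) l')) :: ('c + 'r) set)"
    unfolding l' window_Suc_left[of x "Suc l'"] window_Suc_right[of "Suc x" l'] add_Suc add_Suc_right ..
  have sub: "card {r. Inr r \<in> T} < k" if "T \<subseteq> window x l" for T :: "('c + 'r) set"
  proof -
    have "{r. Inr r \<in> T} \<subseteq> {r. Inr r \<in> (window x l :: ('c + 'r) set)}" using that by blast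
    then have "card {r. Inr r \<in> T} \<le> card {r. Inr r \<in> (window x l :: ('c + 'r) set)}" by (rule card_mono[OF finite])
    then show ?thesis using Suc.prems(6) by (rule le_less_trans)
  qed
  show ?case
    unfolding eq k'
  proof (rule col_ideal_up_step)
    have "col_ideal k (window x (Suc l')) \<in> knutson_ideals (cyc_poly :: ('r \<times> 'c, 'k) mpoly)"
    proof (rule Suc.hyps(1))
      show "card {r :: 'r. Inr r \<in> (window x (Suc l') :: ('c + 'r) set)} < k"
        by (rule sub) (simp only: l' window_Suc_right[of x "Suc l'"] subset_insertI)
    qed (use num in linarith)+
    then show "col_ideal (Suc k') (insert (cyc x) (window (Suc x) l')) \<in> knutson_ideals (cyc_poly :: ('r \<times> 'c, 'k) mpoly)"
      unfolding k' window_Suc_left .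
    have "col_ideal k (window (Suc x) (Suc l')) \<in> knutson_ideals (cyc_poly :: ('r \<times> 'c, 'k) mpoly)"
    proof (rule Suc.hyps(1))
      show "card {r :: 'r. Inr r \<in> (window (Suc x) (Suc l') :: ('c + 'r) set)} < k"
        by (rule sub) (simp only: l' window_Suc_left[of x "Suc l'"] subset_insertI)
    qed (use num in linarith)+
    then show "col_ideal (Suc k') (insert (cyc (x + Suc l')) (window (Suc x) l')) \<in> knutson_ideals (cyc_poly :: ('r \<times> 'c, 'k) mpoly)"
      unfolding k' window_Suc_right[of "Suc x" l'] add_Suc add_Suc_right .
    show "card {r :: 'r. Inr r \<in> insert (cyc x :: 'c + 'r) (insert (cyc (x + Suc l')) (window (Suc x) l'))} \<le> k'"
      using Suc.prems(6) unfolding eq k' less_Suc_eq_le .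
    show "k' \<le> CARD('r)" using Suc.prems(3) k' by simp
    show "k' \<le> card (window (Suc x) l' :: ('c + 'r) set)"
    proof -
      have "card (window (Suc x) l' :: ('c + 'r) set) = l'" by (rule card_window) (use num in linarith)
      then show ?thesis using num k' by linarith
    qed
  qed
qed

section \<open>Initial rows and initial columns as windows\<close>

lemma block_gens_Un: "block_gens (A \<union> B) = block_gens A \<union> block_gens B"
  unfolding block_gens_def by blast

lemma block_gens_insert: "block_gens (insert x B) = block_gens {x} \<union> block_gens B"
  using block_gens_Un[of "{x}" B] by simp

lemma gen_ideal_zero: "G \<subseteq> {0} \<Longrightarrow> gen_ideal G = {0 :: 'a::comm_ring_1}"
  using rmod.span_minimal[OF _ rmod.subspace_single_0, of G] rmod.span_zero[of G] by blast

lemma block_gens_zero: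
  fixes A :: "'r::finite set" and C :: "'c::finite set"
  assumes "card A < t \<or> card C < t"
  shows "block_gens {(A, C, t)} \<subseteq> {0 :: ('r \<times> 'c, 'k::comm_ring_1) mpoly}"
proof
  fix z :: "('r \<times> 'c, 'k) mpoly" assume "z \<in> block_gens {(A, C, t)}"
  then obtain a b where z: "z = gmin a b" "length a = t" "length b = t" "set a \<subseteq> A" "set b \<subseteq> C"
    unfolding block_gens_def by blast
  have "\<not> distinct a \<or> \<not> distinct b"
    using assms z(2-5) card_mono[of A "set a"] card_mono[of C "set b"] by (auto simp: distinct_card)
  then have "gmin a b = (0 :: ('r \<times> 'c, 'k) mpoly)"
    unfolding gmin_def
  proof
    assume "\<not> distinct a" then show "lm (\<lambda>x y. indet (x, y)) a b = (0 :: ('r \<times> 'c, 'k) mpoly)"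
      by (rule lm_not_distinct_rows[rotated]) (use z in simp)
  next
    assume "\<not> distinct b" then show "lm (\<lambda>x y. indet (x, y)) a b = (0 :: ('r \<times> 'c, 'k) mpoly)"
      by (rule lm_not_distinct_cols[rotated]) (use z in simp)
  qed
  then show "z \<in> {0}" using z(1) by simp
qed

lemma nth_sorted_list_downset:
  fixes A :: "'a::{finite,linorder} set"
  assumes A: "downset A" and i: "i < CARD('a)"
  shows "sorted_list_of_set UNIV ! i \<in> A \<longleftrightarrow> i < card A"
proof -
  let ?l = "sorted_list_of_set (UNIV :: 'a set)"
  have len: "length ?l = CARD('a)" by simp
  have s: "sorted_wrt (<) ?l" by (rule sorted_list_of_set.strict_sorted_key_list_of_set)
  have mono: "?l ! x < ?l ! y \<longleftrightarrow> x < y" if "x < CARD('a)" "y < CARD('a)" for x y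
    using s that len unfolding sorted_wrt_iff_nth_less
    by (metis linorder_less_linear order_less_asym)
  have img: "(!) ?l ` {..<CARD('a)} = UNIV"
  proof -
    have "set ?l = (!) ?l ` {..<CARD('a)}" unfolding set_conv_nth len by blast
    then show ?thesis by simp
  qed
  have inj: "inj_on ((!) ?l) {..<CARD('a)}"
    by (auto intro!: inj_onI simp: nth_eq_iff_index_eq)
  show ?thesis
  proof
    assume "?l ! i \<in> A"
    then have "(!) ?l ` {..i} \<subseteq> A"
      using A mono i unfolding downset_def by (auto simp: image_subset_iff le_less)
    moreover have "card ((!) ?l ` {..i}) = Suc i"
      by (subst card_image) (use inj i in \<open>auto intro: inj_on_subset\<close>)
    ultimately show "i < card A" using card_mono[of A "(!) ?l ` {..i}"] by simp
  next
    assume c: "i < card A"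
    show "?l ! i \<in> A"
    proof (rule ccontr)
      assume n: "?l ! i \<notin> A"
      have "A \<subseteq> (!) ?l ` {..<i}"
      proof
        fix z assume z: "z \<in> A"
        have "z \<in> (!) ?l ` {..<CARD('a)}" unfolding img by simp
        then obtain j where j: "z = ?l ! j" "j < CARD('a)" by auto
        have "\<not> ?l ! i \<le> z" using n A z unfolding downset_def by blast
        then have "?l ! j < ?l ! i" unfolding j(1) not_le .
        then have "j < i" unfolding mono[OF j(2) i] .
        then show "z \<in> (!) ?l ` {..<i}" using j(1) by blast
      qed
      then have "card A \<le> card ((!) ?l ` {..<i})" by (rule card_mono[rotated]) simp
      also have "\<dots> \<le> i" using card_image_le[of "{..<i}" "(!) ?l"] by simp
      finally show False using c by simp
    qed
  qed
qed

text \<open>The window runs through all matrix columns and then through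
  \<open>CARD('r) - card A\<close> identity columns of the next round. Rows are arranged in
  decreasing order, so these belong to the largest rows, the complement of the initial segment
  \<open>A\<close>.\<close>

lemma window_of_row_downset:
  fixes A :: "'r::{finite,linorder} set"
  assumes A: "downset A"
  defines "W \<equiv> window CARD('r) (CARD('c) + (CARD('r) - card A)) :: ('c::{finite,linorder} + 'r) set"
  shows "{r. Inr r \<in> W} = - A" "{c. Inl c \<in> W} = UNIV"
proof -
  have cA: "card A \<le> CARD('r)" by (rule card_mono) auto
  have cn: "card (- A) = CARD('r) - card A" by (simp add: Compl_eq_Diff_UNIV card_Diff_subset)
  have sub: "r \<notin> A" if rW: "Inr r \<in> W" for r
  proof -
    obtain j where j: "(Inr r :: 'c + 'r) = cyc j" "CARD('r) \<le> j" "j < CARD('r) + (CARD('c) + (CARD('r) - card A))"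
      using rW unfolding W_def window_def by auto
    show ?thesis
    proof (cases "j < CARD('r) + CARD('c)")
      case True
      have "j = CARD('r) + (j - CARD('r))" using j(2) by simp
      then have "(cyc j :: 'c + 'r) = cyc (CARD('r) + (j - CARD('r)))" by (rule arg_cong)
      also have "\<dots> = Inl (sorted_list_of_set UNIV ! (CARD('c) - Suc (j - CARD('r))))"
        by (rule cyc_col) (use True j(2) in linarith)
      finally show ?thesis using j(1) by simp
    next
      case False
      define i where "i = j - (CARD('r) + CARD('c))"
      have i: "i < CARD('r) - card A" using False j(3) unfolding i_def by linarith
      have "j = CARD('r) + CARD('c) + i" using False unfolding i_def by linarith
      then have "(cyc j :: 'c + 'r) = cyc (CARD('r) + CARD('c) + i)" by (rule arg_cong)
      also have "\<dots> = Inr (sorted_list_of_set UNIV ! (CARD('r) - Suc i))"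
        by (rule cyc_row2) (use i in linarith)
      finally have "r = sorted_list_of_set UNIV ! (CARD('r) - Suc i)" using j(1) by simp
      then show ?thesis using nth_sorted_list_downset[OF A, of "CARD('r) - Suc i"] i by auto
    qed
  qed
  have c: "card W = CARD('c) + (CARD('r) - card A)"
    unfolding W_def by (rule card_window) simp
  have s: "card {r. Inr r \<in> W} + card {c. Inl c \<in> W} = card W" by (rule card_sum_set)
  have le1: "card {r. Inr r \<in> W} \<le> card (- A)" by (rule card_mono) (use sub in auto)
  have le2: "card {c. Inl c \<in> W} \<le> CARD('c)" by (rule card_mono) auto
  show "{r. Inr r \<in> W} = - A"
    by (rule card_subset_eq) (use sub s c le1 le2 cn in auto)
  show "{c. Inl c \<in> W} = UNIV"
    by (rule card_subset_eq) (use s c le1 le2 cn in auto)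
qed

text \<open>Columns are arranged in decreasing order, so the smallest ones, which form
  \<open>C\<close>, are the last before the cycle closes.\<close>

lemma window_of_col_downset:
  fixes C :: "'c::{finite,linorder} set"
  assumes C: "downset C"
  defines "W \<equiv> window (CARD('r) + (CARD('c) - card C)) (card C) :: ('c + 'r::{finite,linorder}) set"
  shows "{r. Inr r \<in> W} = {}" "{c. Inl c \<in> W} = C"
proof -
  have cC: "card C \<le> CARD('c)" by (rule card_mono) auto
  have el: "\<exists>c\<in>C. w = Inl c" if wW: "w \<in> W" for w
  proof -
    obtain j where j: "w = cyc j" "CARD('r) + (CARD('c) - card C) \<le> j" "j < CARD('r) + (CARD('c) - card C) + card C"
      using wW unfolding W_def window_def by auto
    define i where "i = j - CARD('r)"
    have i: "CARD('c) - card C \<le> i" "i < CARD('c)" using j(2,3) cC unfolding i_def by linarith+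
    have "j = CARD('r) + i" using j(2) unfolding i_def by linarith
    then have "(cyc j :: 'c + 'r) = cyc (CARD('r) + i)" by (rule arg_cong)
    also have "\<dots> = Inl (sorted_list_of_set UNIV ! (CARD('c) - Suc i))" by (rule cyc_col) (rule i(2))
    finally have w: "w = Inl (sorted_list_of_set UNIV ! (CARD('c) - Suc i))" using j(1) by simp
    have "sorted_list_of_set UNIV ! (CARD('c) - Suc i) \<in> C"
      using nth_sorted_list_downset[OF C, of "CARD('c) - Suc i"] i cC by auto
    then show ?thesis using w by blast
  qed
  show e: "{r. Inr r \<in> W} = {}" using el by blast
  have "card W = card C" unfolding W_def by (rule card_window) (use cC in simp)
  then have "card {c. Inl c \<in> W} = card C" using card_sum_set[of W] e by simp
  then show "{c. Inl c \<in> W} = C" by (intro card_subset_eq) (use el in auto)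
qed

lemma row_block_knutson:
  fixes A :: "'r::{finite,linorder} set"
  assumes A: "downset A" and t: "0 < t" "t \<le> card A" "t \<le> CARD('c)"
  shows "gen_ideal (block_gens {(A, UNIV, t)}) \<in>
    knutson_ideals (cyc_poly :: ('r \<times> 'c::{finite,linorder}, 'k::comm_ring_1) mpoly)"
proof -
  let ?W = "window CARD('r) (CARD('c) + (CARD('r) - card A)) :: ('c + 'r) set"
  let ?k = "t + (CARD('r) - card A)"
  have cA: "card A \<le> CARD('r)" by (rule card_mono) auto
  have cn: "card (- A) = CARD('r) - card A" by (simp add: Compl_eq_Diff_UNIV card_Diff_subset)
  note W = window_of_row_downset[OF A, where 'c = 'c]
  have "col_ideal ?k ?W = gen_ideal (block_gens {(- {r. Inr r \<in> ?W}, {c. Inl c \<in> ?W}, t)} :: ('r \<times> 'c, 'k) mpoly set)"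
    by (rule col_ideal_eq_block) (simp only: W(1) cn)
  then have eq: "gen_ideal (block_gens {(A, UNIV, t)} :: ('r \<times> 'c, 'k) mpoly set) = col_ideal ?k ?W"
    by (simp only: W double_complement)
  have "card {r. Inr r \<in> ?W} < ?k" unfolding W(1) cn using t(1) by simp
  then show ?thesis
    unfolding eq by (rule window_up[rotated 5]) (use t cA in linarith)+
qed

lemma col_block_knutson:
  fixes C :: "'c::{finite,linorder} set"
  assumes C: "downset C" and t: "0 < t" "t \<le> card C" "t \<le> CARD('r)"
  shows "gen_ideal (block_gens {(UNIV, C, t)}) \<in>
    knutson_ideals (cyc_poly :: ('r::{finite,linorder} \<times> 'c, 'k::comm_ring_1) mpoly)"
proof -
  let ?W = "window (CARD('r) + (CARD('c) - card C)) (card C) :: ('c + 'r) set"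
  have cC: "card C \<le> CARD('c)" by (rule card_mono) auto
  note W = window_of_col_downset[OF C, where 'r = 'r]
  have "col_ideal t ?W = gen_ideal (block_gens {(- {r. Inr r \<in> ?W}, {c. Inl c \<in> ?W}, t)} :: ('r \<times> 'c, 'k) mpoly set)"
    by (rule col_ideal_eq_block) (simp only: W(1) card.empty add_0_right)
  then have eq: "gen_ideal (block_gens {(UNIV, C, t)} :: ('r \<times> 'c, 'k) mpoly set) = col_ideal t ?W"
    by (simp only: W Compl_empty_eq)
  have "card {r. Inr r \<in> ?W} < t" unfolding W(1) using t(1) by simp
  then show ?thesis
    unfolding eq by (rule window_up[rotated 5]) (use t cC in linarith)+
qed

text \<open>Blocks that are too small contribute nothing, so only the remaining ones are added up.\<close>

lemma block_sum_knutson: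
  fixes f :: "('r::finite \<times> 'c::finite, 'k::comm_ring_1) mpoly"
  assumes fin: "finite B" and B: "\<And>x. x \<in> B \<Longrightarrow> block_gens {x} \<subseteq> {0 :: ('r \<times> 'c, 'k) mpoly} \<or>
      gen_ideal (block_gens {x}) \<in> knutson_ideals f"
  shows "block_gens B \<subseteq> {0 :: ('r \<times> 'c, 'k) mpoly} \<or> gen_ideal (block_gens B) \<in> knutson_ideals f"
  using fin B
proof (induction B rule: finite_induct)
  case empty
  then show ?case by (simp add: block_gens_def)
next
  case (insert x B)
  let ?G = "block_gens {x} :: ('r \<times> 'c, 'k) mpoly set" and ?H = "block_gens B :: ('r \<times> 'c, 'k) mpoly set"
  have eq: "block_gens (insert x B) = ?G \<union> ?H" by (rule block_gens_insert)
  have 1: "?G \<subseteq> {0} \<or> gen_ideal ?G \<in> knutson_ideals f" by (rule insert.prems) simp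
  have 2: "?H \<subseteq> {0} \<or> gen_ideal ?H \<in> knutson_ideals f" by (rule insert.IH) (rule insert.prems, simp)
  have drop: "gen_ideal (G \<union> H) = gen_ideal H" if "G \<subseteq> {0}" for G H :: "('r \<times> 'c, 'k) mpoly set"
  proof
    have "G \<union> H \<subseteq> gen_ideal H" using that rmod.span_superset[of H] rmod.span_zero[of H] by blast
    then show "gen_ideal (G \<union> H) \<subseteq> gen_ideal H" by (rule rmod.span_minimal) (rule rmod.subspace_span)
    show "gen_ideal H \<subseteq> gen_ideal (G \<union> H)" by (rule rmod.span_mono) blast
  qed
  show ?case unfolding eq
  proof (cases "?G \<subseteq> {0}")
    case True
    then show "?G \<union> ?H \<subseteq> {0} \<or> gen_ideal (?G \<union> ?H) \<in> knutson_ideals f" using 2 drop[OF True] by auto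
  next
    case G: False
    show "?G \<union> ?H \<subseteq> {0} \<or> gen_ideal (?G \<union> ?H) \<in> knutson_ideals f"
    proof (cases "?H \<subseteq> {0}")
      case True
      then show ?thesis using 1 G drop[OF True, of ?G] by (simp only: Un_commute simp_thms)
    next
      case False
      then show ?thesis using 1 2 G knutson_ideals.sum[of "gen_ideal ?G" f "gen_ideal ?H"] by (simp only: set_add_gen_ideal simp_thms)
    qed
  qed
qed

lemma cogen_ideal_knutson:
  fixes a :: "'r::{finite,linorder} list" and b :: "'c::{finite,linorder} list"
  shows "block_gens (cogen_blocks a b) \<subseteq> {0 :: ('r \<times> 'c, 'k::comm_ring_1) mpoly} \<or>
    gen_ideal (block_gens (cogen_blocks a b)) \<in> knutson_ideals (cyc_poly :: ('r \<times> 'c, 'k) mpoly)"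
proof (rule block_sum_knutson)
  have "cogen_blocks a b \<subseteq> (\<lambda>A. (A, UNIV, Suc (card (set a \<inter> A)))) ` UNIV \<union> (\<lambda>C. (UNIV, C, Suc (card (set b \<inter> C)))) ` UNIV"
    unfolding cogen_blocks_def by blast
  then show "finite (cogen_blocks a b)" by (rule finite_subset) (intro finite_UnI finite_imageI finite)
  fix x assume "x \<in> cogen_blocks a b"
  then consider A where "downset A" "x = (A, UNIV, Suc (card (set a \<inter> A)))"
    | C where "downset C" "x = (UNIV, C, Suc (card (set b \<inter> C)))"
    unfolding cogen_blocks_def by blast
  then show "block_gens {x} \<subseteq> {0 :: ('r \<times> 'c, 'k) mpoly} \<or> gen_ideal (block_gens {x}) \<in> knutson_ideals (cyc_poly :: ('r \<times> 'c, 'k) mpoly)"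
  proof cases
    case 1
    let ?t = "Suc (card (set a \<inter> A))"
    show ?thesis
    proof (cases "card A < ?t \<or> CARD('c) < ?t")
      case True
      show ?thesis unfolding 1(2) by (rule disjI1) (rule block_gens_zero[OF True])
    next
      case False
      show ?thesis unfolding 1(2) by (rule disjI2) (rule row_block_knutson[OF 1(1)], use False in auto)
    qed
  next
    case 2
    let ?t = "Suc (card (set b \<inter> C))"
    show ?thesis
    proof (cases "CARD('r) < ?t \<or> card C < ?t")
      case True
      show ?thesis unfolding 2(2) by (rule disjI1) (rule block_gens_zero[OF True])
    next
      case False
      show ?thesis unfolding 2(2) by (rule disjI2) (rule col_block_knutson[OF 2(1)], use False in auto)
    qed
  qed
qed

text \<open>The diagonal of \<open>[a|b]\<close> has at most \<open>card (set a \<inter> A)\<close>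
  cells in the rows \<open>A\<close>, and the corresponding block asks for one more; columns are
  alike.\<close>

lemma cogen_nonzerodivisor:
  fixes g :: "('r::{finite,linorder} \<times> 'c::{finite,linorder}, 'k::comm_ring_1) mpoly"
  assumes ab: "sorted_wrt (<) a" "sorted_wrt (<) b" "length a = length b"
    and g: "gmin a b * g \<in> gen_ideal (block_gens (cogen_blocks a b))"
  shows "g \<in> gen_ideal (block_gens (cogen_blocks a b))"
proof -
  interpret rank_blocks "rk :: 'r \<Rightarrow> nat" "rk :: 'c \<Rightarrow> nat" "length a" "\<lambda>k. {x. a ! k \<le> x}" "\<lambda>k. {x. b ! k \<le> x}" "cogen_blocks a b"
    by (rule rank_blocks_cogen[OF ab])
  show ?thesis
  proof (rule gmin_nonzerodivisor[OF ab(3) _ _ _ g])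
    show "sorted_wrt (\<lambda>y z. rk y < rk z) a" "sorted_wrt (\<lambda>y z. rk y < rk z) b"
      using ab(1,2) by (simp_all only: rk_less)
    fix A C t assume "(A, C, t) \<in> cogen_blocks a b"
    then consider "C = UNIV" "t = Suc (card (set a \<inter> A))" | "A = UNIV" "t = Suc (card (set b \<inter> C))"
      unfolding cogen_blocks_def by blast
    moreover have "distinct a" "distinct b" using ab strict_sorted_iff by blast+
    ultimately show "card {i. i < length a \<and> a ! i \<in> A \<and> b ! i \<in> C} < t"
      using card_nth_in[of a A] card_nth_in[of b C] ab(3) by cases auto
  qed
qed

section \<open>Downward induction over the poset ideals\<close>

lemma minor_le_trans:
  assumes "minor_le p q" "minor_le q r"
  shows "minor_le p r"
proof -
  obtain a b c d e f where [simp]: "p = (a, b)" "q = (c, d)" "r = (e, f)" by (cases p, cases q, cases r)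
  have "a ! i \<le> e ! i \<and> b ! i \<le> f ! i" if "i < length e" for i
    using assms that order_trans[of "a ! i" "c ! i" "e ! i"] order_trans[of "b ! i" "d ! i" "f ! i"] by simp
  then show ?thesis using assms by simp
qed

lemma minor_le_antisym:
  assumes "minor_le p q" "minor_le q p" "p \<in> minors" "q \<in> minors"
  shows "p = q"
proof -
  obtain a b c d where [simp]: "p = (a, b)" "q = (c, d)" by (cases p, cases q)
  have len: "length a = length c" "length a = length b" "length c = length d"
    using assms by (simp_all add: minors_def)
  have "a ! i = c ! i \<and> b ! i = d ! i" if "i < length a" for i
    using assms(1,2) that len antisym[of "a ! i" "c ! i"] antisym[of "b ! i" "d ! i"] by simp
  then have "a = c" "b = d" using len by (simp_all add: list_eq_iff_nth_eq)
  then show ?thesis by simp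
qed

lemma finite_minors: "finite (minors :: ('r::{finite,linorder}, 'c::{finite,linorder}) minor_index set)"
proof -
  have "minors \<subseteq> {a :: 'r list. set a \<subseteq> UNIV \<and> distinct a} \<times> {b :: 'c list. set b \<subseteq> UNIV \<and> distinct b}"
    by (auto simp: minors_def strict_sorted_iff)
  then show ?thesis by (rule finite_subset) (intro finite_cartesian_product finite_subset_distinct finite)
qed

lemma exists_minimal_minor:
  assumes "(A :: ('r::{finite,linorder}, 'c::{finite,linorder}) minor_index set) \<subseteq> minors" "A \<noteq> {}"
  obtains p where "p \<in> A" "\<And>q. q \<in> A \<Longrightarrow> minor_le q p \<Longrightarrow> q = p"
proof -
  have "finite A" using assms(1) finite_minors by (rule finite_subset)
  then have "\<exists>p\<in>A. \<forall>q\<in>A. minor_le q p \<longrightarrow> q = p"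
    using assms(2,1)
  proof (induction A rule: finite_ne_induct)
    case (singleton x)
    then show ?case by blast
  next
    case (insert x F)
    obtain p where p: "p \<in> F" "\<forall>q\<in>F. minor_le q p \<longrightarrow> q = p" using insert by blast
    show ?case
    proof (cases "minor_le x p")
      case True
      have "q = x" if "q \<in> insert x F" "minor_le q x" for q
      proof (rule ccontr)
        assume n: "q \<noteq> x"
        then have "q \<in> F" using that(1) by blast
        moreover have "minor_le q p" using that(2) True by (rule minor_le_trans)
        ultimately have "q = p" using p(2) by blast
        then have "q = x" using that True insert.prems p(1) by (intro minor_le_antisym) auto
        then show False using n by blast
      qed
      then show ?thesis by blast
    next
      case False
      then show ?thesis using p by blast
    qed
  qed
  then show ?thesis using that by blast
qed

lemma omega_ideal_inter:
  fixes \<Omega> :: "('r::{finite,linorder}, 'c::{finite,linorder}) minor_index set"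
  assumes om: "minor_poset_ideal \<Omega>" and ab: "(a, b) \<in> minors" "(a, b) \<notin> \<Omega>"
    and min: "\<And>q. q \<in> minors \<Longrightarrow> minor_le q (a, b) \<Longrightarrow> q \<noteq> (a, b) \<Longrightarrow> q \<in> \<Omega>"
  shows "(omega_ideal \<Omega> :: ('r \<times> 'c, 'k::comm_ring_1) mpoly set) =
    gen_ideal (block_gens (cogen_blocks a b)) \<inter> omega_ideal (insert (a, b) \<Omega>)" (is "?O = ?I \<inter> ?O'")
proof
  have s: "sorted_wrt (<) a" "sorted_wrt (<) b" "length a = length b" using ab(1) by (auto simp: minors_def)
  have "?O \<subseteq> ?I"
    unfolding omega_ideal_def
  proof (rule rmod.span_minimal)
    show "minor_poly ` \<Omega> \<subseteq> ?I"
    proof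
      fix z :: "('r \<times> 'c, 'k) mpoly" assume "z \<in> minor_poly ` \<Omega>"
      then obtain c d where cd: "z = minor_poly (c, d)" "(c, d) \<in> \<Omega>" by auto
      have "(c, d) \<in> minors" using cd(2) om by (auto simp: minor_poset_ideal_def)
      moreover have "\<not> minor_le (a, b) (c, d)" using cd(2) om ab unfolding minor_poset_ideal_def by blast
      ultimately show "z \<in> ?I" unfolding cd(1) minor_poly_gmin by (intro minor_not_ge_in_cogen s)
    qed
  qed (rule rmod.subspace_span)
  moreover have "?O \<subseteq> ?O'" unfolding omega_ideal_def by (rule rmod.span_mono) blast
  ultimately show "?O \<subseteq> ?I \<inter> ?O'" by blast
  have OI: "?O \<subseteq> ?I" by fact
  show "?I \<inter> ?O' \<subseteq> ?O"
  proof
    fix x assume x: "x \<in> ?I \<inter> ?O'"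
    then have "x \<in> gen_ideal (insert (minor_poly (a, b)) (minor_poly ` \<Omega>))" by (simp add: omega_ideal_def)
    \<comment> \<open>Modulo the ideal of \<open>\<Omega>\<close>, \<open>x\<close> is a multiple of
      the new minor. This multiple lies in \<open>?I\<close>, so \<open>z\<close> does by
      regularity, and straightening then puts \<open>gmin a b * z\<close> into the ideal of
      \<open>\<Omega>\<close>.\<close>
    then obtain z where z: "x - z * minor_poly (a, b) \<in> ?O"
      unfolding omega_ideal_def by (rule rmod.span_breakdown_eq[THEN iffD1, THEN exE])
    have "x - z * minor_poly (a, b) \<in> ?I" using z OI by blast
    then have "x - (x - z * minor_poly (a, b)) \<in> ?I" by (rule rmod.span_diff[OF IntD1[OF x]])
    moreover have "x - (x - z * minor_poly (a, b)) = gmin a b * z" unfolding minor_poly_gmin by (simp add: mult.commute)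
    ultimately have "gmin a b * z \<in> ?I" by simp
    then have "z \<in> ?I" by (rule cogen_nonzerodivisor[OF s])
    with min have "gmin a b * z \<in> ?O" by (rule straighten_in_omega[OF ab(1)])
    then have "(x - z * minor_poly (a, b)) + gmin a b * z \<in> ?O" using z unfolding omega_ideal_def by (intro rmod.span_add)
    moreover have "(x - z * minor_poly (a, b)) + gmin a b * z = x" unfolding minor_poly_gmin by (simp add: mult.commute)
    ultimately show "x \<in> ?O" by simp
  qed
qed

text \<open>\<open>cogen_ideal_knutson\<close> leaves open that all blocks are too small and the
  ideal is zero. A member of the nonempty \<open>\<Omega>\<close> rules this out, being a nonzero
  element of the ideal.\<close>

lemma cogen_ideal_nonzero:
  fixes \<Omega> :: "('r::{finite,linorder}, 'c::{finite,linorder}) minor_index set"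
  assumes om: "minor_poset_ideal \<Omega>" "\<Omega> \<noteq> {}" and s: "sorted_wrt (<) a" "sorted_wrt (<) b" "length a = length b"
    and ab: "\<And>p. p \<in> \<Omega> \<Longrightarrow> \<not> minor_le (a, b) p"
  shows "gen_ideal (block_gens (cogen_blocks a b)) \<in> knutson_ideals (cyc_poly :: ('r \<times> 'c, 'k::comm_ring_1) mpoly)"
proof -
  let ?G = "block_gens (cogen_blocks a b) :: ('r \<times> 'c, 'k) mpoly set"
  obtain c d where cd: "(c, d) \<in> \<Omega>" using om(2) by auto
  have m: "(c, d) \<in> minors" using cd om(1) by (auto simp: minor_poset_ideal_def)
  have "gmin c d \<in> gen_ideal ?G" by (rule minor_not_ge_in_cogen[OF m s ab[OF cd]])
  moreover have "gmin c d \<noteq> (0 :: ('r \<times> 'c, 'k) mpoly)"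
  proof
    assume "gmin c d = (0 :: ('r \<times> 'c, 'k) mpoly)"
    then have z: "gmin c d * (1 :: ('r \<times> 'c, 'k) mpoly) = 0" by simp
    have "(1 :: ('r \<times> 'c, 'k) mpoly) = 0"
      by (rule gmin_nonzerodivisor_0[OF _ _ _ z]) (use m in \<open>auto simp: minors_def\<close>)
    then show False by simp
  qed
  ultimately have "\<not> ?G \<subseteq> {0}" using gen_ideal_zero[of ?G] by blast
  then show ?thesis using cogen_ideal_knutson[of a b, where 'k = 'k] by blast
qed

text \<open>The empty minor acts as a largest element: no minor lies above it, and its blocks ask
  for 1-minors, that is, for variables. This starts the downward induction.\<close>

lemma omega_ideal_minors:
  "(omega_ideal minors :: ('r::{finite,linorder} \<times> 'c::{finite,linorder}, 'k::comm_ring_1) mpoly set) =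
    gen_ideal (block_gens (cogen_blocks [] []))"
proof
  show "omega_ideal minors \<subseteq> (gen_ideal (block_gens (cogen_blocks [] [])) :: ('r \<times> 'c, 'k) mpoly set)"
    unfolding omega_ideal_def
  proof (rule rmod.span_minimal)
    show "minor_poly ` minors \<subseteq> (gen_ideal (block_gens (cogen_blocks [] [])) :: ('r \<times> 'c, 'k) mpoly set)"
    proof
      fix z :: "('r \<times> 'c, 'k) mpoly" assume "z \<in> minor_poly ` minors"
      then obtain c d where cd: "z = minor_poly (c, d)" "(c, d) \<in> minors" by auto
      have "\<not> minor_le ([], []) (c, d)" using cd(2) by (auto simp: minors_def)
      then show "z \<in> gen_ideal (block_gens (cogen_blocks [] []))" unfolding cd(1) minor_poly_gmin
        by (intro minor_not_ge_in_cogen cd(2)) simp_all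
    qed
  qed (rule rmod.subspace_span)
  show "(gen_ideal (block_gens (cogen_blocks [] [])) :: ('r \<times> 'c, 'k) mpoly set) \<subseteq> omega_ideal minors"
    unfolding omega_ideal_def
  proof (rule rmod.span_minimal)
    show "block_gens (cogen_blocks [] []) \<subseteq> (gen_ideal (minor_poly ` minors) :: ('r \<times> 'c, 'k) mpoly set)"
    proof
      fix z :: "('r \<times> 'c, 'k) mpoly" assume "z \<in> block_gens (cogen_blocks [] [])"
      then obtain a b where z: "z = gmin a b" "length a = 1" "length b = 1"
        unfolding block_gens_def cogen_blocks_def by auto
      obtain x y where xy: "a = [x]" "b = [y]" using z(2,3) by (metis One_nat_def length_0_conv length_Suc_conv)
      have "([x], [y]) \<in> minors" by (simp add: minors_def)
      then have "minor_poly ([x], [y]) \<in> (gen_ideal (minor_poly ` minors) :: ('r \<times> 'c, 'k) mpoly set)"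
        by (intro rmod.span_base imageI)
      then show "z \<in> gen_ideal (minor_poly ` minors)" unfolding z(1) xy minor_poly_gmin .
    qed
  qed (rule rmod.subspace_span)
qed

theorem omega_ideal_knutson:
  fixes \<Omega> :: "('r::{finite,linorder}, 'c::{finite,linorder}) minor_index set"
  assumes "minor_poset_ideal \<Omega>" "\<Omega> \<noteq> {}"
  shows "omega_ideal \<Omega> \<in> knutson_ideals (cyc_poly :: ('r \<times> 'c, 'k::comm_ring_1) mpoly)"
  using assms
proof (induction "card (minors - \<Omega>)" arbitrary: \<Omega> rule: less_induct)
  case less
  have sub: "\<Omega> \<subseteq> minors" using less.prems(1) by (simp add: minor_poset_ideal_def)
  show ?case
  proof (cases "\<Omega> = minors")
    case True
    show ?thesis unfolding True omega_ideal_minors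
      by (rule cogen_ideal_nonzero[OF less.prems]) (use sub in \<open>auto simp: minors_def\<close>)
  next
    case False
    then have "minors - \<Omega> \<noteq> {}" using sub by blast
    then obtain p where p: "p \<in> minors - \<Omega>" "\<And>q. q \<in> minors - \<Omega> \<Longrightarrow> minor_le q p \<Longrightarrow> q = p"
      using exists_minimal_minor[of "minors - \<Omega>"] by blast
    obtain a b where ab: "p = (a, b)" by (cases p)
    have m: "(a, b) \<in> minors" "(a, b) \<notin> \<Omega>" using p(1) ab by auto
    have min: "q \<in> \<Omega>" if "q \<in> minors" "minor_le q (a, b)" "q \<noteq> (a, b)" for q
      using p(2)[of q] that unfolding ab by blast
    have s: "sorted_wrt (<) a" "sorted_wrt (<) b" "length a = length b" using m(1) by (auto simp: minors_def)
    have om': "minor_poset_ideal (insert (a, b) \<Omega>)"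
      using less.prems(1) m(1) min unfolding minor_poset_ideal_def by blast
    have "minors - insert (a, b) \<Omega> \<subset> minors - \<Omega>" using m by blast
    then have "card (minors - insert (a, b) \<Omega>) < card (minors - \<Omega>)"
      by (intro psubset_card_mono finite_Diff finite_minors)
    then have "omega_ideal (insert (a, b) \<Omega>) \<in> knutson_ideals (cyc_poly :: ('r \<times> 'c, 'k) mpoly)"
      by (rule less.hyps) (use om' in simp_all)
    moreover have "gen_ideal (block_gens (cogen_blocks a b)) \<in> knutson_ideals (cyc_poly :: ('r \<times> 'c, 'k) mpoly)"
    proof (rule cogen_ideal_nonzero[OF less.prems s])
      fix q assume "q \<in> \<Omega>"
      then show "\<not> minor_le (a, b) q" using less.prems(1) m unfolding minor_poset_ideal_def by blast
    qed
    moreover have "(omega_ideal \<Omega> :: ('r \<times> 'c, 'k) mpoly set) =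
        gen_ideal (block_gens (cogen_blocks a b)) \<inter> omega_ideal (insert (a, b) \<Omega>)"
      by (rule omega_ideal_inter[OF less.prems(1) m]) (rule min)
    ultimately show ?thesis by (simp only: knutson_ideals.inter)
  qed
qed

lemma poset_ideal_omega_ideal: "poset_ideal \<Omega> = omega_ideal \<Omega>"
  unfolding poset_ideal_def omega_ideal_def by (rule genideal_class_ring)

section \<open>Initial monomials\<close>

lemma term_orderD:
  assumes "term_order leq"
  shows "leq t t" "leq s t \<Longrightarrow> leq t u \<Longrightarrow> leq s u" "leq s t \<Longrightarrow> leq t s \<Longrightarrow> s = t" "leq s t \<or> leq t s"
    "leq 0 t" "leq s t \<Longrightarrow> leq (s + u) (t + u)"
proof -
  interpret lo: linorder leq "\<lambda>s t. leq s t \<and> s \<noteq> t" using assms by (simp add: term_order_def)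
  show "leq t t" by (rule lo.order_refl)
  show "leq s t \<Longrightarrow> leq t u \<Longrightarrow> leq s u" by (rule lo.order_trans)
  show "leq s t \<Longrightarrow> leq t s \<Longrightarrow> s = t" by (rule lo.order_antisym)
  show "leq s t \<or> leq t s" by (rule lo.linear)
  show "leq 0 t" "leq s t \<Longrightarrow> leq (s + u) (t + u)" using assms by (simp_all add: term_order_def)
qed

text \<open>Over a ring with zero divisors initial monomials need not multiply. Leading coefficients
  1 and -1 prevent the loss, and minors and their products have no others.\<close>

definition signed_initial :: "('v monom \<Rightarrow> 'v monom \<Rightarrow> bool) \<Rightarrow> ('v, 'k::comm_ring_1) mpoly \<Rightarrow> 'v monom \<Rightarrow> bool" where
  "signed_initial leq f t \<longleftrightarrow> (Poly_Mapping.lookup f t = 1 \<or> Poly_Mapping.lookup f t = - 1) \<and>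
     (\<forall>s\<in>Poly_Mapping.keys f. leq s t)"

lemma term_order_add_cancel:
  assumes "term_order leq" "leq u s" "leq v t" "u + v = s + t"
  shows "u = s \<and> v = t"
proof -
  have "leq (u + v) (s + v)" by (rule term_orderD(6)[OF assms(1,2)])
  moreover have "leq (s + v) (s + t)" using term_orderD(6)[OF assms(1,3), of s] by (simp only: add.commute)
  ultimately have "s + v = s + t" unfolding assms(4) by (rule term_orderD(3)[OF assms(1), rotated])
  then have "v = t" by simp
  then show ?thesis using assms(4) by simp
qed

lemma lookup_initial_mult:
  fixes f g :: "('v, 'k::comm_ring_1) mpoly"
  assumes to: "term_order leq" and f: "\<forall>u\<in>Poly_Mapping.keys f. leq u s" and g: "\<forall>u\<in>Poly_Mapping.keys g. leq u t"
  shows "Poly_Mapping.lookup (f * g) (s + t) = Poly_Mapping.lookup f s * Poly_Mapping.lookup g t"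
proof -
  define f' where "f' = f - Poly_Mapping.single s (Poly_Mapping.lookup f s)"
  have f': "u \<noteq> s \<and> u \<in> Poly_Mapping.keys f" if "u \<in> Poly_Mapping.keys f'" for u
    using that unfolding f'_def in_keys_iff lookup_minus lookup_single by (auto simp: when_def split: if_splits)
  have "s + t \<notin> Poly_Mapping.keys (f' * g)"
  proof
    assume "s + t \<in> Poly_Mapping.keys (f' * g)"
    then obtain u v where uv: "s + t = u + v" "u \<in> Poly_Mapping.keys f'" "v \<in> Poly_Mapping.keys g"
      by (rule in_keys_multE)
    have "u = s \<and> v = t"
      by (rule term_order_add_cancel[OF to]) (use uv f' f g in simp_all)
    then show False using f' uv by blast
  qed
  then have z: "Poly_Mapping.lookup (f' * g) (s + t) = 0" by (simp add: in_keys_iff)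
  have "f = Poly_Mapping.single s (Poly_Mapping.lookup f s) + f'" by (simp add: f'_def)
  then have "f * g = Poly_Mapping.single s (Poly_Mapping.lookup f s) * g + f' * g" by (metis distrib_right)
  then have "Poly_Mapping.lookup (f * g) (s + t) =
      Poly_Mapping.lookup (Poly_Mapping.single s (Poly_Mapping.lookup f s) * g) (s + t) + Poly_Mapping.lookup (f' * g) (s + t)"
    by (simp only: lookup_add)
  then show ?thesis unfolding z by (simp only: lookup_single_mult_add add_0_right)
qed

lemma keys_mult_le:
  assumes to: "term_order leq" and f: "\<forall>u\<in>Poly_Mapping.keys f. leq u s" and g: "\<forall>u\<in>Poly_Mapping.keys g. leq u t"
    and w: "w \<in> Poly_Mapping.keys (f * g)"
  shows "leq w (s + t)"
proof -
  obtain u v where uv: "w = u + v" "u \<in> Poly_Mapping.keys f" "v \<in> Poly_Mapping.keys g"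
    using w by (rule in_keys_multE)
  have "leq (u + v) (s + v)" by (rule term_orderD(6)[OF to]) (use f uv in simp)
  moreover have "leq v t" using g uv by simp
  then have "leq (s + v) (s + t)" using term_orderD(6)[OF to, of v t s] by (simp only: add.commute)
  ultimately show ?thesis unfolding uv(1) by (rule term_orderD(2)[OF to])
qed

lemma signed_initial_mult:
  assumes "term_order leq" "signed_initial leq f s" "signed_initial leq g t"
  shows "signed_initial leq (f * g) (s + t)"
  using lookup_initial_mult[OF assms(1), of f s g t] keys_mult_le[OF assms(1), of f s g t] assms(2,3)
  unfolding signed_initial_def by auto

lemma signed_initial_1:
  assumes "term_order leq"
  shows "signed_initial leq 1 0"
  unfolding signed_initial_def by (auto simp: lookup_one when_def in_keys_iff term_orderD(1)[OF assms] split: if_splits)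

lemma signed_initial_prod:
  assumes "term_order leq" "\<And>x. x \<in> A \<Longrightarrow> signed_initial leq (h x) (T x)"
  shows "signed_initial leq (prod h A) (sum T A)"
  using assms(2)
proof (induction A rule: infinite_finite_induct)
  case (insert x A)
  show ?case unfolding prod.insert[OF insert.hyps] sum.insert[OF insert.hyps]
    by (rule signed_initial_mult[OF assms(1)]) (use insert in simp_all)
qed (simp_all add: signed_initial_1[OF assms(1)])

lemma signed_initial_power:
  assumes "term_order leq" "signed_initial leq f t"
  shows "signed_initial leq (f ^ n) (\<Sum>i<n. t)"
  using signed_initial_prod[OF assms(1), of "{..<n}" "\<lambda>_. f" "\<lambda>_. t"] assms(2) by (simp only: prod_constant card_lessThan)

lemma signed_initial_uminus: "signed_initial leq (- f) t \<longleftrightarrow> signed_initial leq f t"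
  unfolding signed_initial_def by (auto simp: in_keys_iff minus_equation_iff)

section \<open>Coefficients of minors\<close>

lemma lookup_indet_mult:
  "Poly_Mapping.lookup (indet v * h :: ('v, 'k::comm_ring_1) mpoly) t =
    (if Poly_Mapping.lookup t v = 0 then 0 else Poly_Mapping.lookup h (t - Poly_Mapping.single v 1))"
proof (cases "Poly_Mapping.lookup t v = 0")
  case True
  have "t \<notin> Poly_Mapping.keys (indet v * h)"
  proof
    assume "t \<in> Poly_Mapping.keys (indet v * h)"
    then have "t \<in> (+) (Poly_Mapping.single v 1) ` Poly_Mapping.keys h"
      unfolding indet_def monom_poly_def using keys_single_mult by blast
    then show False using True by (auto simp: lookup_add)
  qed
  then show ?thesis using True by (simp add: in_keys_iff)
next
  case False
  have t: "Poly_Mapping.single v 1 + (t - Poly_Mapping.single v 1) = t"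
    by (rule poly_mapping_eqI) (use False in \<open>auto simp: lookup_add lookup_minus lookup_single when_def\<close>)
  show ?thesis
    using lookup_single_mult_add[of "Poly_Mapping.single v 1" 1 h "t - Poly_Mapping.single v 1"] False
    unfolding indet_def monom_poly_def t by simp
qed

lemma lookup_minus_one_power_mult:
  "Poly_Mapping.lookup ((- 1) ^ j * h :: ('v, 'k::comm_ring_1) mpoly) t = (- 1) ^ j * Poly_Mapping.lookup h t"
  by (cases "even j") simp_all

lemma lookup_gmin_Cons:
  assumes "length b = Suc (length a)"
  shows "Poly_Mapping.lookup (gmin (x # a) b :: ('r \<times> 'c, 'k::comm_ring_1) mpoly) t =
    (\<Sum>j<length b. if Poly_Mapping.lookup t (x, b ! j) = 0 then 0
       else (- 1) ^ j * Poly_Mapping.lookup (gmin a (del j b)) (t - Poly_Mapping.single (x, b ! j) 1))"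
proof -
  have "gmin (x # a) b = (\<Sum>j<length b. indet (x, b ! j) * ((- 1) ^ j * gmin a (del j b)) :: ('r \<times> 'c, 'k) mpoly)"
    unfolding gmin_def mult.assoc[symmetric] by (rule lm_expand_first_row) (use assms in simp)
  then show ?thesis
    by (simp only: lookup_sum lookup_indet_mult lookup_minus_one_power_mult)
qed

lemma gmin_Nil: "gmin [] [] = (1 :: ('r \<times> 'c, 'k::comm_ring_1) mpoly)"
  by (simp add: gmin_def)

lemma lookup_gmin_of_int:
  assumes "length a = length b"
  shows "Poly_Mapping.lookup (gmin a b :: ('r \<times> 'c, 'k::comm_ring_1) mpoly) t =
    of_int (Poly_Mapping.lookup (gmin a b :: ('r \<times> 'c, int) mpoly) t)"
  using assms
proof (induction a arbitrary: b t)
  case Nil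
  then show ?case by (simp add: gmin_Nil lookup_one when_def)
next
  case (Cons x a)
  have len: "length b = Suc (length a)" using Cons.prems by simp
  have IH: "Poly_Mapping.lookup (gmin a (del j b) :: ('r \<times> 'c, 'k) mpoly) s =
      of_int (Poly_Mapping.lookup (gmin a (del j b) :: ('r \<times> 'c, int) mpoly) s)" if "j < length b" for j s
    by (rule Cons.IH) (use that len length_del[of j b] in simp)
  show ?case unfolding lookup_gmin_Cons[OF len] of_int_sum
    by (rule sum.cong[OF refl]) (use IH in \<open>auto simp: of_int_mult of_int_power\<close>)
qed

lemma keys_gmin:
  assumes "length a = length b" "t \<in> Poly_Mapping.keys (gmin a b :: ('r \<times> 'c, 'k::comm_ring_1) mpoly)"
  shows "Poly_Mapping.keys t \<subseteq> set a \<times> set b" "monom_degree t = length a"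
  using assms
proof (induction a arbitrary: b t)
  case Nil
  { case 1 then show ?case by (auto simp: gmin_Nil in_keys_iff lookup_one when_def split: if_splits) }
  { case 2 then show ?case by (auto simp: gmin_Nil in_keys_iff lookup_one when_def monom_degree_def split: if_splits) }
next
  case (Cons x a)
  have *: "Poly_Mapping.keys t \<subseteq> set (x # a) \<times> set b \<and> monom_degree t = length (x # a)"
    if l: "length (x # a) = length b" and t: "t \<in> Poly_Mapping.keys (gmin (x # a) b :: ('r \<times> 'c, 'k) mpoly)" for b t
  proof -
    have len: "length b = Suc (length a)" using l by simp
    have "(\<Sum>j<length b. if Poly_Mapping.lookup t (x, b ! j) = 0 then 0
       else (- 1) ^ j * Poly_Mapping.lookup (gmin a (del j b) :: ('r \<times> 'c, 'k) mpoly) (t - Poly_Mapping.single (x, b ! j) 1)) \<noteq> 0"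
      using t unfolding in_keys_iff lookup_gmin_Cons[OF len] .
    then obtain j where j: "j < length b" "(if Poly_Mapping.lookup t (x, b ! j) = 0 then 0
       else (- 1) ^ j * Poly_Mapping.lookup (gmin a (del j b) :: ('r \<times> 'c, 'k) mpoly) (t - Poly_Mapping.single (x, b ! j) 1)) \<noteq> 0"
      by (rule sum.not_neutral_contains_not_neutral) (simp only: lessThan_iff)
    define s where "s = t - Poly_Mapping.single (x, b ! j) 1"
    have tv: "Poly_Mapping.lookup t (x, b ! j) \<noteq> 0" using j(2) by meson
    have s: "s \<in> Poly_Mapping.keys (gmin a (del j b) :: ('r \<times> 'c, 'k) mpoly)"
      using j(2) tv unfolding s_def in_keys_iff by auto
    have ld: "length a = length (del j b)" using length_del[OF j(1)] len by simp
    have ts: "t = Poly_Mapping.single (x, b ! j) 1 + s"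
      unfolding s_def by (rule poly_mapping_eqI) (use tv in \<open>auto simp: lookup_add lookup_minus lookup_single when_def\<close>)
    have "set (del j b) \<subseteq> set b" by (auto simp: del_def dest: in_set_takeD in_set_dropD)
    then have "set a \<times> set (del j b) \<subseteq> set a \<times> set b" by (rule Sigma_mono[OF subset_refl])
    then have "Poly_Mapping.keys s \<subseteq> set a \<times> set b" by (rule subset_trans[OF Cons.IH(1)[OF ld s]])
    then have k: "Poly_Mapping.keys t \<subseteq> set (x # a) \<times> set b"
      unfolding ts using keys_add[of "Poly_Mapping.single (x, b ! j) 1" s] j(1) by (auto split: if_splits)
    have w: "real (monom_degree u) = weight (\<lambda>_. 1) u" for u :: "('r \<times> 'c) monom" by (simp add: monom_degree_def weight_def)
    have "real (monom_degree t) = 1 + real (monom_degree s)"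
      unfolding w by (subst ts) (simp only: weight_add weight_single of_nat_1 mult_1)
    then have "monom_degree t = length (x # a)" using Cons.IH(2)[OF ld s] by simp
    then show ?thesis using k by blast
  qed
  { case 1 then show ?case using * by blast }
  { case 2 then show ?case using * by blast }
qed

lemma lookup_gmin_int:
  assumes "length a = length b" "distinct a" "distinct b"
  shows "Poly_Mapping.lookup (gmin a b :: ('r \<times> 'c, int) mpoly) t \<in> {- 1, 0, 1}"
  using assms
proof (induction a arbitrary: b t)
  case Nil
  then show ?case by (simp add: gmin_Nil lookup_one when_def)
next
  case (Cons x a)
  have len: "length b = Suc (length a)" using Cons.prems by simp
  define h where "h j = (if Poly_Mapping.lookup t (x, b ! j) = 0 then 0
       else (- 1) ^ j * Poly_Mapping.lookup (gmin a (del j b) :: ('r \<times> 'c, int) mpoly) (t - Poly_Mapping.single (x, b ! j) 1))" for j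
  have eq: "Poly_Mapping.lookup (gmin (x # a) b :: ('r \<times> 'c, int) mpoly) t = (\<Sum>j<length b. h j)"
    unfolding h_def by (rule lookup_gmin_Cons[OF len])
  have hv: "h j \<in> {- 1, 0, 1}" if j: "j < length b" for j
  proof -
    have "distinct (del j b)" using Cons.prems(3) unfolding del_def
      by (simp add: set_take_disj_set_drop_if_distinct)
    then have "Poly_Mapping.lookup (gmin a (del j b) :: ('r \<times> 'c, int) mpoly) s \<in> {- 1, 0, 1}" for s
      by (intro Cons.IH) (use Cons.prems length_del[OF j] in simp_all)
    then have "Poly_Mapping.lookup (gmin a (del j b) :: ('r \<times> 'c, int) mpoly) (t - Poly_Mapping.single (x, b ! j) 1) \<in> {- 1, 0, 1}" .
    then show ?thesis unfolding h_def by (cases "even j") auto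
  qed
  \<comment> \<open>Every monomial of the minor contains exactly one variable from row
    \<open>x\<close>, so at most one term of the expansion contributes to the coefficient at
    \<open>t\<close>.\<close>
  have uniq: "j = j'" if "j < length b" "j' < length b" "h j \<noteq> 0" "h j' \<noteq> 0" for j j'
  proof (rule ccontr)
    assume ne: "j \<noteq> j'"
    have tv: "Poly_Mapping.lookup t (x, b ! j') \<noteq> 0" using \<open>h j' \<noteq> 0\<close> unfolding h_def by meson
    define s where "s = t - Poly_Mapping.single (x, b ! j) 1"
    have "s \<in> Poly_Mapping.keys (gmin a (del j b) :: ('r \<times> 'c, int) mpoly)"
      using \<open>h j \<noteq> 0\<close> unfolding h_def s_def in_keys_iff by (auto split: if_splits)
    then have "Poly_Mapping.keys s \<subseteq> set a \<times> set (del j b)"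
      by (rule keys_gmin(1)[rotated]) (use len length_del[OF \<open>j < length b\<close>] in simp)
    moreover have "x \<notin> set a" using Cons.prems(2) by simp
    ultimately have "Poly_Mapping.lookup s (x, b ! j') = 0" by (auto simp: in_keys_iff)
    moreover have "b ! j \<noteq> b ! j'" using ne that Cons.prems(3) by (simp add: nth_eq_iff_index_eq)
    ultimately show False using tv unfolding s_def by (simp add: lookup_minus lookup_single)
  qed
  show ?case
  proof (cases "\<exists>j<length b. h j \<noteq> 0")
    case True
    then obtain j where j: "j < length b" "h j \<noteq> 0" by blast
    have "(\<Sum>j<length b. h j) = h j + (\<Sum>i\<in>{..<length b} - {j}. h i)" by (rule sum.remove) (use j in auto)
    also have "(\<Sum>i\<in>{..<length b} - {j}. h i) = 0" using uniq[OF j(1) _ j(2)] by (intro sum.neutral) auto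
    finally show ?thesis unfolding eq using hv[OF j(1)] by simp
  next
    case False
    then have "(\<Sum>j<length b. h j) = 0" by (intro sum.neutral) auto
    then show ?thesis unfolding eq by simp
  qed
qed

lemma antidiagonal_list_monom:
  assumes "length a = length b"
  shows "antidiagonal (a, b) = list_monom (zip a (rev b))"
  using assms by (simp add: list_monom_def sum_list_sum_nth atLeast0LessThan)

lemma keys_uminus: "Poly_Mapping.keys (- f) = Poly_Mapping.keys (f :: 'b \<Rightarrow>\<^sub>0 'k::ab_group_add)"
  by (auto simp: in_keys_iff)

lemma gmin_rev_sign:
  assumes "distinct a" "distinct b" "length a = length b"
  shows "gmin a (rev b) = (gmin a b :: ('r \<times> 'c, 'k::comm_ring_1) mpoly) \<or> gmin a (rev b) = - (gmin a b :: ('r \<times> 'c, 'k) mpoly)"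
  unfolding gmin_def using lm_up_to_sign[of a a b "rev b"] assms by simp

text \<open>Numbering the columns backwards turns the weight \<open>wt\<close>, which favours
  diagonals, into one that favours antidiagonals.\<close>

definition antidiagonal_weight :: "'r::{finite,linorder} \<times> 'c::{finite,linorder} \<Rightarrow> real" where
  "antidiagonal_weight v = real (rk (fst v) * (CARD('c) - Suc (rk (snd v))))"

lemma rk_less_card: "rk (x :: 'a::{finite,linorder}) < CARD('a)"
  unfolding rk_def by (rule psubset_card_mono) auto

lemma gmin_antidiagonal:
  fixes a :: "'r::{finite,linorder} list" and b :: "'c::{finite,linorder} list"
  assumes m: "sorted_wrt (<) a" "sorted_wrt (<) b" "length a = length b"
  shows "Poly_Mapping.lookup (gmin a b :: ('r \<times> 'c, 'k::comm_ring_1) mpoly) (antidiagonal (a, b)) \<in> {1, - 1}"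
    and "s \<in> Poly_Mapping.keys (gmin a b :: ('r \<times> 'c, 'k) mpoly) \<Longrightarrow> s \<noteq> antidiagonal (a, b) \<Longrightarrow>
      weight antidiagonal_weight s < weight antidiagonal_weight (antidiagonal (a, b))"
proof -
  let ?g = "\<lambda>c :: 'c. CARD('c) - Suc (rk c)"
  have g: "?g y < ?g z \<longleftrightarrow> z < y" for y z
    using rk_less_card[of y] rk_less_card[of z] rk_less[of z y] by linarith
  interpret matrix_order "rk :: 'r \<Rightarrow> nat" ?g
  proof
    show "inj (rk :: 'r \<Rightarrow> nat)" by (rule inj_rk)
    show "inj ?g"
    proof (rule injI)
      fix y z :: 'c assume "?g y = ?g z"
      then have "\<not> z < y" "\<not> y < z" using g[of y z] g[of z y] by linarith+
      then show "y = z" by simp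
    qed
  qed
  have wt: "wt = antidiagonal_weight" by (rule ext) (simp add: wt_def antidiagonal_weight_def)
  have d: "distinct a" "distinct b" using m strict_sorted_iff by blast+
  have ad: "antidiagonal (a, b) = list_monom (zip a (rev b))" by (rule antidiagonal_list_monom[OF m(3)])
  have ap: "approx wt (weight wt (antidiagonal (a, b))) (gmin a (rev b)) (monom_poly (antidiagonal (a, b)) :: ('r \<times> 'c, 'k) mpoly)"
    unfolding ad
  proof (rule gmin_approx)
    show "length a = length (rev b)" using m(3) by simp
    show "sorted_wrt (\<lambda>y z. rk y < rk z) a" using m(1) by (simp only: rk_less)
    show "sorted_wrt (\<lambda>y z. ?g y < ?g z) (rev b)" using m(2) by (simp only: g sorted_wrt_rev)
  qed
  have l: "Poly_Mapping.lookup (gmin a (rev b) :: ('r \<times> 'c, 'k) mpoly) (antidiagonal (a, b)) = 1"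
    using approx_lookup[OF ap order_refl] by (simp add: monom_poly_def)
  note sg = gmin_rev_sign[OF d m(3), where 'k = 'k]
  show "Poly_Mapping.lookup (gmin a b :: ('r \<times> 'c, 'k) mpoly) (antidiagonal (a, b)) \<in> {1, - 1}"
    using sg
  proof (elim disjE)
    assume eq: "gmin a (rev b) = (gmin a b :: ('r \<times> 'c, 'k) mpoly)"
    show ?thesis using l unfolding eq by simp
  next
    assume eq: "gmin a (rev b) = - (gmin a b :: ('r \<times> 'c, 'k) mpoly)"
    show ?thesis using l unfolding eq lookup_uminus minus_equation_iff[of _ 1] by simp
  qed
  assume s: "s \<in> Poly_Mapping.keys (gmin a b :: ('r \<times> 'c, 'k) mpoly)" "s \<noteq> antidiagonal (a, b)"
  have "Poly_Mapping.keys (gmin a (rev b) :: ('r \<times> 'c, 'k) mpoly) = Poly_Mapping.keys (gmin a b :: ('r \<times> 'c, 'k) mpoly)"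
    using sg by (elim disjE) (simp_all only: keys_uminus)
  then have "s \<in> Poly_Mapping.keys (gmin a (rev b) :: ('r \<times> 'c, 'k) mpoly)" using s(1) by (simp only:)
  then have "Poly_Mapping.lookup (gmin a (rev b) :: ('r \<times> 'c, 'k) mpoly) s \<noteq> 0" unfolding in_keys_iff .
  then have "s \<in> Poly_Mapping.keys (gmin a (rev b) - monom_poly (antidiagonal (a, b)) :: ('r \<times> 'c, 'k) mpoly)"
    using s(2) unfolding in_keys_iff lookup_minus monom_poly_def lookup_single by (simp add: when_def)
  then show "weight antidiagonal_weight s < weight antidiagonal_weight (antidiagonal (a, b))"
    using ap unfolding approx_def wt by blast
qed

text \<open>The order is antidiagonal over \<open>'k\<close>, but it is applied over other
  coefficient rings as well. The coefficients of a minor are the images of -1, 0 and 1, so a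
  monomial that occurs over \<open>'l\<close> also occurs over \<open>'k\<close>.\<close>

lemma minors_signed_initial:
  assumes leq: "antidiagonal_order (TYPE('k::field)) (leq :: ('r::{finite,linorder} \<times> 'c::{finite,linorder}) monom \<Rightarrow> _)"
    and ab: "(a, b) \<in> minors"
  shows "signed_initial leq (gmin a b :: ('r \<times> 'c, 'l::comm_ring_1) mpoly) (antidiagonal (a, b))"
proof -
  have m: "sorted_wrt (<) a" "sorted_wrt (<) b" "length a = length b" using ab by (auto simp: minors_def)
  have d: "distinct a" "distinct b" using m strict_sorted_iff by blast+
  have "leq s (antidiagonal (a, b))" if "s \<in> Poly_Mapping.keys (gmin a b :: ('r \<times> 'c, 'l) mpoly)" for s
  proof -
    have "Poly_Mapping.lookup (gmin a b :: ('r \<times> 'c, int) mpoly) s \<noteq> 0"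
      using that unfolding in_keys_iff lookup_gmin_of_int[OF m(3), where 'k = 'l] by auto
    then have "Poly_Mapping.lookup (gmin a b :: ('r \<times> 'c, int) mpoly) s = 1 \<or> Poly_Mapping.lookup (gmin a b :: ('r \<times> 'c, int) mpoly) s = - 1"
      using lookup_gmin_int[OF m(3) d, of s] by blast
    then have "s \<in> Poly_Mapping.keys (gmin a b :: ('r \<times> 'c, 'k) mpoly)"
      unfolding in_keys_iff lookup_gmin_of_int[OF m(3), where 'k = 'k] by auto
    then show ?thesis
      using leq ab unfolding antidiagonal_order_def is_initial_monom_def minor_poly_gmin[symmetric] by blast
  qed
  then show ?thesis unfolding signed_initial_def using gmin_antidiagonal(1)[OF m, where 'k = 'l] by blast
qed

section \<open>A term order\<close>

definition nat_monom :: "'v::finite monom \<Rightarrow> nat \<Rightarrow>\<^sub>0 nat" where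
  "nat_monom t = (\<Sum>v\<in>UNIV. Poly_Mapping.single (to_nat_on (UNIV :: 'v set) v) (Poly_Mapping.lookup t v))"

lemma nat_monom_add: "nat_monom (s + t) = nat_monom s + nat_monom t"
  by (simp add: nat_monom_def lookup_add single_add sum.distrib)

lemma nat_monom_0: "nat_monom 0 = 0"
  by (simp add: nat_monom_def)

lemma inj_nat_monom: "nat_monom s = nat_monom t \<Longrightarrow> s = t"
proof (rule poly_mapping_eqI)
  fix v :: 'a
  have inj: "to_nat_on (UNIV :: 'a set) u = to_nat_on UNIV v \<longleftrightarrow> u = v" for u v
    by (simp add: countable_finite)
  have l: "Poly_Mapping.lookup (nat_monom r) (to_nat_on (UNIV :: 'a set) v) = Poly_Mapping.lookup r v" for r
    by (simp add: nat_monom_def lookup_sum lookup_single inj when_def)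
  assume "nat_monom s = nat_monom t"
  then show "Poly_Mapping.lookup s v = Poly_Mapping.lookup t v" using l[of s] l[of t] by simp
qed

lemma nat_poly_mapping_nonneg: "0 \<le> (f :: nat \<Rightarrow>\<^sub>0 nat)"
proof (cases "f = 0")
  case False
  define k where "k = (LEAST n. Poly_Mapping.lookup f n \<noteq> 0)"
  from False have "\<exists>n. Poly_Mapping.lookup f n \<noteq> 0" using poly_mapping_eqI[of f 0] by (auto simp only: lookup_zero)
  then have k: "Poly_Mapping.lookup f k \<noteq> 0" unfolding k_def by (rule LeastI_ex)
  have l: "Poly_Mapping.lookup f n = 0" if "n < k" for n
    using not_less_Least[OF that[unfolded k_def]] by simp
  have "Poly_Mapping.lookup 0 k < Poly_Mapping.lookup f k" using k by simp
  moreover have "\<forall>n<k. Poly_Mapping.lookup 0 n = Poly_Mapping.lookup f n" using l by simp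
  ultimately have "less_fun (Poly_Mapping.lookup 0) (Poly_Mapping.lookup f)"
    unfolding less_fun_def by blast
  then have "0 < f" by (simp only: less_poly_mapping.rep_eq)
  then show ?thesis by simp
qed simp

text \<open>The weight makes antidiagonals initial, and the comparison of \<open>nat_monom\<close>
  breaks ties. This supplies the term order for \<open>knutson_poly\<close> and for the splitting
  behind purity.\<close>

definition weighted_lex :: "('v \<Rightarrow> real) \<Rightarrow> 'v::finite monom \<Rightarrow> 'v monom \<Rightarrow> bool" where
  "weighted_lex w s t \<longleftrightarrow> weight w s < weight w t \<or> weight w s = weight w t \<and> nat_monom s \<le> nat_monom t"

lemma term_order_weighted_lex:
  assumes "\<And>v. 0 \<le> w v"
  shows "term_order (weighted_lex w)"
proof -
  have lin: "class.linorder (weighted_lex w) (\<lambda>s t. weighted_lex w s t \<and> s \<noteq> t)"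
  proof
    fix s t u :: "'a monom"
    show "weighted_lex w s s" by (simp add: weighted_lex_def)
    show "weighted_lex w s t \<Longrightarrow> weighted_lex w t u \<Longrightarrow> weighted_lex w s u"
      using order_trans[of "nat_monom s" "nat_monom t" "nat_monom u"] unfolding weighted_lex_def by argo
    show "weighted_lex w s t \<Longrightarrow> weighted_lex w t s \<Longrightarrow> s = t"
      using inj_nat_monom[of s t] antisym[of "nat_monom s" "nat_monom t"] unfolding weighted_lex_def by argo
    then show "(weighted_lex w s t \<and> s \<noteq> t) = (weighted_lex w s t \<and> \<not> weighted_lex w t s)"
      using \<open>weighted_lex w s s\<close> by blast
    show "weighted_lex w s t \<or> weighted_lex w t s"
      using linear[of "nat_monom s" "nat_monom t"] unfolding weighted_lex_def by argo
  qed
  have pos: "0 \<le> weight w t" for t :: "'a monom" unfolding weight_def by (rule sum_nonneg) (simp add: assms)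
  have "weighted_lex w 0 t" for t
  proof -
    have "0 < weight w t \<or> 0 = weight w t" using pos[of t] by linarith
    then show ?thesis
      unfolding weighted_lex_def nat_monom_0 weight_0 using nat_poly_mapping_nonneg[of "nat_monom t"] by blast
  qed
  moreover have "weighted_lex w (s + u) (t + u)" if st: "weighted_lex w s t" for s t u
    using st unfolding weighted_lex_def
  proof (elim disjE conjE)
    assume "weight w s < weight w t"
    then show "weight w (s + u) < weight w (t + u) \<or> weight w (s + u) = weight w (t + u) \<and> nat_monom (s + u) \<le> nat_monom (t + u)"
      unfolding weight_add by simp
  next
    assume "weight w s = weight w t" "nat_monom s \<le> nat_monom t"
    then show "weight w (s + u) < weight w (t + u) \<or> weight w (s + u) = weight w (t + u) \<and> nat_monom (s + u) \<le> nat_monom (t + u)"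
      unfolding weight_add nat_monom_add by (intro disjI2 conjI add_right_mono) simp_all
  qed
  ultimately show ?thesis unfolding term_order_def using lin by blast
qed

lemma weighted_lex_gmin:
  assumes "sorted_wrt (<) a" "sorted_wrt (<) b" "length a = length b"
  shows "signed_initial (weighted_lex antidiagonal_weight)
    (gmin a b :: ('r::{finite,linorder} \<times> 'c::{finite,linorder}, 'k::comm_ring_1) mpoly) (antidiagonal (a, b))"
proof -
  have "weighted_lex antidiagonal_weight s (antidiagonal (a, b))"
    if "s \<in> Poly_Mapping.keys (gmin a b :: ('r \<times> 'c, 'k) mpoly)" for s
    using gmin_antidiagonal(2)[OF assms that] unfolding weighted_lex_def by (cases "s = antidiagonal (a, b)") blast+
  then show ?thesis unfolding signed_initial_def using gmin_antidiagonal(1)[OF assms, where 'k = 'k] by blast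
qed

section \<open>The initial monomial of the polynomial\<close>

lemma nth_rk: "sorted_list_of_set UNIV ! rk (x :: 'a::{finite,linorder}) = x"
proof -
  have d1: "downset {..<x}" and d2: "downset {..x}" by (auto simp: downset_def)
  have "{..x} = insert x {..<x}" by auto
  then have c: "card {..x} = Suc (card {..<x})" by simp
  have rk: "rk x = card {..<x}" by (simp add: rk_def lessThan_def)
  have "\<not> sorted_list_of_set UNIV ! rk x < x" using nth_sorted_list_downset[OF d1 rk_less_card[of x]] rk by simp
  moreover have "sorted_list_of_set UNIV ! rk x \<le> x" using nth_sorted_list_downset[OF d2 rk_less_card[of x]] rk c by simp
  ultimately show ?thesis by simp
qed

lemma rk_nth: "i < CARD('a) \<Longrightarrow> rk (sorted_list_of_set UNIV ! i :: 'a::{finite,linorder}) = i"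
proof -
  assume i: "i < CARD('a)"
  let ?l = "sorted_list_of_set UNIV :: 'a list"
  have "?l ! rk (?l ! i) = ?l ! i" by (rule nth_rk)
  then show ?thesis using i rk_less_card[of "?l ! i"] by (subst (asm) nth_eq_iff_index_eq) simp_all
qed

lemma map_rk_interval:
  "map rk (sorted_list_of_set {y :: 'a::{finite,linorder}. lo \<le> rk y \<and> rk y < hi}) = [lo..<min hi CARD('a)]"
proof (rule sorted_distinct_set_unique)
  let ?l = "sorted_list_of_set {y :: 'a. lo \<le> rk y \<and> rk y < hi}"
  have "sorted_wrt (<) (map rk ?l)"
    unfolding sorted_wrt_map rk_less by (rule sorted_list_of_set.strict_sorted_key_list_of_set)
  then show "sorted (map rk ?l)" "distinct (map rk ?l)" by (simp_all only: strict_sorted_iff)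
  have "i \<in> rk ` {y :: 'a. lo \<le> rk y \<and> rk y < hi}" if "lo \<le> i" "i < hi" "i < CARD('a)" for i
    by (rule image_eqI[of _ _ "sorted_list_of_set UNIV ! i"]) (use that rk_nth[OF that(3)] in simp_all)
  then show "set (map rk ?l) = set [lo..<min hi CARD('a)]"
    using rk_less_card[where 'a = 'a] by auto
qed simp_all

lemma cyc_eq_Inr: "(cyc i :: 'c::{finite,linorder} + 'r::{finite,linorder}) = Inr r \<longleftrightarrow>
    i mod (CARD('c) + CARD('r)) = CARD('r) - Suc (rk r)"
proof -
  have p: "CARD('r) - Suc (rk r) < CARD('r)" using rk_less_card[of r] by linarith
  have "CARD('r) - Suc (CARD('r) - Suc (rk r)) = rk r" using rk_less_card[of r] by linarith
  then have "(cyc (CARD('r) - Suc (rk r)) :: 'c + 'r) = Inr r" unfolding cyc_row[OF p] by (simp only: nth_rk)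
  then have "(cyc i :: 'c + 'r) = Inr r \<longleftrightarrow> (cyc i :: 'c + 'r) = cyc (CARD('r) - Suc (rk r))" by simp
  also have "\<dots> \<longleftrightarrow> i mod (CARD('c) + CARD('r)) = CARD('r) - Suc (rk r)"
    unfolding cyc_eq_iff by (subst (2) mod_less) (use p in linarith, rule refl)
  finally show ?thesis .
qed

lemma cyc_eq_Inl: "(cyc i :: 'c::{finite,linorder} + 'r::{finite,linorder}) = Inl c \<longleftrightarrow>
    i mod (CARD('c) + CARD('r)) = CARD('r) + (CARD('c) - Suc (rk c))"
proof -
  have p: "CARD('c) - Suc (rk c) < CARD('c)" using rk_less_card[of c] by linarith
  have "CARD('c) - Suc (CARD('c) - Suc (rk c)) = rk c" using rk_less_card[of c] by linarith
  then have "(cyc (CARD('r) + (CARD('c) - Suc (rk c))) :: 'c + 'r) = Inl c" unfolding cyc_col[OF p] by (simp only: nth_rk)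
  then have "(cyc i :: 'c + 'r) = Inl c \<longleftrightarrow> (cyc i :: 'c + 'r) = cyc (CARD('r) + (CARD('c) - Suc (rk c)))" by simp
  also have "\<dots> \<longleftrightarrow> i mod (CARD('c) + CARD('r)) = CARD('r) + (CARD('c) - Suc (rk c))" unfolding cyc_eq_iff using p by simp
  finally show ?thesis .
qed

lemma mod_eq_cases:
  assumes "(i :: nat) < 2 * N" "p < N"
  shows "i mod N = p \<longleftrightarrow> i = p \<or> i = N + p"
proof (cases "i < N")
  case False
  then have "i mod N = i - N" using assms by (simp add: mod_if)
  then show ?thesis using False assms by auto
qed (use assms in auto)

text \<open>The window ends before the cycle has been run through twice, so an identity column can
  occur only at the two positions \<open>m - Suc j\<close> and
  \<open>n + m + (m - Suc j)\<close>.\<close>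

lemma Inr_in_window:
  fixes r :: "'r::{finite,linorder}"
  assumes x: "x \<in> {1..<CARD('r) + CARD('c)}"
  shows "Inr r \<notin> (window x CARD('r) :: ('c::{finite,linorder} + 'r) set) \<longleftrightarrow>
    CARD('r) - x \<le> rk r \<and> rk r < CARD('r) + CARD('c) - x"
proof -
  define m where "m = CARD('r)"
  define n where "n = CARD('c)"
  define j where "j = rk r"
  have j: "j < m" unfolding m_def j_def by (rule rk_less_card)
  have n: "0 < n" unfolding n_def by simp
  have x': "1 \<le> x" "x < m + n" using x unfolding m_def n_def by simp_all
  have "Inr r \<in> (window x CARD('r) :: ('c + 'r) set) \<longleftrightarrow> (\<exists>i\<in>{x..<x + m}. (cyc i :: 'c + 'r) = Inr r)"
    unfolding window_def image_iff m_def by (rule bex_cong[OF refl], rule eq_commute)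
  also have "\<dots> \<longleftrightarrow> (\<exists>i\<in>{x..<x + m}. i = m - Suc j \<or> i = n + m + (m - Suc j))"
    unfolding cyc_eq_Inr m_def[symmetric] n_def[symmetric] j_def[symmetric]
    by (rule bex_cong[OF refl], rule mod_eq_cases) (use x' j in auto)
  also have "\<dots> \<longleftrightarrow> m - Suc j \<in> {x..<x + m} \<or> n + m + (m - Suc j) \<in> {x..<x + m}" by blast
  also have "\<dots> \<longleftrightarrow> \<not> (m - x \<le> j \<and> j < m + n - x)" unfolding atLeastLessThan_iff using x' j n by auto
  finally show ?thesis unfolding m_def n_def j_def by blast
qed

lemma Inl_in_window:
  fixes c :: "'c::{finite,linorder}"
  assumes x: "x \<in> {1..<CARD('r) + CARD('c)}"
  shows "Inl c \<in> (window x CARD('r) :: ('c + 'r::{finite,linorder}) set) \<longleftrightarrow>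
    CARD('c) - x \<le> rk c \<and> rk c < CARD('r) + CARD('c) - x"
proof -
  define m where "m = CARD('r)"
  define n where "n = CARD('c)"
  define j where "j = rk c"
  have j: "j < n" unfolding n_def j_def by (rule rk_less_card)
  have m: "0 < m" unfolding m_def by simp
  have x': "1 \<le> x" "x < m + n" using x unfolding m_def n_def by simp_all
  have "Inl c \<in> (window x CARD('r) :: ('c + 'r) set) \<longleftrightarrow> (\<exists>i\<in>{x..<x + m}. (cyc i :: 'c + 'r) = Inl c)"
    unfolding window_def image_iff m_def by (rule bex_cong[OF refl], rule eq_commute)
  also have "\<dots> \<longleftrightarrow> (\<exists>i\<in>{x..<x + m}. i = m + (n - Suc j) \<or> i = n + m + (m + (n - Suc j)))"
    unfolding cyc_eq_Inl m_def[symmetric] n_def[symmetric] j_def[symmetric]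
    by (rule bex_cong[OF refl], rule mod_eq_cases) (use x' j in auto)
  also have "\<dots> \<longleftrightarrow> m + (n - Suc j) \<in> {x..<x + m} \<or> n + m + (m + (n - Suc j)) \<in> {x..<x + m}" by blast
  also have "\<dots> \<longleftrightarrow> n - x \<le> j \<and> j < m + n - x" unfolding atLeastLessThan_iff using x' j m by auto
  finally show ?thesis unfolding m_def n_def j_def .
qed

lemma antidiagonal_arith:
  fixes m n x i r c :: nat
  assumes "1 \<le> x" "x < m + n" "i < min (m + n - x) m - (m - x)" "r < m" "c < n"
  shows "(m - x + i = r \<and> n - x + (min (m + n - x) n - (n - x) - Suc i) = c) = (i = r - (m - x) \<and> r + c + x + 1 = m + n)"
proof (cases "x \<le> m")
  case True
  then obtain d where m: "m = x + d" using le_Suc_ex by blast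
  have mn: "min (m + n - x) n = n" using m by simp
  show ?thesis
  proof (cases "x \<le> n")
    case True
    then obtain e where n: "n = x + e" using le_Suc_ex by blast
    show ?thesis using assms unfolding mn unfolding m n min_def by auto
  next
    case False
    then show ?thesis using assms unfolding mn unfolding m min_def by auto
  qed
next
  case F: False
  then have "m \<le> x" by simp
  then obtain d where d: "x = m + d" using le_Suc_ex by blast
  show ?thesis
  proof (cases "x \<le> n")
    case True
    then obtain e where n: "n = x + e" using le_Suc_ex by blast
    show ?thesis using assms unfolding d n min_def by auto
  next
    case False
    then show ?thesis using assms F unfolding d min_def by (auto split: if_splits)
  qed
qed

definition window_monom :: "nat \<Rightarrow> ('r::{finite,linorder} \<times> 'c::{finite,linorder}) monom" where
  "window_monom x = antidiagonal (sorted_list_of_set {r :: 'r. Inr r \<notin> (window x CARD('r) :: ('c + 'r) set)},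
     sorted_list_of_set {c :: 'c. Inl c \<in> (window x CARD('r) :: ('c + 'r) set)})"

text \<open>Rows and columns of a window minor are intervals, and its antidiagonal fills the line
  \<open>rk r + rk c = CARD('r) + CARD('c) - 1 - x\<close>. As \<open>x\<close> varies, these lines
  pass through every cell of the matrix exactly once, which is why the product of the antidiagonals
  is squarefree.\<close>

lemma window_minor_index:
  assumes x: "x \<in> {1..<CARD('r) + CARD('c)}"
  shows "(sorted_list_of_set {r :: 'r::{finite,linorder}. Inr r \<notin> (window x CARD('r) :: ('c::{finite,linorder} + 'r) set)},
     sorted_list_of_set {c :: 'c. Inl c \<in> (window x CARD('r) :: ('c + 'r) set)}) \<in> minors" (is "(?A, ?B) \<in> _")
    and "Poly_Mapping.lookup (window_monom x :: ('r \<times> 'c) monom) (r, c) =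
      (if rk r + rk c + x + 1 = CARD('r) + CARD('c) then 1 else 0)"
proof -
  define m where "m = CARD('r)"
  define n where "n = CARD('c)"
  have mn: "0 < m" "0 < n" unfolding m_def n_def by simp_all
  have x': "1 \<le> x" "x < m + n" using x unfolding m_def n_def by simp_all
  have A: "map rk ?A = [m - x..<min (m + n - x) m]"
    unfolding Inr_in_window[OF x] m_def n_def by (rule map_rk_interval)
  have B: "map rk ?B = [n - x..<min (m + n - x) n]"
    unfolding Inl_in_window[OF x] m_def n_def by (rule map_rk_interval)
  have len: "length ?A = length ?B" by (rule window_minor_gmin(1))
  have lA: "length ?A = min (m + n - x) m - (m - x)" using arg_cong[OF A, of length] by (simp only: length_map length_upt)
  have lB: "length ?B = min (m + n - x) n - (n - x)" using arg_cong[OF B, of length] by (simp only: length_map length_upt)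
  have "0 < length ?A" unfolding lA using x' mn by linarith
  then show "(?A, ?B) \<in> minors"
    unfolding minors_def mem_Collect_eq prod.case length_greater_0_conv
    using len by (intro conjI sorted_list_of_set.strict_sorted_key_list_of_set)
  let ?c = "rk r + rk c + x + 1 = m + n"
  have r: "rk r < m" and c: "rk c < n" unfolding m_def n_def by (rule rk_less_card)+
  have eq: "((?A ! i, rev ?B ! i) = (r, c)) \<longleftrightarrow> i = rk r - (m - x) \<and> ?c" if i: "i < length ?A" for i
  proof -
    have 1: "rk (?A ! i) = m - x + i"
      using arg_cong[OF A, of "\<lambda>l. l ! i"] i lA by (simp only: nth_map nth_upt)
    have i': "length ?B - Suc i < length ?B" using i len by linarith
    have "rk (?B ! (length ?B - Suc i)) = map rk ?B ! (length ?B - Suc i)" by (rule nth_map[symmetric]) (rule i')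
    also have "\<dots> = n - x + (length ?B - Suc i)" unfolding B by (rule nth_upt) (use i' lB in linarith)
    finally have 2: "rk (rev ?B ! i) = n - x + (length ?B - Suc i)" using i len by (simp only: rev_nth)
    have "((?A ! i, rev ?B ! i) = (r, c)) \<longleftrightarrow> rk (?A ! i) = rk r \<and> rk (rev ?B ! i) = rk c"
      by (simp only: prod.inject inj_eq[OF inj_rk])
    also have "\<dots> \<longleftrightarrow> m - x + i = rk r \<and> n - x + (min (m + n - x) n - (n - x) - Suc i) = rk c"
      unfolding 1 2 lB ..
    also have "\<dots> \<longleftrightarrow> i = rk r - (m - x) \<and> ?c"
      by (rule antidiagonal_arith[OF x' i[unfolded lA] r c])
    finally show ?thesis .
  qed
  have "Poly_Mapping.lookup (window_monom x :: ('r \<times> 'c) monom) (r, c) = (\<Sum>i<length ?A. if (?A ! i, rev ?B ! i) = (r, c) then 1 else 0)"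
    unfolding window_monom_def antidiagonal.simps lookup_sum lookup_single when_def ..
  also have "\<dots> = (\<Sum>i<length ?A. if i = rk r - (m - x) then (if ?c then 1 else 0) else 0)"
    by (rule sum.cong[OF refl]) (use eq in auto)
  also have "\<dots> = (if rk r - (m - x) < length ?A then (if ?c then 1 else 0) else 0)"
    by (subst sum.delta) auto
  also have "\<dots> = (if ?c then 1 else 0)"
  proof -
    have "rk r - (m - x) < length ?A" if ?c unfolding lA using that r c x' by linarith
    then show ?thesis by auto
  qed
  finally show "Poly_Mapping.lookup (window_monom x :: ('r \<times> 'c) monom) (r, c) =
      (if rk r + rk c + x + 1 = CARD('r) + CARD('c) then 1 else 0)" unfolding m_def n_def .
qed

lemma sum_window_monom:
  "Poly_Mapping.lookup (\<Sum>x\<in>{1..<CARD('r) + CARD('c)}. window_monom x :: ('r::{finite,linorder} \<times> 'c::{finite,linorder}) monom) v = 1"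
proof -
  obtain r c where v: "v = (r, c)" by (cases v)
  define x where "x = CARD('r) + CARD('c) - (rk r + rk c + 1)"
  have rc: "rk r < CARD('r)" "rk c < CARD('c)" by (rule rk_less_card)+
  have "Poly_Mapping.lookup (\<Sum>x\<in>{1..<CARD('r) + CARD('c)}. window_monom x :: ('r \<times> 'c) monom) v =
      (\<Sum>y\<in>{1..<CARD('r) + CARD('c)}. if rk r + rk c + y + 1 = CARD('r) + CARD('c) then 1 else 0)"
    unfolding lookup_sum v by (rule sum.cong[OF refl]) (rule window_minor_index(2))
  also have "\<dots> = (\<Sum>y\<in>{1..<CARD('r) + CARD('c)}. if y = x then 1 else 0)"
    by (rule sum.cong[OF refl]) (use rc in \<open>auto simp: x_def\<close>)
  also have "\<dots> = 1" using rc by (subst sum.delta) (auto simp: x_def)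
  finally show ?thesis .
qed

lemma cyc_poly_signed_initial:
  assumes to: "term_order leq"
    and init: "\<And>a b. (a, b) \<in> minors \<Longrightarrow>
      signed_initial leq (gmin a b :: ('r::{finite,linorder} \<times> 'c::{finite,linorder}, 'k::comm_ring_1) mpoly) (antidiagonal (a, b))"
  shows "signed_initial leq (cyc_poly :: ('r \<times> 'c, 'k) mpoly) (\<Sum>x\<in>{1..<CARD('r) + CARD('c)}. window_monom x)"
  unfolding cyc_poly_def
proof (rule signed_initial_prod[OF to])
  fix x assume x: "x \<in> {1..<CARD('r) + CARD('c)}"
  let ?A = "sorted_list_of_set {r :: 'r. Inr r \<notin> (window x CARD('r) :: ('c + 'r) set)}"
  let ?B = "sorted_list_of_set {c :: 'c. Inl c \<in> (window x CARD('r) :: ('c + 'r) set)}"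
  have *: "signed_initial leq (gmin ?A ?B :: ('r \<times> 'c, 'k) mpoly) (window_monom x)"
    unfolding window_monom_def by (rule init[OF window_minor_index(1)[OF x]])
  have "window_minor x = (gmin ?A ?B :: ('r \<times> 'c, 'k) mpoly) \<or> window_minor x = - (gmin ?A ?B :: ('r \<times> 'c, 'k) mpoly)"
    by (rule window_minor_gmin(2))
  then show "signed_initial leq (window_minor x :: ('r \<times> 'c, 'k) mpoly) (window_monom x)"
  proof (elim disjE)
    assume eq: "window_minor x = (gmin ?A ?B :: ('r \<times> 'c, 'k) mpoly)"
    show ?thesis unfolding eq by (rule *)
  next
    assume eq: "window_minor x = - (gmin ?A ?B :: ('r \<times> 'c, 'k) mpoly)"
    show ?thesis unfolding eq signed_initial_uminus by (rule *)
  qed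
qed

lemma homogeneous_window_minor:
  "homogeneous (window_minor x :: ('r::{finite,linorder} \<times> 'c::{finite,linorder}, 'k::comm_ring_1) mpoly)"
proof -
  let ?A = "sorted_list_of_set {r :: 'r. Inr r \<notin> (window x CARD('r) :: ('c + 'r) set)}"
  let ?B = "sorted_list_of_set {c :: 'c. Inl c \<in> (window x CARD('r) :: ('c + 'r) set)}"
  have "window_minor x = (gmin ?A ?B :: ('r \<times> 'c, 'k) mpoly) \<or> window_minor x = - (gmin ?A ?B :: ('r \<times> 'c, 'k) mpoly)"
    by (rule window_minor_gmin(2))
  then have eq: "Poly_Mapping.keys (window_minor x :: ('r \<times> 'c, 'k) mpoly) = Poly_Mapping.keys (gmin ?A ?B :: ('r \<times> 'c, 'k) mpoly)"
    by (elim disjE) (simp_all only: keys_uminus)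
  have "length ?A = length ?B" by (rule window_minor_gmin(1))
  then have "\<forall>t\<in>Poly_Mapping.keys (gmin ?A ?B :: ('r \<times> 'c, 'k) mpoly). monom_degree t = length ?A"
    by (intro ballI keys_gmin(2))
  then show ?thesis unfolding homogeneous_def eq by (rule exI)
qed

lemma monom_degree_weight: "real (monom_degree t) = weight (\<lambda>_. 1) t"
  by (simp add: monom_degree_def weight_def)

lemma monom_degree_add: "monom_degree (s + t) = monom_degree s + monom_degree t"
proof -
  have "real (monom_degree (s + t)) = real (monom_degree s + monom_degree t)"
    by (simp only: monom_degree_weight weight_add of_nat_add)
  then show ?thesis by (simp only: of_nat_eq_iff)
qed

lemma homogeneous_prod:
  fixes h :: "'b \<Rightarrow> ('v, 'k::comm_ring_1) mpoly"
  assumes "\<And>x. x \<in> A \<Longrightarrow> homogeneous (h x)"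
  shows "homogeneous (prod h A)"
  using assms
proof (induction A rule: infinite_finite_induct)
  case (insert x A)
  obtain d where d: "\<forall>t\<in>Poly_Mapping.keys (h x). monom_degree t = d"
    using insert.prems[OF insertI1] unfolding homogeneous_def by (rule exE)
  obtain e where e: "\<forall>t\<in>Poly_Mapping.keys (prod h A). monom_degree t = e"
    using insert.IH[OF insert.prems[OF insertI2]] unfolding homogeneous_def by (rule exE)
  have "monom_degree t = d + e" if "t \<in> Poly_Mapping.keys (h x * prod h A)" for t
    by (rule in_keys_multE[OF that]) (use d e in \<open>simp add: monom_degree_add\<close>)
  then show ?case unfolding prod.insert[OF insert.hyps] homogeneous_def by blast
qed (simp_all add: homogeneous_def in_keys_iff lookup_one when_def)

lemma knutson_poly_cyc_poly:
  "knutson_poly (cyc_poly :: ('r::{finite,linorder} \<times> 'c::{finite,linorder}, 'k::field) mpoly)"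
proof -
  define leq where "leq = weighted_lex (antidiagonal_weight :: 'r \<times> 'c \<Rightarrow> real)"
  define T where "T = (\<Sum>x\<in>{1..<CARD('r) + CARD('c)}. window_monom x :: ('r \<times> 'c) monom)"
  have hom: "homogeneous (cyc_poly :: ('r \<times> 'c, 'k) mpoly)"
    unfolding cyc_poly_def by (rule homogeneous_prod) (rule homogeneous_window_minor)
  have to: "term_order leq"
    unfolding leq_def by (rule term_order_weighted_lex) (simp add: antidiagonal_weight_def)
  have "signed_initial leq (gmin a b :: ('r \<times> 'c, 'k) mpoly) (antidiagonal (a, b))" if "(a, b) \<in> minors" for a b
    unfolding leq_def by (rule weighted_lex_gmin) (use that in \<open>simp_all add: minors_def\<close>)
  then have "signed_initial leq (cyc_poly :: ('r \<times> 'c, 'k) mpoly) T"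
    unfolding T_def by (rule cyc_poly_signed_initial[OF to])
  then have "is_initial_monom leq (cyc_poly :: ('r \<times> 'c, 'k) mpoly) T"
    unfolding signed_initial_def is_initial_monom_def in_keys_iff by auto
  moreover have "squarefree_monom T" unfolding squarefree_monom_def T_def sum_window_monom by simp
  ultimately show ?thesis unfolding knutson_poly_def using hom to by blast
qed

section \<open>Traces\<close>

definition scale :: "nat \<Rightarrow> 'v monom \<Rightarrow> 'v monom" where
  "scale n t = (\<Sum>i<n. t)"

lemma lookup_scale [simp]: "Poly_Mapping.lookup (scale n t) v = n * Poly_Mapping.lookup t v"
  by (simp add: scale_def lookup_sum)

lemma scale_add: "scale n (s + t) = scale n s + scale n t"
  by (simp add: scale_def sum.distrib)

lemma scale_0 [simp]: "scale n 0 = 0"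
  by (simp add: scale_def)

lemma inj_scale: "0 < n \<Longrightarrow> scale n s = scale n t \<longleftrightarrow> s = t"
proof -
  assume n: "0 < n"
  have "s = t" if "scale n s = scale n t"
  proof (rule poly_mapping_eqI)
    fix v
    have "n * Poly_Mapping.lookup s v = n * Poly_Mapping.lookup t v"
      using arg_cong[OF that, of "\<lambda>t. Poly_Mapping.lookup t v"] by (simp only: lookup_scale)
    then show "Poly_Mapping.lookup s v = Poly_Mapping.lookup t v" using n by simp
  qed
  then show ?thesis by blast
qed

lemma scale_mono:
  assumes "term_order leq" "leq s t"
  shows "leq (scale n s) (scale n t)"
proof (induction n)
  case 0
  then show ?case by (simp add: scale_def term_orderD(1)[OF assms(1)])
next
  case (Suc n)
  have S: "scale (Suc n) u = scale n u + u" for u :: "'a monom" by (simp add: scale_def)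
  have "leq (scale n s + s) (scale n t + s)" by (rule term_orderD(6)[OF assms(1) Suc.IH])
  moreover have "leq (scale n t + s) (scale n t + t)"
    using term_orderD(6)[OF assms, of "scale n t"] by (simp only: add.commute)
  ultimately show ?case unfolding S by (rule term_orderD(2)[OF assms(1)])
qed

lemma single_power: "Poly_Mapping.single t (c :: 'k::comm_ring_1) ^ n = Poly_Mapping.single (scale n t) (c ^ n)"
proof (induction n)
  case 0
  then show ?case by (simp add: scale_def)
next
  case (Suc n)
  have "scale (Suc n) t = t + scale n t" by (simp add: scale_def add.commute)
  then show ?case unfolding power_Suc Suc.IH mult_single by (simp only:)
qed

definition support :: "'v monom \<Rightarrow> 'v monom" where
  "support t = (\<Sum>v\<in>Poly_Mapping.keys t. Poly_Mapping.single v 1)"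

lemma lookup_support: "Poly_Mapping.lookup (support t) v = (if Poly_Mapping.lookup t v = 0 then 0 else 1)"
  by (simp add: support_def lookup_sum lookup_single when_def in_keys_iff)

text \<open>The error term is kept as a multiple of \<open>p\<close>, since the product of the prime
  fields does not have characteristic \<open>p\<close>; there only \<open>\<phi>\<close> removes
  it.\<close>

lemma prime_power_add:
  assumes "prime p"
  obtains r where "(a + b :: 'a::comm_ring_1) ^ p = a ^ p + b ^ p + of_nat p * r"
proof -
  have p: "0 < p" using assms by (rule prime_gt_0_nat)
  have "\<exists>r. of_nat (p choose k) * a ^ k * b ^ (p - k) = of_nat p * (r :: 'a)" if "k \<in> {0<..<p}" for k
  proof -
    have "p dvd p choose k" by (rule dvd_choose_prime) (use that assms p in auto)
    then obtain m where "p choose k = p * m" by (rule dvdE)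
    then have "of_nat (p choose k) * a ^ k * b ^ (p - k) = of_nat p * (of_nat m * a ^ k * b ^ (p - k))"
      by (simp only: of_nat_mult mult.assoc)
    then show ?thesis by blast
  qed
  then obtain r where r: "\<And>k. k \<in> {0<..<p} \<Longrightarrow> of_nat (p choose k) * a ^ k * b ^ (p - k) = of_nat p * (r k :: 'a)" by metis
  have "{..p} = insert 0 (insert p {0<..<p})" using p by auto
  then have "(a + b) ^ p = (\<Sum>k\<in>insert 0 (insert p {0<..<p}). of_nat (p choose k) * a ^ k * b ^ (p - k))"
    unfolding binomial_ring by (simp only:)
  also have "\<dots> = b ^ p + (a ^ p + (\<Sum>k\<in>{0<..<p}. of_nat (p choose k) * a ^ k * b ^ (p - k)))"
    using p by simp
  also have "(\<Sum>k\<in>{0<..<p}. of_nat (p choose k) * a ^ k * b ^ (p - k)) = of_nat p * (\<Sum>k\<in>{0<..<p}. r k)"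
    unfolding sum_distrib_left by (rule sum.cong[OF refl]) (rule r)
  finally have "(a + b) ^ p = a ^ p + b ^ p + of_nat p * (\<Sum>k\<in>{0<..<p}. r k)" by (simp only: add_ac)
  then show ?thesis by (rule that)
qed

text \<open>\<open>T\<close> is the product of all variables, and \<open>f\<close> has initial monomial \<open>T\<close>. The idempotent \<open>e\<close>
  is \<open>1\<close> over a field of characteristic \<open>p\<close>; over the product of all prime fields it is the
  projection to the \<open>p\<close>-th factor.\<close>

locale frobenius_trace =
  fixes p :: nat and e :: "'k::comm_ring_1" and \<phi> :: "'k \<Rightarrow> 'k" and T :: "'v::finite monom"
  assumes p: "prime p" and phi_add: "\<phi> (c + d) = \<phi> c + \<phi> d" and phi_pow: "\<phi> (c ^ p * d) = c * \<phi> d"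
    and phi_p: "\<phi> (of_nat p * d) = 0" and phi_e: "\<phi> e = e"
    and T: "Poly_Mapping.lookup T v = 1"
begin

lemma p_pos: "0 < p"
  using p by (rule prime_gt_0_nat)

lemma phi_0 [simp]: "\<phi> 0 = 0"
  using phi_p[of 0] by simp

lemma phi_uminus: "\<phi> (- c) = - \<phi> c"
proof -
  have "\<phi> (- c) + \<phi> c = 0" unfolding phi_add[symmetric] by simp
  then show ?thesis by (rule eq_neg_iff_add_eq_0[THEN iffD2])
qed

text \<open>The trace dual to the monomial with all exponents \<open>p - 1\<close>: only monomials
  whose exponents are all \<open>p - 1\<close> modulo \<open>p\<close> contribute, and their
  coefficients pass through \<open>\<phi>\<close>.\<close>

definition Tr :: "('v, 'k) mpoly \<Rightarrow> ('v, 'k) mpoly" where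
  "Tr g = Abs_poly_mapping (\<lambda>w. \<phi> (Poly_Mapping.lookup g (scale p w + scale (p - 1) T)))"

lemma lookup_Tr: "Poly_Mapping.lookup (Tr g) w = \<phi> (Poly_Mapping.lookup g (scale p w + scale (p - 1) T))"
proof -
  let ?h = "\<lambda>w. scale p w + scale (p - 1) T"
  have "finite (?h -` Poly_Mapping.keys g)"
    by (rule finite_vimageI[OF finite_keys]) (auto intro!: injI simp: inj_scale[OF p_pos])
  moreover have "{w. \<phi> (Poly_Mapping.lookup g (?h w)) \<noteq> 0} \<subseteq> ?h -` Poly_Mapping.keys g"
    by (auto simp: in_keys_iff)
  ultimately have "finite {w. \<phi> (Poly_Mapping.lookup g (?h w)) \<noteq> 0}" by (rule finite_subset[rotated])
  then show ?thesis unfolding Tr_def by simp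
qed

lemma Tr_add: "Tr (g + h) = Tr g + Tr h"
  by (rule poly_mapping_eqI) (simp only: lookup_Tr lookup_add phi_add)

lemma Tr_0: "Tr 0 = 0"
  by (rule poly_mapping_eqI) (simp only: lookup_Tr lookup_zero phi_0)

lemma Tr_p: "Tr (of_nat p * g) = 0"
proof (rule poly_mapping_eqI)
  fix w
  have "of_nat p * g = Poly_Mapping.single 0 (of_nat p) * g" by (simp only: single_of_nat)
  then show "Poly_Mapping.lookup (Tr (of_nat p * g)) w = Poly_Mapping.lookup 0 w"
    by (simp only: lookup_Tr lookup_single_0_mult phi_p lookup_zero)
qed

lemma Tr_single: "Tr (Poly_Mapping.single s c ^ p * g) = Poly_Mapping.single s c * Tr g"
proof (rule poly_mapping_eqI)
  fix w
  let ?q = "scale (p - 1) T"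
  show "Poly_Mapping.lookup (Tr (Poly_Mapping.single s c ^ p * g)) w = Poly_Mapping.lookup (Poly_Mapping.single s c * Tr g) w"
  proof (cases "\<forall>v. Poly_Mapping.lookup s v \<le> Poly_Mapping.lookup w v")
    case True
    have w: "w = s + (w - s)" by (rule poly_mapping_eqI) (use True in \<open>simp add: lookup_add lookup_minus\<close>)
    define u where "u = w - s"
    have w': "w = s + u" using w unfolding u_def .
    have eq: "scale p (s + u) + ?q = scale p s + (scale p u + ?q)" by (simp only: scale_add add.assoc)
    show ?thesis
      unfolding w' lookup_Tr single_power eq lookup_single_mult_add phi_pow ..
  next
    case False
    then obtain v where v: "Poly_Mapping.lookup w v < Poly_Mapping.lookup s v" by (auto simp: not_le)
    have "w \<notin> Poly_Mapping.keys (Poly_Mapping.single s c * Tr g)"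
    proof
      assume "w \<in> Poly_Mapping.keys (Poly_Mapping.single s c * Tr g)"
      then obtain u where "w = s + u" using keys_single_mult[of s c "Tr g"] by blast
      then show False using v by (simp add: lookup_add)
    qed
    moreover have "scale p w + ?q \<notin> Poly_Mapping.keys (Poly_Mapping.single (scale p s) (c ^ p) * g)"
    proof
      assume "scale p w + ?q \<in> Poly_Mapping.keys (Poly_Mapping.single (scale p s) (c ^ p) * g)"
      then obtain u where u: "scale p w + ?q = scale p s + u" using keys_single_mult[of "scale p s" "c ^ p" g] by blast
      have "p * Poly_Mapping.lookup w v + (p - 1) = p * Poly_Mapping.lookup s v + Poly_Mapping.lookup u v"
        using arg_cong[OF u, of "\<lambda>t. Poly_Mapping.lookup t v"] by (simp add: lookup_add T)
      \<comment> \<open>Every exponent of \<open>?q\<close> is \<open>p - 1\<close>, too small to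
        make up for \<open>w\<close> falling short of \<open>s\<close> at \<open>v\<close>.\<close>
      moreover have "p * Suc (Poly_Mapping.lookup w v) \<le> p * Poly_Mapping.lookup s v" by (rule mult_le_mono2) (use v in simp)
      ultimately show False using p_pos unfolding mult_Suc_right by linarith
    qed
    ultimately show ?thesis by (simp add: lookup_Tr single_power in_keys_iff)
  qed
qed

lemma Tr_power_mult: "Tr (h ^ p * g) = h * Tr g"
proof (induction h rule: mpoly_induct)
  case zero
  then show ?case using p_pos by (simp add: Tr_0 power_0_left)
next
  case (add s c h)
  obtain r where r: "(Poly_Mapping.single s c + h) ^ p = Poly_Mapping.single s c ^ p + h ^ p + of_nat p * r"
    using p by (rule prime_power_add)
  have "Tr ((Poly_Mapping.single s c + h) ^ p * g) = Tr (Poly_Mapping.single s c ^ p * g) + Tr (h ^ p * g) + Tr (of_nat p * (r * g))"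
    unfolding r distrib_right mult.assoc Tr_add ..
  then show ?case unfolding Tr_p Tr_single add.IH distrib_right by simp
qed

end

locale frobenius_splitting = frobenius_trace p e \<phi> T
  for p and e :: "'k::comm_ring_1" and \<phi> and T :: "'v::finite monom" +
  fixes leq :: "'v monom \<Rightarrow> 'v monom \<Rightarrow> bool" and f :: "('v, 'k) mpoly"
  assumes to: "term_order leq" and f: "signed_initial leq f T"
begin

definition spl :: "('v, 'k) mpoly \<Rightarrow> ('v, 'k) mpoly" where
  "spl g = Tr (f ^ (p - 1) * g)"

lemma spl_add: "spl (g + h) = spl g + spl h"
  by (simp only: spl_def distrib_left Tr_add)

lemma spl_0: "spl 0 = 0"
  by (simp only: spl_def mult_zero_right Tr_0)

lemma spl_power_mult: "spl (h ^ p * g) = h * spl g"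
  unfolding spl_def Tr_power_mult[symmetric] by (simp only: mult.left_commute)

lemma power_pred: "x ^ p = x * x ^ (p - 1)" for x :: "'a::monoid_mult"
  using p_pos by (metis Suc_diff_1 power_Suc)

text \<open>For the principal ideal, \<open>f ^ (p - 1)\<close> turns a multiple of \<open>f\<close>
  into a multiple of \<open>f ^ p\<close>. For a colon ideal, multiply \<open>g * y\<close> by
  \<open>y ^ (p - 1)\<close>, so that \<open>y ^ p\<close> leaves the splitting as \<open>y\<close>.
  Sums follow by additivity, and intersections are immediate.\<close>

lemma knutson_spl: "I \<in> knutson_ideals f \<Longrightarrow> g \<in> I \<Longrightarrow> spl g \<in> I"
proof (induction arbitrary: g rule: knutson_ideals.induct)
  case principal
  then obtain u where u: "g = u * f" unfolding cgenideal_class_ring rmod.span_singleton by blast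
  have "f ^ (p - 1) * g = f ^ p * u" unfolding u power_pred[of f] by (simp only: mult_ac)
  then have "spl g = Tr u * f" unfolding spl_def using Tr_power_mult[of f u] by (simp only: mult.commute)
  then show ?case unfolding cgenideal_class_ring rmod.span_singleton by blast
next
  case (colon I J)
  have I: "rmod.subspace I" using colon.hyps(1) by (rule knutson_subspace)
  have "spl g * y \<in> I" if y: "y \<in> J" for y
  proof -
    have "g * y \<in> I" using colon.prems y unfolding colon_ideal_def by blast
    then have "y ^ (p - 1) * (g * y) \<in> I" by (rule rmod.subspace_scale[OF I])
    moreover have "y ^ (p - 1) * (g * y) = y ^ p * g" unfolding power_pred[of y] by (simp only: mult_ac)
    ultimately have "spl (y ^ p * g) \<in> I" using colon.IH by (simp only:)
    then show ?thesis unfolding spl_power_mult by (simp only: mult.commute)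
  qed
  then show ?case unfolding colon_ideal_def by blast
next
  case (sum I J)
  then obtain x y where "g = x + y" "x \<in> I" "y \<in> J" unfolding set_add_class_ring by blast
  then show ?case using sum.IH unfolding set_add_class_ring by (auto simp only: spl_add)
next
  case (inter I J)
  then show ?case by blast
qed

text \<open>The leading coefficient is \<open>e\<close> rather than 1: over the product of the prime
  fields only the factor of \<open>p\<close> matters, and \<open>\<phi>\<close> fixes
  \<open>e\<close>.\<close>

definition has_initial :: "('v, 'k) mpoly set \<Rightarrow> 'v monom \<Rightarrow> bool" where
  "has_initial I t \<longleftrightarrow> (\<exists>g\<in>I. Poly_Mapping.lookup g t = e \<and> (\<forall>u\<in>Poly_Mapping.keys g. leq u t))"

lemma signed_initial_f: "signed_initial leq (f ^ (p - 1)) (scale (p - 1) T)"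
  unfolding scale_def by (rule signed_initial_power[OF to f])

text \<open>Multiplying \<open>g\<close> by the quotient of \<open>scale p w\<close> by
  \<open>t\<close> moves its initial monomial to \<open>scale p w\<close>. The factor
  \<open>f ^ (p - 1)\<close> adds \<open>scale (p - 1) T\<close>, and this is the place from which
  \<open>Tr\<close> reads the coefficient at \<open>w\<close>. Nothing larger appears because
  \<open>scale\<close> preserves the order.\<close>

lemma has_initial_root:
  assumes I: "rmod.subspace I" "\<And>g. g \<in> I \<Longrightarrow> spl g \<in> I" and t: "has_initial I t"
    and le: "\<And>v. Poly_Mapping.lookup t v \<le> p * Poly_Mapping.lookup w v"
  shows "has_initial I w"
proof -
  obtain g where g: "g \<in> I" "Poly_Mapping.lookup g t = e" "\<forall>u\<in>Poly_Mapping.keys g. leq u t"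
    using t unfolding has_initial_def by blast
  define r where "r = scale p w - t"
  have rt: "r + t = scale p w"
    unfolding r_def by (rule poly_mapping_eqI) (use le in \<open>simp add: lookup_add lookup_minus\<close>)
  let ?q = "scale (p - 1) T"
  let ?m = "monom_poly r :: ('v, 'k) mpoly"
  have m: "\<forall>u\<in>Poly_Mapping.keys ?m. leq u r" by (simp add: monom_poly_def term_orderD(1)[OF to])
  have mg: "Poly_Mapping.lookup (?m * g) (scale p w) = e"
    using lookup_initial_mult[OF to m g(3)] g(2) unfolding rt by (simp add: monom_poly_def)
  have kmg: "\<forall>u\<in>Poly_Mapping.keys (?m * g). leq u (scale p w)"
    using keys_mult_le[OF to m g(3)] unfolding rt by blast
  let ?F = "f ^ (p - 1) * (?m * g)"
  have kf: "\<forall>u\<in>Poly_Mapping.keys (f ^ (p - 1)). leq u ?q" using signed_initial_f unfolding signed_initial_def by blast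
  have F: "Poly_Mapping.lookup ?F (?q + scale p w) = Poly_Mapping.lookup (f ^ (p - 1)) ?q * e"
    using lookup_initial_mult[OF to kf kmg] unfolding mg .
  have kF: "leq u (?q + scale p w)" if "u \<in> Poly_Mapping.keys ?F" for u
    by (rule keys_mult_le[OF to kf kmg that])
  define \<epsilon> where "\<epsilon> = Poly_Mapping.lookup (f ^ (p - 1)) ?q"
  have eps: "\<epsilon> = 1 \<or> \<epsilon> = - 1" using signed_initial_f unfolding signed_initial_def \<epsilon>_def by blast
  define h where "h = spl (?m * g)"
  have "?m * g \<in> I" by (rule rmod.subspace_scale[OF I(1) g(1)])
  then have hI: "h \<in> I" unfolding h_def by (rule I(2))
  have hw: "Poly_Mapping.lookup h w = \<epsilon> * e"
    unfolding h_def spl_def lookup_Tr add.commute[of "scale p w"] F \<epsilon>_def[symmetric]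
    using eps by (auto simp: phi_uminus phi_e)
  have kh: "leq u w" if "u \<in> Poly_Mapping.keys h" for u
  proof (rule ccontr)
    assume n: "\<not> leq u w"
    have "\<phi> (Poly_Mapping.lookup ?F (?q + scale p u)) \<noteq> 0"
      using that unfolding h_def spl_def in_keys_iff lookup_Tr add.commute[of "scale p u"] .
    then have "?q + scale p u \<in> Poly_Mapping.keys ?F" unfolding in_keys_iff using phi_0 by force
    then have 1: "leq (?q + scale p u) (?q + scale p w)" by (rule kF)
    have "leq w u" using term_orderD(4)[OF to, of u w] n by blast
    then have "leq (scale p w) (scale p u)" by (rule scale_mono[OF to])
    then have "leq (scale p w + ?q) (scale p u + ?q)" by (rule term_orderD(6)[OF to])
    then have "?q + scale p u = ?q + scale p w" using 1 by (intro term_orderD(3)[OF to]) (simp_all only: add.commute)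
    then have "u = w" by (simp add: inj_scale[OF p_pos])
    then show False using n term_orderD(1)[OF to] by blast
  qed
  \<comment> \<open>The leading coefficient of \<open>f ^ (p - 1)\<close> is 1 or -1; multiplying by
    it once more restores \<open>e\<close>.\<close>
  define c where "c = Poly_Mapping.single (0 :: 'v monom) \<epsilon>"
  have "c * h \<in> I" by (rule rmod.subspace_scale[OF I(1) hI])
  moreover have "Poly_Mapping.lookup (c * h) w = e"
    unfolding c_def lookup_single_0_mult hw using eps by auto
  moreover have "leq u w" if "u \<in> Poly_Mapping.keys (c * h)" for u
  proof (rule kh)
    show "u \<in> Poly_Mapping.keys h" using that unfolding c_def in_keys_iff lookup_single_0_mult by auto
  qed
  ultimately show ?thesis unfolding has_initial_def by blast
qed

text \<open>Roots are taken repeatedly: if all exponents are at most \<open>p ^ Suc k\<close>, the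
  monomial with exponents \<open>p ^ k\<close> on the same support is again initial, and
  \<open>k = 0\<close> is the squarefree case.\<close>

lemma has_initial_support:
  assumes I: "rmod.subspace I" "\<And>g. g \<in> I \<Longrightarrow> spl g \<in> I" and t: "has_initial I t"
  shows "has_initial I (support t)"
proof -
  have *: "has_initial I (support t)" if "has_initial I t" "\<And>v. Poly_Mapping.lookup t v \<le> p ^ k" for k t
    using that
  proof (induction k arbitrary: t)
    case 0
    have "support t = t"
    proof (rule poly_mapping_eqI)
      fix v show "Poly_Mapping.lookup (support t) v = Poly_Mapping.lookup t v"
        using 0(2)[of v] unfolding lookup_support by (cases "Poly_Mapping.lookup t v") simp_all
    qed
    then show ?case using 0(1) by simp
  next
    case (Suc k)
    define w where "w = (\<Sum>v\<in>Poly_Mapping.keys t. Poly_Mapping.single v (p ^ k))"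
    have w: "Poly_Mapping.lookup w v = (if Poly_Mapping.lookup t v = 0 then 0 else p ^ k)" for v
      by (simp add: w_def lookup_sum lookup_single when_def in_keys_iff)
    have "has_initial I w"
      by (rule has_initial_root[OF I Suc.prems(1)]) (use Suc.prems(2) in \<open>auto simp: w\<close>)
    then have "has_initial I (support w)" by (rule Suc.IH) (simp add: w)
    moreover have "support w = support t"
      by (rule poly_mapping_eqI) (use p_pos in \<open>simp add: lookup_support w\<close>)
    ultimately show ?case by simp
  qed
  have "Poly_Mapping.lookup t v \<le> p ^ (\<Sum>v\<in>UNIV. Poly_Mapping.lookup t v)" for v
  proof -
    have "Poly_Mapping.lookup t v \<le> (\<Sum>v\<in>UNIV. Poly_Mapping.lookup t v)" by (rule member_le_sum) auto
    also have "\<dots> < p ^ (\<Sum>v\<in>UNIV. Poly_Mapping.lookup t v)" using prime_gt_1_nat[OF p] by (intro power_gt_expt) simp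
    finally show ?thesis by simp
  qed
  then show ?thesis by (rule *[OF t])
qed

text \<open>\<open>Tr\<close> reads \<open>f ^ (p - 1)\<close> only at
  \<open>scale (p - 1) T\<close> and at its multiples by \<open>p\<close>-th powers; a proper
  multiple exceeds the initial monomial.\<close>

lemma spl_1_const: "spl 1 = Poly_Mapping.single 0 (\<phi> 1) \<or> spl 1 = Poly_Mapping.single 0 (- \<phi> 1)"
proof -
  let ?q = "scale (p - 1) T"
  have kf: "\<forall>u\<in>Poly_Mapping.keys (f ^ (p - 1)). leq u ?q"
    and lf: "Poly_Mapping.lookup (f ^ (p - 1)) ?q = 1 \<or> Poly_Mapping.lookup (f ^ (p - 1)) ?q = - 1"
    using signed_initial_f unfolding signed_initial_def by blast+
  have "Poly_Mapping.lookup (spl 1) w = (\<phi> (Poly_Mapping.lookup (f ^ (p - 1)) ?q) when w = 0)" for w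
  proof (cases "w = 0")
    case True
    then show ?thesis by (simp add: spl_def lookup_Tr)
  next
    case False
    have "scale p w + ?q \<notin> Poly_Mapping.keys (f ^ (p - 1))"
    proof
      assume "scale p w + ?q \<in> Poly_Mapping.keys (f ^ (p - 1))"
      then have 1: "leq (scale p w + ?q) ?q" using kf by blast
      have "leq (0 + ?q) (scale p w + ?q)" by (rule term_orderD(6)[OF to term_orderD(5)[OF to]])
      then have "scale p w + ?q = ?q" using 1 by (intro term_orderD(3)[OF to]) simp_all
      then have "scale p w = scale p 0" by simp
      then show False using False unfolding inj_scale[OF p_pos] by simp
    qed
    then show ?thesis using False by (simp add: spl_def lookup_Tr in_keys_iff)
  qed
  then have "spl 1 = Poly_Mapping.single 0 (\<phi> (Poly_Mapping.lookup (f ^ (p - 1)) ?q))"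
    by (intro poly_mapping_eqI) (simp add: lookup_single when_def eq_commute)
  then show ?thesis using lf by (auto simp: phi_uminus)
qed

end

section \<open>Positive characteristic\<close>

text \<open>Acting through \<open>c ^ CHAR('k)\<close> makes the field a vector space over itself in
  which 1 is linearly independent; extending \<open>1 \<mapsto> 1\<close> to a linear map also
  covers imperfect fields.\<close>

lemma exists_trace_functional:
  assumes "0 < CHAR('k::field)"
  obtains \<phi> :: "'k::field \<Rightarrow> 'k" where "\<And>c d. \<phi> (c + d) = \<phi> c + \<phi> d" "\<And>c d. \<phi> (c ^ CHAR('k) * d) = c * \<phi> d" "\<phi> 1 = 1"
proof -
  have p: "prime CHAR('k)" using assms by (rule prime_CHAR_semidom)
  have fd: "(a + b) ^ CHAR('k) = a ^ CHAR('k) + b ^ CHAR('k)" for a b :: 'k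
    by (rule freshmans_dream[OF p refl])
  interpret vector_space_pair "\<lambda>c d :: 'k. c ^ CHAR('k) * d" "(*) :: 'k \<Rightarrow> 'k \<Rightarrow> 'k"
    by unfold_locales (simp_all only: fd distrib_left distrib_right power_mult_distrib mult.assoc power_one mult_1_left)
  have "vs1.independent {1 :: 'k}"
    using vs1.dependent_single[of "1 :: 'k"] by simp
  then obtain \<phi> where phi: "Vector_Spaces.linear (\<lambda>c d :: 'k. c ^ CHAR('k) * d) (*) \<phi>" "\<forall>x\<in>{1}. \<phi> x = (1 :: 'k)"
    using linear_independent_extend[of "{1}" "\<lambda>_. 1"] by blast
  show ?thesis
  proof (rule that)
    show "\<phi> (c + d) = \<phi> c + \<phi> d" for c d using phi(1) unfolding Vector_Spaces.linear_iff by blast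
    show "\<phi> (c ^ CHAR('k) * d) = c * \<phi> d" for c d using phi(1) unfolding Vector_Spaces.linear_iff by blast
    show "\<phi> 1 = 1" using phi(2) by blast
  qed
qed

lemma frobenius_trace_field:
  fixes \<phi> :: "'k::field \<Rightarrow> 'k" and T :: "'v::finite monom"
  assumes "0 < CHAR('k)" "\<And>c d. \<phi> (c + d) = \<phi> c + \<phi> d" "\<And>c d. \<phi> (c ^ CHAR('k) * d) = c * \<phi> d" "\<phi> 1 = 1"
    and "\<And>v. Poly_Mapping.lookup T v = 1"
  shows "frobenius_trace CHAR('k) 1 \<phi> T"
proof
  show "prime CHAR('k)" using assms(1) by (rule prime_CHAR_semidom)
  have "\<phi> 0 = 0" using assms(2)[of 0 0] unfolding add_0_right add_cancel_right_right .
  then show "\<phi> (of_nat CHAR('k) * d) = 0" for d by simp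
qed (use assms in simp_all)

text \<open>By \<open>sum_window_monom\<close> this is the product of all variables, written in the
  form in which it arises as the initial monomial of \<open>cyc_poly\<close>.\<close>

abbreviation all_vars :: "('r::{finite,linorder} \<times> 'c::{finite,linorder}) monom" where
  "all_vars \<equiv> \<Sum>x\<in>{1..<CARD('r) + CARD('c)}. window_monom x"

lemma frobenius_splitting_cyc:
  fixes \<phi> :: "'l::comm_ring_1 \<Rightarrow> 'l"
  assumes "frobenius_trace p e \<phi> (all_vars :: ('r::{finite,linorder} \<times> 'c::{finite,linorder}) monom)"
    and to: "term_order leq"
    and init: "\<And>a b. (a, b) \<in> minors \<Longrightarrow> signed_initial leq (gmin a b :: ('r \<times> 'c, 'l) mpoly) (antidiagonal (a, b))"
  shows "frobenius_splitting p e \<phi> all_vars leq (cyc_poly :: ('r \<times> 'c, 'l) mpoly)"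
proof -
  interpret frobenius_trace p e \<phi> "all_vars :: ('r \<times> 'c) monom" by fact
  show ?thesis
  proof
    show "term_order leq" by (rule to)
    show "signed_initial leq (cyc_poly :: ('r \<times> 'c, 'l) mpoly) all_vars"
      by (rule cyc_poly_signed_initial[OF to init])
  qed
qed

lemma omega_ideal_empty: "omega_ideal {} = {0}"
  unfolding omega_ideal_def by simp

lemma omega_ideal_subspace: "rmod.subspace (omega_ideal \<Omega>)"
  unfolding omega_ideal_def by (rule rmod.subspace_span)

lemma omega_ideal_spl:
  fixes \<Omega> :: "('r::{finite,linorder}, 'c::{finite,linorder}) minor_index set"
  assumes "frobenius_splitting p e \<phi> T leq (cyc_poly :: ('r \<times> 'c, 'l::comm_ring_1) mpoly)"
    and om: "minor_poset_ideal \<Omega>" and g: "g \<in> omega_ideal \<Omega>"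
  shows "frobenius_splitting.spl p \<phi> T (cyc_poly :: ('r \<times> 'c, 'l) mpoly) g \<in> omega_ideal \<Omega>"
proof -
  interpret frobenius_splitting p e \<phi> T leq "cyc_poly :: ('r \<times> 'c, 'l) mpoly" by fact
  show ?thesis
  proof (cases "\<Omega> = {}")
    \<comment> \<open>The zero ideal is not a Knutson ideal and is treated separately.\<close>
    case True
    then show ?thesis using g by (simp add: omega_ideal_empty spl_0)
  next
    case False
    show ?thesis by (rule knutson_spl[OF omega_ideal_knutson[OF om False] g])
  qed
qed

lemma omega_ideal_initial_support:
  fixes \<Omega> :: "('r::{finite,linorder}, 'c::{finite,linorder}) minor_index set"
  assumes fs: "frobenius_splitting p e \<phi> T leq (cyc_poly :: ('r \<times> 'c, 'l::comm_ring_1) mpoly)"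
    and om: "minor_poset_ideal \<Omega>"
    and g: "g \<in> omega_ideal \<Omega>" "Poly_Mapping.lookup g t = e" "\<forall>u\<in>Poly_Mapping.keys g. leq u t"
  obtains h :: "('r \<times> 'c, 'l::comm_ring_1) mpoly" where "h \<in> omega_ideal \<Omega>" "Poly_Mapping.lookup h (support t) = e"
    "\<forall>u\<in>Poly_Mapping.keys h. leq u (support t)"
proof -
  interpret frobenius_splitting p e \<phi> T leq "cyc_poly :: ('r \<times> 'c, 'l) mpoly" by (rule fs)
  have "has_initial (omega_ideal \<Omega>) t" unfolding has_initial_def using g by blast
  then have "has_initial (omega_ideal \<Omega>) (support t)"
  proof (rule has_initial_support[OF omega_ideal_subspace, rotated])
    fix g assume "g \<in> (omega_ideal \<Omega> :: ('r \<times> 'c, 'l) mpoly set)"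
    then show "spl g \<in> omega_ideal \<Omega>" by (rule omega_ideal_spl[OF fs om])
  qed
  then show ?thesis unfolding has_initial_def using that by blast
qed

text \<open>Each initial monomial is a multiple of its support, so once the supports are initial
  they generate the same ideal.\<close>

lemma squarefree_initial_ideal:
  assumes to: "term_order leq"
    and root: "\<And>t. \<exists>g\<in>I. is_initial_monom leq g t \<Longrightarrow> \<exists>g\<in>I. is_initial_monom leq g (support t)"
  shows "squarefree_monomial_ideal (initial_ideal leq (I :: ('v, 'k::field) mpoly set))"
proof -
  let ?M = "{t. \<exists>g\<in>I. is_initial_monom leq g t}"
  let ?B = "support ` ?M"
  have "Idl\<^bsub>class_ring\<^esub> (monom_poly ` ?M) = Idl\<^bsub>class_ring\<^esub> (monom_poly ` ?B :: ('v, 'k) mpoly set)"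
    unfolding genideal_class_ring
  proof
    show "gen_ideal (monom_poly ` ?M) \<subseteq> gen_ideal (monom_poly ` ?B :: ('v, 'k) mpoly set)"
    proof (rule rmod.span_minimal[OF _ rmod.subspace_span], rule image_subsetI)
      fix t assume "t \<in> ?M"
      then have "monom_poly (support t) \<in> gen_ideal (monom_poly ` ?B :: ('v, 'k) mpoly set)"
        by (intro rmod.span_base imageI)
      then have "monom_poly (t - support t) * monom_poly (support t) \<in> gen_ideal (monom_poly ` ?B :: ('v, 'k) mpoly set)"
        by (rule rmod.span_scale)
      then have "monom_poly ((t - support t) + support t) \<in> gen_ideal (monom_poly ` ?B :: ('v, 'k) mpoly set)"
        unfolding monom_poly_mult .
      moreover have "(t - support t) + support t = t"
        by (rule poly_mapping_eqI) (simp add: lookup_add lookup_minus lookup_support)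
      ultimately show "monom_poly t \<in> gen_ideal (monom_poly ` ?B :: ('v, 'k) mpoly set)" by (simp only:)
    qed
    show "gen_ideal (monom_poly ` ?B) \<subseteq> gen_ideal (monom_poly ` ?M :: ('v, 'k) mpoly set)"
    proof (rule rmod.span_mono, rule image_mono)
      show "?B \<subseteq> ?M" using root by blast
    qed
  qed
  moreover have "\<forall>t\<in>?B. squarefree_monom t" by (simp add: squarefree_monom_def lookup_support)
  ultimately show ?thesis unfolding squarefree_monomial_ideal_def initial_ideal_def by (intro exI[of _ ?B] conjI)
qed

lemma initial_ideal_squarefree_pos_char:
  fixes \<Omega> :: "('r::{finite,linorder}, 'c::{finite,linorder}) minor_index set"
  assumes char: "0 < CHAR('k::field)" and om: "minor_poset_ideal \<Omega>" and leq: "antidiagonal_order TYPE('k) leq"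
  shows "squarefree_monomial_ideal (initial_ideal leq (omega_ideal \<Omega> :: ('r \<times> 'c, 'k) mpoly set))"
proof (rule squarefree_initial_ideal)
  show to: "term_order leq" using leq by (simp add: antidiagonal_order_def)
  obtain \<phi> :: "'k \<Rightarrow> 'k" where phi: "\<And>c d. \<phi> (c + d) = \<phi> c + \<phi> d" "\<And>c d. \<phi> (c ^ CHAR('k) * d) = c * \<phi> d" "\<phi> 1 = 1"
    using exists_trace_functional[OF char] by blast
  have tr: "frobenius_trace CHAR('k) 1 \<phi> (all_vars :: ('r \<times> 'c) monom)"
    by (rule frobenius_trace_field[OF char phi sum_window_monom])
  have fs: "frobenius_splitting CHAR('k) 1 \<phi> all_vars leq (cyc_poly :: ('r \<times> 'c, 'k) mpoly)"
    by (rule frobenius_splitting_cyc[OF tr to minors_signed_initial[OF leq]])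
  fix t assume "\<exists>g\<in>(omega_ideal \<Omega> :: ('r \<times> 'c, 'k) mpoly set). is_initial_monom leq g t"
  then obtain g :: "('r \<times> 'c, 'k) mpoly" where g: "g \<in> omega_ideal \<Omega>" "t \<in> Poly_Mapping.keys g" "\<forall>s\<in>Poly_Mapping.keys g. leq s t"
    unfolding is_initial_monom_def by blast
  define h where "h = Poly_Mapping.single 0 (inverse (Poly_Mapping.lookup g t)) * g"
  have "h \<in> omega_ideal \<Omega>" unfolding h_def by (rule rmod.subspace_scale[OF omega_ideal_subspace g(1)])
  moreover have "Poly_Mapping.lookup h t = 1"
    using g(2) unfolding h_def lookup_single_0_mult in_keys_iff by simp
  moreover have "Poly_Mapping.keys h \<subseteq> Poly_Mapping.keys g"
    unfolding h_def by (auto simp: in_keys_iff lookup_single_0_mult)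
  then have "\<forall>u\<in>Poly_Mapping.keys h. leq u t" using g(3) by blast
  ultimately obtain h' :: "('r \<times> 'c, 'k) mpoly" where h': "h' \<in> omega_ideal \<Omega>" "Poly_Mapping.lookup h' (support t) = 1"
    "\<forall>u\<in>Poly_Mapping.keys h'. leq u (support t)"
    by (rule omega_ideal_initial_support[OF fs om])
  then have "is_initial_monom leq h' (support t)" unfolding is_initial_monom_def in_keys_iff by simp
  then show "\<exists>g\<in>(omega_ideal \<Omega> :: ('r \<times> 'c, 'k) mpoly set). is_initial_monom leq g (support t)" using h'(1) by blast
qed

section \<open>Purity\<close>

text \<open>The closure properties on which the tensor relators depend; for
  \<open>regular_module\<close> and \<open>frobenius_module\<close> they are checked
  directly.\<close>

definition module_closed :: "('s, 'x) ring_scheme \<Rightarrow> ('s, 'm, 'y) module_scheme \<Rightarrow> bool" where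
  "module_closed R M \<longleftrightarrow> (\<forall>x\<in>carrier M. \<forall>y\<in>carrier M. x \<oplus>\<^bsub>M\<^esub> y \<in> carrier M) \<and>
     (\<forall>r\<in>carrier R. \<forall>x\<in>carrier M. r \<odot>\<^bsub>M\<^esub> x \<in> carrier M)"

lemma module_closed_module: "Module.module R M \<Longrightarrow> module_closed R M"
  unfolding module_closed_def
  by (auto intro: module.smult_closed abelian_groupE(1)[OF module.axioms(2)])

abbreviation tensor_ext :: "('m \<Rightarrow> 'n) \<Rightarrow> ('m \<times> 'q \<Rightarrow>\<^sub>0 int) \<Rightarrow> ('n \<times> 'q \<Rightarrow>\<^sub>0 int)" where
  "tensor_ext \<phi> \<equiv> frag_extend (\<lambda>(x, y). frag_of (\<phi> x, y))"

lemma tensor_relators_carrier: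
  assumes M: "module_closed R M" and Q: "module_closed R Q"
  shows "tensor_relators R M Q \<subseteq> carrier (free_Abelian_group (carrier M \<times> carrier Q))"
proof
  have two: "frag_of a - frag_of b \<in> carrier (free_Abelian_group S)" if "a \<in> S" "b \<in> S" for a b :: "'c \<times> 'e" and S
    using keys_diff[of "frag_of a" "frag_of b"] that by auto
  have three: "frag_of a - frag_of b - frag_of c \<in> carrier (free_Abelian_group S)" if "a \<in> S" "b \<in> S" "c \<in> S" for a b c :: "'c \<times> 'e" and S
    using keys_diff[of "frag_of a - frag_of b" "frag_of c"] two[OF that(1,2)] that(3) by auto
  fix u assume "u \<in> tensor_relators R M Q"
  then consider x x' y where "u = frag_of (x \<oplus>\<^bsub>M\<^esub> x', y) - frag_of (x, y) - frag_of (x', y)" "x \<in> carrier M" "x' \<in> carrier M" "y \<in> carrier Q"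
    | x y y' where "u = frag_of (x, y \<oplus>\<^bsub>Q\<^esub> y') - frag_of (x, y) - frag_of (x, y')" "x \<in> carrier M" "y \<in> carrier Q" "y' \<in> carrier Q"
    | r x y where "u = frag_of (r \<odot>\<^bsub>M\<^esub> x, y) - frag_of (x, r \<odot>\<^bsub>Q\<^esub> y)" "r \<in> carrier R" "x \<in> carrier M" "y \<in> carrier Q"
    unfolding tensor_relators_def by blast
  then show "u \<in> carrier (free_Abelian_group (carrier M \<times> carrier Q))"
  proof cases
    case 1
    show ?thesis unfolding 1(1) by (rule three) (use 1 M in \<open>auto simp: module_closed_def\<close>)
  next
    case 2
    show ?thesis unfolding 2(1) by (rule three) (use 2 Q in \<open>auto simp: module_closed_def\<close>)
  next
    case 3
    show ?thesis unfolding 3(1) by (rule two) (use 3 M Q in \<open>auto simp: module_closed_def\<close>)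
  qed
qed

lemma tensor_kernel_subgroup:
  assumes "module_closed R M" "module_closed R Q"
  shows "subgroup (tensor_kernel R M Q) (free_Abelian_group (carrier M \<times> carrier Q))"
  unfolding tensor_kernel_def
  by (rule group.generate_is_subgroup[OF group_free_Abelian_group tensor_relators_carrier[OF assms]])

lemma tensor_kernel_closed:
  assumes M: "module_closed R M" and Q: "module_closed R Q"
  shows "0 \<in> tensor_kernel R M Q" and "u \<in> tensor_kernel R M Q \<Longrightarrow> v \<in> tensor_kernel R M Q \<Longrightarrow> u + v \<in> tensor_kernel R M Q"
    and "u \<in> tensor_kernel R M Q \<Longrightarrow> - u \<in> tensor_kernel R M Q"
    and "u \<in> tensor_kernel R M Q \<Longrightarrow> Poly_Mapping.keys u \<subseteq> carrier M \<times> carrier Q"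
proof -
  let ?G = "free_Abelian_group (carrier M \<times> carrier Q)"
  interpret K: subgroup "tensor_kernel R M Q" ?G by (rule tensor_kernel_subgroup[OF assms])
  show "0 \<in> tensor_kernel R M Q" using K.one_closed by simp
  show "u \<in> tensor_kernel R M Q \<Longrightarrow> v \<in> tensor_kernel R M Q \<Longrightarrow> u + v \<in> tensor_kernel R M Q" using K.m_closed[of u v] by simp
  have keys: "Poly_Mapping.keys u \<subseteq> carrier M \<times> carrier Q" if "u \<in> tensor_kernel R M Q" for u
    using K.mem_carrier[OF that] by simp
  then show "u \<in> tensor_kernel R M Q \<Longrightarrow> Poly_Mapping.keys u \<subseteq> carrier M \<times> carrier Q" .
  show "- u \<in> tensor_kernel R M Q" if "u \<in> tensor_kernel R M Q"
    using K.m_inv_closed[OF that] inv_free_Abelian_group[OF keys[OF that]] by simp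
qed

lemma tensor_ext_kernel:
  assumes M: "module_closed R M" and N: "module_closed R N" and Q: "module_closed R Q"
    and hom: "\<phi> \<in> LinearCombinations.module_hom R M N" and u: "u \<in> tensor_kernel R M Q"
  shows "tensor_ext \<phi> u \<in> tensor_kernel R N Q"
  using u unfolding tensor_kernel_def[of R M Q]
proof (induction rule: generate.induct)
  have closed: "\<phi> x \<in> carrier N" if "x \<in> carrier M" for x using hom that unfolding LinearCombinations.module_hom_def by blast
  have add: "\<phi> (x \<oplus>\<^bsub>M\<^esub> y) = \<phi> x \<oplus>\<^bsub>N\<^esub> \<phi> y" if "x \<in> carrier M" "y \<in> carrier M" for x y
    using hom that unfolding LinearCombinations.module_hom_def by blast
  have smult: "\<phi> (r \<odot>\<^bsub>M\<^esub> x) = r \<odot>\<^bsub>N\<^esub> \<phi> x" if "r \<in> carrier R" "x \<in> carrier M" for r x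
    using hom that unfolding LinearCombinations.module_hom_def by blast
  have rel: "tensor_ext \<phi> h \<in> tensor_relators R N Q" if h: "h \<in> tensor_relators R M Q" for h
  proof -
    from h consider x x' y where "h = frag_of (x \<oplus>\<^bsub>M\<^esub> x', y) - frag_of (x, y) - frag_of (x', y)" "x \<in> carrier M" "x' \<in> carrier M" "y \<in> carrier Q"
      | x y y' where "h = frag_of (x, y \<oplus>\<^bsub>Q\<^esub> y') - frag_of (x, y) - frag_of (x, y')" "x \<in> carrier M" "y \<in> carrier Q" "y' \<in> carrier Q"
      | r x y where "h = frag_of (r \<odot>\<^bsub>M\<^esub> x, y) - frag_of (x, r \<odot>\<^bsub>Q\<^esub> y)" "r \<in> carrier R" "x \<in> carrier M" "y \<in> carrier Q"
      unfolding tensor_relators_def by blast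
    then show ?thesis
    proof cases
      case 1
      have "tensor_ext \<phi> h = frag_of (\<phi> x \<oplus>\<^bsub>N\<^esub> \<phi> x', y) - frag_of (\<phi> x, y) - frag_of (\<phi> x', y)"
        unfolding 1(1) frag_extend_diff frag_extend_of prod.case add[OF 1(2,3)] ..
      then show ?thesis unfolding tensor_relators_def using closed[OF 1(2)] closed[OF 1(3)] 1(4) by blast
    next
      case 2
      have "tensor_ext \<phi> h = frag_of (\<phi> x, y \<oplus>\<^bsub>Q\<^esub> y') - frag_of (\<phi> x, y) - frag_of (\<phi> x, y')"
        unfolding 2(1) frag_extend_diff frag_extend_of prod.case ..
      then show ?thesis unfolding tensor_relators_def using closed[OF 2(2)] 2(3,4) by blast
    next
      case 3
      have "tensor_ext \<phi> h = frag_of (r \<odot>\<^bsub>N\<^esub> \<phi> x, y) - frag_of (\<phi> x, r \<odot>\<^bsub>Q\<^esub> y)"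
        unfolding 3(1) frag_extend_diff frag_extend_of prod.case smult[OF 3(2,3)] ..
      then show ?thesis unfolding tensor_relators_def using closed[OF 3(3)] 3(2,4) by blast
    qed
  qed
  have rel': "tensor_ext \<phi> h \<in> tensor_kernel R N Q" if "h \<in> tensor_relators R M Q" for h
    unfolding tensor_kernel_def by (rule generate.incl[OF rel[OF that]])
  {
    case one
    then show ?case using tensor_kernel_closed(1)[OF N Q] by simp
  next
    case (incl h)
    then show ?case by (rule rel')
  next
    case (inv h)
    have "Poly_Mapping.keys h \<subseteq> carrier M \<times> carrier Q"
      using subsetD[OF tensor_relators_carrier[OF M Q] inv] unfolding carrier_free_Abelian_group_iff .
    then show ?case
      using tensor_kernel_closed(3)[OF N Q rel'[OF inv]] by (simp only: inv_free_Abelian_group frag_extend_minus)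
  next
    case (eng h1 h2)
    then show ?case
      using tensor_kernel_closed(2)[OF N Q, of "tensor_ext \<phi> h1" "tensor_ext \<phi> h2"] by (simp only: mult_free_Abelian_group frag_extend_add)
  }
qed

lemma r_coset_free_Abelian_group: "K #>\<^bsub>free_Abelian_group S\<^esub> u = (\<lambda>k. k + u) ` K"
  by (auto simp: r_coset_def)

lemma tensor_coset_eq_iff:
  assumes M: "module_closed R M" and Q: "module_closed R Q"
  shows "tensor_kernel R M Q #>\<^bsub>free_Abelian_group S\<^esub> u = tensor_kernel R M Q #>\<^bsub>free_Abelian_group S\<^esub> v \<longleftrightarrow> u - v \<in> tensor_kernel R M Q"
proof -
  let ?K = "tensor_kernel R M Q"
  note c = tensor_kernel_closed[OF M Q]
  have sub: "(\<lambda>k. k + u) ` ?K \<subseteq> (\<lambda>k. k + v) ` ?K" if "u - v \<in> ?K" for u v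
  proof (rule image_subsetI)
    fix k assume "k \<in> ?K"
    then have "k + (u - v) \<in> ?K" using that by (rule c(2))
    then show "k + u \<in> (\<lambda>k. k + v) ` ?K" by (rule image_eqI[rotated]) simp
  qed
  show ?thesis
    unfolding r_coset_free_Abelian_group
  proof
    assume eq: "(\<lambda>k. k + u) ` ?K = (\<lambda>k. k + v) ` ?K"
    have "0 + u \<in> (\<lambda>k. k + u) ` ?K" by (rule imageI[OF c(1)])
    then obtain k where "0 + u = k + v" "k \<in> ?K" unfolding eq by blast
    then show "u - v \<in> ?K" by simp
  next
    assume uv: "u - v \<in> ?K"
    have "v - u \<in> ?K" using c(3)[OF uv] by simp
    then show "(\<lambda>k. k + u) ` ?K = (\<lambda>k. k + v) ` ?K" using sub[OF uv] sub by blast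
  qed
qed

lemma tensor_map_coset:
  assumes M: "module_closed R M" and N: "module_closed R N" and Q: "module_closed R Q"
    and hom: "\<phi> \<in> LinearCombinations.module_hom R M N"
  shows "tensor_map R N Q \<phi> (tensor_kernel R M Q #>\<^bsub>free_Abelian_group S\<^esub> u) =
    tensor_kernel R N Q #>\<^bsub>free_Abelian_group (carrier N \<times> carrier Q)\<^esub> tensor_ext \<phi> u"
proof -
  let ?c = "\<lambda>u. tensor_kernel R N Q #>\<^bsub>free_Abelian_group (carrier N \<times> carrier Q)\<^esub> tensor_ext \<phi> u"
  have const: "?c (k + u) = ?c u" if "k \<in> tensor_kernel R M Q" for k
    unfolding tensor_coset_eq_iff[OF N Q] frag_extend_diff[symmetric]
    using tensor_ext_kernel[OF M N Q hom that] by simp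
  have "?c ` ((\<lambda>k. k + u) ` tensor_kernel R M Q) = (\<lambda>k. ?c u) ` tensor_kernel R M Q"
    unfolding image_image by (rule image_cong[OF refl]) (rule const)
  also have "\<dots> = {?c u}" by (rule image_constant[OF tensor_kernel_closed(1)[OF M Q]])
  finally show ?thesis unfolding tensor_map_def r_coset_free_Abelian_group[where S = S] by (simp only: the_elem_eq)
qed

text \<open>A split map is pure: \<open>\<psi>\<close> also sends relators to relators, so it
  induces a left inverse of the map induced by \<open>\<phi>\<close> on tensor products.\<close>

lemma pure_module_hom_retraction:
  assumes M: "module_closed R M" and N: "module_closed R N"
    and phi: "\<phi> \<in> LinearCombinations.module_hom R M N" and psi: "\<psi> \<in> LinearCombinations.module_hom R N M"
    and ret: "\<And>x. x \<in> carrier M \<Longrightarrow> \<psi> (\<phi> x) = x"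
  shows "pure_module_hom TYPE('q) R M N \<phi>"
  unfolding pure_module_hom_def
proof (intro conjI allI impI inj_onI)
  show "\<phi> \<in> LinearCombinations.module_hom R M N" by (rule phi)
  fix Q :: "('a, 'q) module" and C D
  assume "Module.module R Q"
  then have Q: "module_closed R Q" by (rule module_closed_module)
  let ?G = "free_Abelian_group (carrier M \<times> carrier Q)"
  assume "C \<in> carrier (tensor_product R M Q)" "D \<in> carrier (tensor_product R M Q)"
  then obtain u v where u: "u \<in> carrier ?G" "C = tensor_kernel R M Q #>\<^bsub>?G\<^esub> u"
    and v: "v \<in> carrier ?G" "D = tensor_kernel R M Q #>\<^bsub>?G\<^esub> v"
    unfolding tensor_product_def carrier_FactGroup by blast
  have retr: "tensor_ext \<psi> (tensor_ext \<phi> w) = w" if "w \<in> carrier ?G" for w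
  proof -
    have "Poly_Mapping.keys w \<subseteq> carrier M \<times> carrier Q" using that by simp
    then show ?thesis
    proof (induction w rule: frag_induction)
      case (one x)
      then show ?case using ret by (auto simp only: frag_extend_of split: prod.splits)
    next
      case (diff a b)
      then show ?case by (simp only: frag_extend_diff)
    qed simp
  qed
  assume "tensor_map R N Q \<phi> C = tensor_map R N Q \<phi> D"
  then have "tensor_ext \<phi> u - tensor_ext \<phi> v \<in> tensor_kernel R N Q"
    unfolding u(2) v(2) tensor_map_coset[OF M N Q phi] tensor_coset_eq_iff[OF N Q] .
  then have "tensor_ext \<psi> (tensor_ext \<phi> u - tensor_ext \<phi> v) \<in> tensor_kernel R M Q"
    by (rule tensor_ext_kernel[OF N M Q psi])
  then have "u - v \<in> tensor_kernel R M Q" unfolding frag_extend_diff retr[OF u(1)] retr[OF v(1)] .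
  then show "C = D" unfolding u(2) v(2) tensor_coset_eq_iff[OF M Q] .
qed

section \<open>F-purity\<close>

text \<open>A splitting \<open>s\<close> that preserves \<open>I\<close> descends to the quotient
  and retracts Frobenius there. By \<open>const\<close> no nonzero constant is lost, so the quotient
  keeps the characteristic of the field.\<close>

lemma F_pure_quotient:
  fixes I :: "('v, 'k::field) mpoly set"
  assumes I: "rmod.subspace I" and const: "\<And>c. Poly_Mapping.single 0 c \<in> I \<Longrightarrow> c = 0" and char: "0 < CHAR('k)"
    and s: "\<And>g h. s (g + h) = s g + s h" "\<And>g h. s (h ^ CHAR('k) * g) = h * s g" "\<And>g. g \<in> I \<Longrightarrow> s g \<in> I" "s 1 = 1"
  shows "F_pure TYPE('q) (class_ring Quot I)"
proof -
  let ?R = "class_ring :: ('v, 'k) mpoly ring"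
  let ?S = "?R Quot I"
  let ?p = "CHAR('k)"
  have p: "prime ?p" using char by (rule prime_CHAR_semidom)
  interpret ideal I ?R using I by (simp add: ideal_class_ring_iff)
  interpret S: ring ?S by (rule quotient_is_ring)
  let ?q = "\<lambda>x. I +>\<^bsub>?R\<^esub> x"
  have qhom: "?q \<in> Ring.ring_hom ?R ?S" by (rule rcos_ring_hom)
  have qadd: "?q (x + y) = ?q x \<oplus>\<^bsub>?S\<^esub> ?q y" for x y using Ring.ring_hom_add[OF qhom, of x y] by simp
  have qmult: "?q (x * y) = ?q x \<otimes>\<^bsub>?S\<^esub> ?q y" for x y using Ring.ring_hom_mult[OF qhom, of x y] by simp
  have qone: "?q 1 = \<one>\<^bsub>?S\<^esub>" using Ring.ring_hom_one[OF qhom] by simp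
  have qset: "?q x = {i + x | i. i \<in> I}" for x by (auto simp: a_r_coset_def')
  have qeq: "?q x = ?q y \<longleftrightarrow> x - y \<in> I" for x y
  proof
    assume eq: "?q x = ?q y"
    have "0 + x \<in> ?q x" unfolding qset using rmod.subspace_0[OF I] by blast
    then obtain i where "0 + x = i + y" "i \<in> I" unfolding eq unfolding qset by blast
    then show "x - y \<in> I" by simp
  next
    have sub: "?q x \<subseteq> ?q y" if "x - y \<in> I" for x y
    proof
      fix z assume "z \<in> ?q x"
      then obtain i where i: "z = i + x" "i \<in> I" unfolding qset by blast
      have "z = (i + (x - y)) + y" using i(1) by simp
      moreover have "i + (x - y) \<in> I" using i(2) that by (rule rmod.subspace_add[OF I])
      ultimately show "z \<in> ?q y" unfolding qset by blast
    qed
    assume xy: "x - y \<in> I"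
    have "y - x \<in> I" using rmod.subspace_neg[OF I xy] by simp
    then show "?q x = ?q y" using sub[OF xy] sub by blast
  qed
  have carr: "carrier ?S = range ?q" unfolding FactRing_def partial_object.simps A_RCOSETS_def' by auto
  have qpow: "?q x [^]\<^bsub>?S\<^esub> n = ?q (x ^ n)" for x and n :: nat
    by (induction n) (simp_all only: S.nat_pow_0 S.nat_pow_Suc power_0 power_Suc2 qone qmult)
  have char_ring: "of_nat n \<in> I \<longleftrightarrow> ?p dvd n" for n
  proof -
    have "(of_nat n :: ('v, 'k) mpoly) = Poly_Mapping.single 0 (of_nat n)" by (simp only: single_of_nat)
    moreover have "Poly_Mapping.single 0 c \<in> I \<longleftrightarrow> c = 0" for c
      using const[of c] rmod.subspace_0[OF I] by (cases "c = 0") auto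
    ultimately have "of_nat n \<in> I \<longleftrightarrow> (of_nat n :: 'k) = 0" by (simp only:)
    then show ?thesis by (simp only: of_nat_eq_0_iff_char_dvd)
  qed
  have "ring_characteristic ?S = ?p"
  proof -
    have "?q 0 = I" unfolding qset by simp
    then have zero: "\<zero>\<^bsub>?S\<^esub> = ?q (of_nat 0)" by (simp add: FactRing_def)
    have pow: "[n] \<cdot>\<^bsub>?S\<^esub> \<one>\<^bsub>?S\<^esub> = ?q (of_nat n)" for n :: nat
    proof (induction n)
      case 0
      show ?case unfolding S.add.nat_pow_0 by (rule zero)
    next
      case (Suc n)
      have "[Suc n] \<cdot>\<^bsub>?S\<^esub> \<one>\<^bsub>?S\<^esub> = ?q (of_nat n) \<oplus>\<^bsub>?S\<^esub> ?q 1"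
        unfolding S.add.nat_pow_Suc Suc.IH qone ..
      then show ?case unfolding qadd[symmetric] by (simp only: of_nat_Suc add.commute)
    qed
    have ord: "S.add.ord \<one>\<^bsub>?S\<^esub> dvd n \<longleftrightarrow> ?p dvd n" for n
    proof -
      have "S.add.ord \<one>\<^bsub>?S\<^esub> dvd n \<longleftrightarrow> [n] \<cdot>\<^bsub>?S\<^esub> \<one>\<^bsub>?S\<^esub> = \<zero>\<^bsub>?S\<^esub>"
        by (rule S.add.pow_eq_id[OF S.one_closed, symmetric])
      also have "\<dots> \<longleftrightarrow> ?q (of_nat n) = ?q (of_nat 0)" by (simp only: pow zero)
      also have "\<dots> \<longleftrightarrow> ?p dvd n" unfolding qeq by (simp add: char_ring)
      finally show ?thesis .
    qed
    have "S.add.ord \<one>\<^bsub>?S\<^esub> dvd ?p" unfolding ord by (rule dvd_refl)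
    moreover have "?p dvd S.add.ord \<one>\<^bsub>?S\<^esub>" unfolding ord[symmetric] by (rule dvd_refl)
    ultimately show ?thesis unfolding ring_characteristic_def by (rule dvd_antisym)
  qed
  moreover have "pure_module_hom TYPE('q) ?S (regular_module ?S) (frobenius_module ?p ?S) (\<lambda>x. x [^]\<^bsub>?S\<^esub> ?p)"
  proof -
    \<comment> \<open>The chosen representative does not matter, since \<open>s\<close> is additive
      and preserves \<open>I\<close>.\<close>
    define \<psi> where "\<psi> A = ?q (s (SOME x. ?q x = A))" for A
    have s0: "s (x - y) = s x - s y" for x y using s(1)[of "x - y" y] by simp
    have psi: "\<psi> (?q x) = ?q (s x)" for x
    proof -
      have "?q (SOME y. ?q y = ?q x) = ?q x" by (rule someI[of _ x]) (rule refl)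
      then have "(SOME y. ?q y = ?q x) - x \<in> I" unfolding qeq .
      then show ?thesis unfolding \<psi>_def qeq s0[symmetric] by (rule s(3))
    qed
    have reg: "carrier (regular_module ?S) = carrier ?S" "x \<oplus>\<^bsub>regular_module ?S\<^esub> y = x \<oplus>\<^bsub>?S\<^esub> y" "x \<odot>\<^bsub>regular_module ?S\<^esub> y = x \<otimes>\<^bsub>?S\<^esub> y" for x y
      by (simp_all add: regular_module_def)
    have fro: "carrier (frobenius_module ?p ?S) = carrier ?S" "x \<oplus>\<^bsub>frobenius_module ?p ?S\<^esub> y = x \<oplus>\<^bsub>?S\<^esub> y"
      "x \<odot>\<^bsub>frobenius_module ?p ?S\<^esub> y = (x [^]\<^bsub>?S\<^esub> ?p) \<otimes>\<^bsub>?S\<^esub> y" for x y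
      by (simp_all add: frobenius_module_def)
    have frob_add: "(x + y) ^ ?p = x ^ ?p + y ^ ?p" for x y :: "('v, 'k) mpoly"
    proof -
      obtain r where r: "(x + y) ^ ?p = x ^ ?p + y ^ ?p + of_nat ?p * r" using p by (rule prime_power_add)
      have "(of_nat ?p :: ('v, 'k) mpoly) = Poly_Mapping.single 0 (of_nat ?p)" by (simp only: single_of_nat)
      then have "(of_nat ?p :: ('v, 'k) mpoly) = 0" by simp
      then show ?thesis using r by simp
    qed
    show ?thesis
    proof (rule pure_module_hom_retraction)
      show "module_closed ?S (regular_module ?S)" unfolding module_closed_def reg by simp
      show "module_closed ?S (frobenius_module ?p ?S)" unfolding module_closed_def fro by simp
      show "(\<lambda>x. x [^]\<^bsub>?S\<^esub> ?p) \<in> LinearCombinations.module_hom ?S (regular_module ?S) (frobenius_module ?p ?S)"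
        unfolding LinearCombinations.module_hom_def reg fro mem_Collect_eq
      proof (intro conjI allI impI)
        show "(\<lambda>x. x [^]\<^bsub>?S\<^esub> ?p) \<in> carrier ?S \<rightarrow> carrier ?S" by simp
        fix A B assume AB: "A \<in> carrier ?S \<and> B \<in> carrier ?S"
        then obtain x y where xy: "A = ?q x" "B = ?q y" unfolding carr by blast
        show "(A \<oplus>\<^bsub>?S\<^esub> B) [^]\<^bsub>?S\<^esub> ?p = A [^]\<^bsub>?S\<^esub> ?p \<oplus>\<^bsub>?S\<^esub> B [^]\<^bsub>?S\<^esub> ?p"
          unfolding xy qadd[symmetric] qpow frob_add ..
        show "(A \<otimes>\<^bsub>?S\<^esub> B) [^]\<^bsub>?S\<^esub> ?p = A [^]\<^bsub>?S\<^esub> ?p \<otimes>\<^bsub>?S\<^esub> B [^]\<^bsub>?S\<^esub> ?p"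
          unfolding xy qmult[symmetric] qpow power_mult_distrib ..
      qed
      show "\<psi> \<in> LinearCombinations.module_hom ?S (frobenius_module ?p ?S) (regular_module ?S)"
        unfolding LinearCombinations.module_hom_def reg fro mem_Collect_eq
      proof (intro conjI allI impI)
        show "\<psi> \<in> carrier ?S \<rightarrow> carrier ?S" unfolding carr by (auto simp: psi)
        fix A B assume AB: "A \<in> carrier ?S \<and> B \<in> carrier ?S"
        then obtain x y where xy: "A = ?q x" "B = ?q y" unfolding carr by blast
        show "\<psi> (A \<oplus>\<^bsub>?S\<^esub> B) = \<psi> A \<oplus>\<^bsub>?S\<^esub> \<psi> B"
          unfolding xy qadd[symmetric] psi s(1) ..
        show "\<psi> (A [^]\<^bsub>?S\<^esub> ?p \<otimes>\<^bsub>?S\<^esub> B) = A \<otimes>\<^bsub>?S\<^esub> \<psi> B"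
          unfolding xy qpow qmult[symmetric] psi s(2) ..
      qed
      fix A assume "A \<in> carrier (regular_module ?S)"
      then obtain x where x: "A = ?q x" unfolding reg carr by blast
      have "s (x ^ ?p) = x" using s(2)[of x 1] unfolding s(4) mult_1_right .
      then show "\<psi> (A [^]\<^bsub>?S\<^esub> ?p) = A" unfolding x qpow psi by (simp only:)
    qed
  qed
  ultimately show ?thesis unfolding F_pure_def Let_def using char by (simp only: simp_thms)
qed

text \<open>The constant coefficient is multiplicative and vanishes on the minors in
  \<open>\<Omega>\<close>, as these have positive degree.\<close>

lemma const_in_omega_ideal:
  assumes om: "minor_poset_ideal \<Omega>" and c: "Poly_Mapping.single 0 c \<in> (omega_ideal \<Omega> :: ('r::{finite,linorder} \<times> 'c::{finite,linorder}, 'k::comm_ring_1) mpoly set)"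
  shows "c = 0"
proof -
  let ?V = "{g :: ('r \<times> 'c, 'k) mpoly. Poly_Mapping.lookup g 0 = 0}"
  have l0: "Poly_Mapping.lookup (g * h) 0 = Poly_Mapping.lookup g 0 * Poly_Mapping.lookup h 0" for g h :: "('r \<times> 'c, 'k) mpoly"
  proof -
    have "0 \<notin> Poly_Mapping.keys ((g - Poly_Mapping.single 0 (Poly_Mapping.lookup g 0)) * h)"
    proof
      assume "0 \<in> Poly_Mapping.keys ((g - Poly_Mapping.single 0 (Poly_Mapping.lookup g 0)) * h)"
      then obtain u v where uv: "0 = u + v" "u \<in> Poly_Mapping.keys (g - Poly_Mapping.single 0 (Poly_Mapping.lookup g 0))"
        by (rule in_keys_multE)
      have "u = 0"
      proof (rule poly_mapping_eqI)
        fix x show "Poly_Mapping.lookup u x = Poly_Mapping.lookup 0 x"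
          using arg_cong[OF uv(1), of "\<lambda>t. Poly_Mapping.lookup t x"] by (simp add: lookup_add)
      qed
      then show False using uv(2) by (simp add: in_keys_iff lookup_minus)
    qed
    then have z: "Poly_Mapping.lookup ((g - Poly_Mapping.single 0 (Poly_Mapping.lookup g 0)) * h) 0 = 0" by (simp add: in_keys_iff)
    have "g * h = Poly_Mapping.single 0 (Poly_Mapping.lookup g 0) * h + (g - Poly_Mapping.single 0 (Poly_Mapping.lookup g 0)) * h"
      by (simp only: left_diff_distrib) simp
    then have "Poly_Mapping.lookup (g * h) 0 = Poly_Mapping.lookup (Poly_Mapping.single 0 (Poly_Mapping.lookup g 0) * h) 0 +
        Poly_Mapping.lookup ((g - Poly_Mapping.single 0 (Poly_Mapping.lookup g 0)) * h) 0" by (metis lookup_add)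
    then show ?thesis unfolding z by (simp only: lookup_single_0_mult add_0_right)
  qed
  have "omega_ideal \<Omega> \<subseteq> ?V"
    unfolding omega_ideal_def
  proof (rule rmod.span_minimal)
    show "rmod.subspace ?V" by (rule rmod.subspaceI) (simp_all add: lookup_add l0)
    show "minor_poly ` \<Omega> \<subseteq> ?V"
    proof (rule image_subsetI)
      fix q assume q: "q \<in> \<Omega>"
      obtain a b where ab: "q = (a, b)" by (cases q)
      have m: "a \<noteq> []" "length a = length b" using q om unfolding ab minor_poset_ideal_def minors_def by auto
      have "0 \<notin> Poly_Mapping.keys (gmin a b :: ('r \<times> 'c, 'k) mpoly)"
        using keys_gmin(2)[OF m(2), of 0, where 'k = 'k] m(1) by (auto simp: monom_degree_def)
      then show "minor_poly q \<in> ?V" unfolding ab minor_poly_gmin in_keys_iff by simp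
    qed
  qed
  then have "Poly_Mapping.lookup (Poly_Mapping.single (0 :: ('r \<times> 'c) monom) c) 0 = 0" using c by blast
  then show ?thesis by simp
qed

lemma omega_ideal_F_pure:
  fixes \<Omega> :: "('r::{finite,linorder}, 'c::{finite,linorder}) minor_index set"
  assumes char: "0 < CHAR('k::field)" and om: "minor_poset_ideal \<Omega>"
  shows "F_pure TYPE('q) (class_ring Quot (omega_ideal \<Omega> :: ('r \<times> 'c, 'k) mpoly set))"
proof -
  obtain \<phi> :: "'k \<Rightarrow> 'k" where phi: "\<And>c d. \<phi> (c + d) = \<phi> c + \<phi> d" "\<And>c d. \<phi> (c ^ CHAR('k) * d) = c * \<phi> d" "\<phi> 1 = 1"
    using exists_trace_functional[OF char] by blast
  let ?leq = "weighted_lex (antidiagonal_weight :: 'r \<times> 'c \<Rightarrow> real)"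
  have to: "term_order ?leq" by (rule term_order_weighted_lex) (simp add: antidiagonal_weight_def)
  have tr: "frobenius_trace CHAR('k) 1 \<phi> (all_vars :: ('r \<times> 'c) monom)"
    by (rule frobenius_trace_field[OF char phi sum_window_monom])
  have fs: "frobenius_splitting CHAR('k) 1 \<phi> all_vars ?leq (cyc_poly :: ('r \<times> 'c, 'k) mpoly)"
  proof (rule frobenius_splitting_cyc[OF tr to])
    fix a b assume "(a, b) \<in> (minors :: ('r, 'c) minor_index set)"
    then show "signed_initial ?leq (gmin a b :: ('r \<times> 'c, 'k) mpoly) (antidiagonal (a, b))"
      by (intro weighted_lex_gmin) (simp_all add: minors_def)
  qed
  interpret frobenius_splitting "CHAR('k)" 1 \<phi> all_vars ?leq "cyc_poly :: ('r \<times> 'c, 'k) mpoly" by (rule fs)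
  have closed: "spl g \<in> omega_ideal \<Omega>" if "g \<in> omega_ideal \<Omega>" for g
    by (rule omega_ideal_spl[OF fs om that])
  \<comment> \<open>\<open>spl 1\<close> is 1 or -1; its inverse normalizes the splitting.\<close>
  obtain \<epsilon> :: "('r \<times> 'c, 'k) mpoly" where eps: "\<epsilon> * spl 1 = 1"
  proof -
    have "spl 1 = 1 \<or> spl 1 = - 1" using spl_1_const unfolding phi(3) by (simp only: single_one single_uminus)
    then have "spl 1 * spl 1 = 1" by auto
    then show ?thesis by (rule that)
  qed
  show ?thesis
  proof (rule F_pure_quotient[where s = "\<lambda>g. \<epsilon> * spl g"])
    show "rmod.subspace (omega_ideal \<Omega> :: ('r \<times> 'c, 'k) mpoly set)" by (rule omega_ideal_subspace)
    show "c = 0" if "Poly_Mapping.single 0 c \<in> (omega_ideal \<Omega> :: ('r \<times> 'c, 'k) mpoly set)" for c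
      by (rule const_in_omega_ideal[OF om that])
    show "0 < CHAR('k)" by (rule char)
    show "\<epsilon> * spl (g + h) = \<epsilon> * spl g + \<epsilon> * spl h" for g h by (simp only: spl_add distrib_left)
    show "\<epsilon> * spl (h ^ CHAR('k) * g) = h * (\<epsilon> * spl g)" for g h by (simp only: spl_power_mult mult.left_commute)
    show "\<epsilon> * spl g \<in> omega_ideal \<Omega>" if "g \<in> omega_ideal \<Omega>" for g
      by (rule rmod.subspace_scale[OF omega_ideal_subspace closed[OF that]])
    show "\<epsilon> * spl 1 = 1" by (rule eps)
  qed
qed

section \<open>The product of the prime fields\<close>

text \<open>The factors are indexed by all natural numbers; a number that is not prime contributes
  the zero ring.\<close>

definition prime_modulus :: "nat \<Rightarrow> int" where
  "prime_modulus n = (if prime n then int n else 1)"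

typedef prime_fields = "{f :: nat \<Rightarrow> int. \<forall>n. f n mod prime_modulus n = f n}" morphisms residue Abs_prime_fields
  by (rule exI[of _ "\<lambda>_. 0"]) simp

definition of_residues :: "(nat \<Rightarrow> int) \<Rightarrow> prime_fields" where
  "of_residues f = Abs_prime_fields (\<lambda>n. f n mod prime_modulus n)"

lemma residue_of_residues [simp]: "residue (of_residues f) n = f n mod prime_modulus n"
  unfolding of_residues_def by (subst Abs_prime_fields_inverse) simp_all

lemma residue_mod [simp]: "residue x n mod prime_modulus n = residue x n"
  using residue[of x] by simp

lemma prime_fields_eqI: "(\<And>n. residue x n = residue y n) \<Longrightarrow> x = y"
  using residue_inject[of x y] by blast

instantiation prime_fields :: comm_ring_1
begin

definition zero_prime_fields where "0 = of_residues (\<lambda>_. 0)"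
definition one_prime_fields where "1 = of_residues (\<lambda>_. 1)"
definition plus_prime_fields where "x + y = of_residues (\<lambda>n. residue x n + residue y n)"
definition minus_prime_fields where "x - y = of_residues (\<lambda>n. residue x n - residue y n)"
definition uminus_prime_fields where "- x = of_residues (\<lambda>n. - residue x n)"
definition times_prime_fields where "x * y = of_residues (\<lambda>n. residue x n * residue y n)"

lemma residue_simps:
  "residue 0 n = 0" "residue 1 n = 1 mod prime_modulus n"
  "residue (x + y) n = (residue x n + residue y n) mod prime_modulus n"
  "residue (x - y) n = (residue x n - residue y n) mod prime_modulus n"
  "residue (- x) n = (- residue x n) mod prime_modulus n"
  "residue (x * y) n = (residue x n * residue y n) mod prime_modulus n"
  by (simp_all add: zero_prime_fields_def one_prime_fields_def plus_prime_fields_def minus_prime_fields_def uminus_prime_fields_def times_prime_fields_def)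

instance
proof
  fix x y z :: prime_fields
  show "x + y + z = x + (y + z)"
    by (rule prime_fields_eqI) (simp add: residue_simps mod_simps add.assoc)
  show "x + y = y + x"
    by (rule prime_fields_eqI) (simp add: residue_simps add.commute)
  show "0 + x = x"
    by (rule prime_fields_eqI) (simp add: residue_simps)
  show "- x + x = 0"
    by (rule prime_fields_eqI) (simp add: residue_simps mod_simps)
  show "x - y = x + - y"
    by (rule prime_fields_eqI) (simp add: residue_simps mod_simps)
  show "x * y * z = x * (y * z)"
    by (rule prime_fields_eqI) (simp only: residue_simps mod_mult_left_eq mod_mult_right_eq mult.assoc)
  show "x * y = y * x"
    by (rule prime_fields_eqI) (simp add: residue_simps mult.commute)
  show "1 * x = x"
    by (rule prime_fields_eqI) (simp add: residue_simps mod_simps)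
  show "(x + y) * z = x * z + y * z"
    by (rule prime_fields_eqI) (simp only: residue_simps mod_mult_left_eq mod_add_eq distrib_right)
  show "(0 :: prime_fields) \<noteq> 1"
  proof
    assume "(0 :: prime_fields) = 1"
    then have "residue 0 2 = residue 1 2" by simp
    then show False by (simp add: residue_simps prime_modulus_def)
  qed
qed

end

lemma residue_of_nat: "residue (of_nat k) n = int k mod prime_modulus n"
  by (induction k) (simp_all add: residue_simps mod_simps)

lemma residue_of_int: "residue (of_int k) n = k mod prime_modulus n"
  by (cases k) (simp_all add: residue_of_nat residue_simps mod_simps)

lemma residue_power: "residue (x ^ k) n = residue x n ^ k mod prime_modulus n"
  by (induction k) (simp_all add: residue_simps mod_simps)

definition prime_idem :: "nat \<Rightarrow> prime_fields" where
  "prime_idem p = of_residues (\<lambda>n. if n = p then 1 else 0)"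

lemma residue_prime_idem: "prime p \<Longrightarrow> residue (prime_idem p) n = (if n = p then 1 else 0)"
  using prime_gt_1_nat[of p] by (simp add: prime_idem_def prime_modulus_def)

lemma prime_dvd_power_minus:
  assumes p: "prime p"
  shows "int p dvd a ^ p - a"
proof -
  have nat: "int p dvd int k ^ p - int k" for k
  proof (induction k)
    case 0
    then show ?case using prime_gt_0_nat[OF p] by (cases p) simp_all
  next
    case (Suc k)
    obtain r where "(int k + 1) ^ p = int k ^ p + 1 ^ p + of_nat p * r" using p by (rule prime_power_add)
    then have eq: "int (Suc k) ^ p - int (Suc k) = (int k ^ p - int k) + int p * r" by (simp add: add.commute)
    show ?case unfolding eq by (rule dvd_add[OF Suc.IH dvd_triv_left])
  qed
  have "int p dvd (a mod int p) ^ p - (a mod int p)"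
    using nat[of "nat (a mod int p)"] prime_gt_0_nat[OF p] by simp
  then have "((a mod int p) ^ p - (a mod int p)) mod int p = 0" by (rule dvd_imp_mod_0)
  moreover have "((a mod int p) ^ p - (a mod int p)) mod int p = ((a mod int p) ^ p mod int p - a mod int p) mod int p"
    by (rule mod_diff_left_eq[symmetric])
  moreover have "\<dots> = (a ^ p - a) mod int p" unfolding power_mod by (rule mod_diff_eq)
  ultimately have "(a ^ p - a) mod int p = 0" by (simp only:)
  then show ?thesis by (rule mod_0_imp_dvd)
qed

text \<open>A prime field is fixed by its Frobenius map, so the identity serves as
  \<open>\<phi>\<close> on the factor of \<open>p\<close>, while the idempotent kills all other
  factors.\<close>

lemma prime_idem_frobenius:
  assumes p: "prime p"
  shows "prime_idem p * (c ^ p * d) = c * (prime_idem p * d)"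
proof (rule prime_fields_eqI)
  fix n
  show "residue (prime_idem p * (c ^ p * d)) n = residue (c * (prime_idem p * d)) n"
  proof (cases "n = p")
    case True
    have m: "prime_modulus p = int p" using p by (simp add: prime_modulus_def)
    have "residue c p ^ p mod int p = residue c p mod int p"
      using prime_dvd_power_minus[OF p, of "residue c p"] by (simp only: mod_eq_dvd_iff)
    then have eq: "residue c p ^ p * residue d p mod int p = residue c p * residue d p mod int p"
      by (rule mod_mult_cong[OF _ refl])
    show ?thesis
      unfolding True residue_simps residue_power residue_prime_idem[OF p] m
      by (simp only: if_True refl mult_1 mod_mult_left_eq mod_mult_right_eq mod_mod_trivial eq)
  next
    case False
    then show ?thesis unfolding residue_simps residue_prime_idem[OF p]
      by (simp only: if_False mult_zero_left mult_zero_right mod_0)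
  qed
qed

lemma frobenius_trace_prime_fields:
  assumes p: "prime p" and T: "\<And>v. Poly_Mapping.lookup T v = 1"
  shows "frobenius_trace p (prime_idem p) ((*) (prime_idem p)) (T :: 'v::finite monom)"
proof
  show "prime p" by (rule p)
  show "prime_idem p * (c + d) = prime_idem p * c + prime_idem p * d" for c d by (rule distrib_left)
  show "prime_idem p * (c ^ p * d) = c * (prime_idem p * d)" for c d by (rule prime_idem_frobenius[OF p])
  have m: "prime_modulus p = int p" using p by (simp add: prime_modulus_def)
  show "prime_idem p * (of_nat p * d) = 0" for d
  proof (rule prime_fields_eqI)
    fix n
    show "residue (prime_idem p * (of_nat p * d)) n = residue 0 n"
      unfolding residue_simps residue_of_nat residue_prime_idem[OF p] by (cases "n = p") (simp_all add: m)
  qed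
  show "prime_idem p * prime_idem p = prime_idem p"
  proof (rule prime_fields_eqI)
    fix n
    show "residue (prime_idem p * prime_idem p) n = residue (prime_idem p) n"
      unfolding residue_simps residue_prime_idem[OF p] using prime_gt_1_nat[OF p] by (cases "n = p") (simp_all add: m)
  qed
  show "Poly_Mapping.lookup T v = 1" for v by (rule T)
qed

section \<open>Characteristic zero\<close>

text \<open>The Fredholm alternative over the rationals with denominators cleared, by induction on
  the columns: a functional that separates \<open>b\<close> from the earlier columns either
  annihilates column \<open>j\<close> as well or serves to eliminate it.\<close>

lemma fredholm_int:
  fixes a :: "'s \<Rightarrow> 'i \<Rightarrow> int"
  assumes F: "finite F" and S: "finite S"
  shows "(\<exists>N c. N \<noteq> 0 \<and> (\<forall>s\<in>S. (\<Sum>i\<in>F. c i * a s i) = N * b s)) \<or>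
    (\<exists>y. (\<forall>i\<in>F. (\<Sum>s\<in>S. y s * a s i) = 0) \<and> (\<Sum>s\<in>S. y s * b s) \<noteq> 0)"
  using F
proof (induction F arbitrary: b rule: finite_induct)
  case empty
  show ?case
  proof (cases "\<forall>s\<in>S. b s = 0")
    case True
    then show ?thesis by (intro disjI1 exI[of _ 1]) simp
  next
    case False
    then obtain s where s: "s \<in> S" "b s \<noteq> 0" by blast
    have "(\<Sum>r\<in>S. (if r = s then 1 else 0) * b r) = (\<Sum>r\<in>S. if r = s then b r else 0)"
      by (rule sum.cong[OF refl]) simp
    also have "\<dots> = b s" using S s(1) by simp
    finally show ?thesis using s(2) by (intro disjI2 exI[of _ "\<lambda>r. if r = s then 1 else 0"]) simp
  qed
next
  case (insert j F)
  define dot where "dot y v = (\<Sum>s\<in>S. y s * v s)" for y v :: "'s \<Rightarrow> int"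
  have dot_lin: "dot (\<lambda>s. k * x s - l * y s) v = k * dot x v - l * dot y v" for k l x y v
    unfolding dot_def by (simp only: left_diff_distrib sum_subtractf sum_distrib_left mult.assoc)
  have dot_lin2: "dot y (\<lambda>s. k * v s - l * w s) = k * dot y v - l * dot y w" for k l y v w
    unfolding dot_def by (simp only: right_diff_distrib sum_subtractf sum_distrib_left mult.left_commute)
  have upd: "(\<Sum>i\<in>insert j F. (c(j := k)) i * a s i) = k * a s j + (\<Sum>i\<in>F. c i * a s i)" for c k s
  proof -
    have "(\<Sum>i\<in>F. (c(j := k)) i * a s i) = (\<Sum>i\<in>F. c i * a s i)"
    proof (rule sum.cong[OF refl])
      fix i assume "i \<in> F"
      then have "i \<noteq> j" using insert.hyps(2) by blast
      then show "(c(j := k)) i * a s i = c i * a s i" by simp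
    qed
    then show ?thesis unfolding sum.insert[OF insert.hyps] fun_upd_same by (simp only:)
  qed
  show ?case
  proof (cases "\<exists>N c. N \<noteq> 0 \<and> (\<forall>s\<in>S. (\<Sum>i\<in>F. c i * a s i) = N * b s)")
    case True
    then obtain N c where Nc: "N \<noteq> 0" "\<forall>s\<in>S. (\<Sum>i\<in>F. c i * a s i) = N * b s" by blast
    have "\<forall>s\<in>S. (\<Sum>i\<in>insert j F. (c(j := 0)) i * a s i) = N * b s"
      unfolding upd using Nc(2) by simp
    then show ?thesis using Nc(1) by blast
  next
    case False
    then obtain y where y: "\<forall>i\<in>F. dot y (\<lambda>s. a s i) = 0" "dot y b \<noteq> 0"
      using insert.IH[of b] unfolding dot_def by blast
    let ?\<alpha> = "dot y (\<lambda>s. a s j)" and ?\<beta> = "dot y b"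
    show ?thesis
    proof (cases "?\<alpha> = 0")
      case True
      then have "\<forall>i\<in>insert j F. dot y (\<lambda>s. a s i) = 0" using y(1) by blast
      then show ?thesis using y(2) unfolding dot_def by blast
    next
      case al: False
      \<comment> \<open>The multiple of \<open>b\<close> is corrected by column \<open>j\<close> so
        that \<open>y\<close> annihilates it. A solution for \<open>?b\<close> gives one for
        \<open>b\<close>; a certificate \<open>z\<close> for \<open>?b\<close> becomes one for
        \<open>b\<close> once a multiple of \<open>z\<close> is corrected by \<open>y\<close> to be
        orthogonal to column \<open>j\<close>.\<close>
      let ?b = "\<lambda>s. ?\<alpha> * b s - ?\<beta> * a s j"
      from insert.IH[of ?b] show ?thesis
      proof
        assume "\<exists>N c. N \<noteq> 0 \<and> (\<forall>s\<in>S. (\<Sum>i\<in>F. c i * a s i) = N * ?b s)"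
        then obtain N c where Nc: "N \<noteq> 0" "\<forall>s\<in>S. (\<Sum>i\<in>F. c i * a s i) = N * ?b s" by blast
        have "(\<Sum>i\<in>insert j F. (c(j := N * ?\<beta>)) i * a s i) = (N * ?\<alpha>) * b s" if "s \<in> S" for s
          unfolding upd using Nc(2) that by (simp add: right_diff_distrib)
        moreover have "N * ?\<alpha> \<noteq> 0" using Nc(1) al by simp
        ultimately show ?thesis by blast
      next
        assume "\<exists>z. (\<forall>i\<in>F. (\<Sum>s\<in>S. z s * a s i) = 0) \<and> (\<Sum>s\<in>S. z s * ?b s) \<noteq> 0"
        then obtain z where z: "\<forall>i\<in>F. dot z (\<lambda>s. a s i) = 0" "dot z ?b \<noteq> 0" unfolding dot_def by blast
        define w where "w = (\<lambda>s. ?\<alpha> * z s - dot z (\<lambda>s. a s j) * y s)"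
        have "dot w (\<lambda>s. a s i) = 0" if "i \<in> insert j F" for i
        proof (cases "i = j")
          case True
          show ?thesis unfolding w_def dot_lin True by (simp only: mult.commute diff_self)
        next
          case False
          then have "i \<in> F" using that by blast
          then show ?thesis unfolding w_def dot_lin using z(1) y(1) by simp
        qed
        moreover have "dot w b \<noteq> 0" using z(2) unfolding w_def dot_lin dot_lin2 by (simp only: mult.commute not_False_eq_True)
        ultimately show ?thesis unfolding dot_def by blast
      qed
    qed
  qed
qed

section \<open>Graded pieces as integer linear systems\<close>

lemma lookup_single_mult_if:
  fixes h :: "('v, 'k::comm_ring_1) mpoly"
  shows "Poly_Mapping.lookup (Poly_Mapping.single u c * h) s = (if \<exists>w. s = u + w then c * Poly_Mapping.lookup h (s - u) else 0)"
proof (cases "\<exists>w. s = u + w")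
  case True
  then obtain w where w: "s = u + w" by blast
  show ?thesis using True unfolding w lookup_single_mult_add by simp
next
  case False
  then have "s \<notin> Poly_Mapping.keys (Poly_Mapping.single u c * h)" using keys_single_mult[of u c h] by blast
  then show ?thesis using False by (simp add: in_keys_iff)
qed

lemma finite_monom_degree: "finite {t :: 'v::finite monom. monom_degree t = d}"
proof -
  have le: "Poly_Mapping.lookup t v \<le> monom_degree t" for t :: "'v monom" and v
  proof (cases "v \<in> Poly_Mapping.keys t")
    case True
    then show ?thesis unfolding monom_degree_def by (rule member_le_sum) simp_all
  qed (simp add: in_keys_iff)
  have "Poly_Mapping.lookup ` {t :: 'v monom. monom_degree t = d} \<subseteq> PiE UNIV (\<lambda>_. {..d})"
  proof (rule image_subsetI)
    fix t :: "'v monom" assume "t \<in> {t. monom_degree t = d}"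
    then have "Poly_Mapping.lookup t v \<le> d" for v using le[of t v] by simp
    then show "Poly_Mapping.lookup t \<in> PiE UNIV (\<lambda>_. {..d})" by (simp add: PiE_UNIV_domain)
  qed
  then have "finite (Poly_Mapping.lookup ` {t :: 'v monom. monom_degree t = d})"
    by (rule finite_subset) (rule finite_PiE, simp_all)
  then show ?thesis by (rule finite_imageD) (rule inj_onI, rule poly_mapping_eqI, simp)
qed

definition graded_index :: "('r, 'c) minor_index set \<Rightarrow> nat \<Rightarrow> (('r \<times> 'c) monom \<times> ('r, 'c) minor_index) set" where
  "graded_index \<Omega> d = {(u, q). q \<in> \<Omega> \<and> monom_degree u + length (fst q) = d}"

definition minor_coeff :: "('r \<times> 'c) monom \<Rightarrow> ('r \<times> 'c) monom \<times> ('r, 'c) minor_index \<Rightarrow> int" where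
  "minor_coeff s i = Poly_Mapping.lookup (Poly_Mapping.single (fst i) 1 * minor_poly (snd i)) s"

lemma lookup_minor_coeff:
  fixes a :: "'r list" and b :: "'c list"
  assumes "length a = length b"
  shows "Poly_Mapping.lookup (Poly_Mapping.single u c * minor_poly (a, b) :: ('r \<times> 'c, 'k::comm_ring_1) mpoly) s = c * of_int (minor_coeff s (u, (a, b)))"
  unfolding minor_coeff_def fst_conv snd_conv minor_poly_gmin lookup_single_mult_if
    lookup_gmin_of_int[OF assms, where 'k = 'k] by (cases "\<exists>w. s = u + w") (simp_all only: if_True if_False mult_1 of_int_0 mult_zero_right)

lemma minor_coeff_degree:
  assumes "length a = length b" "minor_coeff s (u, (a, b)) \<noteq> 0"
  shows "monom_degree s = monom_degree u + length a"
proof -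
  have nz: "(if \<exists>w. s = u + w then 1 * Poly_Mapping.lookup (gmin a b :: ('a \<times> 'b, int) mpoly) (s - u) else 0) \<noteq> 0"
    using assms(2) unfolding minor_coeff_def fst_conv snd_conv minor_poly_gmin lookup_single_mult_if .
  show ?thesis
  proof (cases "\<exists>w. s = u + w")
    case True
    then obtain w where w: "s = u + w" by (rule exE)
    have "Poly_Mapping.lookup (gmin a b :: ('a \<times> 'b, int) mpoly) (s - u) \<noteq> 0"
      using nz True by (simp only: if_True mult_1 simp_thms)
    then have "w \<in> Poly_Mapping.keys (gmin a b :: ('a \<times> 'b, int) mpoly)" unfolding w in_keys_iff add_diff_cancel_left' .
    then have "monom_degree w = length a" by (rule keys_gmin(2)[OF assms(1)])
    then show ?thesis unfolding w monom_degree_add by (simp only:)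
  next
    case False
    then show ?thesis using nz by (simp only: if_False)
  qed
qed

lemma finite_graded_index:
  fixes \<Omega> :: "('r::{finite,linorder}, 'c::{finite,linorder}) minor_index set"
  assumes "minor_poset_ideal \<Omega>"
  shows "finite (graded_index \<Omega> d)"
proof -
  have "\<Omega> \<subseteq> minors" using assms by (simp add: minor_poset_ideal_def)
  then have om: "finite \<Omega>" using finite_minors by (rule finite_subset)
  have sub: "graded_index \<Omega> d \<subseteq> (\<Union>e\<le>d. {u. monom_degree u = e}) \<times> \<Omega>"
    unfolding graded_index_def by auto
  have "finite (\<Union>e\<le>d. {u :: ('r \<times> 'c) monom. monom_degree u = e})" by (simp add: finite_monom_degree)
  then show ?thesis using om finite_subset[OF sub] by simp
qed

lemma omega_minor_lengths:
  assumes "minor_poset_ideal \<Omega>" "(a, b) \<in> \<Omega>"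
  shows "length a = length b"
  using assms by (auto simp: minor_poset_ideal_def minors_def)

text \<open>The graded pieces of the ideal are images of integer matrices.\<close>

lemma omega_ideal_coeffs:
  fixes \<Omega> :: "('r::{finite,linorder}, 'c::{finite,linorder}) minor_index set"
  assumes om: "minor_poset_ideal \<Omega>" and g: "g \<in> (omega_ideal \<Omega> :: ('r \<times> 'c, 'k::comm_ring_1) mpoly set)"
  shows "\<exists>c. \<forall>s. monom_degree s = d \<longrightarrow> Poly_Mapping.lookup g s = (\<Sum>i\<in>graded_index \<Omega> d. c i * of_int (minor_coeff s i))"
  using g unfolding omega_ideal_def
proof (induction g rule: rmod.span_induct_alt)
  case base
  show ?case by (rule exI[of _ "\<lambda>_. 0"]) simp
next
  case (step h x y)
  obtain a b where q: "(a, b) \<in> \<Omega>" "x = minor_poly (a, b)" using step.hyps by force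
  have len: "length a = length b" by (rule omega_minor_lengths[OF om q(1)])
  obtain c where c: "\<And>s. monom_degree s = d \<Longrightarrow> Poly_Mapping.lookup y s = (\<Sum>i\<in>graded_index \<Omega> d. c i * of_int (minor_coeff s i))"
    using step.IH by blast
  define c' where "c' i = c i + (if snd i = (a, b) then Poly_Mapping.lookup h (fst i) else 0)" for i
  have "Poly_Mapping.lookup (h * x + y) s = (\<Sum>i\<in>graded_index \<Omega> d. c' i * of_int (minor_coeff s i))" if s: "monom_degree s = d" for s
  proof -
    let ?L = "\<lambda>u. Poly_Mapping.lookup h u * of_int (minor_coeff s (u, (a, b)))"
    let ?U = "{u :: ('r \<times> 'c) monom. monom_degree u + length a = d}"
    have fU: "finite ?U"
    proof (rule finite_subset)
      show "?U \<subseteq> {u. monom_degree u = d - length a}" by auto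
    qed (rule finite_monom_degree)
    have "h * x = (\<Sum>u\<in>Poly_Mapping.keys h. Poly_Mapping.single u (Poly_Mapping.lookup h u) * x)"
      by (subst poly_mapping_eq_sum_single[of h]) (rule sum_distrib_right)
    then have "Poly_Mapping.lookup (h * x) s = (\<Sum>u\<in>Poly_Mapping.keys h. ?L u)"
      unfolding q(2) by (simp only: lookup_sum lookup_minor_coeff[OF len])
    also have "\<dots> = (\<Sum>u\<in>?U. ?L u)"
    proof (rule sum.mono_neutral_cong[OF fU finite_keys])
      fix u assume "u \<in> ?U - Poly_Mapping.keys h"
      then show "?L u = 0" by (simp add: in_keys_iff)
    next
      fix u assume "u \<in> Poly_Mapping.keys h - ?U"
      then have "minor_coeff s (u, (a, b)) = 0" using minor_coeff_degree[OF len, of s u] s by auto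
      then show "?L u = 0" by simp
    qed simp
    also have "\<dots> = (\<Sum>i\<in>(\<lambda>u. (u, (a, b))) ` ?U. Poly_Mapping.lookup h (fst i) * of_int (minor_coeff s i))"
      by (subst sum.reindex) (auto intro: inj_onI)
    also have "\<dots> = (\<Sum>i\<in>graded_index \<Omega> d. (if snd i = (a, b) then Poly_Mapping.lookup h (fst i) else 0) * of_int (minor_coeff s i))"
    proof (rule sum.mono_neutral_cong_left[OF finite_graded_index[OF om]])
      show "(\<lambda>u. (u, (a, b))) ` ?U \<subseteq> graded_index \<Omega> d" using q(1) by (auto simp: graded_index_def)
      show "\<forall>i\<in>graded_index \<Omega> d - (\<lambda>u. (u, (a, b))) ` ?U. (if snd i = (a, b) then Poly_Mapping.lookup h (fst i) else 0) * of_int (minor_coeff s i) = 0"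
        by (auto simp: graded_index_def)
    qed auto
    finally have hx: "Poly_Mapping.lookup (h * x) s = (\<Sum>i\<in>graded_index \<Omega> d. (if snd i = (a, b) then Poly_Mapping.lookup h (fst i) else 0) * of_int (minor_coeff s i))" .
    show ?thesis
      unfolding lookup_add hx c[OF s] c'_def distrib_right sum.distrib by (rule add.commute)
  qed
  then show ?case by blast
qed

lemma omega_ideal_of_coeffs:
  fixes \<Omega> :: "('r::{finite,linorder}, 'c::{finite,linorder}) minor_index set" and c :: "_ \<Rightarrow> 'k::comm_ring_1"
  assumes om: "minor_poset_ideal \<Omega>"
  obtains g :: "('r \<times> 'c, 'k) mpoly" where "g \<in> omega_ideal \<Omega>"
    "\<forall>s. Poly_Mapping.lookup g s = (\<Sum>i\<in>graded_index \<Omega> d. c i * of_int (minor_coeff s i))"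
    "\<forall>s\<in>Poly_Mapping.keys g. monom_degree s = d"
proof -
  define g :: "('r \<times> 'c, 'k) mpoly" where "g = (\<Sum>i\<in>graded_index \<Omega> d. Poly_Mapping.single (fst i) (c i) * minor_poly (snd i))"
  have len: "length (fst (snd i)) = length (snd (snd i))" if "i \<in> graded_index \<Omega> d" for i
    using that omega_minor_lengths[OF om, of "fst (snd i)" "snd (snd i)"] by (auto simp: graded_index_def)
  have 1: "g \<in> omega_ideal \<Omega>"
    unfolding g_def
  proof (rule rmod.subspace_sum[OF omega_ideal_subspace])
    fix i assume "i \<in> graded_index \<Omega> d"
    then have "minor_poly (snd i) \<in> (omega_ideal \<Omega> :: ('r \<times> 'c, 'k) mpoly set)"
      unfolding omega_ideal_def graded_index_def by (intro rmod.span_base imageI) auto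
    then show "Poly_Mapping.single (fst i) (c i) * minor_poly (snd i) \<in> (omega_ideal \<Omega> :: ('r \<times> 'c, 'k) mpoly set)"
      by (rule rmod.subspace_scale[OF omega_ideal_subspace])
  qed
  have 2: "Poly_Mapping.lookup g s = (\<Sum>i\<in>graded_index \<Omega> d. c i * of_int (minor_coeff s i))" for s
    unfolding g_def lookup_sum
  proof (rule sum.cong[OF refl])
    fix i assume i: "i \<in> graded_index \<Omega> d"
    obtain u a b where iu: "i = (u, (a, b))" by (cases i) auto
    have "length a = length b" using len[OF i] unfolding iu by simp
    then show "Poly_Mapping.lookup (Poly_Mapping.single (fst i) (c i) * minor_poly (snd i)) s = c i * of_int (minor_coeff s i)"
      unfolding iu fst_conv snd_conv by (rule lookup_minor_coeff)
  qed
  have 3: "monom_degree s = d" if "s \<in> Poly_Mapping.keys g" for s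
  proof -
    have "(\<Sum>i\<in>graded_index \<Omega> d. c i * of_int (minor_coeff s i)) \<noteq> 0" using that unfolding in_keys_iff 2 .
    then obtain i where i: "i \<in> graded_index \<Omega> d" "c i * of_int (minor_coeff s i) \<noteq> 0"
      by (rule sum.not_neutral_contains_not_neutral)
    obtain u a b where iu: "i = (u, (a, b))" by (cases i) auto
    have "minor_coeff s (u, (a, b)) \<noteq> 0" using i(2) unfolding iu by auto
    then have "monom_degree s = monom_degree u + length a" using len[OF i(1)] unfolding iu by (intro minor_coeff_degree) simp_all
    then show ?thesis using i(1) unfolding iu graded_index_def by simp
  qed
  show ?thesis by (rule that[OF 1]) (use 2 3 in blast)+
qed

definition monoms_above :: "('v monom \<Rightarrow> 'v monom \<Rightarrow> bool) \<Rightarrow> 'v monom \<Rightarrow> 'v monom set" where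
  "monoms_above leq t = {s. monom_degree s = monom_degree t \<and> leq t s}"

lemma finite_monoms_above: "finite (monoms_above leq (t :: 'v::finite monom))"
  unfolding monoms_above_def by (rule finite_subset[OF _ finite_monom_degree[of "monom_degree t"]]) auto

text \<open>The integer linear system for an element of the ideal with initial monomial
  \<open>t\<close>, stated independently of a coefficient ring; \<open>N\<close> is a common
  denominator of a rational solution.\<close>

definition solvable :: "('r, 'c) minor_index set \<Rightarrow> (('r \<times> 'c) monom \<Rightarrow> ('r \<times> 'c) monom \<Rightarrow> bool) \<Rightarrow> ('r \<times> 'c) monom \<Rightarrow> bool" where
  "solvable \<Omega> leq t \<longleftrightarrow> (\<exists>N c. N \<noteq> 0 \<and> (\<forall>s\<in>monoms_above leq t.
     (\<Sum>i\<in>graded_index \<Omega> (monom_degree t). c i * minor_coeff s i) = (if s = t then N else 0)))"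

lemma not_solvable_certificate:
  fixes \<Omega> :: "('r::{finite,linorder}, 'c::{finite,linorder}) minor_index set"
  assumes to: "term_order leq" and om: "minor_poset_ideal \<Omega>" and ns: "\<not> solvable \<Omega> leq t"
  obtains y where "\<forall>i\<in>graded_index \<Omega> (monom_degree t). (\<Sum>s\<in>monoms_above leq t. y s * minor_coeff s i) = 0" "y t \<noteq> 0"
proof -
  let ?F = "graded_index \<Omega> (monom_degree t)" and ?S = "monoms_above leq t" and ?b = "\<lambda>s. if s = t then 1 else 0 :: int"
  have t: "t \<in> ?S" by (simp add: monoms_above_def term_orderD(1)[OF to])
  have "\<not> (\<exists>N c. N \<noteq> 0 \<and> (\<forall>s\<in>?S. (\<Sum>i\<in>?F. c i * minor_coeff s i) = N * ?b s))"
  proof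
    assume "\<exists>N c. N \<noteq> 0 \<and> (\<forall>s\<in>?S. (\<Sum>i\<in>?F. c i * minor_coeff s i) = N * ?b s)"
    then obtain N c where N: "N \<noteq> 0" "\<forall>s\<in>?S. (\<Sum>i\<in>?F. c i * minor_coeff s i) = N * ?b s" by blast
    have "N * ?b s = (if s = t then N else 0)" for s by simp
    then show False using ns N unfolding solvable_def by auto
  qed
  then obtain y where y: "\<forall>i\<in>?F. (\<Sum>s\<in>?S. y s * minor_coeff s i) = 0" "(\<Sum>s\<in>?S. y s * ?b s) \<noteq> 0"
    using fredholm_int[OF finite_graded_index[OF om] finite_monoms_above[of leq t], where a = minor_coeff and b = ?b] by blast
  have "(\<Sum>s\<in>?S. y s * ?b s) = (\<Sum>s\<in>?S. if s = t then y s else 0)" by (rule sum.cong[OF refl]) simp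
  also have "\<dots> = y t" using t finite_monoms_above[of leq t] by simp
  finally have yt: "(\<Sum>s\<in>?S. y s * ?b s) = y t" .
  show ?thesis using y(2) unfolding yt by (rule that[OF y(1)])
qed

text \<open>Pair \<open>y\<close> with the coefficients of \<open>g\<close> in the degree of
  \<open>t\<close>. Those strictly above \<open>t\<close> vanish, which leaves the term at
  \<open>t\<close>; and the pairing is zero because \<open>y\<close> is orthogonal to the
  coefficients of all products of monomials and minors.\<close>

lemma certificate_mult:
  fixes \<Omega> :: "('r::{finite,linorder}, 'c::{finite,linorder}) minor_index set"
  assumes to: "term_order leq" and om: "minor_poset_ideal \<Omega>" and g: "g \<in> (omega_ideal \<Omega> :: ('r \<times> 'c, 'k::comm_ring_1) mpoly set)"
    and keys: "\<forall>u\<in>Poly_Mapping.keys g. leq u t"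
    and y: "\<forall>i\<in>graded_index \<Omega> (monom_degree t). (\<Sum>s\<in>monoms_above leq t. y s * minor_coeff s i) = 0"
  shows "of_int (y t) * Poly_Mapping.lookup g t = 0"
proof -
  let ?F = "graded_index \<Omega> (monom_degree t)" and ?S = "monoms_above leq t"
  obtain c where c: "\<And>s. monom_degree s = monom_degree t \<Longrightarrow> Poly_Mapping.lookup g s = (\<Sum>i\<in>?F. c i * of_int (minor_coeff s i))"
    using omega_ideal_coeffs[OF om g, of "monom_degree t"] by blast
  have t: "t \<in> ?S" by (simp add: monoms_above_def term_orderD(1)[OF to])
  have z: "Poly_Mapping.lookup g s = 0" if "s \<in> ?S" "s \<noteq> t" for s
  proof (rule ccontr)
    assume "Poly_Mapping.lookup g s \<noteq> 0"
    then have "leq s t" using keys by (simp add: in_keys_iff)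
    moreover have "leq t s" using that(1) by (simp add: monoms_above_def)
    ultimately show False using term_orderD(3)[OF to] that(2) by blast
  qed
  have "of_int (y t) * Poly_Mapping.lookup g t = (\<Sum>s\<in>?S. if s = t then of_int (y s) * Poly_Mapping.lookup g s else 0)"
    using t finite_monoms_above[of leq t] by simp
  also have "\<dots> = (\<Sum>s\<in>?S. of_int (y s) * Poly_Mapping.lookup g s)"
    by (rule sum.cong[OF refl]) (use z in simp)
  also have "\<dots> = (\<Sum>s\<in>?S. \<Sum>i\<in>?F. c i * of_int (y s * minor_coeff s i))"
  proof (rule sum.cong[OF refl])
    fix s assume "s \<in> ?S"
    then have "monom_degree s = monom_degree t" by (simp add: monoms_above_def)
    then show "of_int (y s) * Poly_Mapping.lookup g s = (\<Sum>i\<in>?F. c i * of_int (y s * minor_coeff s i))"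
      by (simp only: c sum_distrib_left of_int_mult mult.left_commute)
  qed
  also have "\<dots> = (\<Sum>i\<in>?F. \<Sum>s\<in>?S. c i * of_int (y s * minor_coeff s i))" by (rule sum.swap)
  also have "\<dots> = (\<Sum>i\<in>?F. c i * of_int (\<Sum>s\<in>?S. y s * minor_coeff s i))"
    by (simp only: sum_distrib_left of_int_sum)
  also have "\<dots> = 0"
  proof (rule sum.neutral, rule ballI)
    fix i assume "i \<in> ?F"
    then have "(\<Sum>s\<in>?S. y s * minor_coeff s i) = 0" using y by blast
    then show "c i * of_int (\<Sum>s\<in>?S. y s * minor_coeff s i) = 0" by (simp only: of_int_0 mult_zero_right)
  qed
  finally show ?thesis .
qed

lemma solvable_polynomial:
  fixes \<Omega> :: "('r::{finite,linorder}, 'c::{finite,linorder}) minor_index set"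
  assumes to: "term_order leq" and om: "minor_poset_ideal \<Omega>" and sol: "solvable \<Omega> leq t"
  obtains N where "N \<noteq> 0" "\<exists>g\<in>(omega_ideal \<Omega> :: ('r \<times> 'c, 'k::comm_ring_1) mpoly set).
      Poly_Mapping.lookup g t = of_int N \<and> (\<forall>u\<in>Poly_Mapping.keys g. leq u t)"
proof -
  let ?d = "monom_degree t"
  obtain N c where N: "N \<noteq> 0" and c: "\<And>s. s \<in> monoms_above leq t \<Longrightarrow>
      (\<Sum>i\<in>graded_index \<Omega> ?d. c i * minor_coeff s i) = (if s = t then N else 0)"
    using sol unfolding solvable_def by blast
  have t: "t \<in> monoms_above leq t" by (simp add: monoms_above_def term_orderD(1)[OF to])
  have conc: "Poly_Mapping.lookup g t = of_int N \<and> (\<forall>u\<in>Poly_Mapping.keys g. leq u t)"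
    if l: "\<And>s. Poly_Mapping.lookup g s = (\<Sum>i\<in>graded_index \<Omega> ?d. of_int (c i) * of_int (minor_coeff s i))"
      and k: "\<And>s. s \<in> Poly_Mapping.keys g \<Longrightarrow> monom_degree s = ?d" for g :: "('r \<times> 'c, 'k) mpoly"
  proof -
    have l': "Poly_Mapping.lookup g s = of_int (\<Sum>i\<in>graded_index \<Omega> ?d. c i * minor_coeff s i)" for s
      unfolding l by (simp only: of_int_sum of_int_mult)
    have "leq u t" if u: "u \<in> Poly_Mapping.keys g" for u
    proof (rule ccontr)
      assume n: "\<not> leq u t"
      then have "leq t u" using term_orderD(4)[OF to, of u t] by blast
      then have "u \<in> monoms_above leq t" using k[OF u] by (simp add: monoms_above_def)
      moreover have "u \<noteq> t" using n term_orderD(1)[OF to] by blast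
      ultimately have "Poly_Mapping.lookup g u = 0" unfolding l' using c[of u] by simp
      then show False using u by (simp add: in_keys_iff)
    qed
    moreover have "Poly_Mapping.lookup g t = of_int N" unfolding l' using c[OF t] by simp
    ultimately show ?thesis by blast
  qed
  obtain g :: "('r \<times> 'c, 'k) mpoly" where g: "g \<in> omega_ideal \<Omega>"
    "\<forall>s. Poly_Mapping.lookup g s = (\<Sum>i\<in>graded_index \<Omega> ?d. of_int (c i) * of_int (minor_coeff s i))"
    "\<forall>s\<in>Poly_Mapping.keys g. monom_degree s = ?d"
    by (rule omega_ideal_of_coeffs[OF om, where d = ?d and c = "\<lambda>i. of_int (c i)"])
  have "Poly_Mapping.lookup g t = of_int N \<and> (\<forall>u\<in>Poly_Mapping.keys g. leq u t)"
    by (rule conc[OF spec[OF g(2)] bspec[OF g(3)]])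
  then show ?thesis by (intro that[OF N] bexI[OF _ g(1)])
qed

lemma of_int_char_0: "CHAR('k::field) = 0 \<Longrightarrow> of_int n = (0 :: 'k) \<Longrightarrow> n = 0"
proof -
  assume ch: "CHAR('k) = 0" and n: "of_int n = (0 :: 'k)"
  obtain m where m: "n = int m \<or> n = - int m" by (metis int_cases2)
  then have "(of_nat m :: 'k) = 0"
  proof
    assume "n = int m"
    then show ?thesis using n by (simp only: of_int_of_nat_eq)
  next
    assume "n = - int m"
    then show ?thesis using n by (simp only: of_int_minus of_int_of_nat_eq neg_equal_0_iff_equal)
  qed
  then have "CHAR('k) dvd m" by (simp only: of_nat_eq_0_iff_char_dvd)
  then have "m = 0" unfolding ch by simp
  then show "n = 0" using m by auto
qed

text \<open>A dependency certificate that obstructs the squarefree part of an initial monomial over a field of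
  characteristic 0 also obstructs it modulo all large primes \<open>p\<close>.\<close>

lemma initial_ideal_squarefree_char_0:
  fixes \<Omega> :: "('r::{finite,linorder}, 'c::{finite,linorder}) minor_index set"
  assumes char: "CHAR('k::field) = 0" and om: "minor_poset_ideal \<Omega>" and leq: "antidiagonal_order TYPE('k) leq"
  shows "squarefree_monomial_ideal (initial_ideal leq (omega_ideal \<Omega> :: ('r \<times> 'c, 'k) mpoly set))"
proof (rule squarefree_initial_ideal)
  show to: "term_order leq" using leq by (simp add: antidiagonal_order_def)
  fix t assume "\<exists>g\<in>(omega_ideal \<Omega> :: ('r \<times> 'c, 'k) mpoly set). is_initial_monom leq g t"
  then obtain g :: "('r \<times> 'c, 'k) mpoly" where g: "g \<in> omega_ideal \<Omega>" "t \<in> Poly_Mapping.keys g" "\<forall>s\<in>Poly_Mapping.keys g. leq s t"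
    unfolding is_initial_monom_def by blast
  \<comment> \<open>A certificate would annihilate the nonzero leading coefficient of
    \<open>g\<close>, which characteristic 0 excludes. The integer solution then yields an element
    over \<open>prime_fields\<close> as well.\<close>
  have sol: "solvable \<Omega> leq t"
  proof (rule ccontr)
    assume "\<not> solvable \<Omega> leq t"
    then obtain y where y: "\<forall>i\<in>graded_index \<Omega> (monom_degree t). (\<Sum>s\<in>monoms_above leq t. y s * minor_coeff s i) = 0" "y t \<noteq> 0"
      by (rule not_solvable_certificate[OF to om])
    have "of_int (y t) * Poly_Mapping.lookup g t = 0" by (rule certificate_mult[OF to om g(1,3) y(1)])
    then have "(of_int (y t) :: 'k) = 0" using g(2) by (simp add: in_keys_iff)
    then have "y t = 0" by (rule of_int_char_0[OF char])
    then show False using y(2) by simp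
  qed
  obtain N where N: "N \<noteq> 0" "\<exists>g\<in>(omega_ideal \<Omega> :: ('r \<times> 'c, prime_fields) mpoly set).
      Poly_Mapping.lookup g t = of_int N \<and> (\<forall>u\<in>Poly_Mapping.keys g. leq u t)"
    by (rule solvable_polynomial[OF to om sol])
  then obtain h :: "('r \<times> 'c, prime_fields) mpoly" where h: "h \<in> omega_ideal \<Omega>"
      "Poly_Mapping.lookup h t = of_int N" "\<forall>u\<in>Poly_Mapping.keys h. leq u t" by blast
  have sol': "solvable \<Omega> leq (support t)"
  proof (rule ccontr)
    assume "\<not> solvable \<Omega> leq (support t)"
    then obtain y where y: "\<forall>i\<in>graded_index \<Omega> (monom_degree (support t)).
        (\<Sum>s\<in>monoms_above leq (support t). y s * minor_coeff s i) = 0" "y (support t) \<noteq> 0"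
      by (rule not_solvable_certificate[OF to om])
    \<comment> \<open>With \<open>p\<close> above both absolute values, \<open>N\<close> is
      invertible and \<open>y (support t)\<close> is nonzero modulo \<open>p\<close>.\<close>
    obtain p where p: "prime p" "nat (\<bar>N\<bar> + \<bar>y (support t)\<bar>) < p" using bigger_prime by blast
    have big: "\<bar>N\<bar> + \<bar>y (support t)\<bar> < int p" using p(2) by linarith
    have m: "prime_modulus p = int p" using p(1) by (simp add: prime_modulus_def)
    have "\<not> int p dvd N" using dvd_imp_le_int[OF N(1), of "int p"] big by linarith
    then have "coprime N (int p)" using p(1) by (metis coprime_commute prime_imp_coprime prime_nat_int_transfer)
    then have "gcd N (int p) = 1" by (rule coprime_imp_gcd_eq_1)
    then obtain M v where "M * N + v * int p = 1" using bezout_int[of N "int p"] by metis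
    then have "N * M - 1 = int p * (- v)" by (simp add: algebra_simps)
    then have "int p dvd N * M - 1" by (rule dvdI)
    then have M: "N * M mod int p = 1 mod int p" by (simp only: mod_eq_dvd_iff)
    \<comment> \<open>The leading coefficient of \<open>h\<close> becomes 1 in the factor of
      \<open>p\<close>, and all other factors are discarded.\<close>
    define h' where "h' = Poly_Mapping.single 0 (prime_idem p * of_int M) * h"
    have h'1: "h' \<in> omega_ideal \<Omega>" unfolding h'_def by (rule rmod.subspace_scale[OF omega_ideal_subspace h(1)])
    have "prime_idem p * of_int M * of_int N = prime_idem p"
    proof (rule prime_fields_eqI)
      fix n
      have "residue (prime_idem p * of_int M * of_int N) n = residue (prime_idem p * of_int (N * M)) n"
        by (simp only: of_int_mult mult_ac)
      also have "\<dots> = residue (prime_idem p) n"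
      proof (cases "n = p")
        case True
        show ?thesis
          unfolding True residue_simps residue_of_int residue_prime_idem[OF p(1)] m using M prime_gt_1_nat[OF p(1)] by simp
      next
        case False
        then show ?thesis by (simp add: residue_simps residue_prime_idem[OF p(1)])
      qed
      finally show "residue (prime_idem p * of_int M * of_int N) n = residue (prime_idem p) n" .
    qed
    then have h'2: "Poly_Mapping.lookup h' t = prime_idem p" unfolding h'_def lookup_single_0_mult h(2) .
    have "Poly_Mapping.keys h' \<subseteq> Poly_Mapping.keys h"
      unfolding h'_def by (auto simp: in_keys_iff lookup_single_0_mult)
    then have h'3: "\<forall>u\<in>Poly_Mapping.keys h'. leq u t" using h(3) by blast
    have tr: "frobenius_trace p (prime_idem p) ((*) (prime_idem p)) (all_vars :: ('r \<times> 'c) monom)"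
      by (rule frobenius_trace_prime_fields[OF p(1) sum_window_monom])
    have fs: "frobenius_splitting p (prime_idem p) ((*) (prime_idem p)) all_vars leq (cyc_poly :: ('r \<times> 'c, prime_fields) mpoly)"
      by (rule frobenius_splitting_cyc[OF tr to minors_signed_initial[OF leq]])
    obtain k :: "('r \<times> 'c, prime_fields) mpoly" where k: "k \<in> omega_ideal \<Omega>" "Poly_Mapping.lookup k (support t) = prime_idem p"
      "\<forall>u\<in>Poly_Mapping.keys k. leq u (support t)"
      by (rule omega_ideal_initial_support[OF fs om h'1 h'2 h'3])
    \<comment> \<open>In the factor of \<open>p\<close> the leading coefficient of \<open>k\<close>
      is 1, so the certificate would be divisible by \<open>p\<close> at
      \<open>support t\<close>.\<close>
    have "of_int (y (support t)) * Poly_Mapping.lookup k (support t) = 0"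
      by (rule certificate_mult[OF to om k(1,3) y(1)])
    then have "residue (of_int (y (support t)) * prime_idem p) p = 0" unfolding k(2) by (simp add: residue_simps)
    then have "y (support t) mod int p = 0"
      by (simp add: residue_simps residue_of_int residue_prime_idem[OF p(1)] m)
    then have "int p dvd y (support t)" by (rule mod_0_imp_dvd)
    then show False using dvd_imp_le_int[OF y(2), of "int p"] big by linarith
  qed
  obtain N' where N': "N' \<noteq> 0" "\<exists>g\<in>(omega_ideal \<Omega> :: ('r \<times> 'c, 'k) mpoly set).
      Poly_Mapping.lookup g (support t) = of_int N' \<and> (\<forall>u\<in>Poly_Mapping.keys g. leq u (support t))"
    by (rule solvable_polynomial[OF to om sol'])
  then obtain k :: "('r \<times> 'c, 'k) mpoly" where k: "k \<in> omega_ideal \<Omega>" "Poly_Mapping.lookup k (support t) = of_int N'"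
    "\<forall>u\<in>Poly_Mapping.keys k. leq u (support t)" by blast
  have "(of_int N' :: 'k) \<noteq> 0"
  proof
    assume "(of_int N' :: 'k) = 0"
    then have "N' = 0" by (rule of_int_char_0[OF char])
    then show False using N'(1) by simp
  qed
  then have "support t \<in> Poly_Mapping.keys k" unfolding in_keys_iff k(2) .
  then have "is_initial_monom leq k (support t)" unfolding is_initial_monom_def using k(3) by blast
  then show "\<exists>g\<in>(omega_ideal \<Omega> :: ('r \<times> 'c, 'k) mpoly set). is_initial_monom leq g (support t)" using k(1) by blast
qed

theorem theoremC:
  shows "(\<exists>f :: ('r::{finite,linorder} \<times> 'c::{finite,linorder}, 'k::field) mpoly.
            knutson_poly f \<and>
            (\<forall>\<Omega> :: ('r, 'c) minor_index set.
               minor_poset_ideal \<Omega> \<and> \<Omega> \<noteq> {} \<longrightarrow> poset_ideal \<Omega> \<in> knutson_ideals f)) \<and>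
         (\<forall>\<Omega> :: ('r, 'c) minor_index set. minor_poset_ideal \<Omega> \<longrightarrow>
            (\<forall>leq. antidiagonal_order TYPE('k) leq \<longrightarrow>
               squarefree_monomial_ideal
                 (initial_ideal leq (poset_ideal \<Omega> :: ('r \<times> 'c, 'k) mpoly set)))) \<and>
         (CHAR('k) > 0 \<longrightarrow>
          (\<forall>\<Omega> :: ('r, 'c) minor_index set. minor_poset_ideal \<Omega> \<longrightarrow>
             F_pure TYPE('q)
               (class_ring Quot (poset_ideal \<Omega> :: ('r \<times> 'c, 'k) mpoly set))))"
  unfolding poset_ideal_omega_ideal
proof (intro conjI impI allI exI[of _ cyc_poly])
  show "knutson_poly (cyc_poly :: ('r \<times> 'c, 'k) mpoly)" by (rule knutson_poly_cyc_poly)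
next
  fix \<Omega> :: "('r, 'c) minor_index set"
  assume "minor_poset_ideal \<Omega> \<and> \<Omega> \<noteq> {}"
  then show "omega_ideal \<Omega> \<in> knutson_ideals (cyc_poly :: ('r \<times> 'c, 'k) mpoly)"
    by (intro omega_ideal_knutson) simp_all
next
  fix \<Omega> :: "('r, 'c) minor_index set" and leq :: "('r \<times> 'c) monom \<Rightarrow> ('r \<times> 'c) monom \<Rightarrow> bool"
  assume om: "minor_poset_ideal \<Omega>" and leq: "antidiagonal_order TYPE('k) leq"
  show "squarefree_monomial_ideal (initial_ideal leq (omega_ideal \<Omega> :: ('r \<times> 'c, 'k) mpoly set))"
  proof (cases "CHAR('k) = 0")
    case True
    then show ?thesis using om leq by (rule initial_ideal_squarefree_char_0)
  next
    case False
    then have "0 < CHAR('k)" by simp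
    then show ?thesis using om leq by (rule initial_ideal_squarefree_pos_char)
  qed
next
  fix \<Omega> :: "('r, 'c) minor_index set"
  assume "0 < CHAR('k)" "minor_poset_ideal \<Omega>"
  then show "F_pure TYPE('q) (class_ring Quot (omega_ideal \<Omega> :: ('r \<times> 'c, 'k) mpoly set))"
    by (rule omega_ideal_F_pure)
qed

end
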